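(* Let $k$ be an algebraically closed field of characteristic zero and let $P=\mathbb P^2$. (a) Let $\pi\subset\mathbb P(R_2)$ be a net of conics such that $\Gamma_\pi$ is smooth, let $\phi$ be the unique cubic such that $\pi=J_\phi$, and let $H$ be the Hessian of $\phi$. A point of $P$ admits a common conjugate with respect to all the conics of $\pi$ if and only if it belongs to $H$. In that case its common conjugate is unique, distinct from it, and also belongs to $H$. Hence there is a canonical regular fixed-point-free involution $i:H\to H$ (sending a point to its common conjugate), and $$\pi=\{\gamma\in\mathbb P(R_2)\ :\ \forall x\in H,\ x\text{ and }i(x)\text{ are conjugate with respect to }\gamma\}.$$ (b) Conversely, let $H\subset P$ be a smooth cubic with a regular fixed-point-free involution $i$. Then the set $$\pi=\{\gamma\in\mathbb P(R_2)\ :\ \forall x\in H,\ x\text{ and }i(x)\text{ are conjugate with respect to }\gamma\}$$ is a plane of $\mathbb P(R_2)$ such that $\Gamma_\pi$ is smooth. If $\phi$ is the cubic such that $\pi=J_\phi$, then $H$ is the Hessian of $\phi$ and $i$ is the involution on $H$ associated to $\pi$ by the procedure of (a). (c) Consequently the classification (up to $PGL(3)$) of smooth plane cubics endowed with a regular fixed-point-free involution is equivalent, via the correspondence of (a) and (b), to the classification of nets $\pi$ with $\Gamma_\pi$ smooth. (d) There are exactly three regular fixed-point-free involutions on a smooth cubic. Once an origin (algebraic group structure) is fixed on the cubic, they are the translations by the three points of order two.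
   Context: $R_i$ is the space of degree-$i$ forms in $X,Y,Z$ over $k$. A net of conics is a plane $\pi\subset\mathbb P(R_2)=\mathbb P^5$. $S_4\subset\mathbb P(R_2)$ is the cubic hypersurface of singular conics (vanishing determinant of the symmetric matrix), and $\Gamma_\pi=\pi\cap S_4$ (scheme intersection). For a cubic $\phi$ with equation $F=0$, $J_\phi$ is the projectivization of $\langle F'_X,F'_Y,F'_Z\rangle\subset R_2$, and the Hessian of $\phi$ is the curve $\det(\partial^2F/\partial X_a\partial X_b)=0$. When $\Gamma_\pi$ is smooth there is a unique plane cubic $\phi$ with $\pi=J_\phi$. Two points $x,y\in P$ are conjugate with respect to the conic $q=0$ if $B_q(x,y)=0$, where $B_q$ is the symmetric bilinear form polar to $q$. A common conjugate of $x$ with respect to all conics of $\pi$ is a point $y\in P$ conjugate to $x$ with respect to every conic in $\pi$. *)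

theory Defs
  imports
    "HOL-Analysis.Analysis"
    "HOL-Library.Poly_Mapping"
    "HOL-Computational_Algebra.Polynomial"
    "HOL-Algebra.Multiplicative_Group"
begin

section \<open>Polynomials in the variables indexed by a finite type\<close>

type_synonym ('n, 'a) mpol = "('n \<Rightarrow>\<^sub>0 nat) \<Rightarrow>\<^sub>0 'a"

text \<open>The variables \<open>X, Y, Z\<close> are indexed by the three-element type \<open>3\<close>.\<close>

type_synonym 'a form = "(3, 'a) mpol"

definition Const :: "'a::comm_ring_1 \<Rightarrow> ('n, 'a) mpol" where
  "Const c = Poly_Mapping.single 0 c"

definition Var :: "'n \<Rightarrow> ('n, 'a::comm_ring_1) mpol" where
  "Var a = Poly_Mapping.single (Poly_Mapping.single a 1) 1"

definition pscale :: "'a::comm_ring_1 \<Rightarrow> ('n, 'a) mpol \<Rightarrow> ('n, 'a) mpol" where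
  "pscale c F = Const c * F"

interpretation pol: vector_space "pscale :: 'a::field \<Rightarrow> ('n, 'a) mpol \<Rightarrow> ('n, 'a) mpol"
  by unfold_locales
    (simp_all add: pscale_def Const_def algebra_simps single_add mult_single single_one
      flip: mult.assoc)

definition peval :: "('n::finite, 'a::comm_ring_1) mpol \<Rightarrow> 'a ^ 'n \<Rightarrow> 'a" where
  "peval F v = (\<Sum>m\<in>Poly_Mapping.keys F. Poly_Mapping.lookup F m * (\<Prod>a\<in>UNIV. (v $ a) ^ Poly_Mapping.lookup m a))"

definition pdiff :: "'n \<Rightarrow> ('n, 'a::comm_ring_1) mpol \<Rightarrow> ('n, 'a) mpol" where
  "pdiff a F = (\<Sum>m\<in>Poly_Mapping.keys F.
     Poly_Mapping.single (m - Poly_Mapping.single a 1) (of_nat (Poly_Mapping.lookup m a) * Poly_Mapping.lookup F m))"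

text \<open>The polynomial \<open>F(g v)\<close> in the coordinates of \<open>v\<close>.\<close>

definition linsubst :: "'a::comm_ring_1 ^ 'n ^ 'n \<Rightarrow> ('n::finite, 'a) mpol \<Rightarrow> ('n, 'a) mpol" where
  "linsubst g F = (\<Sum>m\<in>Poly_Mapping.keys F. Const (Poly_Mapping.lookup F m) *
     (\<Prod>a\<in>UNIV. (\<Sum>b\<in>UNIV. Const (g $ a $ b) * Var b) ^ Poly_Mapping.lookup m a))"

definition forms :: "nat \<Rightarrow> 'a::comm_ring_1 form set" where
  "forms d = {F. \<forall>m\<in>Poly_Mapping.keys F. (\<Sum>a\<in>UNIV. Poly_Mapping.lookup m a) = d}"

text \<open>Bihomogeneous forms of bidegree \<open>(d, e)\<close> in two triples of variables, and their evaluation.\<close>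

definition biforms :: "nat \<Rightarrow> nat \<Rightarrow> (3 + 3, 'a::comm_ring_1) mpol set" where
  "biforms d e = {F. \<forall>m\<in>Poly_Mapping.keys F.
     (\<Sum>a\<in>UNIV. Poly_Mapping.lookup m (Inl a)) = d \<and> (\<Sum>b\<in>UNIV. Poly_Mapping.lookup m (Inr b)) = e}"

definition bieval :: "(3 + 3, 'a::comm_ring_1) mpol \<Rightarrow> 'a ^ 3 \<Rightarrow> 'a ^ 3 \<Rightarrow> 'a" where
  "bieval F u v = peval F (\<chi> s. case s of Inl a \<Rightarrow> u $ a | Inr b \<Rightarrow> v $ b)"

section \<open>Projective spaces\<close>

text \<open>
  A point of a projective space is a one-dimensional linear subspace, as a set of vectors.
  Homogeneous conditions on a point are imposed on all vectors (or forms) of that subspace,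
  which avoids choosing representatives.
\<close>

type_synonym 'a pt = "('a ^ 3) set"
type_synonym 'a curve = "'a form set"

definition P2 :: "'a::field pt set" where
  "P2 = {vec.span {v} |v. v \<noteq> 0}"

definition proj :: "'a::field form set \<Rightarrow> 'a curve set" where
  "proj W = {pol.span {F} |F. F \<in> W \<and> F \<noteq> 0}"

text \<open>Plane curves of degree \<open>d\<close>, i.e. points of \<open>P(R\<^sub>d)\<close>.\<close>

abbreviation curves :: "nat \<Rightarrow> 'a::field curve set" where
  "curves d \<equiv> proj (forms d)"

definition is_net :: "'a::field curve set \<Rightarrow> bool" where
  "is_net \<pi> \<longleftrightarrow> (\<exists>W. pol.subspace W \<and> W \<subseteq> forms 2 \<and> pol.dim W = 3 \<and> \<pi> = proj W)"

definition pts :: "'a::field curve \<Rightarrow> 'a pt set" where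
  "pts C = {x \<in> P2. \<forall>F\<in>C. \<forall>v\<in>x. peval F v = 0}"

text \<open>Jacobian criterion. For \<open>C = {0}\<close> it fails at every point.\<close>

definition smooth :: "'a::field curve \<Rightarrow> bool" where
  "smooth C \<longleftrightarrow> (\<forall>x\<in>pts C. \<exists>F\<in>C. \<exists>v\<in>x. \<exists>a. peval (pdiff a F) v \<noteq> 0)"

section \<open>Conics, the discriminant curve, polars and Hessian\<close>

text \<open>The symmetric bilinear form polar to \<open>q\<close>, normalised so that \<open>polar q v v = q(v)\<close>.\<close>

definition polar :: "'a::field form \<Rightarrow> 'a ^ 3 \<Rightarrow> 'a ^ 3 \<Rightarrow> 'a" where
  "polar q u v = (peval q (u + v) - peval q u - peval q v) / 2"

definition sym_matrix :: "'a::field form \<Rightarrow> 'a ^ 3 ^ 3" where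
  "sym_matrix q = (\<chi> a b. polar q (axis a 1) (axis b 1))"

text \<open>
  A basis \<open>b\<close> of a net identifies it with \<open>P\<^sup>2\<close>, the point \<open>[X:Y:Z]\<close> corresponding to the conic
  \<open>X b\<^sub>1 + Y b\<^sub>2 + Z b\<^sub>3\<close>. In these coordinates the equation of the scheme of singular conics of
  the net is the following cubic form.
\<close>

definition discr_form :: "(3 \<Rightarrow> 'a::field form) \<Rightarrow> 'a form" where
  "discr_form b = det (\<chi> i j. \<Sum>c\<in>UNIV. Const (sym_matrix (b c) $ i $ j) * Var c)"

text \<open>
  The scheme of singular conics is a smooth plane curve. The condition does not depend on the
  basis, and it fails when all conics of the net are singular.
\<close>

definition smooth_discr :: "'a::field curve set \<Rightarrow> bool" where
  "smooth_discr \<pi> \<longleftrightarrow> (\<exists>b. inj b \<and> pol.independent (range b) \<and> \<pi> = proj (pol.span (range b)) \<and>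
     smooth (pol.span {discr_form b}))"

definition smooth_nets :: "'a::field curve set set" where
  "smooth_nets = {\<pi>. is_net \<pi> \<and> smooth_discr \<pi>}"

definition jacobian_net :: "'a::field curve \<Rightarrow> 'a curve set" where
  "jacobian_net \<phi> = proj (pol.span {pdiff a F |a F. F \<in> \<phi>})"

definition hessian :: "'a::field curve \<Rightarrow> 'a curve" where
  "hessian \<phi> = pol.span ((\<lambda>F. det (\<chi> a b. pdiff a (pdiff b F))) ` \<phi>)"

definition cubic_of_net :: "'a::field curve set \<Rightarrow> 'a curve" where
  "cubic_of_net \<pi> = (THE \<phi>. \<phi> \<in> curves 3 \<and> \<pi> = jacobian_net \<phi>)"

definition conjugate :: "'a::field curve \<Rightarrow> 'a pt \<Rightarrow> 'a pt \<Rightarrow> bool" where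
  "conjugate \<gamma> x y \<longleftrightarrow> (\<forall>q\<in>\<gamma>. \<forall>u\<in>x. \<forall>v\<in>y. polar q u v = 0)"

definition common_conjugate :: "'a::field curve set \<Rightarrow> 'a pt \<Rightarrow> 'a pt \<Rightarrow> bool" where
  "common_conjugate \<pi> x y \<longleftrightarrow> y \<in> P2 \<and> (\<forall>\<gamma>\<in>\<pi>. conjugate \<gamma> x y)"

section \<open>Regular maps and involutions\<close>

text \<open>
  A map is regular if around each point it is given by three forms of equal degree without
  common zero at that point; the open neighbourhood is the set where these forms do not all vanish.
\<close>

definition regular_map :: "'a::field curve \<Rightarrow> 'a curve \<Rightarrow> ('a pt \<Rightarrow> 'a pt) \<Rightarrow> bool" where
  "regular_map C D f \<longleftrightarrow> f \<in> pts C \<rightarrow> pts D \<and>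
     (\<forall>x\<in>pts C. \<exists>d g. (\<forall>a::3. g a \<in> forms d) \<and>
        (\<exists>v\<in>x - {0}. \<exists>a. peval (g a) v \<noteq> 0) \<and>
        (\<forall>y\<in>pts C. \<forall>v\<in>y - {0}. (\<exists>a. peval (g a) v \<noteq> 0) \<longrightarrow>
           f y = vec.span {\<chi> a. peval (g a) v}))"

definition regular_map2 ::
    "'a::field curve \<Rightarrow> 'a curve \<Rightarrow> 'a curve \<Rightarrow> ('a pt \<Rightarrow> 'a pt \<Rightarrow> 'a pt) \<Rightarrow> bool" where
  "regular_map2 C C' D f \<longleftrightarrow> (\<forall>x\<in>pts C. \<forall>x'\<in>pts C'. f x x' \<in> pts D) \<and>
     (\<forall>x\<in>pts C. \<forall>x'\<in>pts C'. \<exists>d e g. (\<forall>a::3. g a \<in> biforms d e) \<and>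
        (\<exists>v\<in>x - {0}. \<exists>v'\<in>x' - {0}. \<exists>a. bieval (g a) v v' \<noteq> 0) \<and>
        (\<forall>y\<in>pts C. \<forall>y'\<in>pts C'. \<forall>v\<in>y - {0}. \<forall>v'\<in>y' - {0}. (\<exists>a. bieval (g a) v v' \<noteq> 0) \<longrightarrow>
           f y y' = vec.span {\<chi> a. bieval (g a) v v'}))"

text \<open>Maps on a curve are made extensional so that they can be compared and counted.\<close>

definition fpf_involutions :: "'a::field curve \<Rightarrow> ('a pt \<Rightarrow> 'a pt) set" where
  "fpf_involutions C = {i \<in> extensional (pts C).
     regular_map C C i \<and> (\<forall>x\<in>pts C. i (i x) = x \<and> i x \<noteq> x)}"

definition conjugate_map :: "'a::field curve set \<Rightarrow> 'a curve \<Rightarrow> 'a pt \<Rightarrow> 'a pt" where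
  "conjugate_map \<pi> H = (\<lambda>x\<in>pts H. THE y. common_conjugate \<pi> x y)"

definition net_of :: "'a::field curve \<Rightarrow> ('a pt \<Rightarrow> 'a pt) \<Rightarrow> 'a curve set" where
  "net_of H i = {\<gamma> \<in> curves 2. \<forall>x\<in>pts H. conjugate \<gamma> x (i x)}"

definition cubic_pairs :: "('a::field curve \<times> ('a pt \<Rightarrow> 'a pt)) set" where
  "cubic_pairs = {(H, i). H \<in> curves 3 \<and> smooth H \<and> i \<in> fpf_involutions H}"

definition pair_of_net :: "'a::field curve set \<Rightarrow> 'a curve \<times> ('a pt \<Rightarrow> 'a pt)" where
  "pair_of_net \<pi> = (let H = hessian (cubic_of_net \<pi>) in (H, conjugate_map \<pi> H))"

section \<open>Projective equivalence\<close>

text \<open>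
  Elements of \<open>PGL(3)\<close> are represented by invertible matrices; scalar matrices act trivially.
  The matrix \<open>g\<close> transports the first object to the second one if the second one pulls back
  to the first one along \<open>v \<mapsto> g v\<close>.
\<close>

definition net_transport :: "'a::field ^ 3 ^ 3 \<Rightarrow> 'a curve set \<Rightarrow> 'a curve set \<Rightarrow> bool" where
  "net_transport g \<pi> \<pi>' \<longleftrightarrow> \<pi> = (\<lambda>\<gamma>. linsubst g ` \<gamma>) ` \<pi>'"

definition pair_transport :: "'a::field ^ 3 ^ 3 \<Rightarrow>
    'a curve \<times> ('a pt \<Rightarrow> 'a pt) \<Rightarrow> 'a curve \<times> ('a pt \<Rightarrow> 'a pt) \<Rightarrow> bool" where
  "pair_transport g = (\<lambda>(H, i) (H', i'). H = linsubst g ` H' \<and>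
     (\<forall>x\<in>pts H. i' ((*v) g ` x) = (*v) g ` i x))"

definition net_equiv :: "('a::field curve set \<times> 'a curve set) set" where
  "net_equiv = {(\<pi>, \<pi>'). \<pi> \<in> smooth_nets \<and> \<pi>' \<in> smooth_nets \<and>
     (\<exists>g. invertible g \<and> net_transport g \<pi> \<pi>')}"

definition pair_equiv ::
    "(('a::field curve \<times> ('a pt \<Rightarrow> 'a pt)) \<times> ('a curve \<times> ('a pt \<Rightarrow> 'a pt))) set" where
  "pair_equiv = {(p, p'). p \<in> cubic_pairs \<and> p' \<in> cubic_pairs \<and>
     (\<exists>g. invertible g \<and> pair_transport g p p')}"

section \<open>Algebraic group structures on a curve\<close>

definition algebraic_group_on :: "'a::field curve \<Rightarrow> 'a pt monoid \<Rightarrow> bool" where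
  "algebraic_group_on C G \<longleftrightarrow> group G \<and> carrier G = pts C \<and>
     regular_map2 C C C (mult G) \<and> regular_map C C (m_inv G)"

definition translation :: "'b monoid \<Rightarrow> 'b \<Rightarrow> 'b \<Rightarrow> 'b" where
  "translation G t = (\<lambda>x\<in>carrier G. t \<otimes>\<^bsub>G\<^esub> x)"

end

theory Submission
  imports Defs
begin

text \<open>
  The conics of a net with smooth discriminant have rank at least two, and the linear equations
  saying that a map from vectors to conics of the net is the differential of a cubic have a nonzero
  solution, because one relation between them holds for every net. This gives the cubic \<open>F\<close>. In
  terms of its symmetric trilinear form \<open>T\<close>, a point \<open>y\<close> is a common conjugate of \<open>x\<close> iff
  \<open>T(x, y, \<cdot>) = 0\<close>; this relation is symmetric, and \<open>x\<close> admits such a \<open>y\<close> iff the polar conic of \<open>x\<close>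
  is singular, which means that \<open>x\<close> lies on the Hessian.

  For the converse, a smooth cubic is brought into Weierstrass form with the origin of its group law
  at infinity. Regular functions on the affine part are polynomials \<open>p(x) + q(x) y\<close>, so that
  automorphisms fixing the origin are of the form \<open>(x, y) \<mapsto> (u x + r, s y)\<close> and finite in number.
  By rigidity every involution \<open>i\<close> is \<open>x \<mapsto> t + \<alpha>(x)\<close> with \<open>\<alpha>\<close> one of them and \<open>\<alpha>\<^sup>2 = 1\<close>; for
  \<open>\<alpha> = -1\<close> halving \<open>t\<close> produces a fixed point, which leaves the translations by the points of order
  two. With such a point moved to \<open>x = y = 0\<close>, the translation is \<open>(x, y) \<mapsto> (b / x, - b y / x\<^sup>2)\<close>, and
  the conics for which \<open>x\<close> and \<open>i(x)\<close> are conjugate form an explicit net, whose discriminant is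
  smooth. Its cubic has a Hessian containing the given curve, hence equal to it.
\<close>

text \<open>Smoothness of the discriminant is used through its gradient: at a singular conic of rank
  two with vertex x the gradient is evaluation of conics at x, up to a scalar, and at rank one it
  vanishes. A nonzero gradient therefore gives rank two, which makes common conjugates unique, and
  keeps x off the base locus, which excludes fixed points of the involution. The group law is built
  from an explicit chord operation, without divisors. Its associativity, the shape of the
  involutions and the uniqueness of algebraic group laws all rest on one rigidity principle: in a
  family of automorphisms fixing the origin, parametrised by the curve, infinitely many members
  coincide because there are only finitely many candidates, and then all coincide by the identity
  principle. That a net consists of all conics for which x and i(x) are conjugate is not shown
  directly. One inclusion is formal; the explicit computation for translations shows that the larger
  set is a net as well, and dimensions decide.\<close>

definition monomial_value :: "('n::finite \<Rightarrow>\<^sub>0 nat) \<Rightarrow> 'a::comm_ring_1 ^ 'n \<Rightarrow> 'a" where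
  "monomial_value m v = (\<Prod>a\<in>UNIV. (v $ a) ^ Poly_Mapping.lookup m a)"

lemma peval_superset:
  assumes "finite K" "Poly_Mapping.keys F \<subseteq> K"
  shows "peval F v = (\<Sum>m\<in>K. Poly_Mapping.lookup F m * monomial_value m v)"
  unfolding peval_def monomial_value_def
  by (rule sum.mono_neutral_left) (use assms in \<open>auto simp: in_keys_iff\<close>)

lemma peval_0 [simp]: "peval 0 v = 0"
  by (simp add: peval_def)

lemma peval_single: "peval (Poly_Mapping.single m c) v = c * monomial_value m v"
  by (subst peval_superset[of "{m}"]) auto

lemma peval_add: "peval (F + G) v = peval F v + peval G v"
proof -
  let ?K = "Poly_Mapping.keys F \<union> Poly_Mapping.keys G"
  have "Poly_Mapping.keys (F + G) \<subseteq> ?K" by (rule keys_add)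
  then show ?thesis
    by (simp add: peval_superset[of ?K] lookup_add distrib_right sum.distrib)
qed

lemma peval_sum: "peval (\<Sum>i\<in>I. F i) v = (\<Sum>i\<in>I. peval (F i) v)"
  by (induction I rule: infinite_finite_induct) (auto simp: peval_add)

lemma monomial_value_add: "monomial_value (m + n) v = monomial_value m v * monomial_value n v"
  by (simp add: monomial_value_def lookup_add power_add prod.distrib)

lemma poly_mapping_sum_singles:
  "F = (\<Sum>m\<in>Poly_Mapping.keys F. Poly_Mapping.single m (Poly_Mapping.lookup F m))"
  by (rule poly_mapping_eqI)
    (auto simp: lookup_sum lookup_single when_def in_keys_iff sum.delta)

lemma peval_mult: "peval (F * G) v = peval F v * peval G v"
proof -
  let ?s = "\<lambda>F m. Poly_Mapping.single m (Poly_Mapping.lookup F m)"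
  have "F * G = (\<Sum>m\<in>Poly_Mapping.keys F. ?s F m) * (\<Sum>n\<in>Poly_Mapping.keys G. ?s G n)"
    using poly_mapping_sum_singles[of F] poly_mapping_sum_singles[of G] by simp
  also have "\<dots> = (\<Sum>m\<in>Poly_Mapping.keys F. \<Sum>n\<in>Poly_Mapping.keys G. ?s F m * ?s G n)"
    by (simp add: sum_product)
  finally have "peval (F * G) v = (\<Sum>m\<in>Poly_Mapping.keys F. \<Sum>n\<in>Poly_Mapping.keys G.
      peval (?s F m) v * peval (?s G n) v)"
    by (simp add: peval_sum mult_single peval_single monomial_value_add ac_simps)
  also have "\<dots> = (\<Sum>m\<in>Poly_Mapping.keys F. peval (?s F m) v) * (\<Sum>n\<in>Poly_Mapping.keys G. peval (?s G n) v)"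
    by (simp add: sum_product)
  also have "\<dots> = peval (\<Sum>m\<in>Poly_Mapping.keys F. ?s F m) v * peval (\<Sum>n\<in>Poly_Mapping.keys G. ?s G n) v"
    by (simp add: peval_sum)
  also have "\<dots> = peval F v * peval G v"
    using poly_mapping_sum_singles[of F] poly_mapping_sum_singles[of G] by simp
  finally show ?thesis .
qed

lemma peval_Const [simp]: "peval (Const c) v = c"
  by (simp add: Const_def peval_single monomial_value_def)

lemma peval_1 [simp]: "peval 1 v = 1"
  using peval_Const[of 1 v] by (simp add: Const_def single_one)

lemma peval_Var [simp]: "peval (Var a) v = v $ a"
proof -
  have "(\<Prod>b\<in>UNIV. (v $ b) ^ Poly_Mapping.lookup (Poly_Mapping.single a 1) b)
      = (\<Prod>b\<in>UNIV. if b = a then v $ b else 1)"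
    by (intro prod.cong) (auto simp: lookup_single)
  then show ?thesis
    by (simp add: Var_def peval_single monomial_value_def prod.delta)
qed

lemma peval_pscale [simp]: "peval (pscale c F) v = c * peval F v"
  by (simp add: pscale_def peval_mult)

lemma peval_prod: "peval (\<Prod>i\<in>I. F i) v = (\<Prod>i\<in>I. peval (F i) v)"
  by (induction I rule: infinite_finite_induct) (auto simp: peval_mult)

lemma peval_power: "peval (F ^ n) v = peval F v ^ n"
  by (induction n) (auto simp: peval_mult)

lemma peval_uminus: "peval (- F) v = - peval F v"
  using peval_add[of F "- F" v] by (simp add: eq_neg_iff_add_eq_0 add.commute)

lemma peval_diff: "peval (F - G) v = peval F v - peval G v"
  using peval_add[of F "- G" v] by (simp add: peval_uminus)

text \<open>The class \<open>C\<close> is kept abstract so that the rule can be instantiated with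
  the polynomial functions \<open>polE\<close> on the affine curve.\<close>

lemma peval_closed:
  fixes C :: "('x \<Rightarrow> 'a::comm_ring_1) \<Rightarrow> bool" and f :: "'x \<Rightarrow> 'a ^ 'n::finite"
  assumes const: "\<And>c. C (\<lambda>x. c)"
    and add: "\<And>f g. C f \<Longrightarrow> C g \<Longrightarrow> C (\<lambda>x. f x + g x)"
    and mult: "\<And>f g. C f \<Longrightarrow> C g \<Longrightarrow> C (\<lambda>x. f x * g x)"
    and f: "\<And>a. C (\<lambda>x. f x $ a)"
  shows "C (\<lambda>x. peval F (f x))"
proof -
  have sum: "C (\<lambda>x. \<Sum>i\<in>I. g i x)" if "\<And>i. C (g i)" for I and g :: "('n \<Rightarrow>\<^sub>0 nat) \<Rightarrow> _"
    by (induction I rule: infinite_finite_induct) (auto intro: const add that)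
  have pow: "C (\<lambda>x. g x ^ n)" if "C g" for n g
    by (induction n) (auto intro: const mult that)
  have prod: "C (\<lambda>x. \<Prod>i\<in>I. g i x)" if "\<And>i. C (g i)" for I and g :: "'n \<Rightarrow> _"
    by (induction I rule: infinite_finite_induct) (auto intro: const mult that)
  show ?thesis
    unfolding peval_def by (intro sum mult const prod pow f)
qed

section \<open>Homogeneous polynomials\<close>

text \<open>An arbitrary weight \<open>w\<close> serves \<open>forms\<close> (total degree) and
  \<open>biforms\<close> (pairs of degrees, added componentwise) at once.\<close>

definition homogeneous :: "(('n \<Rightarrow>\<^sub>0 nat) \<Rightarrow> 'b) \<Rightarrow> 'b \<Rightarrow> ('n, 'a::comm_ring_1) mpol set" where
  "homogeneous w d = {F. \<forall>m\<in>Poly_Mapping.keys F. w m = d}"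

lemma homogeneous_0 [simp]: "0 \<in> homogeneous w d"
  by (simp add: homogeneous_def)

lemma homogeneous_add: "F \<in> homogeneous w d \<Longrightarrow> G \<in> homogeneous w d \<Longrightarrow> F + G \<in> homogeneous w d"
  using keys_add[of F G] by (auto simp: homogeneous_def)

lemma homogeneous_sum: "(\<And>i. i \<in> I \<Longrightarrow> F i \<in> homogeneous w d) \<Longrightarrow> (\<Sum>i\<in>I. F i) \<in> homogeneous w d"
  by (induction I rule: infinite_finite_induct) (auto simp: homogeneous_add)

lemma homogeneous_single: "c = 0 \<or> w m = d \<Longrightarrow> Poly_Mapping.single m c \<in> homogeneous w d"
  by (auto simp: homogeneous_def)

lemma homogeneous_mult:
  assumes "F \<in> homogeneous w d" "G \<in> homogeneous w e" "\<And>m n. w (m + n) = w m + w n"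
  shows "F * G \<in> homogeneous w (d + e)"
  using keys_mult[of F G] assms by (auto simp: homogeneous_def)

definition total_degree :: "('n::finite \<Rightarrow>\<^sub>0 nat) \<Rightarrow> nat" where
  "total_degree m = (\<Sum>a\<in>UNIV. Poly_Mapping.lookup m a)"

definition bidegree :: "(3 + 3 \<Rightarrow>\<^sub>0 nat) \<Rightarrow> nat \<times> nat" where
  "bidegree m = (\<Sum>a\<in>UNIV. Poly_Mapping.lookup m (Inl a), \<Sum>b\<in>UNIV. Poly_Mapping.lookup m (Inr b))"

lemma total_degree_add: "total_degree (m + n) = total_degree m + total_degree n"
  by (simp add: total_degree_def lookup_add sum.distrib)

lemma bidegree_add: "bidegree (m + n) = bidegree m + bidegree n"
  by (simp add: bidegree_def lookup_add sum.distrib)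

lemma forms_homogeneous: "forms d = homogeneous total_degree d"
  by (simp add: forms_def homogeneous_def total_degree_def)

lemma biforms_homogeneous: "biforms d e = homogeneous bidegree (d, e)"
  by (simp add: biforms_def homogeneous_def bidegree_def)

lemma forms_0 [simp]: "0 \<in> forms d"
  by (simp add: forms_homogeneous)

lemma forms_add: "F \<in> forms d \<Longrightarrow> G \<in> forms d \<Longrightarrow> F + G \<in> forms d"
  by (simp add: forms_homogeneous homogeneous_add)

lemma forms_sum: "(\<And>i. i \<in> I \<Longrightarrow> F i \<in> forms d) \<Longrightarrow> (\<Sum>i\<in>I. F i) \<in> forms d"
  by (simp add: forms_homogeneous homogeneous_sum)

lemma forms_mult: "F \<in> forms d \<Longrightarrow> G \<in> forms e \<Longrightarrow> F * G \<in> forms (d + e)"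
  by (simp add: forms_homogeneous homogeneous_mult total_degree_add)

lemma forms_Const: "Const c \<in> forms 0"
  by (simp add: forms_homogeneous Const_def homogeneous_single total_degree_def)

lemma total_degree_single: "total_degree (Poly_Mapping.single a k) = k"
  by (simp add: total_degree_def lookup_single when_def eq_commute sum.delta)

lemma forms_Var: "Var a \<in> forms 1"
  by (simp add: forms_homogeneous Var_def homogeneous_single total_degree_single)

lemma forms_pscale: "F \<in> forms d \<Longrightarrow> pscale c F \<in> forms d"
  using forms_mult[OF forms_Const, of F d c] by (simp add: pscale_def)

lemma forms_uminus: "F \<in> forms d \<Longrightarrow> - F \<in> forms d"
  by (auto simp: forms_def)

lemma forms_diff: "F \<in> forms d \<Longrightarrow> G \<in> forms d \<Longrightarrow> F - G \<in> forms d"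
  using forms_add[of F d "- G"] forms_uminus[of G d] by simp

text \<open>Functions induced by forms replace the forms themselves, so that the degree of a
  composite is assembled by closure rules without naming a polynomial.\<close>

definition form_fun :: "nat \<Rightarrow> ('a::comm_ring_1 ^ 3 \<Rightarrow> 'a) \<Rightarrow> bool" where
  "form_fun d p \<longleftrightarrow> (\<exists>F\<in>forms d. \<forall>v. p v = peval F v)"

lemma form_fun_peval: "F \<in> forms d \<Longrightarrow> form_fun d (peval F)"
  by (auto simp: form_fun_def)

lemma form_fun_0: "form_fun d (\<lambda>v. 0)"
  unfolding form_fun_def by (rule bexI[of _ 0]) auto

lemma form_fun_const: "form_fun 0 (\<lambda>v. c)"
  unfolding form_fun_def by (rule bexI[of _ "Const c"]) (auto simp: forms_Const)

lemma form_fun_coord: "form_fun 1 (\<lambda>v. v $ a)"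
  unfolding form_fun_def by (rule bexI[of _ "Var a"]) (simp, rule forms_Var)

lemma form_fun_add:
  assumes "form_fun d p" "form_fun d q"
  shows "form_fun d (\<lambda>v. p v + q v)"
proof -
  from assms obtain F G where "F \<in> forms d" "G \<in> forms d" "\<And>v. p v = peval F v" "\<And>v. q v = peval G v"
    by (auto simp: form_fun_def)
  then show ?thesis unfolding form_fun_def
    by (intro bexI[of _ "F + G"]) (simp_all add: peval_add forms_add)
qed

lemma form_fun_mult:
  assumes "form_fun d p" "form_fun e q"
  shows "form_fun (d + e) (\<lambda>v. p v * q v)"
proof -
  from assms obtain F G where "F \<in> forms d" "G \<in> forms e" "\<And>v. p v = peval F v" "\<And>v. q v = peval G v"
    by (auto simp: form_fun_def)
  then show ?thesis unfolding form_fun_def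
    by (intro bexI[of _ "F * G"]) (simp_all add: peval_mult forms_mult)
qed

lemma form_fun_cmult: "form_fun d p \<Longrightarrow> form_fun d (\<lambda>v. c * p v)"
  using form_fun_mult[OF form_fun_const] by simp

lemma form_fun_uminus: "form_fun d p \<Longrightarrow> form_fun d (\<lambda>v. - p v)"
  using form_fun_cmult[of d p "-1"] by simp

lemma form_fun_diff: "form_fun d p \<Longrightarrow> form_fun d q \<Longrightarrow> form_fun d (\<lambda>v. p v - q v)"
  using form_fun_add[of d p "\<lambda>v. - q v"] form_fun_uminus by auto

lemma form_fun_sum: "(\<And>i. i \<in> I \<Longrightarrow> form_fun d (p i)) \<Longrightarrow> form_fun d (\<lambda>v. \<Sum>i\<in>I. p i v)"
  by (induction I rule: infinite_finite_induct) (auto intro: form_fun_0 form_fun_add)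

lemma form_fun_power: "form_fun d p \<Longrightarrow> form_fun (d * n) (\<lambda>v. p v ^ n)"
  by (induction n) (auto intro: form_fun_const form_fun_mult)

lemma form_fun_prod: "(\<And>i. i \<in> I \<Longrightarrow> form_fun (d i) (p i)) \<Longrightarrow> form_fun (\<Sum>i\<in>I. d i) (\<lambda>v. \<Prod>i\<in>I. p i v)"
  by (induction I rule: infinite_finite_induct) (auto intro: form_fun_const form_fun_mult)

section \<open>Functions induced by bihomogeneous forms, and composition\<close>

definition biform_fun :: "nat \<Rightarrow> nat \<Rightarrow> ('a::comm_ring_1 ^ 3 \<Rightarrow> 'a ^ 3 \<Rightarrow> 'a) \<Rightarrow> bool" where
  "biform_fun d e p \<longleftrightarrow> (\<exists>F\<in>biforms d e. \<forall>u v. p u v = bieval F u v)"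

lemma biform_fun_0: "biform_fun d e (\<lambda>u v. 0)"
  unfolding biform_fun_def by (rule bexI[of _ 0]) (auto simp: bieval_def biforms_homogeneous)

lemma biform_fun_const: "biform_fun 0 0 (\<lambda>u v. c)"
  unfolding biform_fun_def
  by (rule bexI[of _ "Const c"])
    (auto simp: bieval_def biforms_homogeneous Const_def bidegree_def peval_single
      monomial_value_def intro!: homogeneous_single)

lemma biform_fun_coord1: "biform_fun 1 0 (\<lambda>u v. u $ a)"
  unfolding biform_fun_def
  by (rule bexI[of _ "Var (Inl a)"])
    (auto simp: bieval_def biforms_homogeneous Var_def bidegree_def peval_Var[unfolded Var_def One_nat_def]
      lookup_single when_def sum.delta intro!: homogeneous_single)

lemma biform_fun_coord2: "biform_fun 0 1 (\<lambda>u v. v $ a)"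
  unfolding biform_fun_def
  by (rule bexI[of _ "Var (Inr a)"])
    (auto simp: bieval_def biforms_homogeneous Var_def bidegree_def peval_Var[unfolded Var_def One_nat_def]
      lookup_single when_def sum.delta intro!: homogeneous_single)

lemma biform_fun_add:
  assumes "biform_fun d e p" "biform_fun d e q"
  shows "biform_fun d e (\<lambda>u v. p u v + q u v)"
proof -
  from assms obtain F G where "F \<in> biforms d e" "G \<in> biforms d e"
    "\<And>u v. p u v = bieval F u v" "\<And>u v. q u v = bieval G u v"
    by (auto simp: biform_fun_def)
  then show ?thesis unfolding biform_fun_def
    by (intro bexI[of _ "F + G"]) (simp_all add: bieval_def peval_add biforms_homogeneous homogeneous_add)
qed

lemma biform_fun_mult:
  assumes "biform_fun d e p" "biform_fun d' e' q"
  shows "biform_fun (d + d') (e + e') (\<lambda>u v. p u v * q u v)"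
proof -
  from assms obtain F G where FG: "F \<in> biforms d e" "G \<in> biforms d' e'"
    "\<And>u v. p u v = bieval F u v" "\<And>u v. q u v = bieval G u v"
    by (auto simp: biform_fun_def)
  have "F * G \<in> biforms (d + d') (e + e')"
    using homogeneous_mult[of F bidegree "(d, e)" G "(d', e')", OF _ _ bidegree_add] FG
    by (simp add: biforms_homogeneous)
  moreover have "p u v * q u v = bieval (F * G) u v" for u v
    by (simp add: FG bieval_def peval_mult)
  ultimately show ?thesis by (auto simp: biform_fun_def)
qed

lemma biform_fun_cmult: "biform_fun d e p \<Longrightarrow> biform_fun d e (\<lambda>u v. c * p u v)"
  using biform_fun_mult[OF biform_fun_const] by simp

lemma biform_fun_uminus: "biform_fun d e p \<Longrightarrow> biform_fun d e (\<lambda>u v. - p u v)"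
  using biform_fun_cmult[of d e p "-1"] by simp

lemma biform_fun_diff:
  "biform_fun d e p \<Longrightarrow> biform_fun d e q \<Longrightarrow> biform_fun d e (\<lambda>u v. p u v - q u v)"
  using biform_fun_add[of d e p "\<lambda>u v. - q u v"] biform_fun_uminus by auto

lemma biform_fun_sum:
  "(\<And>i. i \<in> I \<Longrightarrow> biform_fun d e (p i)) \<Longrightarrow> biform_fun d e (\<lambda>u v. \<Sum>i\<in>I. p i u v)"
  by (induction I rule: infinite_finite_induct) (auto intro: biform_fun_0 biform_fun_add)

lemma biform_fun_power: "biform_fun d e p \<Longrightarrow> biform_fun (d * n) (e * n) (\<lambda>u v. p u v ^ n)"
  by (induction n) (auto intro: biform_fun_const biform_fun_mult)

lemma biform_fun_prod:
  "(\<And>i. i \<in> I \<Longrightarrow> biform_fun (d i) (e i) (p i)) \<Longrightarrow>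
    biform_fun (\<Sum>i\<in>I. d i) (\<Sum>i\<in>I. e i) (\<lambda>u v. \<Prod>i\<in>I. p i u v)"
  by (induction I rule: infinite_finite_induct) (auto intro: biform_fun_const biform_fun_mult)

lemma form_fun_compose:
  assumes "form_fun e p" "\<And>a. form_fun d (\<lambda>v. f v $ a)"
  shows "form_fun (e * d) (\<lambda>v. p (f v))"
proof -
  from assms(1) obtain F where F: "F \<in> forms e" "\<And>v. p v = peval F v" by (auto simp: form_fun_def)
  have "form_fun (e * d) (\<lambda>v. Poly_Mapping.lookup F m * (\<Prod>a\<in>UNIV. (f v $ a) ^ Poly_Mapping.lookup m a))"
    if "m \<in> Poly_Mapping.keys F" for m
  proof -
    \<comment> \<open>Every monomial of \<open>F\<close> has total degree \<open>e\<close>, so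
      inserting forms of degree \<open>d\<close> yields degree \<open>e * d\<close> monomial by
      monomial.\<close>
    have "e = (\<Sum>a\<in>UNIV. Poly_Mapping.lookup m a)" using F(1) that by (auto simp: forms_def)
    then have *: "e * d = (\<Sum>a\<in>UNIV. d * Poly_Mapping.lookup m a)"
      by (simp add: sum_distrib_left mult.commute)
    show ?thesis unfolding * by (intro form_fun_cmult form_fun_prod form_fun_power assms(2))
  qed
  then show ?thesis unfolding F(2) peval_def by (rule form_fun_sum)
qed

lemma biform_fun_compose_form:
  assumes "form_fun k p" "\<And>a. biform_fun d e (\<lambda>u v. f u v $ a)"
  shows "biform_fun (k * d) (k * e) (\<lambda>u v. p (f u v))"
proof -
  from assms(1) obtain F where F: "F \<in> forms k" "\<And>v. p v = peval F v" by (auto simp: form_fun_def)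
  have "biform_fun (k * d) (k * e)
      (\<lambda>u v. Poly_Mapping.lookup F m * (\<Prod>a\<in>UNIV. (f u v $ a) ^ Poly_Mapping.lookup m a))"
    if "m \<in> Poly_Mapping.keys F" for m
  proof -
    have k: "k = (\<Sum>a\<in>UNIV. Poly_Mapping.lookup m a)" using F(1) that by (auto simp: forms_def)
    then have *: "k * d = (\<Sum>a\<in>UNIV. d * Poly_Mapping.lookup m a)" "k * e = (\<Sum>a\<in>UNIV. e * Poly_Mapping.lookup m a)"
      by (simp_all add: sum_distrib_left mult.commute)
    show ?thesis unfolding * by (intro biform_fun_cmult biform_fun_prod biform_fun_power assms(2))
  qed
  then show ?thesis unfolding F(2) peval_def by (rule biform_fun_sum)
qed

lemma form_fun_compose_biform:
  assumes "biform_fun d e p" "\<And>a. form_fun k (\<lambda>v. f v $ a)" "\<And>a. form_fun l (\<lambda>v. g v $ a)"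
  shows "form_fun (d * k + e * l) (\<lambda>v. p (f v) (g v))"
proof -
  from assms(1) obtain F where F: "F \<in> biforms d e" "\<And>u v. p u v = bieval F u v"
    by (auto simp: biform_fun_def)
  let ?h = "\<lambda>v s. case s of Inl a \<Rightarrow> f v $ a | Inr b \<Rightarrow> g v $ b"
  have *: "form_fun (d * k + e * l)
      (\<lambda>v. Poly_Mapping.lookup F m * (\<Prod>s\<in>UNIV. (?h v s) ^ Poly_Mapping.lookup m s))"
    if "m \<in> Poly_Mapping.keys F" for m
  proof -
    have de: "d = (\<Sum>a\<in>UNIV. Poly_Mapping.lookup m (Inl a))" "e = (\<Sum>b\<in>UNIV. Poly_Mapping.lookup m (Inr b))"
      using F(1) that by (auto simp: biforms_def)
    \<comment> \<open>Variables of the first triple carry the weight \<open>k\<close>, those of the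
      second the weight \<open>l\<close>.\<close>
    have "d * k + e * l = (\<Sum>s\<in>UNIV. (case s of Inl a \<Rightarrow> k | Inr b \<Rightarrow> l) * Poly_Mapping.lookup m s)"
      unfolding UNIV_Plus_UNIV[symmetric]
      by (subst sum.Plus) (simp_all add: de mult.commute flip: sum_distrib_left)
    moreover have "form_fun (\<Sum>s\<in>UNIV. (case s of Inl a \<Rightarrow> k | Inr b \<Rightarrow> l) * Poly_Mapping.lookup m s)
        (\<lambda>v. \<Prod>s\<in>UNIV. (?h v s) ^ Poly_Mapping.lookup m s)"
      by (intro form_fun_prod form_fun_power) (auto split: sum.split simp: assms(2,3))
    ultimately show ?thesis by (simp add: form_fun_cmult)
  qed
  have "form_fun (d * k + e * l) (\<lambda>v. \<Sum>m\<in>Poly_Mapping.keys F.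
      Poly_Mapping.lookup F m * (\<Prod>s\<in>UNIV. (?h v s) ^ Poly_Mapping.lookup m s))"
    using * by (rule form_fun_sum)
  then show ?thesis unfolding F(2) bieval_def peval_def by simp
qed

section \<open>Forms are determined by their values\<close>

text \<open>Kronecker substitution: for large \<open>N\<close> the exponents \<open>i + N j + N\<^sup>2 k\<close> separate
  the monomials of the polynomial.\<close>

lemma digits_inj:
  fixes N :: nat
  assumes "i + N * (j + N * k) = i' + N * (j' + N * k')" "i < N" "i' < N" "j < N" "j' < N"
  shows "i = i' \<and> j = j' \<and> k = k'"
proof -
  have div: "(x + N * y) div N = y" and mod: "(x + N * y) mod N = x" if "x < N" for x y
    using that by auto
  have i: "i = i'" using mod[of i "j + N * k"] mod[of i' "j' + N * k'"] assms(1-3) by metis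
  have *: "j + N * k = j' + N * k'" using div[of i "j + N * k"] div[of i' "j' + N * k'"] assms(1-3) by metis
  have "j = j'" using mod[of j k] mod[of j' k'] * assms(4,5) by metis
  moreover have "k = k'" using div[of j k] div[of j' k'] * assms(4,5) by metis
  ultimately show ?thesis using i by simp
qed

lemma peval_eq_0_imp:
  fixes F :: "'a::field_char_0 form"
  assumes "\<And>v. peval F v = 0"
  shows "F = 0"
proof (rule ccontr)
  assume "F \<noteq> 0"
  let ?K = "Poly_Mapping.keys F" let ?l = "Poly_Mapping.lookup"
  obtain m0 where m0: "m0 \<in> ?K" using \<open>F \<noteq> 0\<close> by fastforce
  \<comment> \<open>One more than the sum of all exponents of \<open>F\<close>, so every single
    exponent is a digit in base \<open>N\<close>.\<close>
  define N where "N = Suc (\<Sum>m\<in>?K. \<Sum>a\<in>UNIV. ?l m a)"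
  have N: "?l m a < N" if "m \<in> ?K" for m and a :: 3
  proof -
    have "?l m a \<le> (\<Sum>a\<in>UNIV. ?l m a)" by (rule member_le_sum) auto
    also have "\<dots> \<le> (\<Sum>m\<in>?K. \<Sum>a\<in>UNIV. ?l m a)" using that by (intro member_le_sum) auto
    finally show ?thesis by (simp add: N_def)
  qed
  define e where "e m = ?l m 1 + N * (?l m 2 + N * ?l m 3)" for m :: "3 \<Rightarrow>\<^sub>0 nat"
  have inj: "inj_on e ?K"
  proof (rule inj_onI)
    fix m n assume mn: "m \<in> ?K" "n \<in> ?K" "e m = e n"
    then have "?l m 1 = ?l n 1 \<and> ?l m 2 = ?l n 2 \<and> ?l m 3 = ?l n 3"
      unfolding e_def by (intro digits_inj) (auto simp: N)
    then have "?l m k = ?l n k" for k using exhaust_3[of k] by auto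
    then show "m = n" by (rule poly_mapping_eqI)
  qed
  define P where "P = (\<Sum>m\<in>?K. Polynomial.monom (?l F m) (e m))"
  have "poly P t = 0" for t
  proof -
    define v :: "'a ^ 3" where "v = (\<chi> a. if a = 1 then t else if a = 2 then t ^ N else t ^ (N * N))"
    have "monomial_value m v = t ^ e m" for m
      unfolding monomial_value_def UNIV_3
      by (simp add: v_def e_def power_add power_mult[symmetric] algebra_simps)
    then have "peval F v = poly P t"
      unfolding P_def by (simp add: peval_superset[of ?K] poly_sum poly_monom)
    then show ?thesis using assms by simp
  qed
  then have "P = 0" using poly_all_0_iff_0 by blast
  moreover have "Polynomial.coeff P (e m0) = ?l F m0"
  proof -
    have "Polynomial.coeff P (e m0) = (\<Sum>m\<in>?K. if e m = e m0 then ?l F m else 0)"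
      by (simp add: P_def coeff_sum)
    also have "\<dots> = (\<Sum>m\<in>?K. if m = m0 then ?l F m else 0)"
      using inj m0 by (intro sum.cong) (auto simp: inj_on_def)
    finally show ?thesis using m0 by (simp add: sum.delta)
  qed
  ultimately show False using m0 by (simp add: in_keys_iff)
qed

lemma peval_inject:
  fixes F G :: "'a::field_char_0 form"
  assumes "\<And>v. peval F v = peval G v"
  shows "F = G"
  using peval_eq_0_imp[of "F - G"] assms by (simp add: peval_diff)

section \<open>Derivatives\<close>

lemma pdiff_superset:
  assumes "finite K" "Poly_Mapping.keys F \<subseteq> K"
  shows "pdiff a F = (\<Sum>m\<in>K. Poly_Mapping.single (m - Poly_Mapping.single a 1)
    (of_nat (Poly_Mapping.lookup m a) * Poly_Mapping.lookup F m))"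
  unfolding pdiff_def
  by (rule sum.mono_neutral_left) (use assms in \<open>auto simp: in_keys_iff\<close>)

lemma pdiff_add: "pdiff a (F + G) = pdiff a F + pdiff a G"
proof -
  let ?K = "Poly_Mapping.keys F \<union> Poly_Mapping.keys G"
  have "Poly_Mapping.keys (F + G) \<subseteq> ?K" by (rule keys_add)
  then show ?thesis
    by (simp add: pdiff_superset[of ?K] lookup_add distrib_left single_add sum.distrib)
qed

lemma pdiff_0 [simp]: "pdiff a 0 = 0"
  by (simp add: pdiff_def)

lemma pdiff_sum: "pdiff a (\<Sum>i\<in>I. F i) = (\<Sum>i\<in>I. pdiff a (F i))"
  by (induction I rule: infinite_finite_induct) (auto simp: pdiff_add)

lemma pdiff_single:
  "pdiff a (Poly_Mapping.single m c) =
    Poly_Mapping.single (m - Poly_Mapping.single a 1) (of_nat (Poly_Mapping.lookup m a) * c)"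
  by (subst pdiff_superset[of "{m}"]) auto

lemma pdiff_pscale:
  fixes F :: "('n, 'a::field) mpol"
  shows "pdiff a (pscale c F) = pscale c (pdiff a F)"
proof -
  have "pdiff a (pscale c (Poly_Mapping.single m d)) = pscale c (pdiff a (Poly_Mapping.single m d))"
    for m :: "'n \<Rightarrow>\<^sub>0 nat" and d :: 'a
    by (simp add: pscale_def Const_def mult_single pdiff_single algebra_simps)
  then show ?thesis
    by (subst (1 2) poly_mapping_sum_singles[of F])
      (simp add: pol.scale_sum_right pdiff_sum)
qed

lemma pdiff_commute:
  fixes F :: "('n, 'a::comm_ring_1) mpol"
  shows "pdiff a (pdiff b F) = pdiff b (pdiff a F)"
proof -
  have "pdiff a (pdiff b (Poly_Mapping.single m d)) = pdiff b (pdiff a (Poly_Mapping.single m d))"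
    for m :: "'n \<Rightarrow>\<^sub>0 nat" and d :: 'a
  proof (cases "a = b")
    case False
    then have "m - Poly_Mapping.single b 1 - Poly_Mapping.single a 1 = m - Poly_Mapping.single a 1 - Poly_Mapping.single b 1"
      by (intro poly_mapping_eqI) (simp add: lookup_minus)
    with False show ?thesis
      by (simp add: pdiff_single lookup_minus lookup_single algebra_simps)
  qed simp
  then show ?thesis
    by (subst (1 2) poly_mapping_sum_singles[of F]) (simp add: pdiff_sum)
qed

lemma minus_single_add_single:
  fixes m :: "'n \<Rightarrow>\<^sub>0 nat"
  assumes "Poly_Mapping.lookup m a > 0"
  shows "m = (m - Poly_Mapping.single a 1) + Poly_Mapping.single a 1"
proof (rule poly_mapping_eqI)
  fix k
  show "Poly_Mapping.lookup m k = Poly_Mapping.lookup (m - Poly_Mapping.single a 1 + Poly_Mapping.single a 1) k"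
    using assms by (cases "a = k") (simp_all add: lookup_add lookup_minus lookup_single)
qed

lemma pdiff_forms:
  assumes "F \<in> forms (Suc d)"
  shows "pdiff a F \<in> forms d"
  unfolding pdiff_def
proof (rule forms_sum)
  fix m assume m: "m \<in> Poly_Mapping.keys F"
  show "Poly_Mapping.single (m - Poly_Mapping.single a 1)
      (of_nat (Poly_Mapping.lookup m a) * Poly_Mapping.lookup F m) \<in> forms d"
  \<comment> \<open>Subtraction of exponents is truncated: if the variable does not occur the degree
    stays the same, but then the coefficient is zero.\<close>
  proof (cases "Poly_Mapping.lookup m a = 0")
    case False
    have "total_degree m = Suc d" using assms m by (auto simp: forms_homogeneous homogeneous_def)
    then have "total_degree (m - Poly_Mapping.single a 1) = d"
      using minus_single_add_single[of m a] False total_degree_add[of "m - Poly_Mapping.single a 1" "Poly_Mapping.single a 1"]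
      by (simp add: total_degree_single)
    then show ?thesis by (simp add: forms_homogeneous homogeneous_single)
  qed simp
qed

lemma euler_identity:
  assumes "F \<in> forms d"
  shows "(\<Sum>a\<in>UNIV. v $ a * peval (pdiff a F) v) = of_nat d * peval F v"
proof -
  have 1: "v $ a * peval (pdiff a (Poly_Mapping.single m c)) v = of_nat (Poly_Mapping.lookup m a) * peval (Poly_Mapping.single m c) v" for a m c
  proof (cases "Poly_Mapping.lookup m a = 0")
    case False
    have "monomial_value m v = monomial_value (m - Poly_Mapping.single a 1) v * v $ a"
      using minus_single_add_single[of m a] False
        monomial_value_add[of "m - Poly_Mapping.single a 1" "Poly_Mapping.single a 1" v]
        peval_Var[of a v] by (simp add: Var_def peval_single)
    then show ?thesis by (simp add: pdiff_single peval_single)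
  qed (simp add: pdiff_single)
  have "(\<Sum>a\<in>UNIV. v $ a * peval (pdiff a F) v) =
    (\<Sum>a\<in>UNIV. \<Sum>m\<in>Poly_Mapping.keys F. of_nat (Poly_Mapping.lookup m a) * peval (Poly_Mapping.single m (Poly_Mapping.lookup F m)) v)"
    by (subst poly_mapping_sum_singles[of F]) (simp add: pdiff_sum peval_sum sum_distrib_left 1)
  also have "\<dots> = (\<Sum>m\<in>Poly_Mapping.keys F. of_nat (total_degree m) * peval (Poly_Mapping.single m (Poly_Mapping.lookup F m)) v)"
    by (subst sum.swap) (simp add: total_degree_def sum_distrib_right)
  also have "\<dots> = (\<Sum>m\<in>Poly_Mapping.keys F. of_nat d * peval (Poly_Mapping.single m (Poly_Mapping.lookup F m)) v)"
    using assms by (intro sum.cong) (auto simp: forms_homogeneous homogeneous_def)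
  also have "\<dots> = of_nat d * peval F v"
    by (subst (3) poly_mapping_sum_singles[of F]) (simp add: peval_sum sum_distrib_left)
  finally show ?thesis .
qed

text \<open>Lets the constant top derivatives of quadratic and cubic forms be read off at the vector
  0, as \<open>tri\<close> and \<open>bil\<close> do.\<close>

lemma peval_forms_0:
  assumes "F \<in> forms 0"
  shows "peval F v = peval F w"
proof -
  have "m = 0" if "m \<in> Poly_Mapping.keys F" for m
  proof (rule poly_mapping_eqI)
    fix a
    have "Poly_Mapping.lookup m a \<le> total_degree m" unfolding total_degree_def by (rule member_le_sum) auto
    then show "Poly_Mapping.lookup m a = Poly_Mapping.lookup 0 a"
      using assms that by (auto simp: forms_homogeneous homogeneous_def)
  qed
  then have "Poly_Mapping.keys F \<subseteq> {0}" by blast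
  then show ?thesis by (simp add: peval_superset[of "{0}"] monomial_value_def)
qed

section \<open>Vectors in three-space\<close>

definition dot3 :: "'a::comm_ring_1 ^ 3 \<Rightarrow> 'a ^ 3 \<Rightarrow> 'a" where
  "dot3 u v = u $ 1 * v $ 1 + u $ 2 * v $ 2 + u $ 3 * v $ 3"

definition cross :: "'a::comm_ring_1 ^ 3 \<Rightarrow> 'a ^ 3 \<Rightarrow> 'a ^ 3" where
  "cross u v = vector [u $ 2 * v $ 3 - u $ 3 * v $ 2, u $ 3 * v $ 1 - u $ 1 * v $ 3, u $ 1 * v $ 2 - u $ 2 * v $ 1]"

definition det3 :: "'a::comm_ring_1 ^ 3 \<Rightarrow> 'a ^ 3 \<Rightarrow> 'a ^ 3 \<Rightarrow> 'a" where
  "det3 u v w = dot3 (cross u v) w"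

lemma dot3_0_left: "dot3 0 w = 0"
  by (simp add: dot3_def)

lemma cross_nth [simp]:
  "cross u v $ 1 = u $ 2 * v $ 3 - u $ 3 * v $ 2"
  "cross u v $ 2 = u $ 3 * v $ 1 - u $ 1 * v $ 3"
  "cross u v $ 3 = u $ 1 * v $ 2 - u $ 2 * v $ 1"
  by (simp_all add: cross_def)

lemma vec3_eq_iff: "(u :: 'a ^ 3) = v \<longleftrightarrow> u $ 1 = v $ 1 \<and> u $ 2 = v $ 2 \<and> u $ 3 = v $ 3"
  by (simp add: vec_eq_iff forall_3)

lemma cross_self [simp]: "cross u u = 0"
  by (simp add: vec3_eq_iff)

lemma cross_scale [simp]: "cross (c *s u) v = c *s cross u v" "cross u (c *s v) = c *s cross u v"
  by (simp_all add: vec3_eq_iff algebra_simps)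

lemma cross_add: "cross (u + u') v = cross u v + cross u' v" "cross u (v + v') = cross u v + cross u v'"
  by (simp_all add: vec3_eq_iff algebra_simps)

lemma cross_0 [simp]: "cross 0 v = 0" "cross u 0 = 0"
  by (simp_all add: vec3_eq_iff)

lemma cross_skew: "cross v u = - cross u v"
  by (simp add: vec3_eq_iff algebra_simps)

lemma cross_eq_0:
  fixes u v :: "'a::field ^ 3"
  assumes "cross u v = 0" "u \<noteq> 0"
  shows "\<exists>c. v = c *s u"
proof -
  obtain k where k: "u $ k \<noteq> 0" using \<open>u \<noteq> 0\<close> by (auto simp: vec_eq_iff)
  have e: "u $ 2 * v $ 3 = u $ 3 * v $ 2" "u $ 3 * v $ 1 = u $ 1 * v $ 3" "u $ 1 * v $ 2 = u $ 2 * v $ 1"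
    using assms(1) by (simp_all add: vec3_eq_iff)
  have "v = (v $ k / u $ k) *s u"
    using k exhaust_3[of k] e by (auto simp: vec3_eq_iff field_simps)
  then show ?thesis by blast
qed

text \<open>Cramer's rule without division.\<close>

lemma det3_expand:
  "det3 u v w *s x = det3 x v w *s u + det3 u x w *s v + det3 u v x *s w"
  by (simp add: vec3_eq_iff det3_def dot3_def algebra_simps)

lemma det3_zero: "det3 0 v w = 0" "det3 u 0 w = 0" "det3 u v 0 = 0"
  by (simp_all add: det3_def dot3_def)

lemma det3_coordinates:
  fixes u v w :: "'a::field ^ 3"
  assumes "det3 u v w \<noteq> 0"
  obtains r s t where "x = r *s u + s *s v + t *s w"
proof
  let ?d = "det3 u v w"
  have "x = (1 / ?d) *s (?d *s x)" using assms by simp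
  also have "\<dots> = (det3 x v w / ?d) *s u + (det3 u x w / ?d) *s v + (det3 u v x / ?d) *s w"
    by (subst det3_expand) (simp add: vec.scale_right_distrib)
  finally show "x = (det3 x v w / ?d) *s u + (det3 u x w / ?d) *s v + (det3 u v x / ?d) *s w" .
qed

lemma det3_combination:
  "det3 (r *s u + s *s v + t *s w) v w = r * det3 u v w"
  "det3 u (r *s u + s *s v + t *s w) w = s * det3 u v w"
  "det3 u v (r *s u + s *s v + t *s w) = t * det3 u v w"
  by (simp_all add: det3_def dot3_def algebra_simps)

lemma det3_independent:
  fixes u v w :: "'a::field ^ 3"
  assumes "det3 u v w \<noteq> 0" "r *s u + s *s v + t *s w = r' *s u + s' *s v + t' *s w"
  shows "r = r' \<and> s = s' \<and> t = t'"
proof -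
  have "r * det3 u v w = r' * det3 u v w" "s * det3 u v w = s' * det3 u v w" "t * det3 u v w = t' * det3 u v w"
    unfolding det3_combination[symmetric] using assms(2) by (metis det3_combination)+
  then show ?thesis using assms(1) by simp
qed

lemma det3_axis: "det3 u v (axis 1 1) = cross u v $ 1" "det3 u v (axis 2 1) = cross u v $ 2"
    "det3 u v (axis 3 1) = cross u v $ 3"
  by (simp_all add: det3_def dot3_def axis_def)

lemma extend_basis2:
  fixes u v :: "'a::field ^ 3"
  assumes "cross u v \<noteq> 0"
  obtains w where "det3 u v w \<noteq> 0"
  using assms det3_axis[of u v] by (metis vec3_eq_iff zero_index)

lemma extend_basis1:
  fixes u :: "'a::field ^ 3"
  assumes "u \<noteq> 0"
  obtains v where "cross u v \<noteq> 0"
proof -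
  have "\<exists>k. cross u (axis k 1) \<noteq> 0"
  proof (rule ccontr)
    assume "\<not> ?thesis"
    then have "cross u (axis 1 1) = 0" "cross u (axis 2 1) = 0" by auto
    then have "u = 0" by (simp add: vec3_eq_iff axis_def)
    with assms show False by simp
  qed
  with that show ?thesis by blast
qed

lemma det3_cyclic: "det3 v w u = det3 u v w" "det3 w u v = det3 u v w"
  by (simp_all add: det3_def dot3_def algebra_simps)

lemma det3_swap: "det3 v u w = - det3 u v w" "det3 u w v = - det3 u v w"
  by (simp_all add: det3_def dot3_def algebra_simps)

lemma det3_cross: "det3 u v w \<noteq> 0 \<Longrightarrow> cross u v \<noteq> (0 :: 'a::field ^ 3)"
  using dot3_0_left[of w] by (auto simp: det3_def)

lemma cross_eq_0_combination:
  fixes u v w :: "'a::field ^ 3"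
  assumes "cross u v \<noteq> 0" "det3 u v w = 0"
  obtains s t where "w = s *s u + t *s v"
proof -
  obtain z where z: "det3 u v z \<noteq> 0" using extend_basis2[OF assms(1)] .
  obtain r s t where w: "w = r *s u + s *s v + t *s z" using det3_coordinates[OF z] .
  have "t = 0" using det3_combination(3)[of u v r s t z] w assms(2) z by simp
  with w show ?thesis using that by simp
qed

lemma axis_expand:
  fixes v :: "'a::comm_ring_1 ^ 3"
  shows "v = v $ 1 *s axis 1 1 + v $ 2 *s axis 2 1 + v $ 3 *s axis 3 1"
  by (simp add: vec3_eq_iff axis_def)

section \<open>Points and curves\<close>

abbreviation point :: "'a::field ^ 3 \<Rightarrow> 'a pt" where
  "point v \<equiv> vec.span {v}"

lemma in_point_iff: "u \<in> point v \<longleftrightarrow> (\<exists>c. u = c *s v)"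
  by (auto simp: vec.span_singleton)

lemma point_eq_iff:
  fixes u v :: "'a::field ^ 3"
  assumes "u \<noteq> 0" "v \<noteq> 0"
  shows "point u = point v \<longleftrightarrow> (\<exists>c. c \<noteq> 0 \<and> v = c *s u)"
proof
  assume "point u = point v"
  then have "v \<in> point u" by (metis insertI1 vec.span_superset subsetD)
  then show "\<exists>c. c \<noteq> 0 \<and> v = c *s u" using assms by (auto simp: in_point_iff)
next
  assume "\<exists>c. c \<noteq> 0 \<and> v = c *s u"
  then obtain c where c: "c \<noteq> 0" "v = c *s u" by blast
  then have "u = (1 / c) *s v" by simp
  then have "u \<in> point v" "v \<in> point u" using c(2) unfolding in_point_iff by blast+
  then show "point u = point v" unfolding vec.span_eq by blast
qed

lemma point_scale: "c \<noteq> 0 \<Longrightarrow> u \<noteq> 0 \<Longrightarrow> point (c *s u) = point (u :: 'a::field ^ 3)"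
  by (subst eq_commute, subst point_eq_iff) auto

lemma point_eq_cross:
  fixes u v :: "'a::field ^ 3"
  assumes "u \<noteq> 0" "v \<noteq> 0"
  shows "point u = point v \<longleftrightarrow> cross u v = 0"
proof
  assume "cross u v = 0"
  then obtain c where "v = c *s u" using cross_eq_0 assms by blast
  then show "point u = point v" using assms by (subst point_eq_iff) auto
qed (use assms in \<open>auto simp: point_eq_iff\<close>)

lemma P2_iff: "x \<in> P2 \<longleftrightarrow> (\<exists>v. v \<noteq> 0 \<and> x = point v)"
  by (auto simp: P2_def)

lemma peval_scale:
  assumes "F \<in> forms d"
  shows "peval F (c *s v) = c ^ d * peval F v"
proof -
  have "monomial_value m (c *s v) = c ^ d * monomial_value m v" if "m \<in> Poly_Mapping.keys F" for m
    using that assms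
    by (auto simp: monomial_value_def power_mult_distrib prod.distrib forms_def power_sum)
  then show ?thesis
    by (simp add: peval_superset[of "Poly_Mapping.keys F"] sum_distrib_left algebra_simps)
qed

lemma span_pol_singleton: "G \<in> pol.span {F} \<longleftrightarrow> (\<exists>c. G = pscale c F)"
  by (auto simp: pol.span_singleton)

lemma pts_span:
  assumes "F \<in> forms d"
  shows "pts (pol.span {F}) = {point v | v. v \<noteq> 0 \<and> peval F v = 0}"
proof -
  have "(\<forall>G\<in>pol.span {F}. \<forall>u\<in>point v. peval G u = 0) \<longleftrightarrow> peval F v = 0" for v
  proof
    assume "\<forall>G\<in>pol.span {F}. \<forall>u\<in>point v. peval G u = 0"
    then show "peval F v = 0" using pol.span_base[of F "{F}"] vec.span_base[of v "{v}"] by blast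
  next
    assume "peval F v = 0"
    then show "\<forall>G\<in>pol.span {F}. \<forall>u\<in>point v. peval G u = 0"
      by (auto simp: span_pol_singleton in_point_iff peval_scale[OF assms])
  qed
  then show ?thesis by (auto simp: pts_def P2_def)
qed

lemma point_in_pts_iff:
  assumes "F \<in> forms d" "v \<noteq> 0"
  shows "point v \<in> pts (pol.span {F}) \<longleftrightarrow> peval F v = 0"
proof
  assume "point v \<in> pts (pol.span {F})"
  then obtain u where u: "u \<noteq> 0" "peval F u = 0" "point v = point u" by (auto simp: pts_span[OF assms(1)])
  then obtain c where "v = c *s u" using point_eq_iff[of u v] assms by auto
  then show "peval F v = 0" using u by (simp add: peval_scale[OF assms(1)])
qed (use assms in \<open>auto simp: pts_span\<close>)

lemma pts_subset_P2: "pts C \<subseteq> P2"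
  by (auto simp: pts_def)

lemma pts_cases:
  assumes "x \<in> pts C"
  obtains v where "v \<noteq> 0" "x = point v"
  using assms pts_subset_P2[of C] unfolding P2_iff[abs_def] by (metis P2_iff subsetD)

lemma span_pol_eq_iff:
  fixes F G :: "'a::field form"
  assumes "F \<noteq> 0" "G \<noteq> 0"
  shows "pol.span {F} = pol.span {G} \<longleftrightarrow> (\<exists>c. c \<noteq> 0 \<and> G = pscale c F)"
proof
  assume "pol.span {F} = pol.span {G}"
  then have "G \<in> pol.span {F}" by (metis insertI1 pol.span_superset subsetD)
  then show "\<exists>c. c \<noteq> 0 \<and> G = pscale c F" using assms by (auto simp: span_pol_singleton)
next
  assume "\<exists>c. c \<noteq> 0 \<and> G = pscale c F"
  then obtain c where c: "c \<noteq> 0" "G = pscale c F" by blast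
  then have "F = pscale (1 / c) G" by simp
  then have "F \<in> pol.span {G}" "G \<in> pol.span {F}" using c(2) unfolding span_pol_singleton by blast+
  then show "pol.span {F} = pol.span {G}" unfolding pol.span_eq by blast
qed

lemma in_proj_iff:
  fixes F :: "'a::field form"
  assumes "pol.subspace W" "F \<noteq> 0"
  shows "pol.span {F} \<in> proj W \<longleftrightarrow> F \<in> W"
proof
  assume "pol.span {F} \<in> proj W"
  then obtain G where G: "G \<in> W" "G \<noteq> 0" "pol.span {F} = pol.span {G}" by (auto simp: proj_def)
  then have "F \<in> pol.span {G}" by (metis insertI1 pol.span_superset subsetD)
  then show "F \<in> W" using G assms(1) by (auto simp: span_pol_singleton pol.subspace_scale)
qed (use assms in \<open>auto simp: proj_def\<close>)

lemma proj_subset_iff: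
  fixes W :: "'a::field form set"
  assumes "pol.subspace W" "pol.subspace W'"
  shows "proj W \<subseteq> proj W' \<longleftrightarrow> W \<subseteq> W'"
proof
  assume *: "proj W \<subseteq> proj W'"
  show "W \<subseteq> W'"
  proof
    fix F assume "F \<in> W"
    then show "F \<in> W'"
      using * in_proj_iff[of W F] in_proj_iff[of W' F] assms pol.subspace_0[of W'] by (cases "F = 0") auto
  qed
qed (auto simp: proj_def)

lemma proj_inject:
  fixes W :: "'a::field form set"
  assumes "pol.subspace W" "pol.subspace W'" "proj W = proj W'"
  shows "W = W'"
  using assms proj_subset_iff[of W W'] proj_subset_iff[of W' W] by blast

lemma curves_iff: "C \<in> curves d \<longleftrightarrow> (\<exists>F. F \<in> forms d \<and> F \<noteq> 0 \<and> C = pol.span {F})"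
  by (auto simp: proj_def)

section \<open>Polarisation of quadratic and cubic forms\<close>

text \<open>For a cubic form the third derivatives are constants, so their values at 0 are the
  coefficients; the division by 6 makes \<open>tri F v v v\<close> equal to
  \<open>peval F v\<close>.\<close>

definition tri :: "'a::field_char_0 form \<Rightarrow> 'a ^ 3 \<Rightarrow> 'a ^ 3 \<Rightarrow> 'a ^ 3 \<Rightarrow> 'a" where
  "tri F u v w = (\<Sum>a\<in>UNIV. \<Sum>b\<in>UNIV. \<Sum>c\<in>UNIV.
     peval (pdiff a (pdiff b (pdiff c F))) 0 * u $ a * v $ b * w $ c) / 6"

lemma tri_commute1: "tri F u v w = tri F v u w"
  unfolding tri_def
  by (subst sum.swap, subst pdiff_commute) (simp add: mult_ac)

lemma tri_commute2: "tri F u v w = tri F u w v"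
proof -
  have "(\<Sum>b\<in>UNIV. \<Sum>c\<in>UNIV. peval (pdiff a (pdiff b (pdiff c F))) 0 * u $ a * v $ b * w $ c)
      = (\<Sum>b\<in>UNIV. \<Sum>c\<in>UNIV. peval (pdiff a (pdiff b (pdiff c F))) 0 * u $ a * w $ b * v $ c)" for a
    by (subst sum.swap, subst (2) pdiff_commute) (simp add: mult_ac)
  then show ?thesis by (simp add: tri_def)
qed

lemma tri_commute3: "tri F u v w = tri F w v u"
  by (metis tri_commute1 tri_commute2)

lemma tri_add1: "tri F (u + u') v w = tri F u v w + tri F u' v w"
  by (simp add: tri_def algebra_simps sum.distrib add_divide_distrib)

lemma tri_scale1: "tri F (c *s u) v w = c * tri F u v w"
  by (simp add: tri_def algebra_simps sum_distrib_left)

lemma tri_add2: "tri F u (v + v') w = tri F u v w + tri F u v' w"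
  using tri_add1 tri_commute1 by metis

lemma tri_add3: "tri F u v (w + w') = tri F u v w + tri F u v w'"
  using tri_add2 tri_commute2 by metis

lemma tri_scale2: "tri F u (c *s v) w = c * tri F u v w"
  using tri_scale1 tri_commute1 by metis

lemma tri_scale3: "tri F u v (c *s w) = c * tri F u v w"
  using tri_scale2 tri_commute2 by metis

lemma tri_minus1: "tri F (- u) v w = - tri F u v w"
  using tri_scale1[of F "-1" u v w] by simp

lemma tri_minus2: "tri F u (- v) w = - tri F u v w"
  using tri_scale2[of F u "-1" v w] by simp

lemma tri_minus3: "tri F u v (- w) = - tri F u v w"
  using tri_scale3[of F u v "-1" w] by simp

lemma tri_0 [simp]: "tri F 0 v w = 0" "tri F u 0 w = 0" "tri F u v 0 = 0"
  by (simp_all add: tri_def)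

lemmas tri_linear = tri_add1 tri_add2 tri_add3 tri_scale1 tri_scale2 tri_scale3
  tri_minus1 tri_minus2 tri_minus3

lemmas tri_commute = tri_commute1 tri_commute2 tri_commute3

lemma tri_diff: "tri F u v (w - w') = tri F u v w - tri F u v w'"
  by (simp add: diff_conv_add_uminus tri_linear del: add_uminus_conv_diff)

lemma tri_axis: "tri F (axis a 1) (axis b 1) (axis c 1) = peval (pdiff a (pdiff b (pdiff c F))) 0 / 6"
  using exhaust_3[of a] exhaust_3[of b] exhaust_3[of c] by (auto simp: tri_def sum_3 axis_def)

lemma tri_expand3: "tri F u v w = (\<Sum>c\<in>UNIV. w $ c * tri F u v (axis c 1))"
  using arg_cong[OF axis_expand[of w], of "tri F u v"] by (simp add: tri_linear sum_3)

lemma tri_expand: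
  "tri F u v w = (\<Sum>a\<in>UNIV. u $ a * (\<Sum>b\<in>UNIV. v $ b * (\<Sum>c\<in>UNIV. w $ c * tri F (axis a 1) (axis b 1) (axis c 1))))"
proof -
  have 1: "tri F u v w = (\<Sum>a\<in>UNIV. u $ a * tri F (axis a 1) v w)" for u v w
    using tri_expand3[of F w v u] by (simp add: tri_commute3[of F _ v w])
  have 2: "tri F u v w = (\<Sum>a\<in>UNIV. v $ a * tri F u (axis a 1) w)" for u v w
    using tri_expand3[of F u w v] by (simp add: tri_commute2[of F u _ w])
  show ?thesis
    by (subst 1, subst 2, subst tri_expand3) simp
qed

lemma pdiff_pdiff_tri:
  fixes F :: "'a::field_char_0 form"
  assumes "F \<in> forms 3"
  shows "peval (pdiff a (pdiff b F)) v = 6 * tri F v (axis a 1) (axis b 1)"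
proof -
  have f: "pdiff a (pdiff b F) \<in> forms 1" using assms
    by (metis One_nat_def Suc_1 numeral_3_eq_3 pdiff_forms numeral_2_eq_2)
  have "peval (pdiff a (pdiff b F)) v = (\<Sum>c\<in>UNIV. v $ c * peval (pdiff c (pdiff a (pdiff b F))) v)"
    using euler_identity[OF f, of v] by simp
  also have "\<dots> = (\<Sum>c\<in>UNIV. v $ c * peval (pdiff c (pdiff a (pdiff b F))) 0)"
    using f by (intro sum.cong refl arg_cong2[of _ _ _ _ "(*)"] peval_forms_0[OF pdiff_forms]) simp
  also have "\<dots> = 6 * tri F v (axis a 1) (axis b 1)"
  proof -
    have c: "pdiff c (pdiff a (pdiff b F)) = pdiff a (pdiff b (pdiff c F))" for c
      by (metis pdiff_commute)
    have "tri F v (axis a 1) (axis b 1) = tri F (axis a 1) (axis b 1) v"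
      by (metis tri_commute1 tri_commute2)
    also have "\<dots> = (\<Sum>c\<in>UNIV. v $ c * peval (pdiff c (pdiff a (pdiff b F))) 0) / 6"
      by (subst tri_expand3) (simp add: tri_axis c sum_divide_distrib)
    finally show ?thesis by (simp add: mult.commute)
  qed
  finally show ?thesis .
qed

lemma pdiff_tri:
  fixes F :: "'a::field_char_0 form"
  assumes "F \<in> forms 3"
  shows "peval (pdiff a F) v = 3 * tri F v v (axis a 1)"
proof -
  have f: "pdiff a F \<in> forms 2" using assms
    by (metis Suc_1 numeral_3_eq_3 pdiff_forms numeral_2_eq_2)
  have "2 * peval (pdiff a F) v = (\<Sum>c\<in>UNIV. v $ c * peval (pdiff c (pdiff a F)) v)"
    using euler_identity[OF f, of v] by simp
  also have "\<dots> = (\<Sum>c\<in>UNIV. v $ c * (6 * tri F v (axis a 1) (axis c 1)))"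
    using pdiff_pdiff_tri[OF assms] by (simp add: tri_commute2)
  also have "\<dots> = 6 * tri F v (axis a 1) v"
    by (subst (2) tri_expand3) (simp add: sum_distrib_left algebra_simps)
  finally show ?thesis by (simp add: tri_commute2[of F v v])
qed

lemma peval_tri:
  fixes F :: "'a::field_char_0 form"
  assumes "F \<in> forms 3"
  shows "peval F v = tri F v v v"
proof -
  have "3 * peval F v = (\<Sum>c\<in>UNIV. v $ c * peval (pdiff c F) v)"
    using euler_identity[OF assms, of v] by simp
  also have "\<dots> = 3 * tri F v v v"
    by (subst tri_expand3) (simp add: sum_distrib_left pdiff_tri[OF assms] algebra_simps)
  finally show ?thesis by simp
qed

lemma pdiff_forms2: "F \<in> forms 3 \<Longrightarrow> pdiff a F \<in> forms 2"
  by (metis Suc_1 numeral_3_eq_3 pdiff_forms numeral_2_eq_2)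

lemma polar_pdiff:
  fixes F :: "'a::field_char_0 form"
  assumes "F \<in> forms 3"
  shows "polar (pdiff a F) u v = 3 * tri F (axis a 1) u v"
  unfolding polar_def pdiff_tri[OF assms]
  by (simp add: tri_linear tri_commute algebra_simps)

text \<open>In F(v + w) - F(v - w) the terms of even degree in w cancel, which leaves 6 T(v, v, w) +
  2 F(w). Gradients can thus be computed from values alone.\<close>

lemma tri_formula:
  fixes F :: "'a::field_char_0 form"
  assumes "F \<in> forms 3"
  shows "3 * tri F v v w = (peval F (v + w) - peval F (v - w)) / 2 - peval F w"
proof -
  have "tri F (v + w) (v + w) (v + w) = tri F v v v + 3 * tri F v v w + 3 * tri F v w w + tri F w w w"
    by (simp add: tri_linear tri_commute)
  moreover have "tri F (v - w) (v - w) (v - w) = tri F v v v - 3 * tri F v v w + 3 * tri F v w w - tri F w w w"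
    by (simp add: tri_diff tri_commute)
  ultimately show ?thesis unfolding peval_tri[OF assms] by (simp add: field_simps)
qed

text \<open>Uniqueness of polarisation: inclusion-exclusion over sums of u, v, w recovers 6 T(u, v,
  w) from the diagonal, using only symmetry and additivity.\<close>

lemma tri_cong:
  fixes F :: "'a::field_char_0 form"
  assumes "F \<in> forms 3" "\<And>u v w. T u v w = T v u w" "\<And>u v w. T u v w = T u w v"
    "\<And>u u' v w. T (u + u') v w = T u v w + T u' v w"
    "\<And>v. peval F v = T v v v"
  shows "tri F u v w = T u v w"
proof -
  have c3: "T u v w = T w v u" for u v w using assms(2,3) by metis
  have a2: "T u (v + v') w = T u v w + T u v' w" for u v v' w using assms(2,4) by metis
  have a3: "T u v (w + w') = T u v w + T u v w'" for u v w w' using assms(3) a2 by metis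
  have 1: "6 * T u v w = T (u+v+w) (u+v+w) (u+v+w) - T (u+v) (u+v) (u+v) - T (u+w) (u+w) (u+w)
     - T (v+w) (v+w) (v+w) + T u u u + T v v v + T w w w" for u v w
    unfolding assms(4) a2 a3
    by (simp add: assms(2)[of w u] assms(2)[of v u] assms(2)[of w v] assms(3)[of _ w u] assms(3)[of _ v u] assms(3)[of _ w v])
  have 2: "6 * tri F u v w = tri F (u+v+w) (u+v+w) (u+v+w) - tri F (u+v) (u+v) (u+v) - tri F (u+w) (u+w) (u+w)
     - tri F (v+w) (v+w) (v+w) + tri F u u u + tri F v v v + tri F w w w" for u v w
    by (simp add: tri_linear tri_commute algebra_simps)
  have "tri F v v v = T v v v" for v using assms(5) peval_tri[OF assms(1)] by simp
  then have "6 * tri F u v w = 6 * T u v w" unfolding 1 2 by simp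
  then show ?thesis by simp
qed

text \<open>An explicitly bilinear expression, introduced because bilinearity of
  \<open>polar\<close> cannot be seen from its definition by differences of values.\<close>

definition bil :: "'a::field_char_0 form \<Rightarrow> 'a ^ 3 \<Rightarrow> 'a ^ 3 \<Rightarrow> 'a" where
  "bil q u v = (\<Sum>a\<in>UNIV. \<Sum>b\<in>UNIV. peval (pdiff a (pdiff b q)) 0 * u $ a * v $ b) / 2"

lemma peval_bil:
  fixes q :: "'a::field_char_0 form"
  assumes "q \<in> forms 2"
  shows "peval q v = bil q v v"
proof -
  have q1: "pdiff a q \<in> forms 1" for a using assms by (metis One_nat_def Suc_1 pdiff_forms)
  have q0: "peval (pdiff b (pdiff a q)) v = peval (pdiff b (pdiff a q)) 0" for a b v
    by (rule peval_forms_0[OF pdiff_forms]) (use q1[of a] in simp)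
  have 1: "peval (pdiff a q) v = (\<Sum>b\<in>UNIV. v $ b * peval (pdiff b (pdiff a q)) 0)" for a v
  proof -
    have "peval (pdiff a q) v = (\<Sum>b\<in>UNIV. v $ b * peval (pdiff b (pdiff a q)) v)"
      using euler_identity[OF q1, of v a] by simp
    also have "\<dots> = (\<Sum>b\<in>UNIV. v $ b * peval (pdiff b (pdiff a q)) 0)"
      by (intro sum.cong refl arg_cong2[of _ _ _ _ "(*)"] q0)
    finally show ?thesis .
  qed
  have "2 * peval q v = (\<Sum>a\<in>UNIV. v $ a * peval (pdiff a q) v)"
    using euler_identity[OF assms, of v] by simp
  then show ?thesis
    unfolding bil_def 1 by (subst pdiff_commute) (simp add: sum_distrib_left mult_ac)
qed

lemma polar_bil:
  fixes q :: "'a::field_char_0 form"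
  assumes "q \<in> forms 2"
  shows "polar q u v = bil q u v"
proof -
  have c: "bil q u v = bil q v u" for u v
    unfolding bil_def by (subst sum.swap, subst pdiff_commute) (simp add: mult_ac)
  have "bil q (u + v) (u + v) = bil q u u + bil q u v + bil q v u + bil q v v"
    by (simp add: bil_def algebra_simps sum.distrib add_divide_distrib)
  then show ?thesis by (simp add: polar_def peval_bil[OF assms] c[of v u])
qed

lemma polar_commute: "polar q u v = polar q v u"
  by (simp add: polar_def add.commute algebra_simps)

context
  fixes q :: "'a::field_char_0 form"
  assumes q: "q \<in> forms 2"
begin

lemma polar_add1: "polar q (u + u') v = polar q u v + polar q u' v"
  by (simp add: polar_bil[OF q] bil_def algebra_simps sum.distrib add_divide_distrib)

lemma polar_scale1: "polar q (c *s u) v = c * polar q u v"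
  by (simp add: polar_bil[OF q] bil_def algebra_simps sum_distrib_left)

lemma polar_add2: "polar q u (v + v') = polar q u v + polar q u v'"
  using polar_add1 polar_commute by metis

lemma polar_scale2: "polar q u (c *s v) = c * polar q u v"
  using polar_scale1 polar_commute by metis

lemmas polar_linear = polar_add1 polar_add2 polar_scale1 polar_scale2

lemma polar_self: "polar q v v = peval q v"
  by (simp add: polar_bil[OF q] peval_bil[OF q])

end

lemma polar_sym_matrix:
  fixes q :: "'a::field_char_0 form"
  assumes "q \<in> forms 2"
  shows "polar q u v = (\<Sum>a\<in>UNIV. \<Sum>b\<in>UNIV. u $ a * v $ b * sym_matrix q $ a $ b)"
  using arg_cong2[OF axis_expand[of u] axis_expand[of v], of "polar q"]
  by (simp add: polar_linear[OF assms] sym_matrix_def sum_3 algebra_simps)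

lemma polar_plus_form: "polar (p + q) u v = polar p u v + polar q u v"
  by (simp add: polar_def peval_add add_divide_distrib diff_divide_distrib)

lemma polar_pscale: "polar (pscale c q) u v = c * polar q u v"
  by (simp add: polar_def algebra_simps diff_divide_distrib)

lemma polar_sum: "polar (\<Sum>i\<in>I. q i) u v = (\<Sum>i\<in>I. polar (q i) u v)"
  by (induction I rule: infinite_finite_induct) (auto simp: polar_plus_form polar_def[of 0])

lemma form2_eq_polar:
  fixes p q :: "'a::field_char_0 form"
  assumes "p \<in> forms 2" "q \<in> forms 2" "\<And>u v. polar p u v = polar q u v"
  shows "p = q"
  using assms by (intro peval_inject) (simp flip: polar_self)

lemma conjugate_point_iff:
  fixes q :: "'a::field_char_0 form"
  assumes "q \<in> forms 2"
  shows "conjugate (pol.span {q}) (point u) (point v) \<longleftrightarrow> polar q u v = 0"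
proof
  assume "conjugate (pol.span {q}) (point u) (point v)"
  then show "polar q u v = 0"
    unfolding conjugate_def using pol.span_base[of q "{q}"] vec.span_base[of v "{v}"] vec.span_base[of u "{u}"] by blast
qed (auto simp: conjugate_def span_pol_singleton in_point_iff polar_pscale polar_linear[OF assms])

text \<open>The derivative of F at v in direction w is 3 T(v, v, w), so the Jacobian criterion
  becomes a statement about the trilinear form.\<close>

lemma smooth_cubic_iff:
  fixes F :: "'a::field_char_0 form"
  assumes F: "F \<in> forms 3"
  shows "smooth (pol.span {F}) \<longleftrightarrow> (\<forall>v. v \<noteq> 0 \<and> peval F v = 0 \<longrightarrow> (\<exists>w. tri F v v w \<noteq> 0))"
proof -
  have *: "(\<exists>G\<in>pol.span {F}. \<exists>u\<in>point v. \<exists>a. peval (pdiff a G) u \<noteq> 0) \<longleftrightarrow> (\<exists>w. tri F v v w \<noteq> 0)" for v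
  proof
    assume "\<exists>G\<in>pol.span {F}. \<exists>u\<in>point v. \<exists>a. peval (pdiff a G) u \<noteq> 0"
    then obtain c d a where "peval (pdiff a (pscale c F)) (d *s v) \<noteq> 0"
      by (auto simp: span_pol_singleton in_point_iff)
    then have "tri F v v (axis a 1) \<noteq> 0" by (auto simp: pdiff_pscale pdiff_tri[OF F] tri_linear)
    then show "\<exists>w. tri F v v w \<noteq> 0" by blast
  next
    assume "\<exists>w. tri F v v w \<noteq> 0"
    then obtain w where w: "tri F v v w \<noteq> 0" by blast
    have "\<exists>a. tri F v v (axis a 1) \<noteq> 0"
    proof (rule ccontr)
      assume "\<not> ?thesis"
      then have "tri F v v w = 0" by (subst tri_expand3) simp
      with w show False by simp
    qed
    then obtain a where "tri F v v (axis a 1) \<noteq> 0" by blast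
    then have "peval (pdiff a F) v \<noteq> 0" by (simp add: pdiff_tri[OF F])
    then show "\<exists>G\<in>pol.span {F}. \<exists>u\<in>point v. \<exists>a. peval (pdiff a G) u \<noteq> 0"
      using pol.span_base[of F "{F}"] vec.span_base[of v "{v}"] by blast
  qed
  have "smooth (pol.span {F}) \<longleftrightarrow> (\<forall>v. v \<noteq> 0 \<and> peval F v = 0 \<longrightarrow>
      (\<exists>G\<in>pol.span {F}. \<exists>u\<in>point v. \<exists>a. peval (pdiff a G) u \<noteq> 0))"
    unfolding smooth_def pts_span[OF F] by blast
  then show ?thesis using * by simp
qed

lemma peval_linsubst: "peval (linsubst g F) v = peval F (g *v v)"
proof -
  have "peval (linsubst g F) v = (\<Sum>m\<in>Poly_Mapping.keys F. Poly_Mapping.lookup F m *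
     (\<Prod>a\<in>UNIV. (\<Sum>b\<in>UNIV. g $ a $ b * v $ b) ^ Poly_Mapping.lookup m a))"
    unfolding linsubst_def by (simp add: peval_sum peval_mult peval_prod peval_power)
  then show ?thesis by (simp add: peval_def matrix_vector_mult_def)
qed

lemma linsubst_forms:
  assumes "F \<in> forms d"
  shows "linsubst g F \<in> forms d"
proof -
  have pow: "H ^ n \<in> forms (e * n)" if "H \<in> forms e" for H :: "'a form" and e n
  proof (induction n)
    case (Suc n)
    then show ?case using forms_mult[OF that, of "H ^ n" "e * n"] by simp
  qed (use forms_Const[of 1] in \<open>simp add: Const_def single_one\<close>)
  have prd: "(\<Prod>i\<in>I. H i) \<in> forms (\<Sum>i\<in>I. e i)" if "\<And>i. H i \<in> forms (e i)" for H :: "3 \<Rightarrow> 'a form" and e I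
  proof (induction I rule: infinite_finite_induct)
    case (insert i I)
    then show ?case using forms_mult[OF that[of i]] by simp
  qed (use forms_Const[of 1] in \<open>simp_all add: Const_def single_one\<close>)
  have lin: "(\<Sum>b\<in>UNIV. Const (g $ a $ b) * Var b) \<in> forms 1" for a
    by (intro forms_sum forms_pscale[OF forms_Var, unfolded pscale_def])
  show ?thesis
    unfolding linsubst_def
  proof (rule forms_sum)
    fix m assume "m \<in> Poly_Mapping.keys F"
    then have "(\<Sum>a\<in>UNIV. 1 * Poly_Mapping.lookup m a) = d" using assms by (simp add: forms_def)
    moreover have "(\<Prod>a\<in>UNIV. (\<Sum>b\<in>UNIV. Const (g $ a $ b) * Var b) ^ Poly_Mapping.lookup m a)
        \<in> forms (\<Sum>a\<in>UNIV. 1 * Poly_Mapping.lookup m a)"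
      by (intro prd pow lin)
    ultimately show "Const (Poly_Mapping.lookup F m) *
        (\<Prod>a\<in>UNIV. (\<Sum>b\<in>UNIV. Const (g $ a $ b) * Var b) ^ Poly_Mapping.lookup m a) \<in> forms d"
      using forms_pscale[unfolded pscale_def] by simp
  qed
qed

section \<open>Symmetric matrices\<close>

definition det_deriv :: "'a::comm_ring_1 ^ 3 ^ 3 \<Rightarrow> 'a ^ 3 ^ 3 \<Rightarrow> 'a" where
  "det_deriv A B = det3 (B $ 1) (A $ 2) (A $ 3) + det3 (A $ 1) (B $ 2) (A $ 3) + det3 (A $ 1) (A $ 2) (B $ 3)"

lemma det_det3: "det A = det3 (A $ 1) (A $ 2) (A $ 3)"
  by (simp add: det_3 det3_def dot3_def algebra_simps)

text \<open>The determinant analogue of \<open>tri_formula\<close>; comparing both identifies the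
  gradient of the discriminant form with \<open>det_deriv\<close>.\<close>

lemma det_deriv_formula:
  fixes A :: "'a::field_char_0 ^ 3 ^ 3"
  shows "(det (A + B) - det (A - B)) / 2 - det B = det_deriv A B"
proof -
  have "det (A + B) - det (A - B) = 2 * (det_deriv A B + det B)"
    by (simp add: det_det3 det_deriv_def det3_def dot3_def algebra_simps)
  then have *: "(det (A + B) - det (A - B)) / 2 = det_deriv A B + det B"
    by (metis nonzero_mult_div_cancel_left zero_neq_numeral)
  show ?thesis unfolding * by simp
qed

lemma mv_nth: "(A *v x) $ i = dot3 (A $ i) x" for A :: "'a::comm_ring_1 ^ 3 ^ 'n"
  by (simp add: matrix_vector_mult_def dot3_def sum_3)

lemma cross_orthogonal:
  fixes r s x :: "'a::field ^ 3"
  assumes "dot3 r x = 0" "dot3 s x = 0" "x \<noteq> 0"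
  obtains c where "cross r s = c *s x"
proof -
  have "cross (cross r s) x = dot3 r x *s s - dot3 s x *s r"
    by (simp add: vec3_eq_iff dot3_def algebra_simps)
  then have "cross x (cross r s) = 0" using assms by (simp add: cross_skew[of x])
  with cross_eq_0[OF _ \<open>x \<noteq> 0\<close>] that show ?thesis by blast
qed

lemma dot3_scale: "dot3 (c *s u) v = c * dot3 u v" "dot3 u (c *s v) = c * dot3 u v"
  by (simp_all add: dot3_def algebra_simps)

text \<open>\<open>det_deriv A B\<close> is the trace of the adjugate of A times B. Rows of A are
  orthogonal to x, hence their cross products, the rows of the cofactor matrix, are multiples of x;
  since that matrix is symmetric it equals c times x x^T.\<close>

lemma det_deriv_kernel:
  fixes A :: "'a::field ^ 3 ^ 3"
  assumes sym: "\<And>i j. A $ i $ j = A $ j $ i" and x: "x \<noteq> 0" "A *v x = 0"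
  obtains c where "\<And>B. det_deriv A B = c * dot3 x (B *v x)"
proof -
  have d: "dot3 (A $ i) x = 0" for i using x(2) by (metis mv_nth zero_index)
  obtain k1 where k1: "cross (A $ 2) (A $ 3) = k1 *s x" using cross_orthogonal[OF d d x(1)] .
  obtain k2 where k2: "cross (A $ 3) (A $ 1) = k2 *s x" using cross_orthogonal[OF d d x(1)] .
  obtain k3 where k3: "cross (A $ 1) (A $ 2) = k3 *s x" using cross_orthogonal[OF d d x(1)] .
  have 1: "det_deriv A B = k1 * dot3 (B $ 1) x + k2 * dot3 (B $ 2) x + k3 * dot3 (B $ 3) x" for B
  proof -
    have "det_deriv A B = dot3 (cross (A $ 2) (A $ 3)) (B $ 1) + dot3 (cross (A $ 3) (A $ 1)) (B $ 2)
      + dot3 (cross (A $ 1) (A $ 2)) (B $ 3)"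
      by (simp add: det_deriv_def det3_def dot3_def algebra_simps)
    then show ?thesis unfolding k1 k2 k3 by (simp add: dot3_def algebra_simps)
  qed
  have "cross (A $ 2) (A $ 3) $ 2 = cross (A $ 3) (A $ 1) $ 1"
    "cross (A $ 2) (A $ 3) $ 3 = cross (A $ 1) (A $ 2) $ 1"
    "cross (A $ 3) (A $ 1) $ 3 = cross (A $ 1) (A $ 2) $ 2"
    using sym[of 1 2] sym[of 1 3] sym[of 2 3] by (simp_all add: algebra_simps)
  then have "k1 * x $ 2 = k2 * x $ 1" "k1 * x $ 3 = k3 * x $ 1" "k2 * x $ 3 = k3 * x $ 2"
    unfolding k1 k2 k3 by simp_all
  then have "cross x (vector [k1, k2, k3]) = 0" by (simp add: vec3_eq_iff algebra_simps)
  then obtain c where "vector [k1, k2, k3] = c *s x" using cross_eq_0 x(1) by blast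
  then have "k1 = c * x $ 1" "k2 = c * x $ 2" "k3 = c * x $ 3" by (simp_all add: vec3_eq_iff)
  then have "det_deriv A B = c * dot3 x (B *v x)" for B
    unfolding 1 by (simp add: dot3_def mv_nth algebra_simps)
  with that show ?thesis .
qed

text \<open>All rows of A are multiples of \<open>cross x y\<close>, and each of the three
  determinants in the derivative keeps two of these rows.\<close>

lemma det_deriv_rank1:
  fixes A :: "'a::field ^ 3 ^ 3"
  assumes "cross x y \<noteq> 0" "A *v x = 0" "A *v y = 0"
  shows "det_deriv A B = 0"
proof -
  have d: "dot3 (A $ i) x = 0" "dot3 (A $ i) y = 0" for i using assms(2,3) by (metis mv_nth zero_index)+
  have "\<exists>c. A $ i = c *s cross x y" for i
  proof -
    have "cross (cross x y) (A $ i) = dot3 (A $ i) x *s y - dot3 (A $ i) y *s x"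
      by (simp add: vec3_eq_iff dot3_def algebra_simps)
    then show ?thesis using d cross_eq_0 assms(1) by simp
  qed
  then obtain c where c: "\<And>i. A $ i = c i *s cross x y" by metis
  show ?thesis unfolding det_deriv_def c by (simp add: det3_def dot3_def algebra_simps)
qed

lemma det_eq_0_kernel:
  fixes A :: "'a::field ^ 'n ^ 'n"
  shows "det A = 0 \<longleftrightarrow> (\<exists>x. x \<noteq> 0 \<and> A *v x = 0)"
  using invertible_det_nz[of A] invertible_left_inverse[of A] matrix_left_invertible_ker[of A] by blast

section \<open>Nets of conics\<close>

definition lincomb :: "(3 \<Rightarrow> 'a::field form) \<Rightarrow> 'a ^ 3 \<Rightarrow> 'a form" where
  "lincomb b v = (\<Sum>c\<in>UNIV. pscale (v $ c) (b c))"

lemma lincomb_forms: "(\<And>c. b c \<in> forms d) \<Longrightarrow> lincomb b v \<in> forms d"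
  unfolding lincomb_def by (intro forms_sum forms_pscale)

lemma lincomb_add: "lincomb b (u + v) = lincomb b u + lincomb b v"
  by (simp add: lincomb_def pol.scale_left_distrib sum.distrib)

lemma lincomb_scale: "lincomb b (c *s v) = pscale c (lincomb b v)"
  by (simp add: lincomb_def pol.scale_sum_right)

lemma lincomb_0 [simp]: "lincomb b 0 = 0"
  by (simp add: lincomb_def)

lemma lincomb_diff: "lincomb b (u - v) = lincomb b u - lincomb b v"
  by (simp add: lincomb_def pol.scale_left_diff_distrib sum_subtractf)

lemma lincomb_axis: "lincomb b (axis c 1) = b c"
proof -
  have "lincomb b (axis c 1) = (\<Sum>d\<in>UNIV. if d = c then b d else 0)"
    unfolding lincomb_def by (intro sum.cong) (auto simp: axis_def)
  then show ?thesis by simp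
qed

lemma polar_lincomb: "polar (lincomb b v) x y = (\<Sum>c\<in>UNIV. v $ c * polar (b c) x y)"
  by (simp add: lincomb_def polar_sum polar_pscale)

lemma span_range_lincomb: "pol.span (range b) = range (lincomb b)"
proof (rule pol.span_unique)
  show "range b \<subseteq> range (lincomb b)" using lincomb_axis by (metis image_subsetI rangeI)
  show "pol.subspace (range (lincomb b))"
    unfolding pol.subspace_def by (auto simp flip: lincomb_add lincomb_scale) (metis lincomb_0 rangeI)
  show "range (lincomb b) \<subseteq> T" if "range b \<subseteq> T" "pol.subspace T" for T
    unfolding lincomb_def using that by (auto intro!: pol.subspace_sum pol.subspace_scale)
qed

lemma lincomb_subspace: "pol.subspace (range (lincomb b))"
  by (metis pol.subspace_span span_range_lincomb)

text \<open>\<open>inj b\<close> is part of the equivalence because \<open>pol.independent\<close>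
  speaks of the set \<open>range b\<close> and would not notice a repeated form.\<close>

lemma lincomb_independent:
  "(\<forall>v. lincomb b v = 0 \<longrightarrow> v = 0) \<longleftrightarrow> inj b \<and> pol.independent (range b)"
proof
  assume *: "\<forall>v. lincomb b v = 0 \<longrightarrow> v = 0"
  have inj: "inj b"
  proof (rule injI)
    fix i j assume "b i = b j"
    then have "lincomb b (axis i 1 - axis j 1) = 0" by (simp add: lincomb_diff lincomb_axis)
    then have "axis i (1::'a) = axis j 1" using * by (metis eq_iff_diff_eq_0)
    then show "i = j" by (simp add: axis_eq_axis)
  qed
  moreover have "pol.independent (range b)"
  proof
    assume "pol.dependent (range b)"
    then obtain u where u: "\<exists>v\<in>range b. u v \<noteq> 0" "(\<Sum>v\<in>range b. pscale (u v) v) = 0"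
      using pol.dependent_finite[of "range b"] by auto
    then have "lincomb b (\<chi> c. u (b c)) = 0"
      using inj by (simp add: lincomb_def sum.reindex)
    then have "u (b c) = 0" for c using * by (metis vec_lambda_beta zero_index)
    with u show False by auto
  qed
  ultimately show "inj b \<and> pol.independent (range b)" ..
next
  assume *: "inj b \<and> pol.independent (range b)"
  show "\<forall>v. lincomb b v = 0 \<longrightarrow> v = 0"
  proof (intro allI impI)
    fix v assume v: "lincomb b v = 0"
    have s: "(\<Sum>w\<in>range b. pscale (v $ inv_into UNIV b w) w) = 0"
      using * v by (simp add: lincomb_def sum.reindex)
    have "\<forall>w\<in>range b. v $ inv_into UNIV b w = 0"
    proof (rule ccontr)
      assume "\<not> ?thesis"
      then have "pol.dependent (range b)"
        unfolding pol.dependent_finite[OF finite_imageI[OF finite]]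
        by (intro exI[of _ "\<lambda>w. v $ inv_into UNIV b w"] conjI s) simp
      with * show False by simp
    qed
    then show "v = 0" using * by (simp add: vec_eq_iff)
  qed
qed

abbreviation net_matrix :: "(3 \<Rightarrow> 'a::field form) \<Rightarrow> 'a ^ 3 \<Rightarrow> 'a ^ 3 ^ 3" where
  "net_matrix b v \<equiv> sym_matrix (lincomb b v)"

lemma sym_matrix_sym: "sym_matrix q $ i $ j = sym_matrix q $ j $ i"
  by (simp add: sym_matrix_def polar_commute)

lemma net_matrix_add: "net_matrix b (v + w) = net_matrix b v + net_matrix b w"
  by (simp add: vec_eq_iff sym_matrix_def polar_plus_form lincomb_add)

lemma net_matrix_diff: "net_matrix b (v - w) = net_matrix b v - net_matrix b w"
  using net_matrix_add[of b "v - w" w] by (simp add: algebra_simps)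

lemma sym_matrix_mv:
  fixes q :: "'a::field_char_0 form"
  assumes "q \<in> forms 2"
  shows "dot3 x (sym_matrix q *v y) = polar q x y"
  by (simp add: polar_sym_matrix[OF assms] dot3_def mv_nth sum_3 algebra_simps)

lemma sym_matrix_kernel:
  fixes q :: "'a::field_char_0 form"
  assumes "q \<in> forms 2"
  shows "sym_matrix q *v x = 0 \<longleftrightarrow> (\<forall>w. polar q x w = 0)"
proof
  assume "sym_matrix q *v x = 0"
  then have "polar q w x = 0" for w using sym_matrix_mv[OF assms, of w x] by (simp add: dot3_def)
  then show "\<forall>w. polar q x w = 0" by (simp add: polar_commute[of q x])
next
  assume *: "\<forall>w. polar q x w = 0"
  have "(sym_matrix q *v x) $ i = polar q (axis i 1) x" for i
    using exhaust_3[of i] by (auto simp: dot3_def axis_def simp flip: sym_matrix_mv[OF assms])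
  then show "sym_matrix q *v x = 0" using * by (simp add: vec_eq_iff polar_commute[of q _ x])
qed

lemma peval_discr_form: "peval (discr_form b) v = det (net_matrix b v)"
  by (simp add: discr_form_def det_3 peval_add peval_diff peval_mult peval_sum sym_matrix_def
      polar_lincomb sum_3 mult.commute)

lemma discr_form_forms: "discr_form b \<in> forms 3"
proof -
  define l where "l i j = (\<Sum>c\<in>UNIV. Const (sym_matrix (b c) $ i $ j) * Var c)" for i j
  have l: "l i j \<in> forms 1" for i j
    unfolding l_def by (intro forms_sum forms_pscale[OF forms_Var, unfolded pscale_def])
  have "l i j * l i' j' * l i'' j'' \<in> forms 3" for i j i' j' i'' j''
    using forms_mult[OF forms_mult[OF l l] l] by (simp add: numeral_3_eq_3)
  then show ?thesis
    unfolding discr_form_def det_3 by (simp add: forms_add forms_diff flip: l_def)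
qed

text \<open>Moves the Jacobian criterion for the discriminant curve from forms to the symmetric
  matrices of the net, where kernels can be used.\<close>

lemma smooth_discr_form_iff:
  fixes b :: "3 \<Rightarrow> 'a::field_char_0 form"
  shows "smooth (pol.span {discr_form b}) \<longleftrightarrow> (\<forall>v. v \<noteq> 0 \<and> det (net_matrix b v) = 0 \<longrightarrow>
    (\<exists>w. det_deriv (net_matrix b v) (net_matrix b w) \<noteq> 0))"
proof -
  have "3 * tri (discr_form b) v v w = det_deriv (net_matrix b v) (net_matrix b w)" for v w
    by (simp add: tri_formula[OF discr_form_forms] peval_discr_form net_matrix_add net_matrix_diff
        det_deriv_formula)
  then have "tri (discr_form b) v v w \<noteq> 0 \<longleftrightarrow> det_deriv (net_matrix b v) (net_matrix b w) \<noteq> 0" for v w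
    by (metis mult_eq_0_iff zero_neq_numeral)
  then show ?thesis
    by (simp add: smooth_cubic_iff[OF discr_form_forms] peval_discr_form)
qed

locale smooth_net_basis =
  fixes b :: "3 \<Rightarrow> 'a::{alg_closed_field, field_char_0} form"
  assumes conics: "b c \<in> forms 2"
    and smooth: "smooth (pol.span {discr_form b})"
begin

lemma lincomb_conic: "lincomb b v \<in> forms 2"
  by (simp add: lincomb_forms conics)

text \<open>A nonzero parameter v whose conic has two independent singular points gives rank at most
  one, and there the gradient of the determinant vanishes in every direction.\<close>

lemma rank_ge_2:
  assumes "v \<noteq> 0" "\<And>w. polar (lincomb b v) x w = 0" "\<And>w. polar (lincomb b v) y w = 0"
  shows "cross x y = 0"
proof (rule ccontr)
  assume xy: "cross x y \<noteq> 0"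
  then have "x \<noteq> 0" by auto
  have k: "net_matrix b v *v x = 0" "net_matrix b v *v y = 0"
    using assms sym_matrix_kernel[OF lincomb_conic] by auto
  then have "det (net_matrix b v) = 0" using \<open>x \<noteq> 0\<close> det_eq_0_kernel by blast
  moreover have "det_deriv (net_matrix b v) (net_matrix b w) = 0" for w
    by (rule det_deriv_rank1[OF xy k])
  ultimately show False using smooth smooth_discr_form_iff[of b] assms(1) by blast
qed

text \<open>By \<open>det_deriv_kernel\<close> the gradient at a conic singular at x is proportional
  to w |-> q_w(x). This nonvanishing is what later keeps a point from being its own
  conjugate.\<close>

lemma singular_point_not_base:
  assumes "v \<noteq> 0" "x \<noteq> 0" "\<And>w. polar (lincomb b v) x w = 0"
  shows "\<exists>w. polar (lincomb b w) x x \<noteq> 0"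
proof -
  have k: "net_matrix b v *v x = 0" using assms sym_matrix_kernel[OF lincomb_conic] by auto
  then have "det (net_matrix b v) = 0" using assms det_eq_0_kernel by blast
  then obtain w where w: "det_deriv (net_matrix b v) (net_matrix b w) \<noteq> 0"
    using smooth smooth_discr_form_iff[of b] assms(1) by blast
  obtain c where "\<And>B. det_deriv (net_matrix b v) B = c * dot3 x (B *v x)"
    using det_deriv_kernel[OF sym_matrix_sym \<open>x \<noteq> 0\<close> k] by blast
  with w have "polar (lincomb b w) x x \<noteq> 0" by (auto simp: sym_matrix_mv[OF lincomb_conic])
  then show ?thesis ..
qed

text \<open>Linear independence comes for free: a nontrivial combination equal to 0 would be a conic
  of rank zero.\<close>

lemma lincomb_eq_0: "lincomb b v = 0 \<longleftrightarrow> v = 0"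
proof
  assume 0: "lincomb b v = 0"
  have *: "polar (lincomb b v) x w = 0" for x w by (simp add: 0 polar_def)
  show "v = 0"
  proof (rule ccontr)
    assume "v \<noteq> 0"
    then have "cross (axis 1 1) (axis 2 1) = (0 :: 'a ^ 3)" by (rule rank_ge_2) (rule *)+
    then show False by (simp add: vec3_eq_iff axis_def)
  qed
qed simp

lemma independent: "inj b" "pol.independent (range b)"
  using lincomb_independent[of b] lincomb_eq_0 by auto

end

text \<open>The basis in \<open>smooth_discr\<close> is not declared to consist of conics; it does
  because a subspace is determined by its projectivisation.\<close>

lemma smooth_discr_cases:
  assumes "is_net \<pi>" "smooth_discr \<pi>"
  obtains b where "smooth_net_basis b" "\<pi> = proj (range (lincomb b))"
proof -
  obtain b where b: "\<pi> = proj (pol.span (range b))" "smooth (pol.span {discr_form b})"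
    using assms by (auto simp: smooth_discr_def)
  obtain W where W: "pol.subspace W" "W \<subseteq> forms 2" "\<pi> = proj W"
    using assms by (auto simp: is_net_def)
  have "pol.span (range b) = W"
    by (rule proj_inject[OF pol.subspace_span W(1) trans[OF b(1)[symmetric] W(3)]])
  then have "range b \<subseteq> forms 2" using W(2) pol.span_superset[of "range b"] by order
  then have "smooth_net_basis b" using b(2) unfolding smooth_net_basis_def by blast
  with b that show ?thesis by (simp add: span_range_lincomb)
qed

lemma (in smooth_net_basis) smooth_net:
  "is_net (proj (range (lincomb b)))" "smooth_discr (proj (range (lincomb b)))"
proof -
  have "pol.dim (range (lincomb b)) = card (range b)"
    using pol.dim_span_eq_card_independent[OF independent(2)] by (simp add: span_range_lincomb)
  also have "\<dots> = 3" using independent(1) by (simp add: card_image)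
  finally show "is_net (proj (range (lincomb b)))"
    unfolding is_net_def using lincomb_subspace lincomb_conic by blast
  show "smooth_discr (proj (range (lincomb b)))"
    unfolding smooth_discr_def using independent smooth by (auto simp: span_range_lincomb)
qed

section \<open>The cubic of a net\<close>

abbreviation derivs :: "'a::field form \<Rightarrow> 3 \<Rightarrow> 'a form" where
  "derivs F \<equiv> \<lambda>a. pdiff a F"

lemma polar_derivs:
  fixes F :: "'a::field_char_0 form"
  assumes "F \<in> forms 3"
  shows "polar (lincomb (derivs F) v) x y = 3 * tri F v x y"
proof -
  have "tri F v x y = (\<Sum>c\<in>UNIV. v $ c * tri F (axis c 1) x y)"
    by (subst tri_commute3, subst tri_expand3) (simp add: tri_commute3)
  then show ?thesis by (simp add: polar_lincomb polar_pdiff[OF assms] sum_distrib_left mult_ac)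
qed

lemma jacobian_net_span:
  fixes F :: "'a::field_char_0 form"
  shows "jacobian_net (pol.span {F}) = proj (range (lincomb (derivs F)))"
proof -
  have "pol.span {pdiff a G |a G. G \<in> pol.span {F}} = pol.span (range (derivs F))"
  proof (rule antisym)
    show "pol.span {pdiff a G |a G. G \<in> pol.span {F}} \<subseteq> pol.span (range (derivs F))"
      by (rule pol.span_minimal)
        (auto simp: span_pol_singleton pdiff_pscale intro!: pol.span_scale intro: pol.span_base[OF rangeI])
    show "pol.span (range (derivs F)) \<subseteq> pol.span {pdiff a G |a G. G \<in> pol.span {F}}"
      by (rule pol.span_mono) (use pol.span_base[of F "{F}"] in blast)
  qed
  then show ?thesis by (simp add: jacobian_net_def span_range_lincomb)
qed

text \<open>The cyclic successor. The indices \<open>next3 k\<close> and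
  \<open>next3 (next3 k)\<close> form the pair of distinct indices opposite to \<open>k\<close>, so
  \<open>k\<close> can label the three pairs.\<close>

definition next3 :: "3 \<Rightarrow> 3" where
  "next3 k = (if k = 1 then 2 else if k = 2 then 3 else 1)"

lemma next3_simps [simp]: "next3 1 = 2" "next3 2 = 3" "next3 3 = 1"
  by (simp_all add: next3_def)

text \<open>Integrability: a map from vectors to conics of the net is the differential of a cubic iff it
  satisfies a system of nine linear equations in nine unknowns, which are linearly dependent.\<close>

lemma integrable_map:
  fixes b :: "3 \<Rightarrow> 'a::field_char_0 form"
  assumes conics: "\<And>c. b c \<in> forms 2"
  obtains F B where "F \<in> forms 3" "B \<noteq> 0" "\<And>v x y. tri F v x y = polar (lincomb b (B *v v)) x y"
proof -
  define S where "S c i j = sym_matrix (b c) $ i $ j" for c i j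
  have S_sym: "S c i j = S c j i" for c i j unfolding S_def by (rule sym_matrix_sym)
  \<comment> \<open>Row (k, d) is the equation T a i d = T i a d for the two indices a, i other than
    k; column (c, a) belongs to the unknown entry (c, a) of the matrix \<open>B\<close>
    below.\<close>
  define E :: "'a ^ (3 \<times> 3) ^ (3 \<times> 3)" where
    "E = (\<chi> p. \<chi> q. (if snd q = next3 (fst p) then S (fst q) (next3 (next3 (fst p))) (snd p) else 0)
       - (if snd q = next3 (next3 (fst p)) then S (fst q) (next3 (fst p)) (snd p) else 0))"
  \<comment> \<open>The relation: the sum of the rows (k, k) is the full alternation of T, which
    vanishes because T is already symmetric in its last two indices.\<close>
  define z :: "'a ^ (3 \<times> 3)" where "z = (\<chi> p. if fst p = snd p then 1 else 0)"
  have "transpose E *v z = 0"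
  proof -
    have "(transpose E *v z) $ q = 0" for q
    proof -
      have "(transpose E *v z) $ q = (\<Sum>p\<in>UNIV \<times> UNIV. E $ p $ q * z $ p)"
        by (simp add: transpose_def matrix_vector_mult_def)
      also have "\<dots> = (\<Sum>k\<in>UNIV. \<Sum>d\<in>UNIV. E $ (k, d) $ q * z $ (k, d))"
        by (simp add: sum.cartesian_product case_prod_beta)
      also have "\<dots> = 0"
        using exhaust_3[of "snd q"] S_sym[of "fst q" 2 3] S_sym[of "fst q" 1 3] S_sym[of "fst q" 1 2]
        by (auto simp: sum_3 z_def E_def)
      finally show ?thesis .
    qed
    then show ?thesis by (simp add: vec_eq_iff)
  qed
  moreover have "z \<noteq> 0"
  proof
    assume "z = 0"
    then have "z $ (1, 1) = 0" by simp
    then show False by (simp add: z_def)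
  qed
  \<comment> \<open>The system is square, so a dependency between the equations yields a nonzero
    solution.\<close>
  ultimately have "det (transpose E) = 0" using det_eq_0_kernel by blast
  then obtain A where A: "A \<noteq> 0" "E *v A = 0" using det_eq_0_kernel[of E] by (auto simp: det_transpose)
  define B :: "'a ^ 3 ^ 3" where "B = (\<chi> c a. A $ (c, a))"
  define T where "T a i j = (\<Sum>c\<in>UNIV. B $ c $ a * S c i j)" for a i j
  have T2: "T a i j = T a j i" for a i j unfolding T_def by (simp add: S_sym)
  have eq: "T (next3 k) (next3 (next3 k)) d = T (next3 (next3 k)) (next3 k) d" for k d
  proof -
    have "0 = (E *v A) $ (k, d)" using A by simp
    also have "\<dots> = (\<Sum>q\<in>UNIV \<times> UNIV. E $ (k, d) $ q * A $ q)"
      by (simp add: matrix_vector_mult_def)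
    also have "\<dots> = (\<Sum>c\<in>UNIV. \<Sum>a\<in>UNIV. E $ (k, d) $ (c, a) * A $ (c, a))"
      by (simp add: sum.cartesian_product case_prod_beta)
    also have "\<dots> = T (next3 k) (next3 (next3 k)) d - T (next3 (next3 k)) (next3 k) d"
      using exhaust_3[of k] by (auto simp: sum_3 E_def T_def B_def algebra_simps)
    finally show ?thesis by simp
  qed
  have T1: "T a i j = T i a j" for a i j
    using eq[of 1 j] eq[of 2 j] eq[of 3 j] exhaust_3[of a] exhaust_3[of i] by auto
  define T' where "T' u v w = polar (lincomb b (B *v u)) v w" for u v w
  have T': "T' u v w = (\<Sum>a\<in>UNIV. \<Sum>i\<in>UNIV. \<Sum>j\<in>UNIV. u $ a * v $ i * w $ j * T a i j)" for u v w
    by (simp add: T'_def polar_lincomb polar_sym_matrix[OF conics] T_def S_def sum_3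
        matrix_vector_mult_def algebra_simps)
  have T'1: "T' u v w = T' v u w" for u v w
    unfolding T' by (subst sum.swap) (simp add: T1 mult_ac)
  have T'2: "T' u v w = T' u w v" for u v w
    unfolding T'_def by (rule polar_commute)
  have T'3: "T' (u + u') v w = T' u v w + T' u' v w" for u u' v w
    unfolding T'_def by (simp add: matrix_vector_right_distrib lincomb_add polar_plus_form)
  have "form_fun 3 (\<lambda>v. T' v v v)"
  proof -
    have "form_fun (1 + 1 + 1 + 0) (\<lambda>v. v $ a * v $ i * v $ j * T a i j)" for a i j
      by (intro form_fun_mult form_fun_coord form_fun_const)
    then show ?thesis unfolding T' by (intro form_fun_sum) (simp add: numeral_3_eq_3 del: One_nat_def)
  qed
  then obtain F where F: "F \<in> forms 3" "\<And>v. peval F v = T' v v v"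
    unfolding form_fun_def by auto
  have "tri F u v w = T' u v w" for u v w
    by (rule tri_cong[OF F(1) T'1 T'2 T'3 F(2)])
  moreover have "B \<noteq> 0"
  proof
    assume "B = 0"
    then have "B $ c $ a = 0" for c a by simp
    then have "A $ (c, a) = 0" for c a by (simp add: B_def)
    then have "A = 0" by (simp add: vec_eq_iff)
    with A show False by simp
  qed
  ultimately show ?thesis using that F(1) unfolding T'_def by blast
qed

text \<open>When the coefficient \<open>c\<close> vanishes the zero lies at infinity, which is why
  the result is homogeneous in s and t.\<close>

lemma binary_quadratic_zero:
  fixes a b c :: "'a::alg_closed_field"
  obtains s t where "s \<noteq> 0 \<or> t \<noteq> 0" "a * s\<^sup>2 + b * (s * t) + c * t\<^sup>2 = 0"
proof (cases "c = 0")
  case True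
  then show ?thesis using that[of 0 1] by simp
next
  case False
  then obtain t where "poly [:a, b, c:] t = 0"
    using alg_closed_imp_poly_has_root[of "[:a, b, c:]"] by auto
  then show ?thesis using that[of 1 t] by (simp add: power2_eq_square algebra_simps)
qed

lemma singular_2x2_kernel:
  fixes a b c :: "'a::field"
  assumes "a * c = b * b"
  obtains s t where "s \<noteq> 0 \<or> t \<noteq> 0" "s * a + t * b = 0" "s * b + t * c = 0"
proof (cases "a = 0 \<and> b = 0")
  case True
  then show ?thesis using that[of 1 0] by simp
next
  case False
  then show ?thesis using that[of "- b" a] assms by (auto simp: algebra_simps)
qed

text \<open>A cone over points on a line has a polar conic of rank one, its Hessian having a zero.\<close>

lemma (in smooth_net_basis) not_cone:
  assumes T: "\<And>v x y. tri K v x y = polar (lincomb b (B *v v)) x y"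
    and v: "v \<noteq> 0" "B *v v = 0"
  shows "B = 0"
proof -
  have Tv: "tri K v x y = 0" for x y unfolding T v by (simp add: polar_def)
  obtain p where "cross v p \<noteq> 0" using extend_basis1[OF v(1)] .
  then obtain q where vpq: "det3 v p q \<noteq> 0" using extend_basis2 by blast
  \<comment> \<open>Since v lies in the kernel, \<open>K\<close> is a binary cubic on the span of p
    and q; these are its coefficients. The quadratic form solved next is its Hessian.\<close>
  define t0 t1 t2 t3 where t: "t0 = tri K p p p" "t1 = tri K p p q" "t2 = tri K p q q" "t3 = tri K q q q"
  obtain \<alpha> \<beta> where ab: "\<alpha> \<noteq> 0 \<or> \<beta> \<noteq> 0"
    "(t0 * t2 - t1\<^sup>2) * \<alpha>\<^sup>2 + (t0 * t3 - t1 * t2) * (\<alpha> * \<beta>) + (t1 * t3 - t2\<^sup>2) * \<beta>\<^sup>2 = 0"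
    using binary_quadratic_zero .
  have "(\<alpha> * t0 + \<beta> * t1) * (\<alpha> * t2 + \<beta> * t3) = (\<alpha> * t1 + \<beta> * t2) * (\<alpha> * t1 + \<beta> * t2)"
    using ab(2) by (simp add: power2_eq_square algebra_simps)
  then obtain \<gamma> \<delta> where cd: "\<gamma> \<noteq> 0 \<or> \<delta> \<noteq> 0"
    "\<gamma> * (\<alpha> * t0 + \<beta> * t1) + \<delta> * (\<alpha> * t1 + \<beta> * t2) = 0"
    "\<gamma> * (\<alpha> * t1 + \<beta> * t2) + \<delta> * (\<alpha> * t2 + \<beta> * t3) = 0"
    using singular_2x2_kernel by metis
  \<comment> \<open>At the zero y of the Hessian the polar of the binary cubic is degenerate, and z
    spans its kernel; hence T(y, z, -) = 0.\<close>
  define y z where y: "y = \<alpha> *s p + \<beta> *s q" and z: "z = \<gamma> *s p + \<delta> *s q"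
  have indep: "cross (s *s p + t *s q) v \<noteq> 0" if "s \<noteq> 0 \<or> t \<noteq> 0" for s t
  proof
    assume "cross (s *s p + t *s q) v = 0"
    then have 0: "det3 (s *s p + t *s q) v w = 0" for w by (simp add: det3_def dot3_def)
    have "det3 (s *s p + t *s q) v q = - s * det3 v p q" "det3 (s *s p + t *s q) v p = t * det3 v p q"
      by (simp_all add: det3_def dot3_def algebra_simps)
    then show False using 0 that vpq by simp
  qed
  have Tyz: "tri K y z w = 0" for w
  proof -
    obtain r s t where w: "w = r *s v + s *s p + t *s q" using det3_coordinates[OF vpq] .
    have "tri K y z v = 0" using Tv by (metis tri_commute3)
    moreover have "tri K y z p = 0" using cd(2) by (simp add: y z tri_linear t tri_commute algebra_simps)
    moreover have "tri K y z q = 0" using cd(3) by (simp add: y z tri_linear t tri_commute algebra_simps)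
    ultimately show ?thesis by (simp add: w tri_linear)
  qed
  have Tyv: "tri K y v w = 0" for w using Tv by (metis tri_commute1)
  \<comment> \<open>The conic belonging to y is singular at both z and v, too much for a nonzero
    element of the net.\<close>
  have By: "B *v y = 0"
  proof (rule ccontr)
    assume "B *v y \<noteq> 0"
    then have "cross z v = 0" using Tyz Tyv by (intro rank_ge_2[of "B *v y"]) (simp_all flip: T)
    then show False using indep[OF cd(1)] z by simp
  qed
  \<comment> \<open>Now y and v both lie in the kernel of \<open>B\<close>, so by symmetry of T
    every conic \<open>B w\<close> is singular at both of them.\<close>
  have "B *v w = 0" for w
  proof (rule ccontr)
    assume "B *v w \<noteq> 0"
    moreover have "tri K w y x = 0" for x
    proof -
      have "tri K y w x = 0" unfolding T By by (simp add: polar_def)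
      then show ?thesis by (metis tri_commute1)
    qed
    moreover have "tri K w v x = 0" for x using Tv by (metis tri_commute1)
    ultimately have "cross y v = 0" by (intro rank_ge_2[of "B *v w"]) (simp_all flip: T)
    then show False using indep[OF ab(1)] y by simp
  qed
  then have "B *v w = 0 *v w" for w by (simp add: matrix_vector_mult_0)
  then show ?thesis by (metis matrix_eq)
qed

lemma injective_matrix_surj:
  fixes B :: "'a::field ^ 'n ^ 'n"
  assumes "\<And>v. B *v v = 0 \<Longrightarrow> v = 0"
  obtains w' where "w = B *v w'"
proof -
  have "\<exists>C :: 'a ^ 'n ^ 'n. C ** B = mat 1" unfolding matrix_left_invertible_ker by (simp add: assms)
  then obtain C :: "'a ^ 'n ^ 'n" where "C ** B = mat 1" ..
  then have "B ** C = mat 1" by (simp add: matrix_left_right_inverse)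
  then have "B *v (C *v w) = w" by (simp add: matrix_vector_mul_assoc)
  with that show ?thesis by metis
qed

lemma range_lincomb_comp:
  fixes b b' :: "3 \<Rightarrow> 'a::field form"
  assumes "\<And>v. lincomb b' v = lincomb b (B *v v)" "\<And>v. B *v v = 0 \<Longrightarrow> v = 0"
  shows "range (lincomb b') = range (lincomb b)"
proof -
  have "lincomb b w \<in> range (lincomb b')" for w
  proof -
    obtain w' where "w = B *v w'" using injective_matrix_surj[OF assms(2)] by metis
    then show ?thesis using assms(1) by (metis rangeI)
  qed
  then show ?thesis using assms(1) by auto
qed

context smooth_net_basis
begin

lemma ex_cubic:
  obtains F B where "F \<in> forms 3" "F \<noteq> 0" "\<And>v x y. tri F v x y = polar (lincomb b (B *v v)) x y"
    "\<And>v. B *v v = 0 \<Longrightarrow> v = 0"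
proof -
  obtain F B where F: "F \<in> forms 3" "B \<noteq> 0" "\<And>v x y. tri F v x y = polar (lincomb b (B *v v)) x y"
    using integrable_map[of b] conics by metis
  have inj: "v = 0" if "B *v v = 0" for v using not_cone[OF F(3) _ that] F(2) by blast
  have "F \<noteq> 0"
  proof
    assume "F = 0"
    have "lincomb b (B *v axis 1 1) = 0"
    proof (rule form2_eq_polar[OF lincomb_conic])
      show "polar (lincomb b (B *v axis 1 1)) u v = polar 0 u v" for u v
        unfolding F(3)[symmetric] \<open>F = 0\<close> by (simp add: tri_def polar_def)
    qed simp
    then have "B *v axis 1 1 = 0" by (simp add: lincomb_eq_0)
    then have "axis 1 (1::'a) = (0 :: 'a ^ 3)" by (rule inj)
    then show False by (simp add: axis_eq_0_iff)
  qed
  with F inj that show ?thesis by blast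
qed

lemma derivs_map:
  assumes F: "F \<in> forms 3" "\<And>v x y. tri F v x y = polar (lincomb b (B *v v)) x y"
  shows "lincomb (derivs F) v = lincomb b (3 *s (B *v v))"
proof (rule form2_eq_polar[OF lincomb_forms lincomb_conic])
  show "pdiff c F \<in> forms 2" for c by (rule pdiff_forms2[OF F(1)])
  show "polar (lincomb (derivs F) v) x y = polar (lincomb b (3 *s (B *v v))) x y" for x y
    by (simp add: polar_derivs[OF F(1)] F(2) lincomb_scale polar_pscale)
qed

text \<open>Pencil argument: over an algebraically closed field some combination G - c F has a
  singular matrix, and \<open>not_cone\<close> makes this combination zero.\<close>

lemma cubic_unique:
  assumes F: "F \<in> forms 3" "F \<noteq> 0" "\<And>v x y. tri F v x y = polar (lincomb b (B *v v)) x y"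
      "\<And>v. B *v v = 0 \<Longrightarrow> v = 0"
    and G: "G \<in> forms 3" "G \<noteq> 0" "\<And>v x y. tri G v x y = polar (lincomb b (C *v v)) x y"
  shows "pol.span {G} = pol.span {F}"
proof -
  have "det B \<noteq> 0" using F(4) det_eq_0_kernel by blast
  have "\<exists>c. det (C - (\<chi> i j. c * B $ i $ j)) = 0"
  proof -
    \<comment> \<open>The polynomial det (C - t B) in t; its coefficient at t^3 is - det B, so it is
      not constant.\<close>
    define P where "P = det (\<chi> i j. [:C $ i $ j, - B $ i $ j:])"
    have P: "poly P c = det (C - (\<chi> i j. c * B $ i $ j))" for c
      unfolding P_def by (simp add: det_3 algebra_simps)
    have "Polynomial.coeff P 3 = - det B"
      unfolding P_def by (simp add: det_3 numeral_3_eq_3 algebra_simps)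
    then have "degree P > 0" using \<open>det B \<noteq> 0\<close> le_degree[of P 3] by auto
    then show ?thesis using alg_closed_imp_poly_has_root P by metis
  qed
  then obtain c where c: "det (C - (\<chi> i j. c * B $ i $ j)) = 0" by blast
  define D where "D = C - (\<chi> i j. c * B $ i $ j)"
  have D: "D *v v = C *v v - c *s (B *v v)" for v
    by (simp add: D_def vec_eq_iff matrix_vector_mult_def algebra_simps sum_subtractf sum_distrib_left)
  define K where "K = G - pscale c F"
  have K: "K \<in> forms 3" unfolding K_def using F(1) G(1) by (intro forms_diff forms_pscale)
  have "tri K v x y = tri G v x y - c * tri F v x y" for v x y
    by (rule tri_cong[OF K])
      (simp_all add: tri_linear algebra_simps K_def peval_diff peval_tri[OF F(1)] peval_tri[OF G(1)],
        (metis tri_commute)+)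
  then have KD: "tri K v x y = polar (lincomb b (D *v v)) x y" for v x y
    unfolding D by (simp add: F(3) G(3) polar_lincomb sum_subtractf algebra_simps sum_distrib_left)
  obtain v where "v \<noteq> 0" "D *v v = 0" using c det_eq_0_kernel unfolding D_def by blast
  then have "D = 0" using not_cone[OF KD] by blast
  have "peval K v = 0" for v
    using KD[of v v v] \<open>D = 0\<close> by (simp add: peval_tri[OF K] polar_def)
  then have "K = 0" by (rule peval_eq_0_imp)
  then have "G = pscale c F" by (simp add: K_def)
  moreover then have "c \<noteq> 0" using G(2) by auto
  ultimately show ?thesis using span_pol_eq_iff[OF F(2) G(2)] by blast
qed

end

lemma tri_map_of_jacobian:
  fixes G :: "'a::field_char_0 form"
  assumes "G \<in> forms 3" "jacobian_net (pol.span {G}) = proj (range (lincomb b))"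
  obtains C where "\<And>v x y. tri G v x y = polar (lincomb b (C *v v)) x y"
proof -
  have r: "range (lincomb (derivs G)) = range (lincomb b)"
    using proj_inject[OF lincomb_subspace lincomb_subspace] assms(2) by (simp add: jacobian_net_span)
  have "\<exists>v. pdiff a G = lincomb b v" for a using r lincomb_axis[of "derivs G" a] by (metis rangeE rangeI)
  then obtain f where f: "\<And>a. pdiff a G = lincomb b (f a)" by metis
  \<comment> \<open>The division by 3 compensates the factor 3 between the polar of a derivative and
    T.\<close>
  define C :: "'a ^ 3 ^ 3" where "C = (\<chi> i a. f a $ i / 3)"
  have "tri G v x y = polar (lincomb b (C *v v)) x y" for v x y
  proof -
    have "3 * tri G v x y = (\<Sum>a\<in>UNIV. v $ a * polar (pdiff a G) x y)"
      using polar_derivs[OF assms(1), of v x y] by (simp add: polar_lincomb)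
    also have "\<dots> = 3 * polar (lincomb b (C *v v)) x y"
      by (simp add: f polar_lincomb C_def matrix_vector_mult_def sum_3 algebra_simps)
    finally show ?thesis by simp
  qed
  with that show ?thesis by blast
qed

lemma smooth_net_cubic:
  fixes \<pi> :: "'a::{alg_closed_field, field_char_0} curve set"
  assumes "is_net \<pi>" "smooth_discr \<pi>"
  obtains F where "F \<in> forms 3" "F \<noteq> 0" "\<pi> = jacobian_net (pol.span {F})"
    "smooth_net_basis (derivs F)" "\<And>\<phi>. \<phi> \<in> curves 3 \<Longrightarrow> \<pi> = jacobian_net \<phi> \<Longrightarrow> \<phi> = pol.span {F}"
proof -
  obtain b where b: "smooth_net_basis b" "\<pi> = proj (range (lincomb b))"
    using smooth_discr_cases[OF assms] .
  interpret smooth_net_basis b by (rule b)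
  obtain F B where F: "F \<in> forms 3" "F \<noteq> 0" "\<And>v x y. tri F v x y = polar (lincomb b (B *v v)) x y"
    "\<And>v. B *v v = 0 \<Longrightarrow> v = 0" using ex_cubic by (metis (mono_tags))
  \<comment> \<open>\<open>B\<close> expresses T in terms of the net, and the derivatives of F are
    three times as large.\<close>
  define B3 where "B3 = (\<chi> i j. 3 * B $ i $ j)"
  have B3: "B3 *v v = 3 *s (B *v v)" for v
    by (simp add: B3_def vec_eq_iff matrix_vector_mult_def sum_distrib_left algebra_simps)
  have B3_inj: "v = 0" if "B3 *v v = 0" for v using that F(4)[of v] by (simp add: B3)
  have l: "lincomb (derivs F) v = lincomb b (B3 *v v)" for v
    using derivs_map[OF F(1,3), of v] by (simp add: B3)
  have r: "range (lincomb (derivs F)) = range (lincomb b)" by (rule range_lincomb_comp[OF l B3_inj])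
  have J: "\<pi> = jacobian_net (pol.span {F})" by (simp add: b(2) jacobian_net_span r)
  have "smooth_net_basis (derivs F)"
  proof
    show "pdiff c F \<in> forms 2" for c by (rule pdiff_forms2[OF F(1)])
    show "Defs.smooth (pol.span {discr_form (derivs F)})"
      unfolding smooth_discr_form_iff
    proof (intro allI impI)
      \<comment> \<open>Smoothness is carried over from the basis \<open>b\<close> along the
        invertible substitution \<open>B3\<close>.\<close>
      fix v assume v: "v \<noteq> 0 \<and> det (net_matrix (derivs F) v) = 0"
      then have "B3 *v v \<noteq> 0" "det (net_matrix b (B3 *v v)) = 0" using B3_inj by (auto simp: l)
      then obtain w where w: "det_deriv (net_matrix b (B3 *v v)) (net_matrix b w) \<noteq> 0"
        using smooth smooth_discr_form_iff[of b] by blast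
      obtain w' where "w = B3 *v w'" using injective_matrix_surj[OF B3_inj] .
      with w show "\<exists>w. det_deriv (net_matrix (derivs F) v) (net_matrix (derivs F) w) \<noteq> 0"
        by (auto simp: l)
    qed
  qed
  moreover have "\<phi> = pol.span {F}" if \<phi>: "\<phi> \<in> curves 3" "\<pi> = jacobian_net \<phi>" for \<phi>
  proof -
    obtain G where G: "G \<in> forms 3" "G \<noteq> 0" "\<phi> = pol.span {G}" using \<phi>(1) by (auto simp: proj_def)
    have "jacobian_net (pol.span {G}) = proj (range (lincomb b))" using \<phi>(2) G(3) b(2) by simp
    then obtain C where "\<And>v x y. tri G v x y = polar (lincomb b (C *v v)) x y"
      using tri_map_of_jacobian[OF G(1)] by metis
    then show ?thesis using cubic_unique[OF F G(1,2)] G(3) by blast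
  qed
  ultimately show ?thesis using that F(1,2) J by blast
qed

section \<open>The Hessian and the involution of conjugate points\<close>

definition hessian_form :: "'a::field form \<Rightarrow> 'a form" where
  "hessian_form F = det (\<chi> a b. pdiff a (pdiff b F))"

lemma hessian_span:
  fixes F :: "'a::field_char_0 form"
  shows "hessian (pol.span {F}) = pol.span {hessian_form F}"
proof -
  \<comment> \<open>The Hessian is of degree three in F, and the span absorbs the cube of the
    scalar.\<close>
  have h: "hessian_form (pscale c F) = pscale (c ^ 3) (hessian_form F)" for c
    by (rule peval_inject)
      (simp add: hessian_form_def det_3 pdiff_pscale peval_add peval_diff peval_mult power3_eq_cube algebra_simps)
  show ?thesis
    unfolding hessian_def hessian_form_def[symmetric]
  proof (rule antisym)
    show "pol.span (hessian_form ` pol.span {F}) \<subseteq> pol.span {hessian_form F}"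
      by (rule pol.span_minimal) (auto simp: span_pol_singleton h)
    show "pol.span {hessian_form F} \<subseteq> pol.span (hessian_form ` pol.span {F})"
      by (rule pol.span_mono) (use pol.span_base[of F "{F}"] in blast)
  qed
qed

text \<open>The second derivatives are 6 T whereas the polars of the first derivatives are 3 T; a
  determinant of size three turns the ratio 2 into 8.\<close>

lemma hessian_form_discr:
  fixes F :: "'a::field_char_0 form"
  assumes "F \<in> forms 3"
  shows "hessian_form F = pscale 8 (discr_form (derivs F))"
proof (rule peval_inject)
  fix v
  have "peval (hessian_form F) v = det (\<chi> a b. 6 * tri F v (axis a 1) (axis b 1))"
    by (simp add: hessian_form_def det_3 peval_add peval_diff peval_mult pdiff_pdiff_tri[OF assms])
  also have "\<dots> = 8 * det (net_matrix (derivs F) v)"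
    by (simp add: sym_matrix_def polar_derivs[OF assms] det_3)
  finally show "peval (hessian_form F) v = peval (pscale 8 (discr_form (derivs F))) v"
    by (simp add: peval_discr_form)
qed

lemma span_scaled: "c \<noteq> 0 \<Longrightarrow> pol.span {pscale c F} = pol.span {F :: 'a::field form}"
  using pol.span_image_scale[of "{F}" "\<lambda>_. c"] by simp

text \<open>The setting of (a): the conic of the net with parameter x is the polar conic of x, with
  bilinear form 3 T(x, -, -).\<close>

locale polar_cubic =
  fixes F :: "'a::{alg_closed_field, field_char_0} form"
  assumes cubic: "F \<in> forms 3" and smooth_polars: "smooth_net_basis (derivs F)"
begin

sublocale polars: smooth_net_basis "derivs F" by (rule smooth_polars)

abbreviation "T \<equiv> tri F"

lemma tri_rank:
  assumes "v \<noteq> 0" "\<And>w. T v x w = 0" "\<And>w. T v y w = 0"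
  shows "cross x y = 0"
  by (rule polars.rank_ge_2[OF assms(1)]) (simp_all add: polar_derivs[OF cubic] assms)

text \<open>If T(x, x, -) = 0, then x is a singular point of its own polar conic and at the same
  time lies on all conics of the net.\<close>

lemma tri_not_self_conjugate:
  assumes "x \<noteq> 0" shows "\<exists>w. T x x w \<noteq> 0"
proof (rule ccontr)
  assume "\<not> ?thesis"
  then have 0: "T x x w = 0" for w by blast
  then have "\<exists>w. polar (lincomb (derivs F) w) x x \<noteq> 0"
    by (intro polars.singular_point_not_base[OF assms assms]) (simp add: polar_derivs[OF cubic])
  then show False using 0 by (auto simp: polar_derivs[OF cubic] tri_commute3[of F _ x x])
qed

lemma hessian_eq: "hessian (pol.span {F}) = pol.span {discr_form (derivs F)}"
  by (simp add: hessian_span hessian_form_discr[OF cubic] span_scaled)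

lemma discr_form_nonzero: "discr_form (derivs F) \<noteq> 0"
proof
  assume "discr_form (derivs F) = 0"
  with polars.smooth have "Defs.smooth (pol.span {0 :: 'a form})" by simp
  then have "v = 0" for v :: "'a ^ 3" using smooth_cubic_iff[of "0 :: 'a form"] by (simp add: tri_def)
  then show False by (metis axis_eq_0_iff zero_neq_one)
qed

abbreviation "H \<equiv> hessian (pol.span {F})"

lemma H_cubic: "H \<in> curves 3"
  unfolding hessian_eq curves_iff using discr_form_nonzero discr_form_forms by blast

lemma H_smooth: "Defs.smooth H"
  unfolding hessian_eq by (rule polars.smooth)

lemma kernel_iff: "net_matrix (derivs F) x *v y = 0 \<longleftrightarrow> (\<forall>w. T x y w = 0)"
  by (simp add: sym_matrix_kernel[OF polars.lincomb_conic] polar_derivs[OF cubic])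

lemma point_in_H_iff:
  assumes "x \<noteq> 0"
  shows "point x \<in> pts H \<longleftrightarrow> (\<exists>y. y \<noteq> 0 \<and> (\<forall>w. T x y w = 0))"
  unfolding hessian_eq point_in_pts_iff[OF discr_form_forms assms] peval_discr_form det_eq_0_kernel kernel_iff ..

abbreviation "\<pi> \<equiv> jacobian_net (pol.span {F})"

lemma common_conjugate_iff:
  assumes "y \<noteq> 0"
  shows "common_conjugate \<pi> (point x) (point y) \<longleftrightarrow> (\<forall>w. T x y w = 0)"
proof -
  have "(\<forall>\<gamma>\<in>\<pi>. conjugate \<gamma> (point x) (point y)) \<longleftrightarrow> (\<forall>v. polar (lincomb (derivs F) v) x y = 0)"
    (is "?L \<longleftrightarrow> ?R")
  proof
    assume L: ?L
    show ?R
    proof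
      fix v
      show "polar (lincomb (derivs F) v) x y = 0"
      proof (cases "lincomb (derivs F) v = 0")
        case False
        then have "pol.span {lincomb (derivs F) v} \<in> \<pi>"
          by (auto simp: jacobian_net_span proj_def)
        then show ?thesis using L conjugate_point_iff[OF polars.lincomb_conic] by blast
      qed (simp add: polar_def)
    qed
  next
    assume ?R
    then show ?L
      by (auto simp: jacobian_net_span proj_def conjugate_point_iff[OF polars.lincomb_conic])
  qed
  also have "\<dots> \<longleftrightarrow> (\<forall>w. T x y w = 0)"
    by (simp add: polar_derivs[OF cubic]) (metis tri_commute)
  finally show ?thesis using assms by (auto simp: common_conjugate_def P2_iff)
qed

lemma conjugate_unique:
  assumes "x \<noteq> 0" "y \<noteq> 0" "z \<noteq> 0" "\<And>w. T x y w = 0" "\<And>w. T x z w = 0"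
  shows "point y = point z"
  using tri_rank[OF assms(1,4,5)] point_eq_cross[OF assms(2,3)] by simp

lemma ex_common_conjugate_iff:
  assumes "x \<in> P2"
  shows "(\<exists>y. common_conjugate \<pi> x y) \<longleftrightarrow> x \<in> pts H"
proof -
  obtain u where u: "u \<noteq> 0" "x = point u" using assms by (auto simp: P2_iff)
  have "(\<exists>y. common_conjugate \<pi> x y) \<longleftrightarrow> (\<exists>v. v \<noteq> 0 \<and> common_conjugate \<pi> x (point v))"
    unfolding common_conjugate_def P2_iff by blast
  then show ?thesis unfolding u(2) point_in_H_iff[OF u(1)] using common_conjugate_iff by blast
qed

text \<open>Uniqueness is the rank bound, distinctness is \<open>tri_not_self_conjugate\<close>, and
  the remaining claims are the symmetry of the relation T(x, y, -) = 0.\<close>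

lemma conjugate_properties:
  assumes "x \<in> pts H"
  shows "\<exists>!y. common_conjugate \<pi> x y"
    "common_conjugate \<pi> x y \<Longrightarrow> y \<noteq> x \<and> y \<in> pts H \<and> common_conjugate \<pi> y x"
proof -
  obtain u where u: "u \<noteq> 0" "x = point u" using assms by (rule pts_cases)
  have uniq: "y = z" if "common_conjugate \<pi> x y" "common_conjugate \<pi> x z" for y z
  proof -
    obtain v w where "v \<noteq> 0" "y = point v" "w \<noteq> 0" "z = point w"
      using \<open>common_conjugate \<pi> x y\<close> \<open>common_conjugate \<pi> x z\<close> by (auto simp: common_conjugate_def P2_iff)
    then show ?thesis using that conjugate_unique[OF u(1), of v w] by (simp add: u(2) common_conjugate_iff)
  qed
  have "x \<in> P2" using u by (auto simp: P2_iff)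
  then have "\<exists>y. common_conjugate \<pi> x y" using assms ex_common_conjugate_iff by blast
  then show "\<exists>!y. common_conjugate \<pi> x y" using uniq by blast
  assume y: "common_conjugate \<pi> x y"
  then obtain v where v: "v \<noteq> 0" "y = point v" by (auto simp: common_conjugate_def P2_iff)
  have T: "T u v w = 0" for w using y by (simp add: u(2) v(2) common_conjugate_iff[OF v(1)])
  then have T': "T v u w = 0" for w by (metis tri_commute1)
  have "y \<noteq> x"
  proof
    assume "y = x"
    then obtain c where "v = c *s u" using point_eq_iff[OF u(1) v(1)] u(2) v(2) by auto
    with T v(1) have "T u u w = 0" for w by (auto simp: tri_linear)
    then show False using tri_not_self_conjugate[OF u(1)] by blast
  qed
  moreover have "y \<in> pts H" using T' u(1) point_in_H_iff[OF v(1)] v(2) by blast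
  moreover have "common_conjugate \<pi> y x" using T' u v common_conjugate_iff by blast
  ultimately show "y \<noteq> x \<and> y \<in> pts H \<and> common_conjugate \<pi> y x" by blast
qed

abbreviation "i \<equiv> conjugate_map \<pi> H"

lemma conjugate_map_iff:
  assumes "x \<in> pts H"
  shows "i x = y \<longleftrightarrow> common_conjugate \<pi> x y"
  using theI'[OF conjugate_properties(1)[OF assms]] conjugate_properties(1)[OF assms] assms
  by (auto simp: conjugate_map_def)

text \<open>The conjugate of x is orthogonal to the rows of the matrix of its polar conic, so the
  cross product of two independent rows gives it by quadratic forms. Which rows are independent
  depends on the point.\<close>

lemma conjugate_map_regular: "regular_map H H i"
  unfolding regular_map_def
proof (intro conjI ballI Pi_I)
  fix x assume x: "x \<in> pts H"
  have cc: "common_conjugate \<pi> x (i x)" using conjugate_map_iff[OF x] by blast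
  then show "i x \<in> pts H" using conjugate_properties(2)[OF x] by blast
  define r where "r a v = (\<chi> c. T v (axis a 1) (axis c 1))" for a :: 3 and v
  have r_dot: "dot3 (r a v) y = T v (axis a 1) y" for a v y
    by (subst tri_expand3) (simp add: dot3_def r_def sum_3 mult.commute)
  have r_form: "form_fun 1 (\<lambda>v. r a v $ c)" for a c
  proof -
    have "r a v $ c = (\<Sum>k\<in>UNIV. v $ k * T (axis k 1) (axis a 1) (axis c 1))" for v
      unfolding r_def by (subst tri_commute3, subst tri_expand3) (simp add: tri_commute3)
    moreover have "form_fun 1 (\<lambda>v. \<Sum>k\<in>UNIV. v $ k * T (axis k 1) (axis a 1) (axis c 1))"
      using form_fun_mult[OF form_fun_coord form_fun_const] by (intro form_fun_sum) simp
    ultimately show ?thesis by simp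
  qed
  have cr_form: "form_fun 2 (\<lambda>v. cross (r a v) (r a' v) $ c)" for a a' c
  proof -
    have "form_fun (1 + 1) (\<lambda>v. r a v $ k * r a' v $ l - r a v $ k' * r a' v $ l')" for k l k' l'
      by (intro form_fun_diff form_fun_mult r_form)
    then show ?thesis using exhaust_3[of c] by (auto simp: numeral_2_eq_2)
  qed
  obtain u where u: "u \<noteq> 0" "x = point u" using x by (rule pts_cases)
  have "\<exists>a a'. cross (r a u) (r a' u) \<noteq> 0"
  proof (rule ccontr)
    assume "\<not> ?thesis"
    then have cr: "cross (r a u) (r a' u) = 0" for a a' by blast
    \<comment> \<open>If all rows were parallel to one n, everything orthogonal to n would lie in
      the kernel; \<open>cross n p\<close> and \<open>cross n q\<close> would be two independent
      singular points.\<close>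
    have "\<exists>n. n \<noteq> 0 \<and> (\<forall>a. \<exists>c. r a u = c *s n)"
    proof (cases "\<exists>a. r a u \<noteq> 0")
      case True
      then obtain a where "r a u \<noteq> 0" by blast
      then show ?thesis using cross_eq_0[OF cr] by blast
    next
      case False
      then have "r a u = 0 *s axis 1 1" for a by simp
      moreover have "axis 1 1 \<noteq> (0 :: 'a ^ 3)" by (simp add: axis_eq_0_iff)
      ultimately show ?thesis by blast
    qed
    then obtain n c where n: "n \<noteq> 0" "\<And>a. r a u = c a *s n" by metis
    obtain p where p: "cross n p \<noteq> 0" using extend_basis1[OF n(1)] .
    obtain q where q: "det3 n p q \<noteq> 0" using extend_basis2[OF p] .
    have "T u (cross n z) w = 0" for z w
    proof -
      have "dot3 (r a u) (cross n z) = 0" for a by (simp add: n(2) dot3_scale) (simp add: dot3_def algebra_simps)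
      then have "T u (axis a 1) (cross n z) = 0" for a by (simp add: r_dot)
      then have "T u (cross n z) (axis a 1) = 0" for a by (metis tri_commute2)
      then show ?thesis by (subst tri_expand3) simp
    qed
    then have "cross (cross n p) (cross n q) = 0" by (intro tri_rank[OF u(1)])
    moreover have "cross (cross n p) (cross n q) = det3 n p q *s n"
      by (simp add: vec3_eq_iff det3_def dot3_def algebra_simps)
    ultimately show False using q n(1) by simp
  qed
  then obtain a a' where aa: "cross (r a u) (r a' u) \<noteq> 0" by blast
  define h where "h v = cross (r a v) (r a' v)" for v
  have "\<forall>c. \<exists>g. g \<in> forms 2 \<and> (\<forall>v. h v $ c = peval g v)"
    using cr_form unfolding form_fun_def h_def by blast
  then obtain g where g: "\<And>c. g c \<in> forms 2" "\<And>c v. h v $ c = peval (g c) v" by metis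
  have hg: "(\<chi> c. peval (g c) v) = h v" for v by (simp add: vec_eq_iff g(2))
  have "\<exists>c. peval (g c) u \<noteq> 0" using aa hg[of u] unfolding h_def by (metis vec_lambda_eta vec_eq_iff vec_lambda_beta zero_index)
  moreover have "u \<in> x - {0}" using u vec.span_base[of u "{u}"] by auto
  moreover have "i y = point (\<chi> c. peval (g c) v)"
    if y: "y \<in> pts H" and v: "v \<in> y - {0}" and nz: "\<exists>c. peval (g c) v \<noteq> 0" for y v
  proof -
    obtain w where w: "w \<noteq> 0" "y = point w" using y by (rule pts_cases)
    then obtain d where "v = d *s w" "v \<noteq> 0" using v by (auto simp: in_point_iff)
    then have yv: "y = point v" using w point_scale[of d w] by auto
    have "\<exists>z. z \<noteq> 0 \<and> (\<forall>w. T v z w = 0)" using y yv point_in_H_iff[of v] \<open>v \<noteq> 0\<close> by blast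
    then obtain z where z: "z \<noteq> 0" "\<And>w. T v z w = 0" by blast
    have "dot3 (r a v) z = 0" for a using z(2) by (simp add: r_dot) (metis tri_commute2)
    then obtain c where c: "h v = c *s z" unfolding h_def using cross_orthogonal[OF _ _ z(1)] by metis
    have "h v \<noteq> 0" using nz hg[of v] by (metis vec_lambda_beta zero_index)
    then have "point (h v) = point z" unfolding c using z(1) by (intro point_scale) auto
    moreover have "i y = point z" using conjugate_map_iff[OF y] common_conjugate_iff[OF z(1)] z(2) yv by blast
    ultimately show ?thesis by (simp add: hg)
  qed
  ultimately show "\<exists>d g. (\<forall>a. g a \<in> forms d) \<and> (\<exists>v\<in>x - {0}. \<exists>a. peval (g a) v \<noteq> 0) \<and>
      (\<forall>y\<in>pts H. \<forall>v\<in>y - {0}. (\<exists>a. peval (g a) v \<noteq> 0) \<longrightarrow> i y = point (\<chi> a. peval (g a) v))"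
    using g(1) by blast
qed

lemma conjugate_map_involution: "i \<in> fpf_involutions H"
proof -
  have "i (i x) = x \<and> i x \<noteq> x" if x: "x \<in> pts H" for x
  proof -
    have "common_conjugate \<pi> x (i x)" using conjugate_map_iff[OF x] by blast
    then have *: "i x \<noteq> x \<and> i x \<in> pts H \<and> common_conjugate \<pi> (i x) x" by (rule conjugate_properties(2)[OF x])
    then have "i (i x) = x" by (subst conjugate_map_iff) auto
    with * show ?thesis by blast
  qed
  moreover have "i \<in> extensional (pts H)" by (simp add: conjugate_map_def)
  ultimately show ?thesis using conjugate_map_regular by (simp add: fpf_involutions_def)
qed

text \<open>Only the formal inclusion; equality waits for \<open>net_eq\<close>, where the
  right-hand side is known to be a net.\<close>

lemma net_subset: "\<pi> \<subseteq> net_of H i"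
proof
  fix \<gamma> assume \<gamma>: "\<gamma> \<in> \<pi>"
  then obtain v where v: "\<gamma> = pol.span {lincomb (derivs F) v}" "lincomb (derivs F) v \<noteq> 0"
    by (auto simp: jacobian_net_span proj_def)
  have "\<gamma> \<in> curves 2" unfolding v(1) curves_iff using v(2) polars.lincomb_conic by blast
  moreover have "conjugate \<gamma> x (i x)" if x: "x \<in> pts H" for x
  proof -
    have "common_conjugate \<pi> x (i x)" using conjugate_map_iff[OF x] by blast
    then show ?thesis using \<gamma> by (simp add: common_conjugate_def)
  qed
  ultimately show "\<gamma> \<in> net_of H i" by (simp add: net_of_def)
qed

end

section \<open>Regular maps\<close>

definition form_vec :: "nat \<Rightarrow> ('a::comm_ring_1 ^ 3 \<Rightarrow> 'a ^ 3) \<Rightarrow> bool" where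
  "form_vec d h \<longleftrightarrow> (\<forall>a. form_fun d (\<lambda>v. h v $ a))"

definition biform_vec :: "nat \<Rightarrow> nat \<Rightarrow> ('a::comm_ring_1 ^ 3 \<Rightarrow> 'a ^ 3 \<Rightarrow> 'a ^ 3) \<Rightarrow> bool" where
  "biform_vec d e h \<longleftrightarrow> (\<forall>a. biform_fun d e (\<lambda>u v. h u v $ a))"

lemma form_fun_scale: "form_fun d p \<Longrightarrow> p (c *s v) = c ^ d * p v"
  by (auto simp: form_fun_def peval_scale)

lemma form_vec_scale: "form_vec d h \<Longrightarrow> h (c *s v) = c ^ d *s h v"
  unfolding form_vec_def vec_eq_iff using form_fun_scale[of d "\<lambda>v. h v $ _"] by simp

lemma form_vec_forms:
  assumes "form_vec d h"
  obtains g where "\<And>a. g a \<in> forms d" "\<And>v. (\<chi> a. peval (g a) v) = h v"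
proof -
  have "\<forall>a. \<exists>g. g \<in> forms d \<and> (\<forall>v. h v $ a = peval g v)"
    using assms by (auto simp: form_vec_def form_fun_def)
  then obtain g where "\<And>a. g a \<in> forms d" "\<And>a v. h v $ a = peval (g a) v" by metis
  then show ?thesis using that[of g] by (simp add: vec_eq_iff)
qed

lemma biform_vec_biforms:
  assumes "biform_vec d e h"
  obtains g where "\<And>a. g a \<in> biforms d e" "\<And>u v. (\<chi> a. bieval (g a) u v) = h u v"
proof -
  have "\<forall>a. \<exists>g. g \<in> biforms d e \<and> (\<forall>u v. h u v $ a = bieval g u v)"
    using assms unfolding biform_vec_def biform_fun_def by blast
  then obtain g where "\<And>a. g a \<in> biforms d e" "\<And>a u v. h u v $ a = bieval (g a) u v" by metis
  then show ?thesis using that[of g] by (simp add: vec_eq_iff)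
qed

lemma nonzero_vec_iff: "(\<exists>a. f a \<noteq> 0) \<longleftrightarrow> (\<chi> a. f a) \<noteq> 0"
  by (simp add: vec_eq_iff)

lemma generator_iff:
  assumes "x \<in> P2"
  shows "v \<in> x - {0} \<longleftrightarrow> v \<noteq> 0 \<and> x = point v"
proof -
  obtain u where u: "u \<noteq> 0" "x = point u" using assms by (auto simp: P2_iff)
  show ?thesis
  proof
    assume "v \<in> x - {0}"
    then obtain c where "v = c *s u" "v \<noteq> 0" using u by (auto simp: in_point_iff)
    then show "v \<noteq> 0 \<and> x = point v" using u point_scale[of c u] by auto
  next
    assume "v \<noteq> 0 \<and> x = point v"
    then show "v \<in> x - {0}" using vec.span_base[of v "{v}"] by auto
  qed
qed

text \<open>Replaces triples of forms by vector-valued functions and the members of a point by a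
  generator; regularity is handled in this shape from here on.\<close>

lemma regular_map_iff:
  "regular_map C D f \<longleftrightarrow> f \<in> pts C \<rightarrow> pts D \<and> (\<forall>x\<in>pts C. \<exists>d h. form_vec d h \<and>
     (\<exists>v. v \<noteq> 0 \<and> x = point v \<and> h v \<noteq> 0) \<and>
     (\<forall>v. v \<noteq> 0 \<and> point v \<in> pts C \<and> h v \<noteq> 0 \<longrightarrow> f (point v) = point (h v)))"
proof -
  have P2: "x \<in> P2" if "x \<in> pts C" for x using that pts_subset_P2[of C] by auto
  have "(\<exists>d g. (\<forall>a::3. g a \<in> forms d) \<and> (\<exists>v\<in>x - {0}. \<exists>a. peval (g a) v \<noteq> 0) \<and>
        (\<forall>y\<in>pts C. \<forall>v\<in>y - {0}. (\<exists>a. peval (g a) v \<noteq> 0) \<longrightarrow> f y = vec.span {\<chi> a. peval (g a) v}))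
    \<longleftrightarrow> (\<exists>d h. form_vec d h \<and> (\<exists>v. v \<noteq> 0 \<and> x = point v \<and> h v \<noteq> 0) \<and>
     (\<forall>v. v \<noteq> 0 \<and> point v \<in> pts C \<and> h v \<noteq> 0 \<longrightarrow> f (point v) = point (h v)))" (is "?L \<longleftrightarrow> ?R")
    if x: "x \<in> pts C" for x
  proof
    assume ?L
    then obtain d and g :: "3 \<Rightarrow> 'a form" where g: "\<And>a. g a \<in> forms d" "\<exists>v\<in>x - {0}. \<exists>a. peval (g a) v \<noteq> 0"
      "\<And>y v. y \<in> pts C \<Longrightarrow> v \<in> y - {0} \<Longrightarrow> (\<exists>a. peval (g a) v \<noteq> 0) \<Longrightarrow> f y = vec.span {\<chi> a. peval (g a) v}"
      by blast
    define h where "h v = (\<chi> a. peval (g a) v)" for v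
    have "form_vec d h" unfolding form_vec_def h_def using form_fun_peval[OF g(1)] by simp
    moreover have "\<exists>v. v \<noteq> 0 \<and> x = point v \<and> h v \<noteq> 0"
      using g(2) unfolding nonzero_vec_iff h_def using generator_iff[OF P2[OF x]] by blast
    moreover have "f (point v) = point (h v)" if "v \<noteq> 0" "point v \<in> pts C" "h v \<noteq> 0" for v
      using g(3)[OF that(2), of v] that generator_iff[OF P2[OF that(2)], of v] unfolding nonzero_vec_iff h_def by blast
    ultimately show ?R by blast
  next
    assume ?R
    then obtain d h where h: "form_vec d h" "\<exists>v. v \<noteq> 0 \<and> x = point v \<and> h v \<noteq> 0"
      "\<And>v. v \<noteq> 0 \<Longrightarrow> point v \<in> pts C \<Longrightarrow> h v \<noteq> 0 \<Longrightarrow> f (point v) = point (h v)" by blast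
    obtain g where g: "\<And>a. g a \<in> forms d" "\<And>v. (\<chi> a. peval (g a) v) = h v"
      using form_vec_forms[OF h(1)] by blast
    have "\<exists>v\<in>x - {0}. h v \<noteq> 0" using h(2) generator_iff[OF P2[OF x]] by blast
    moreover have "f y = point (h v)" if "y \<in> pts C" "v \<in> y - {0}" "h v \<noteq> 0" for y v
    proof -
      have "v \<noteq> 0" "y = point v" using that generator_iff[OF P2[OF that(1)]] by auto
      then show ?thesis using h(3)[of v] that by simp
    qed
    ultimately show ?L using g(1) unfolding nonzero_vec_iff
      by (intro exI[of _ d] exI[of _ g]) (simp add: g(2))
  qed
  then show ?thesis unfolding regular_map_def by auto
qed

lemma regular_mapE:
  assumes "regular_map C D f" "x \<in> pts C"
  obtains d h v where "form_vec d h" "v \<noteq> 0" "x = point v" "h v \<noteq> 0"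
    "\<forall>v. v \<noteq> 0 \<longrightarrow> point v \<in> pts C \<longrightarrow> h v \<noteq> 0 \<longrightarrow> f (point v) = point (h v)"
  using assms(1)[unfolded regular_map_iff, THEN conjunct2, THEN bspec, OF assms(2)]
  by (elim exE conjE) (rule that, assumption, assumption, assumption, assumption, blast)

lemma regular_map2I:
  assumes "\<And>x y. x \<in> pts C \<Longrightarrow> y \<in> pts C' \<Longrightarrow> f x y \<in> pts D"
    and "\<And>x y. x \<in> pts C \<Longrightarrow> y \<in> pts C' \<Longrightarrow> \<exists>d e h. biform_vec d e h \<and>
     (\<exists>u v. u \<noteq> 0 \<and> v \<noteq> 0 \<and> x = point u \<and> y = point v \<and> h u v \<noteq> 0) \<and>
     (\<forall>u v. u \<noteq> 0 \<and> v \<noteq> 0 \<and> point u \<in> pts C \<and> point v \<in> pts C' \<and> h u v \<noteq> 0 \<longrightarrow>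
        f (point u) (point v) = point (h u v))"
  shows "regular_map2 C C' D f"
  unfolding regular_map2_def
proof (intro conjI ballI)
  fix x y assume xy: "x \<in> pts C" "y \<in> pts C'"
  have P2: "x \<in> P2" if "x \<in> pts C" for x :: "'a pt" and C using that pts_subset_P2[of C] by auto
  obtain d e h where h: "biform_vec d e h" "\<exists>u v. u \<noteq> 0 \<and> v \<noteq> 0 \<and> x = point u \<and> y = point v \<and> h u v \<noteq> 0"
    "\<And>u v. u \<noteq> 0 \<Longrightarrow> v \<noteq> 0 \<Longrightarrow> point u \<in> pts C \<Longrightarrow> point v \<in> pts C' \<Longrightarrow> h u v \<noteq> 0 \<Longrightarrow>
        f (point u) (point v) = point (h u v)"
    using assms(2)[OF xy] by blast
  obtain g where g: "\<And>a. g a \<in> biforms d e" "\<And>u v. (\<chi> a. bieval (g a) u v) = h u v"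
    using biform_vec_biforms[OF h(1)] by blast
  have "\<exists>u\<in>x - {0}. \<exists>v\<in>y - {0}. h u v \<noteq> 0"
    using h(2) generator_iff[OF P2[OF xy(1)]] generator_iff[OF P2[OF xy(2)]] by blast
  moreover have "f x' y' = point (h u v)"
    if "x' \<in> pts C" "y' \<in> pts C'" "u \<in> x' - {0}" "v \<in> y' - {0}" "h u v \<noteq> 0" for x' y' u v
  proof -
    have "u \<noteq> 0" "x' = point u" "v \<noteq> 0" "y' = point v"
      using that generator_iff[OF P2[OF that(1)]] generator_iff[OF P2[OF that(2)]] by auto
    then show ?thesis using h(3)[of u v] that by simp
  qed
  ultimately show "\<exists>d e g. (\<forall>a::3. g a \<in> biforms d e) \<and>
        (\<exists>v\<in>x - {0}. \<exists>v'\<in>y - {0}. \<exists>a. bieval (g a) v v' \<noteq> 0) \<and>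
        (\<forall>y\<in>pts C. \<forall>y'\<in>pts C'. \<forall>v\<in>y - {0}. \<forall>v'\<in>y' - {0}. (\<exists>a. bieval (g a) v v' \<noteq> 0) \<longrightarrow>
           f y y' = vec.span {\<chi> a. bieval (g a) v v'})"
    using g(1) unfolding nonzero_vec_iff
    by (intro exI[of _ d] exI[of _ e] exI[of _ g]) (simp add: g(2))
qed (rule assms(1))

lemma regular_map2D:
  assumes "regular_map2 C C' D f" "x \<in> pts C" "y \<in> pts C'"
  shows "f x y \<in> pts D"
    and "\<exists>d e h. biform_vec d e h \<and>
     (\<exists>u v. u \<noteq> 0 \<and> v \<noteq> 0 \<and> x = point u \<and> y = point v \<and> h u v \<noteq> 0) \<and>
     (\<forall>u v. u \<noteq> 0 \<and> v \<noteq> 0 \<and> point u \<in> pts C \<and> point v \<in> pts C' \<and> h u v \<noteq> 0 \<longrightarrow>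
        f (point u) (point v) = point (h u v))"
proof -
  show "f x y \<in> pts D" using assms by (simp add: regular_map2_def)
  have P2: "x \<in> P2" if "x \<in> pts C" for x :: "'a pt" and C using that pts_subset_P2[of C] by auto
  obtain d e and g :: "3 \<Rightarrow> (3 + 3, 'a) mpol" where g: "\<And>a. g a \<in> biforms d e"
    "\<exists>u\<in>x - {0}. \<exists>v\<in>y - {0}. \<exists>a. bieval (g a) u v \<noteq> 0"
    "\<And>x y u v. x \<in> pts C \<Longrightarrow> y \<in> pts C' \<Longrightarrow> u \<in> x - {0} \<Longrightarrow> v \<in> y - {0} \<Longrightarrow>
      (\<exists>a. bieval (g a) u v \<noteq> 0) \<Longrightarrow> f x y = vec.span {\<chi> a. bieval (g a) u v}"
  proof -
    have "\<exists>d e g. (\<forall>a::3. g a \<in> biforms d e) \<and>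
        (\<exists>u\<in>x - {0}. \<exists>v\<in>y - {0}. \<exists>a. bieval (g a) u v \<noteq> 0) \<and>
        (\<forall>x\<in>pts C. \<forall>y\<in>pts C'. \<forall>u\<in>x - {0}. \<forall>v\<in>y - {0}. (\<exists>a. bieval (g a) u v \<noteq> 0) \<longrightarrow>
           f x y = vec.span {\<chi> a. bieval (g a) u v})"
      using assms(1)[unfolded regular_map2_def, THEN conjunct2, THEN bspec, OF assms(2), THEN bspec, OF assms(3)] .
    then show ?thesis by (elim exE conjE) (rule that, blast, assumption, blast)
  qed
  define h where "h u v = (\<chi> a. bieval (g a) u v)" for u v
  have "biform_vec d e h" using g(1) by (auto simp: biform_vec_def h_def biform_fun_def)
  moreover have "\<exists>u v. u \<noteq> 0 \<and> v \<noteq> 0 \<and> x = point u \<and> y = point v \<and> h u v \<noteq> 0"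
    using g(2) unfolding nonzero_vec_iff h_def
    using generator_iff[OF P2[OF assms(2)]] generator_iff[OF P2[OF assms(3)]] by blast
  moreover have "f (point u) (point v) = point (h u v)"
    if "u \<noteq> 0" "v \<noteq> 0" "point u \<in> pts C" "point v \<in> pts C'" "h u v \<noteq> 0" for u v
    using g(3)[OF that(3,4), of u v] that generator_iff[OF P2[OF that(3)], of u] generator_iff[OF P2[OF that(4)], of v]
    unfolding nonzero_vec_iff h_def by blast
  ultimately show "\<exists>d e h. biform_vec d e h \<and>
     (\<exists>u v. u \<noteq> 0 \<and> v \<noteq> 0 \<and> x = point u \<and> y = point v \<and> h u v \<noteq> 0) \<and>
     (\<forall>u v. u \<noteq> 0 \<and> v \<noteq> 0 \<and> point u \<in> pts C \<and> point v \<in> pts C' \<and> h u v \<noteq> 0 \<longrightarrow>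
        f (point u) (point v) = point (h u v))" by blast
qed

lemma regular_map2E:
  assumes "regular_map2 C C' D f" "x \<in> pts C" "y \<in> pts C'"
  obtains d e h u v where "biform_vec d e h" "u \<noteq> 0" "v \<noteq> 0" "x = point u" "y = point v" "h u v \<noteq> 0"
    "\<forall>u v. u \<noteq> 0 \<longrightarrow> v \<noteq> 0 \<longrightarrow> point u \<in> pts C \<longrightarrow> point v \<in> pts C' \<longrightarrow> h u v \<noteq> 0 \<longrightarrow>
        f (point u) (point v) = point (h u v)"
  using regular_map2D(2)[OF assms]
  by (elim exE conjE) (rule that, assumption, assumption, assumption, assumption, assumption, assumption, blast)

lemma regular_map_in: "regular_map C D f \<Longrightarrow> x \<in> pts C \<Longrightarrow> f x \<in> pts D"
  by (auto simp: regular_map_def)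

lemma regular_map_cong:
  assumes "regular_map C D f" "\<And>x. x \<in> pts C \<Longrightarrow> g x = f x"
  shows "regular_map C D g"
proof -
  have 1: "g \<in> pts C \<rightarrow> pts D" using assms by (auto simp: regular_map_iff)
  have 2: "(\<forall>v. v \<noteq> 0 \<and> point v \<in> pts C \<and> h v \<noteq> 0 \<longrightarrow> g (point v) = point (h v)) \<longleftrightarrow>
    (\<forall>v. v \<noteq> 0 \<and> point v \<in> pts C \<and> h v \<noteq> 0 \<longrightarrow> f (point v) = point (h v))" for h
    using assms(2) by auto
  show ?thesis using assms(1) 1 unfolding regular_map_iff 2 by blast
qed

lemma regular_map_id: "regular_map C C (\<lambda>x. x)"
proof -
  have "form_vec 1 (\<lambda>v :: 'a ^ 3. v)" unfolding form_vec_def using form_fun_coord by blast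
  moreover have "\<exists>v. v \<noteq> 0 \<and> x = point v \<and> v \<noteq> 0" if "x \<in> pts C" for x
    by (rule pts_cases[OF that]) auto
  ultimately show ?thesis unfolding regular_map_iff
    by (intro conjI ballI exI[of _ "1 :: nat"] exI[of _ "\<lambda>v. v"]) auto
qed

lemma regular_map_const:
  assumes "p \<in> pts D"
  shows "regular_map C D (\<lambda>x. p)"
proof -
  obtain u where u: "u \<noteq> 0" "p = point u" using assms by (rule pts_cases)
  have "form_vec 0 (\<lambda>v :: 'a ^ 3. u)" unfolding form_vec_def by (simp add: form_fun_const)
  moreover have "\<exists>v. v \<noteq> 0 \<and> x = point v \<and> u \<noteq> 0" if "x \<in> pts C" for x
    by (rule pts_cases[OF that]) (use u in auto)
  ultimately show ?thesis unfolding regular_map_iff using assms u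
    by (intro conjI ballI exI[of _ "0 :: nat"] exI[of _ "\<lambda>v. u"]) auto
qed

text \<open>In the next lemmas the composite is multiplied by a coordinate of the inner map, since forms of
  degree zero do not vanish at the origin.\<close>

lemma regular_map_compose2:
  assumes m: "regular_map2 C C' D m" and f: "regular_map B C f" and g: "regular_map B C' g"
  shows "regular_map B D (\<lambda>x. m (f x) (g x))"
  unfolding regular_map_iff
proof (intro conjI ballI Pi_I)
  fix x assume x: "x \<in> pts B"
  have fx: "f x \<in> pts C" and gx: "g x \<in> pts C'" using f g x by (auto simp: regular_map_def)
  show "m (f x) (g x) \<in> pts D" using m fx gx by (simp add: regular_map2_def)
  obtain d1 h1 v1 where h1: "form_vec d1 h1" "v1 \<noteq> 0" "x = point v1" "h1 v1 \<noteq> 0"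
    "\<forall>v. v \<noteq> 0 \<longrightarrow> point v \<in> pts B \<longrightarrow> h1 v \<noteq> 0 \<longrightarrow> f (point v) = point (h1 v)"
    using regular_mapE[OF f x] .
  note h1 = h1(1-4) h1(5)[rule_format]
  obtain d2 h2 v2 where h2: "form_vec d2 h2" "v2 \<noteq> 0" "x = point v2" "h2 v2 \<noteq> 0"
    "\<forall>v. v \<noteq> 0 \<longrightarrow> point v \<in> pts B \<longrightarrow> h2 v \<noteq> 0 \<longrightarrow> g (point v) = point (h2 v)"
    using regular_mapE[OF g x] .
  note h2 = h2(1-4) h2(5)[rule_format]
  obtain d e h u w where h: "biform_vec d e h" "u \<noteq> 0" "w \<noteq> 0" "f x = point u" "g x = point w" "h u w \<noteq> 0"
    "\<forall>u v. u \<noteq> 0 \<longrightarrow> v \<noteq> 0 \<longrightarrow> point u \<in> pts C \<longrightarrow> point v \<in> pts C' \<longrightarrow> h u v \<noteq> 0 \<longrightarrow>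
        m (point u) (point v) = point (h u v)"
    using regular_map2E[OF m fx gx] .
  note h = h(1-6) h(7)[rule_format]
  obtain c where c: "c \<noteq> 0" "v2 = c *s v1" using h1(2,3) h2(2,3) point_eq_iff by metis
  have h21: "h2 v1 \<noteq> 0" using h2(4) form_vec_scale[OF h2(1), of c v1] c by auto
  obtain a where a: "h1 v1 $ a \<noteq> 0" using h1(4) by (auto simp: vec_eq_iff)
  obtain b where b: "h2 v1 $ b \<noteq> 0" using h21 by (auto simp: vec_eq_iff)
  define k where "k v = (h1 v $ a * h2 v $ b) *s h (h1 v) (h2 v)" for v
  have "form_vec (d1 + d2 + (d * d1 + e * d2)) k"
    unfolding form_vec_def k_def vector_smult_component
  proof
    fix c
    show "form_fun (d1 + d2 + (d * d1 + e * d2)) (\<lambda>v. h1 v $ a * h2 v $ b * h (h1 v) (h2 v) $ c)"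
      using h1(1) h2(1) h(1) unfolding form_vec_def biform_vec_def
      by (intro form_fun_mult form_fun_compose_biform[where p = "\<lambda>u v. h u v $ c" and f = h1 and g = h2])
        simp_all
  qed
  moreover have "\<exists>v. v \<noteq> 0 \<and> x = point v \<and> k v \<noteq> 0"
  proof -
    have "point (h1 v1) = point u" "point (h2 v1) = point w"
      using h1(2-5) h2(5)[OF h1(2) _ h21] h(4,5) x by auto
    then obtain c1 c2 where c12: "c1 \<noteq> 0" "u = c1 *s h1 v1" "c2 \<noteq> 0" "w = c2 *s h2 v1"
      using point_eq_iff h1(4) h21 h(2,3) by metis
    have "h u w = (c1 ^ d * c2 ^ e) *s h (h1 v1) (h2 v1)"
    proof -
      have bs: "biform_fun d e p \<Longrightarrow> p (c1 *s y) (c2 *s z) = c1 ^ d * c2 ^ e * p y z" for p y z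
      proof -
        assume p: "biform_fun d e p"
        have "form_fun (d * 1 + e * 0) (\<lambda>v. p v z)"
          by (rule form_fun_compose_biform[OF p form_fun_coord form_fun_const])
        moreover have "form_fun (d * 0 + e * 1) (\<lambda>v. p (c1 *s y) v)"
          by (rule form_fun_compose_biform[OF p form_fun_const form_fun_coord])
        ultimately show ?thesis
          using form_fun_scale[of d "\<lambda>v. p v z" c1 y] form_fun_scale[of e "\<lambda>v. p (c1 *s y) v" c2 z]
          by simp
      qed
      show ?thesis unfolding c12(2,4) using h(1) bs[of "\<lambda>u v. h u v $ _"]
        by (simp add: biform_vec_def vec_eq_iff)
    qed
    then have "h (h1 v1) (h2 v1) \<noteq> 0" using h(6) by auto
    then have "k v1 \<noteq> 0" using a b by (simp add: k_def)
    then show ?thesis using h1(2,3) by blast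
  qed
  moreover have "m (f (point v)) (g (point v)) = point (k v)"
    if v: "v \<noteq> 0" "point v \<in> pts B" "k v \<noteq> 0" for v
  proof -
    have nz: "h1 v $ a * h2 v $ b \<noteq> 0" "h (h1 v) (h2 v) \<noteq> 0" using v(3) by (auto simp: k_def)
    then have nz': "h1 v \<noteq> 0" "h2 v \<noteq> 0" by auto
    have 1: "f (point v) = point (h1 v)" "g (point v) = point (h2 v)"
      using h1(5)[OF v(1,2)] h2(5)[OF v(1,2)] nz' by auto
    then have "point (h1 v) \<in> pts C" "point (h2 v) \<in> pts C'"
      using regular_map_in[OF f v(2)] regular_map_in[OF g v(2)] by auto
    then have "m (f (point v)) (g (point v)) = point (h (h1 v) (h2 v))"
      unfolding 1 using h(7) nz nz' by blast
    also have "\<dots> = point (k v)" unfolding k_def using nz by (intro point_scale[symmetric]) auto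
    finally show ?thesis .
  qed
  ultimately show "\<exists>d h. form_vec d h \<and> (\<exists>v. v \<noteq> 0 \<and> x = point v \<and> h v \<noteq> 0) \<and>
     (\<forall>v. v \<noteq> 0 \<and> point v \<in> pts B \<and> h v \<noteq> 0 \<longrightarrow> m (f (point v)) (g (point v)) = point (h v))"
    by blast
qed

lemma regular_map2_compose:
  assumes m: "regular_map2 C C' D m" and f: "regular_map D E f"
  shows "regular_map2 C C' E (\<lambda>x y. f (m x y))"
proof (rule regular_map2I)
  fix x y assume xy: "x \<in> pts C" "y \<in> pts C'"
  have mxy: "m x y \<in> pts D" using m xy by (simp add: regular_map2_def)
  show "f (m x y) \<in> pts E" using f mxy by (rule regular_map_in)
  obtain d e h u v where h: "biform_vec d e h" "u \<noteq> 0" "v \<noteq> 0" "x = point u" "y = point v" "h u v \<noteq> 0"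
    "\<forall>u v. u \<noteq> 0 \<longrightarrow> v \<noteq> 0 \<longrightarrow> point u \<in> pts C \<longrightarrow> point v \<in> pts C' \<longrightarrow> h u v \<noteq> 0 \<longrightarrow>
        m (point u) (point v) = point (h u v)"
    using regular_map2E[OF m xy] .
  note h = h(1-6) h(7)[rule_format]
  obtain l k w where k: "form_vec l k" "w \<noteq> 0" "m x y = point w" "k w \<noteq> 0"
    "\<forall>v. v \<noteq> 0 \<longrightarrow> point v \<in> pts D \<longrightarrow> k v \<noteq> 0 \<longrightarrow> f (point v) = point (k v)"
    using regular_mapE[OF f mxy] .
  note k = k(1-4) k(5)[rule_format]
  obtain a where a: "h u v $ a \<noteq> 0" using h(6) by (auto simp: vec_eq_iff)
  define n where "n u v = h u v $ a *s k (h u v)" for u v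
  have "biform_vec (d + l * d) (e + l * e) n"
    unfolding biform_vec_def n_def vector_smult_component
  proof
    fix c
    show "biform_fun (d + l * d) (e + l * e) (\<lambda>u v. h u v $ a * k (h u v) $ c)"
      using h(1) k(1) unfolding form_vec_def biform_vec_def
      by (intro biform_fun_mult biform_fun_compose_form[where p = "\<lambda>v. k v $ c" and f = h]) simp_all
  qed
  moreover have "\<exists>u v. u \<noteq> 0 \<and> v \<noteq> 0 \<and> x = point u \<and> y = point v \<and> n u v \<noteq> 0"
  proof -
    have "m x y = point (h u v)" using h xy by blast
    then obtain c where "c \<noteq> 0" "w = c *s h u v" using point_eq_iff[OF h(6) k(2)] k(3) by auto
    then have "k (h u v) \<noteq> 0" using form_vec_scale[OF k(1), of c "h u v"] k(4) by auto
    then have "n u v \<noteq> 0" using a by (simp add: n_def)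
    then show ?thesis using h by blast
  qed
  moreover have "f (m (point u) (point v)) = point (n u v)"
    if "u \<noteq> 0" "v \<noteq> 0" "point u \<in> pts C" "point v \<in> pts C'" "n u v \<noteq> 0" for u v
  proof -
    have nz: "h u v $ a \<noteq> 0" "k (h u v) \<noteq> 0" using that(5) by (auto simp: n_def)
    then have "h u v \<noteq> 0" by auto
    then have 1: "m (point u) (point v) = point (h u v)" using h(7) that by blast
    have "m (point u) (point v) \<in> pts D" using m that(3,4) by (rule regular_map2D(1))
    then have "point (h u v) \<in> pts D" using 1 by simp
    then have "f (m (point u) (point v)) = point (k (h u v))" using 1 k(5) nz \<open>h u v \<noteq> 0\<close> by simp
    also have "\<dots> = point (n u v)" unfolding n_def using nz by (intro point_scale[symmetric]) auto
    finally show ?thesis .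
  qed
  ultimately show "\<exists>d e h. biform_vec d e h \<and>
     (\<exists>u v. u \<noteq> 0 \<and> v \<noteq> 0 \<and> x = point u \<and> y = point v \<and> h u v \<noteq> 0) \<and>
     (\<forall>u v. u \<noteq> 0 \<and> v \<noteq> 0 \<and> point u \<in> pts C \<and> point v \<in> pts C' \<and> h u v \<noteq> 0 \<longrightarrow>
        f (m (point u) (point v)) = point (h u v))" by blast
qed

lemma regular_map_compose:
  assumes f: "regular_map B C f" and g: "regular_map C D g"
  shows "regular_map B D (\<lambda>x. g (f x))"
proof -
  \<comment> \<open>Composition is reduced to the case of two arguments by a map that ignores its
    second argument.\<close>
  have "regular_map2 C C D (\<lambda>x y. g x)"
  proof (rule regular_map2I)
    fix x y assume xy: "x \<in> pts C" "y \<in> pts C"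
    show "g x \<in> pts D" using g xy(1) by (rule regular_map_in)
    obtain d h u where h: "form_vec d h" "u \<noteq> 0" "x = point u" "h u \<noteq> 0"
      "\<forall>v. v \<noteq> 0 \<longrightarrow> point v \<in> pts C \<longrightarrow> h v \<noteq> 0 \<longrightarrow> g (point v) = point (h v)"
      using regular_mapE[OF g xy(1)] .
    note h = h(1-4) h(5)[rule_format]
    have "biform_vec (d * 1) (d * 0) (\<lambda>u v. h u)"
      using h(1) unfolding biform_vec_def form_vec_def
      by (intro allI biform_fun_compose_form biform_fun_coord1) auto
    moreover obtain v where "v \<noteq> 0" "y = point v" using xy(2) by (rule pts_cases)
    ultimately show "\<exists>d e k. biform_vec d e k \<and>
       (\<exists>u v. u \<noteq> 0 \<and> v \<noteq> 0 \<and> x = point u \<and> y = point v \<and> k u v \<noteq> 0) \<and>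
       (\<forall>u v. u \<noteq> 0 \<and> v \<noteq> 0 \<and> point u \<in> pts C \<and> point v \<in> pts C \<and> k u v \<noteq> 0 \<longrightarrow>
          g (point u) = point (k u v))"
      using h(2-5)
      by (intro exI[of _ "d * 1"] exI[of _ "d * 0"] exI[of _ "\<lambda>u v. h u"] conjI exI[of _ u] exI[of _ v]) simp_all
  qed
  from regular_map_compose2[OF this f f] show ?thesis .
qed

section \<open>Chords and tangents of a smooth cubic\<close>

text \<open>The line through the points \<open>p\<close> and \<open>q\<close> cuts the cubic in the points \<open>u, v, w\<close>, counted with
  multiplicity.\<close>

definition line_cycle :: "'a::field form \<Rightarrow> 'a ^ 3 \<Rightarrow> 'a ^ 3 \<Rightarrow> 'a ^ 3 \<Rightarrow> bool" where
  "line_cycle F u v w \<longleftrightarrow> u \<noteq> 0 \<and> v \<noteq> 0 \<and> w \<noteq> 0 \<and> (\<exists>p q s1 t1 s2 t2 s3 t3 k. cross p q \<noteq> 0 \<and> k \<noteq> 0 \<and>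
     u = s1 *s p + t1 *s q \<and> v = s2 *s p + t2 *s q \<and> w = s3 *s p + t3 *s q \<and>
     (\<forall>s t. peval F (s *s p + t *s q) = k * ((s * t1 - t * s1) * (s * t2 - t * s2) * (s * t3 - t * s3))))"

lemma line_cycleE:
  assumes "line_cycle F u v w"
  obtains p q s1 t1 s2 t2 s3 t3 k where "cross p q \<noteq> 0" "k \<noteq> 0" "u = s1 *s p + t1 *s q"
    "v = s2 *s p + t2 *s q" "w = s3 *s p + t3 *s q"
    "\<And>s t. peval F (s *s p + t *s q) = k * ((s * t1 - t * s1) * (s * t2 - t * s2) * (s * t3 - t * s3))"
  using assms unfolding line_cycle_def by blast

lemma line_cycle_nonzero: "line_cycle F u v w \<Longrightarrow> u \<noteq> 0 \<and> v \<noteq> 0 \<and> w \<noteq> 0"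
  by (simp add: line_cycle_def)

lemma line_cycleI:
  assumes "cross p q \<noteq> 0" "k \<noteq> 0" "s1 \<noteq> 0 \<or> t1 \<noteq> 0" "s2 \<noteq> 0 \<or> t2 \<noteq> 0" "s3 \<noteq> 0 \<or> t3 \<noteq> 0"
    "\<And>s t. peval F (s *s p + t *s q) = k * ((s * t1 - t * s1) * (s * t2 - t * s2) * (s * t3 - t * s3))"
  shows "line_cycle F (s1 *s p + t1 *s q) (s2 *s p + t2 *s q) (s3 *s p + t3 *s q)"
proof -
  have nz: "s *s p + t *s q \<noteq> 0" if "s \<noteq> 0 \<or> t \<noteq> 0" for s t
  proof
    assume *: "s *s p + t *s q = 0"
    have "cross (s *s p + t *s q) q = s *s cross p q" "cross p (s *s p + t *s q) = t *s cross p q"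
      by (simp_all add: cross_add)
    with * that assms(1) show False by simp
  qed
  show ?thesis unfolding line_cycle_def using assms nz by blast
qed

lemma line_cycle_swap12:
  assumes "line_cycle F u v w"
  shows "line_cycle F v u w"
  using assms
proof (rule line_cycleE)
  fix p q s1 t1 s2 t2 s3 t3 k
  assume a: "cross p q \<noteq> 0" "k \<noteq> 0" "u = s1 *s p + t1 *s q"
    "v = s2 *s p + t2 *s q" "w = s3 *s p + t3 *s q"
    "\<And>s t. peval F (s *s p + t *s q) = k * ((s * t1 - t * s1) * (s * t2 - t * s2) * (s * t3 - t * s3))"
  have "peval F (s *s p + t *s q) = k * ((s * t2 - t * s2) * (s * t1 - t * s1) * (s * t3 - t * s3))" for s t
    using a(6)[of s t] by (simp add: mult_ac)
  with a line_cycle_nonzero[OF assms] show ?thesis unfolding line_cycle_def by blast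
qed

lemma line_cycle_swap23:
  assumes "line_cycle F u v w"
  shows "line_cycle F u w v"
  using assms
proof (rule line_cycleE)
  fix p q s1 t1 s2 t2 s3 t3 k
  assume a: "cross p q \<noteq> 0" "k \<noteq> 0" "u = s1 *s p + t1 *s q"
    "v = s2 *s p + t2 *s q" "w = s3 *s p + t3 *s q"
    "\<And>s t. peval F (s *s p + t *s q) = k * ((s * t1 - t * s1) * (s * t2 - t * s2) * (s * t3 - t * s3))"
  have "peval F (s *s p + t *s q) = k * ((s * t1 - t * s1) * (s * t3 - t * s3) * (s * t2 - t * s2))" for s t
    using a(6)[of s t] by (simp add: mult_ac)
  with a line_cycle_nonzero[OF assms] show ?thesis unfolding line_cycle_def by blast
qed

lemma line_cycle_scale1:
  assumes "line_cycle F u v w" "c \<noteq> 0"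
  shows "line_cycle F (c *s u) v w"
  using assms(1)
proof (rule line_cycleE)
  fix p q s1 t1 s2 t2 s3 t3 k
  assume a: "cross p q \<noteq> 0" "k \<noteq> 0" "u = s1 *s p + t1 *s q"
    "v = s2 *s p + t2 *s q" "w = s3 *s p + t3 *s q"
    "\<And>s t. peval F (s *s p + t *s q) = k * ((s * t1 - t * s1) * (s * t2 - t * s2) * (s * t3 - t * s3))"
  have 1: "peval F (s *s p + t *s q) = (k / c) * ((s * (c * t1) - t * (c * s1)) * (s * t2 - t * s2) * (s * t3 - t * s3))" for s t
    unfolding a(6) using assms(2) by (simp add: field_simps)
  have 2: "c *s u = (c * s1) *s p + (c * t1) *s q" unfolding a(3) by (simp add: vec.scale_right_distrib)
  have "k / c \<noteq> 0" "c *s u \<noteq> 0" using assms(2) a(2) line_cycle_nonzero[OF assms(1)] by auto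
  with 1 2 a line_cycle_nonzero[OF assms(1)] show ?thesis unfolding line_cycle_def by blast
qed

lemma line_cycle_scale:
  assumes "line_cycle F u v w" "c \<noteq> 0" "d \<noteq> 0" "e \<noteq> 0"
  shows "line_cycle F (c *s u) (d *s v) (e *s w)"
proof -
  have "line_cycle F (d *s v) (c *s u) w"
    using assms by (intro line_cycle_scale1 line_cycle_swap12[OF line_cycle_scale1])
  then have "line_cycle F w (c *s u) (d *s v)" by (metis line_cycle_swap12 line_cycle_swap23)
  then have "line_cycle F (e *s w) (c *s u) (d *s v)" using assms by (intro line_cycle_scale1)
  then show ?thesis by (metis line_cycle_swap12 line_cycle_swap23)
qed

lemma line_cycle_on_curve:
  assumes "line_cycle F u v w"
  shows "peval F u = 0 \<and> peval F v = 0 \<and> peval F w = 0"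
  using assms by (rule line_cycleE) (simp add: mult.commute)

locale smooth_cubic =
  fixes F :: "'a::{alg_closed_field, field_char_0} form"
  assumes cubic: "F \<in> forms 3" and smooth: "smooth (pol.span {F})"
begin

abbreviation "T \<equiv> tri F"
abbreviation "C \<equiv> pol.span {F}"

lemma peval_T: "peval F v = T v v v"
  by (rule peval_tri[OF cubic])

lemma gradient_nonzero: "v \<noteq> 0 \<Longrightarrow> peval F v = 0 \<Longrightarrow> \<exists>w. T v v w \<noteq> 0"
  using smooth smooth_cubic_iff[OF cubic] by blast

lemma in_C: "v \<noteq> 0 \<Longrightarrow> point v \<in> pts C \<longleftrightarrow> peval F v = 0"
  by (rule point_in_pts_iff[OF cubic])

lemma peval_line:
  "peval F (s *s u + t *s v) = s ^ 3 * T u u u + 3 * s\<^sup>2 * t * T u u v + 3 * s * t\<^sup>2 * T u v v + t ^ 3 * T v v v"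
  by (simp add: peval_T tri_linear tri_commute power2_eq_square power3_eq_cube algebra_simps)

text \<open>If the line through u and v lay on the cubic, its gradient along the line would be the
  single binary quadratic form T(p, p, w) with w off the line, and a zero of that form would be a
  singular point.\<close>

lemma no_line:
  assumes "cross u v \<noteq> 0" "T u u u = 0" "T v v v = 0" "T u u v = 0" "T u v v = 0"
  shows False
proof -
  obtain w where w: "det3 u v w \<noteq> 0" using extend_basis2[OF assms(1)] .
  obtain s t where st: "s \<noteq> 0 \<or> t \<noteq> 0"
    "T u u w * s\<^sup>2 + (2 * T u v w) * (s * t) + T v v w * t\<^sup>2 = 0" using binary_quadratic_zero .
  define p where "p = s *s u + t *s v"
  have "p \<noteq> 0"
  proof
    assume "p = 0"
    then have "s *s u + t *s v + 0 *s w = 0 *s u + 0 *s v + 0 *s w" by (simp add: p_def)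
    from det3_independent[OF w this] st(1) show False by simp
  qed
  moreover have "peval F p = 0" unfolding p_def peval_line by (simp add: assms)
  moreover have "T p p z = 0" for z
  proof -
    obtain a b c where z: "z = a *s u + b *s v + c *s w" using det3_coordinates[OF w] .
    have "T p p u = 0" "T p p v = 0" by (simp_all add: p_def tri_linear tri_commute assms)
    moreover have "T p p w = 0" using st(2) by (simp add: p_def tri_linear tri_commute power2_eq_square algebra_simps)
    ultimately show ?thesis unfolding z by (simp add: tri_linear)
  qed
  ultimately show False using gradient_nonzero by blast
qed

text \<open>For u, v on the curve F(s u + t v) = 3 s t (s T(u, u, v) + t T(u, v, v)); this is the
  root of the last factor.\<close>

definition chord_vec :: "'a ^ 3 \<Rightarrow> 'a ^ 3 \<Rightarrow> 'a ^ 3" where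
  "chord_vec u v = T u v v *s u - T u u v *s v"

lemma line_cycle_chord_vec:
  assumes "cross u v \<noteq> 0" "peval F u = 0" "peval F v = 0"
  shows "line_cycle F u v (chord_vec u v)"
proof -
  have "line_cycle F (1 *s u + 0 *s v) (0 *s u + 1 *s v) (T u v v *s u + (- T u u v) *s v)"
  proof (rule line_cycleI[where k = 3])
    show "T u v v \<noteq> 0 \<or> - T u u v \<noteq> 0" using no_line[OF assms(1)] assms(2,3) by (auto simp: peval_T)
    show "peval F (s *s u + t *s v) = 3 * ((s * 0 - t * 1) * (s * 1 - t * 0) * (s * - T u u v - t * T u v v))" for s t
      using assms(2,3) unfolding peval_line by (simp add: peval_T power2_eq_square algebra_simps)
  qed (use assms in auto)
  then show ?thesis by (simp add: chord_vec_def)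
qed

text \<open>Evaluating the given factorisation at u + v and u - v recovers T(u, u, v) and T(u, v, v)
  up to a common factor. \<open>?D\<close> is the determinant of the coordinates of u and v on the
  line.\<close>

lemma line_cycle_imp_chord_vec:
  assumes "line_cycle F u v w" "cross u v \<noteq> 0"
  shows "cross w (chord_vec u v) = 0"
  using assms(1)
proof (rule line_cycleE)
  fix p q s1 t1 s2 t2 s3 t3 k
  assume a: "cross p q \<noteq> 0" "k \<noteq> 0" "u = s1 *s p + t1 *s q"
    "v = s2 *s p + t2 *s q" "w = s3 *s p + t3 *s q"
    "\<And>s t. peval F (s *s p + t *s q) = k * ((s * t1 - t * s1) * (s * t2 - t * s2) * (s * t3 - t * s3))"
  have 0: "peval F u = 0" "peval F v = 0" using line_cycle_on_curve[OF assms(1)] by auto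
  let ?D = "s1 * t2 - t1 * s2" and ?a = "s1 * t3 - t1 * s3" and ?b = "s2 * t3 - t2 * s3"
  have p: "peval F (u + v) = - k * ?D\<^sup>2 * (?a + ?b)"
  proof -
    have "u + v = (s1 + s2) *s p + (t1 + t2) *s q" unfolding a(3,4) by (simp add: vec.scale_left_distrib)
    then show ?thesis by (simp only: a(6)) (simp add: power2_eq_square algebra_simps)
  qed
  have m: "peval F (u - v) = k * ?D\<^sup>2 * (?a - ?b)"
  proof -
    have "u - v = (s1 - s2) *s p + (t1 - t2) *s q" unfolding a(3,4) by (simp add: vec.scale_left_diff_distrib)
    then show ?thesis by (simp only: a(6)) (simp add: power2_eq_square algebra_simps)
  qed
  have m': "peval F (v - u) = - (k * ?D\<^sup>2 * (?a - ?b))"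
  proof -
    have "v - u = (s2 - s1) *s p + (t2 - t1) *s q" unfolding a(3,4) by (simp add: vec.scale_left_diff_distrib)
    then show ?thesis by (simp only: a(6)) (simp add: power2_eq_square algebra_simps)
  qed
  have 1: "3 * T u u v = - k * ?D\<^sup>2 * ?a"
  proof -
    have "peval F (u + v) - peval F (u - v) = 2 * (- k * ?D\<^sup>2 * ?a)" unfolding p m by (simp add: algebra_simps)
    then show ?thesis unfolding tri_formula[OF cubic] 0 by simp
  qed
  have "3 * T v v u = - k * ?D\<^sup>2 * ?b"
  proof -
    have "peval F (v + u) - peval F (v - u) = 2 * (- k * ?D\<^sup>2 * ?b)"
      unfolding add.commute[of v u] p m' by (simp add: algebra_simps)
    then show ?thesis unfolding tri_formula[OF cubic] 0 by simp
  qed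
  then have 2: "3 * T u v v = - k * ?D\<^sup>2 * ?b" by (metis tri_commute3)
  have "3 *s chord_vec u v = (3 * T u v v) *s u - (3 * T u u v) *s v"
    by (simp add: chord_vec_def vec.scale_right_diff_distrib)
  also have "\<dots> = (k * ?D\<^sup>2 * ?D) *s w"
    unfolding 1 2 unfolding a(3-5) by (simp add: vec3_eq_iff algebra_simps)
  finally have "3 *s cross w (chord_vec u v) = cross w ((k * ?D\<^sup>2 * ?D) *s w)"
    by (metis cross_scale(2))
  then show ?thesis by simp
qed

text \<open>Along a tangent F(s u + t d) = t^2 (3 s T(u, d, d) + t T(d, d, d)), and the vector in
  the conclusion is the simple root. The work lies in showing that the given line is this
  tangent.\<close>

lemma line_cycle_tangent:
  assumes "line_cycle F u u w" "T u u d = 0" "cross u d \<noteq> 0"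
  shows "cross w (T d d d *s u - (3 * T u d d) *s d) = 0"
  using assms(1)
proof (rule line_cycleE)
  fix p q s1 t1 s2 t2 s3 t3 k
  assume a: "cross p q \<noteq> 0" "k \<noteq> 0" "u = s1 *s p + t1 *s q"
    "u = s2 *s p + t2 *s q" "w = s3 *s p + t3 *s q"
    "\<And>s t. peval F (s *s p + t *s q) = k * ((s * t1 - t * s1) * (s * t2 - t * s2) * (s * t3 - t * s3))"
  have u0: "peval F u = 0" "u \<noteq> 0" using line_cycle_on_curve[OF assms(1)] line_cycle_nonzero[OF assms(1)] by auto
  have "s1 *s cross p q = s2 *s cross p q" "t1 *s cross p q = t2 *s cross p q"
  proof -
    have "cross u q = s1 *s cross p q" "cross p u = t1 *s cross p q" by (simp_all add: a(3) cross_add)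
    moreover have "cross u q = s2 *s cross p q" "cross p u = t2 *s cross p q" by (simp_all add: a(4) cross_add)
    ultimately show "s1 *s cross p q = s2 *s cross p q" "t1 *s cross p q = t2 *s cross p q" by metis+
  qed
  then have st: "s2 = s1" "t2 = t1" using a(1) by auto
  note F = a(6)[unfolded st]
  let ?E = "s1 * t3 - t1 * s3"
  have val: "peval F (c *s u + (s *s p + t *s q)) = k * ((s * t1 - t * s1)\<^sup>2 * (c * ?E + (s * t3 - t * s3)))" for c s t
  proof -
    have "c *s u + (s *s p + t *s q) = (c * s1 + s) *s p + (c * t1 + t) *s q"
      by (simp add: a(3) vec3_eq_iff algebra_simps)
    then show ?thesis by (simp only: F) (simp add: power2_eq_square algebra_simps)
  qed
  have tan: "T u u (s *s p + t *s q) = 0" for s t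
  proof -
    have "u - (s *s p + t *s q) = 1 *s u + ((- s) *s p + (- t) *s q)" by (simp add: vec3_eq_iff)
    then have 1: "peval F (u - (s *s p + t *s q)) = k * ((s * t1 - t * s1)\<^sup>2 * (?E - (s * t3 - t * s3)))"
      by (simp only: val) (simp add: power2_eq_square algebra_simps)
    have 2: "peval F (u + (s *s p + t *s q)) = k * ((s * t1 - t * s1)\<^sup>2 * (?E + (s * t3 - t * s3)))"
      using val[of 1 s t] by simp
    have 3: "peval F (s *s p + t *s q) = k * ((s * t1 - t * s1)\<^sup>2 * (s * t3 - t * s3))"
      unfolding F by (simp add: power2_eq_square)
    have "3 * T u u (s *s p + t *s q) = 0"
      unfolding tri_formula[OF cubic] 1 2 3 by (simp add: field_simps)
    then show ?thesis by simp
  qed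
  \<comment> \<open>All vectors of the given line are tangent at u; a tangent d off that line would
    make the whole gradient at u vanish.\<close>
  have "det3 p q d = 0"
  proof (rule ccontr)
    assume nz: "det3 p q d \<noteq> 0"
    have "T u u z = 0" for z
    proof -
      obtain r s t where z: "z = r *s p + s *s q + t *s d" using det3_coordinates[OF nz] .
      show ?thesis unfolding z using tan[of r s] assms(2) by (simp add: tri_linear)
    qed
    then show False using gradient_nonzero[OF u0(2,1)] by blast
  qed
  then obtain s t where d: "d = s *s p + t *s q" using cross_eq_0_combination[OF a(1)] by metis
  let ?D = "s * t1 - t * s1" and ?b = "s * t3 - t * s3"
  have Fd: "T d d d = k * (?D\<^sup>2 * ?b)"
    using F[of s t] unfolding d[symmetric] by (simp add: peval_T power2_eq_square)
  have "peval F (u + d) = k * (?D\<^sup>2 * (?E + ?b))" using val[of 1 s t] d by simp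
  then have Tudd: "3 * T u d d = k * (?D\<^sup>2 * ?E)"
  proof -
    assume 1: "peval F (u + d) = k * (?D\<^sup>2 * (?E + ?b))"
    have "3 * T u d d = peval F (u + d) - T d d d"
      using peval_line[of 1 u 1 d] assms(2) u0(1)[unfolded peval_T] by simp
    then show ?thesis unfolding 1 Fd by (simp add: algebra_simps)
  qed
  have "T d d d *s u - (3 * T u d d) *s d = (k * ?D\<^sup>2) *s (?b *s u - ?E *s d)"
    unfolding Fd Tudd by (simp add: vec3_eq_iff algebra_simps)
  also have "?b *s u - ?E *s d = ?D *s w"
    unfolding d a(3,5) by (simp add: vec3_eq_iff algebra_simps)
  finally have "T d d d *s u - (3 * T u d d) *s d = (k * ?D\<^sup>2 * ?D) *s w"
    by (simp only: vec.scale_scale)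
  then show ?thesis by (metis cross_scale(2) cross_self vec.scale_zero_right)
qed

lemma ex_tangent:
  assumes "u \<noteq> 0" "peval F u = 0"
  obtains d where "T u u d = 0" "cross u d \<noteq> 0"
proof -
  obtain p where p: "cross u p \<noteq> 0" using extend_basis1[OF assms(1)] .
  obtain q where q: "det3 u p q \<noteq> 0" using extend_basis2[OF p] .
  show ?thesis
  proof (cases "T u u p = 0")
    case False
    let ?d = "T u u p *s q - T u u q *s p"
    have "T u u ?d = 0" by (simp add: tri_linear tri_diff)
    moreover have "cross u ?d \<noteq> 0"
    proof
      assume "cross u ?d = 0"
      then have "det3 u ?d p = 0" by (simp add: det3_def dot3_def)
      moreover have "det3 u ?d p = - T u u p * det3 u p q"
        by (simp add: det3_def dot3_def algebra_simps)
      ultimately show False using False q by simp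
    qed
    ultimately show ?thesis by (rule that)
  qed (use p that in blast)
qed

lemma ex_line_cycle:
  assumes "u \<noteq> 0" "v \<noteq> 0" "peval F u = 0" "peval F v = 0"
  obtains w where "line_cycle F u v w"
proof (cases "cross u v = 0")
  case False
  then show ?thesis using line_cycle_chord_vec assms that by blast
next
  case True
  then obtain c where c: "v = c *s u" using cross_eq_0 assms(1) by blast
  obtain d where d: "T u u d = 0" "cross u d \<noteq> 0" using ex_tangent[OF assms(1,3)] .
  have "line_cycle F (1 *s u + 0 *s d) (1 *s u + 0 *s d) (- T d d d *s u + (3 * T u d d) *s d)"
  proof (rule line_cycleI[where k = 1])
    show "- T d d d \<noteq> 0 \<or> 3 * T u d d \<noteq> 0" using no_line[OF d(2)] assms(3) d(1) by (auto simp: peval_T)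
    show "peval F (s *s u + t *s d) = 1 * ((s * 0 - t * 1) * (s * 0 - t * 1) * (s * (3 * T u d d) - t * - T d d d))" for s t
      using assms(3) d unfolding peval_line by (simp add: peval_T power2_eq_square power3_eq_cube algebra_simps)
  qed (use d in auto)
  then have "line_cycle F u u (- T d d d *s u + (3 * T u d d) *s d)" by simp
  then have "line_cycle F (1 *s u) (c *s u) (1 *s (- T d d d *s u + (3 * T u d d) *s d))"
    using c assms(2) by (intro line_cycle_scale) auto
  then show ?thesis using c that by simp
qed

text \<open>Both candidates are proportional to one explicit nonzero vector: the chord vector if u
  and v are distinct points, the tangent formula if not.\<close>

lemma line_cycle_unique:
  assumes "line_cycle F u v w" "line_cycle F u v w'"
  shows "point w = point w'"
proof -
  note nz = line_cycle_nonzero[OF assms(1)] line_cycle_nonzero[OF assms(2)]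
  note on = line_cycle_on_curve[OF assms(1)]
  have "\<exists>z. z \<noteq> 0 \<and> cross w z = 0 \<and> cross w' z = 0"
  proof (cases "cross u v = 0")
    case False
    then have "chord_vec u v \<noteq> 0" using line_cycle_chord_vec[OF False] on line_cycle_nonzero by blast
    then show ?thesis using line_cycle_imp_chord_vec[OF _ False] assms by blast
  next
    case True
    then obtain c where c: "v = c *s u" using cross_eq_0 nz by blast
    have "c \<noteq> 0" using c nz by auto
    have *: "line_cycle F u u x" if "line_cycle F u v x" for x
      using line_cycle_scale[OF that, of 1 "1 / c" 1] \<open>c \<noteq> 0\<close> c by simp
    obtain d where d: "T u u d = 0" "cross u d \<noteq> 0" using ex_tangent nz on by blast
    let ?z = "T d d d *s u - (3 * T u d d) *s d"
    have "?z \<noteq> 0"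
    proof
      assume z: "?z = 0"
      have "cross ?z d = T d d d *s cross u d" "cross u ?z = - (3 * T u d d) *s cross u d"
        by (simp_all add: vec3_eq_iff algebra_simps)
      then have "T d d d = 0" "T u d d = 0" using z d(2) by auto
      then show False using no_line[OF d(2)] d(1) on by (simp add: peval_T)
    qed
    then show ?thesis using line_cycle_tangent[OF *[OF assms(1)] d] line_cycle_tangent[OF *[OF assms(2)] d] by blast
  qed
  then obtain z where z: "z \<noteq> 0" "cross w z = 0" "cross w' z = 0" by blast
  then have "point w = point z" "point w' = point z" using nz by (simp_all add: point_eq_cross)
  then show ?thesis by simp
qed

definition chord :: "'a pt \<Rightarrow> 'a pt \<Rightarrow> 'a pt" (infixl "\<star>" 70) where
  "x \<star> y = (THE z. \<exists>u v w. x = point u \<and> y = point v \<and> z = point w \<and> line_cycle F u v w)"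

lemma chord_eq:
  assumes "line_cycle F u v w"
  shows "point u \<star> point v = point w"
  unfolding chord_def
proof (rule the_equality)
  show "\<exists>u' v' w'. point u = point u' \<and> point v = point v' \<and> point w = point w' \<and> line_cycle F u' v' w'"
    using assms by blast
  fix z assume "\<exists>u' v' w'. point u = point u' \<and> point v = point v' \<and> z = point w' \<and> line_cycle F u' v' w'"
  then obtain u' v' w' where *: "point u = point u'" "point v = point v'" "z = point w'" "line_cycle F u' v' w'"
    by blast
  note nz = line_cycle_nonzero[OF assms] line_cycle_nonzero[OF *(4)]
  obtain c where c: "c \<noteq> 0" "u = c *s u'" using * nz point_eq_iff[of u' u] by auto
  obtain d where d: "d \<noteq> 0" "v = d *s v'" using * nz point_eq_iff[of v' v] by auto
  have "line_cycle F u v w'" using line_cycle_scale[OF *(4) c(1) d(1), of 1] c d by simp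
  then show "z = point w" using line_cycle_unique[OF assms] *(3) by simp
qed

lemma chord_cases:
  assumes "x \<in> pts C" "y \<in> pts C"
  obtains u v w where "x = point u" "y = point v" "x \<star> y = point w" "line_cycle F u v w"
proof -
  obtain u v where "u \<noteq> 0" "x = point u" "v \<noteq> 0" "y = point v" using assms pts_cases by metis
  moreover then have "peval F u = 0" "peval F v = 0" using assms in_C by auto
  ultimately obtain w where "line_cycle F u v w" using ex_line_cycle by metis
  then show ?thesis using that chord_eq \<open>x = point u\<close> \<open>y = point v\<close> by blast
qed

lemma chord_in: "x \<in> pts C \<Longrightarrow> y \<in> pts C \<Longrightarrow> x \<star> y \<in> pts C"
  by (erule (1) chord_cases) (metis line_cycle_on_curve line_cycle_nonzero in_C)

lemma chord_commute: "x \<in> pts C \<Longrightarrow> y \<in> pts C \<Longrightarrow> x \<star> y = y \<star> x"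
  by (erule (1) chord_cases) (metis chord_eq line_cycle_swap12)

lemma chord_chord: "x \<in> pts C \<Longrightarrow> y \<in> pts C \<Longrightarrow> x \<star> (x \<star> y) = y"
  by (erule (1) chord_cases) (metis chord_eq line_cycle_swap23)

lemma chord_cancel: "x \<in> pts C \<Longrightarrow> y \<in> pts C \<Longrightarrow> z \<in> pts C \<Longrightarrow> x \<star> y = x \<star> z \<Longrightarrow> y = z"
  using chord_chord by metis

end

section \<open>Regularity of the chord operation\<close>

lemma biform_fun_tri:
  assumes "biform_vec d e f" "biform_vec d' e' g" "biform_vec d'' e'' h"
  shows "biform_fun (d + (d' + (d'' + 0))) (e + (e' + (e'' + 0))) (\<lambda>u v. tri F (f u v) (g u v) (h u v))"
proof -
  have f: "biform_fun d e (\<lambda>u v. f u v $ a)" and g: "biform_fun d' e' (\<lambda>u v. g u v $ a)"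
    and h: "biform_fun d'' e'' (\<lambda>u v. h u v $ a)" for a
    using assms by (simp_all add: biform_vec_def)
  show ?thesis
    \<comment> \<open>The trailing zeros in the degrees come from the constant coefficients of the
      expansion.\<close>
    by (subst tri_expand) (intro biform_fun_sum biform_fun_mult f g h biform_fun_const)
qed

lemma biform_vec_diff: "biform_vec d e f \<Longrightarrow> biform_vec d e g \<Longrightarrow> biform_vec d e (\<lambda>u v. f u v - g u v)"
  by (simp add: biform_vec_def biform_fun_diff)

lemma biform_vec_scale: "biform_fun d e p \<Longrightarrow> biform_vec d' e' f \<Longrightarrow> biform_vec (d + d') (e + e') (\<lambda>u v. p u v *s f u v)"
  by (simp add: biform_vec_def biform_fun_mult)

lemma biform_vec_fst: "biform_vec 1 0 (\<lambda>u v. u)"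
  unfolding biform_vec_def using biform_fun_coord1 by blast

lemma biform_vec_snd: "biform_vec 0 1 (\<lambda>u v. v)"
  unfolding biform_vec_def using biform_fun_coord2 by blast

lemma biform_vec_const: "biform_vec 0 0 (\<lambda>u v. c)"
  unfolding biform_vec_def by (simp add: biform_fun_const)

lemma biform_vec_cross:
  assumes "biform_vec d e f" "biform_vec d' e' g"
  shows "biform_vec (d + d') (e + e') (\<lambda>u v. cross (f u v) (g u v))"
  unfolding biform_vec_def
proof
  fix c
  have f: "biform_fun d e (\<lambda>u v. f u v $ a)" and g: "biform_fun d' e' (\<lambda>u v. g u v $ a)" for a
    using assms by (simp_all add: biform_vec_def)
  have "biform_fun (d + d') (e + e') (\<lambda>u v. f u v $ k * g u v $ l - f u v $ k' * g u v $ l')" for k l k' l'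
    by (intro biform_fun_diff biform_fun_mult f g)
  then show "biform_fun (d + d') (e + e') (\<lambda>u v. cross (f u v) (g u v) $ c)"
    using exhaust_3[of c] by auto
qed

context smooth_cubic
begin

lemma chord_vec_biform: "biform_vec 2 2 chord_vec"
proof -
  have "biform_vec (1 + (0 + (0 + 0)) + 1) (0 + (1 + (1 + 0)) + 0) (\<lambda>u v. T u v v *s u)"
    by (intro biform_vec_scale biform_fun_tri biform_vec_fst biform_vec_snd)
  moreover have "biform_vec (1 + (1 + (0 + 0)) + 0) (0 + (0 + (1 + 0)) + 1) (\<lambda>u v. T u u v *s v)"
    by (intro biform_vec_scale biform_fun_tri biform_vec_fst biform_vec_snd)
  ultimately have "biform_vec 2 2 (\<lambda>u v. T u v v *s u)" "biform_vec 2 2 (\<lambda>u v. T u u v *s v)"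
    by (simp_all add: numeral_2_eq_2)
  then have "biform_vec 2 2 (\<lambda>u v. T u v v *s u - T u u v *s v)" by (rule biform_vec_diff)
  then show ?thesis unfolding chord_vec_def[abs_def] .
qed

lemma chord_vec_eq_0:
  assumes "cross u v = 0" "u \<noteq> 0" "peval F u = 0"
  shows "chord_vec u v = 0"
proof -
  obtain c where "v = c *s u" using assms cross_eq_0 by blast
  then show ?thesis using assms(3) by (simp add: chord_vec_def tri_linear peval_T)
qed

text \<open>A formula for the third point valid near the diagonal: after scaling \<open>u\<close> and \<open>v\<close> to vectors
  \<open>u', v'\<close> with the same \<open>k\<close>-th coordinate, the covector \<open>D\<close> with
  \<open>D (v' - u') = F(v') - F(u')\<close> yields the direction \<open>d\<close> of the line.\<close>

definition secant_dir :: "3 \<Rightarrow> 'a ^ 3 \<Rightarrow> 'a ^ 3 \<Rightarrow> 'a ^ 3" where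
  "secant_dir k u v = cross (\<chi> c. T (v $ k *s u) (v $ k *s u) (axis c 1) + T (v $ k *s u) (u $ k *s v) (axis c 1)
     + T (u $ k *s v) (u $ k *s v) (axis c 1)) (axis k 1)"

text \<open>With v' = u' + m d, the roots of F(s u' + t d) are (1, 0), (1, m) and (E, -(B + m E)),
  where B = 3 T(u', d, d) and E = T(d, d, d). As m is not polynomial in u and v, the third root is
  multiplied by \<open>d $ j\<close>, which turns m into \<open>(v' - u') $ j\<close>.\<close>

definition secant_vec :: "3 \<Rightarrow> 3 \<Rightarrow> 'a ^ 3 \<Rightarrow> 'a ^ 3 \<Rightarrow> 'a ^ 3" where
  "secant_vec k j u v = (let d = secant_dir k u v; u' = v $ k *s u; v' = u $ k *s v in
     (d $ j * T d d d) *s u' - (3 * (d $ j * T u' d d) + (v' - u') $ j * T d d d) *s d)"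

text \<open>\<open>u'\<close> has bidegree (1, 1) and \<open>d\<close> has (2, 2), so d_j T(d, d, d)
  u' contributes 2 + 6 + 1 = 9 in each group of variables.\<close>

lemma secant_vec_biform: "biform_vec 9 9 (secant_vec k j)"
proof -
  have u': "biform_vec 1 1 (\<lambda>u v. v $ k *s u)"
    using biform_vec_scale[OF biform_fun_coord2 biform_vec_fst, of k] by simp
  have v': "biform_vec 1 1 (\<lambda>u v. u $ k *s v)"
    using biform_vec_scale[OF biform_fun_coord1 biform_vec_snd, of k] by simp
  have t: "biform_fun 2 2 (\<lambda>u v. T (f u v) (g u v) (axis c 1))" if "biform_vec 1 1 f" "biform_vec 1 1 g" for f g c
    using biform_fun_tri[OF that biform_vec_const] by (simp add: numeral_2_eq_2)
  have "biform_vec 2 2 (\<lambda>u v. \<chi> c. T (v $ k *s u) (v $ k *s u) (axis c 1) + T (v $ k *s u) (u $ k *s v) (axis c 1)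
     + T (u $ k *s v) (u $ k *s v) (axis c 1))"
    unfolding biform_vec_def by (auto intro!: biform_fun_add t u' v')
  from biform_vec_cross[OF this biform_vec_const[of "axis k 1"]]
  have d: "biform_vec 2 2 (secant_dir k)" unfolding secant_dir_def by simp
  then have dj: "biform_fun 2 2 (\<lambda>u v. secant_dir k u v $ j)" by (simp add: biform_vec_def)
  let ?d = "\<lambda>u v. secant_dir k u v" and ?u = "\<lambda>u v. v $ k *s u" and ?v = "\<lambda>u v. u $ k *s v"
  have Td: "biform_fun 6 6 (\<lambda>u v. T (?d u v) (?d u v) (?d u v))"
    using biform_fun_tri[OF d d d] by simp
  have Tu: "biform_fun 5 5 (\<lambda>u v. T (?u u v) (?d u v) (?d u v))"
    using biform_fun_tri[OF u' d d] by simp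
  have vu: "biform_fun 1 1 (\<lambda>u v. (?v u v - ?u u v) $ j)"
    using biform_vec_diff[OF v' u'] unfolding biform_vec_def by blast
  have 1: "biform_vec 9 9 (\<lambda>u v. (?d u v $ j * T (?d u v) (?d u v) (?d u v)) *s ?u u v)"
    using biform_vec_scale[OF biform_fun_mult[OF dj Td] u'] by simp
  have 2: "biform_fun 7 7 (\<lambda>u v. 3 * (?d u v $ j * T (?u u v) (?d u v) (?d u v)))"
    using biform_fun_cmult[OF biform_fun_mult[OF dj Tu]] by simp
  have 3: "biform_fun 7 7 (\<lambda>u v. (?v u v - ?u u v) $ j * T (?d u v) (?d u v) (?d u v))"
    using biform_fun_mult[OF vu Td] by simp
  have 4: "biform_vec 9 9 (\<lambda>u v. (3 * (?d u v $ j * T (?u u v) (?d u v) (?d u v))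
      + (?v u v - ?u u v) $ j * T (?d u v) (?d u v) (?d u v)) *s ?d u v)"
    using biform_vec_scale[OF biform_fun_add[OF 2 3] d] by simp
  show ?thesis
    using biform_vec_diff[OF 1 4] unfolding secant_vec_def[abs_def] Let_def .
qed

lemma cross_axis_eq_0:
  fixes a :: "'b::field ^ 3"
  shows "cross a (axis k 1) = 0 \<Longrightarrow> j \<noteq> k \<Longrightarrow> a $ j = 0"
  using exhaust_3[of j] exhaust_3[of k] by (auto simp: vec3_eq_iff axis_def)

text \<open>On the diagonal the covector is proportional to the gradient at u. Were the direction
  zero, only the k-th partial derivative could survive, and Euler's relation with
  \<open>u $ k\<close> nonzero kills that one too.\<close>

lemma secant_dir_diagonal:
  assumes "u \<noteq> 0" "peval F u = 0" "u $ k \<noteq> 0"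
  shows "secant_dir k u u \<noteq> 0"
proof
  assume "secant_dir k u u = 0"
  then have 0: "T u u (axis j 1) = 0" if "j \<noteq> k" for j
    using cross_axis_eq_0[of _ k j] that assms(3) unfolding secant_dir_def by (fastforce simp: tri_linear)
  have "T u u u = (\<Sum>j\<in>UNIV. u $ j * T u u (axis j 1))" by (rule tri_expand3)
  also have "\<dots> = u $ k * T u u (axis k 1)"
    by (rule sum.mono_neutral_cong_right[where S = "{k}", simplified]) (auto simp: 0)
  finally have "T u u (axis k 1) = 0" using assms by (simp add: peval_T)
  then have "T u u (axis j 1) = 0" for j using 0 by (cases "j = k") auto
  then have "T u u w = 0" for w by (subst tri_expand3) simp
  then show False using gradient_nonzero assms by blast
qed

lemma secant_vec_line_cycle:
  assumes u: "u \<noteq> 0" "peval F u = 0" and v: "v \<noteq> 0" "peval F v = 0" and nz: "secant_vec k j u v \<noteq> 0"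
  shows "line_cycle F (v $ k *s u) (u $ k *s v) (secant_vec k j u v) \<and> u $ k \<noteq> 0 \<and> v $ k \<noteq> 0"
proof -
  define d where "d = secant_dir k u v"
  define u' v' where "u' = v $ k *s u" and "v' = u $ k *s v"
  define D where "D = (\<chi> c. T u' u' (axis c 1) + T u' v' (axis c 1) + T v' v' (axis c 1))"
  have d: "d = cross D (axis k 1)" by (simp add: d_def secant_dir_def D_def u'_def v'_def)
  have w: "secant_vec k j u v = (d $ j * T d d d) *s u' - (3 * (d $ j * T u' d d) + (v' - u') $ j * T d d d) *s d"
    by (simp add: secant_vec_def Let_def d_def u'_def v'_def)
  have "d \<noteq> 0" using nz unfolding w by auto
  have u'v': "peval F u' = 0" "peval F v' = 0"
    using u v by (simp_all add: u'_def v'_def peval_scale[OF cubic])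
  have D: "dot3 D z = T u' u' z + T u' v' z + T v' v' z" for z
  proof -
    have "dot3 D z = (\<Sum>c\<in>UNIV. z $ c * T u' u' (axis c 1)) + (\<Sum>c\<in>UNIV. z $ c * T u' v' (axis c 1))
        + (\<Sum>c\<in>UNIV. z $ c * T v' v' (axis c 1))"
      by (simp add: dot3_def D_def sum_3 algebra_simps)
    then show ?thesis by (simp flip: tri_expand3)
  qed
  \<comment> \<open>The vectors annihilated by \<open>D\<close> and by the k-th coordinate form a
    line, spanned by d.\<close>
  have par: "\<exists>c. z = c *s d" if "dot3 D z = 0" "z $ k = 0" for z
  proof -
    have "cross d z = dot3 D z *s axis k 1 - z $ k *s D"
      using exhaust_3[of k] unfolding d by (auto simp: vec3_eq_iff dot3_def axis_def algebra_simps)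
    then show ?thesis using that cross_eq_0[OF _ \<open>d \<noteq> 0\<close>] by auto
  qed
  \<comment> \<open>The covector \<open>D\<close> is made for this telescoping identity, a trilinear
    form of a^3 - b^3 = (a - b)(a^2 + a b + b^2).\<close>
  have "dot3 D (v' - u') = peval F v' - peval F u'"
    unfolding D peval_T by (simp add: tri_diff tri_commute)
  then have "dot3 D (v' - u') = 0" by (simp add: u'v')
  moreover have "(v' - u') $ k = 0" by (simp add: u'_def v'_def)
  ultimately obtain m where m: "v' - u' = m *s d" using par by blast
  have dj: "d $ j \<noteq> 0"
  proof
    assume "d $ j = 0"
    then have "secant_vec k j u v = 0" unfolding w m by simp
    with nz show False by simp
  qed
  \<comment> \<open>If one of the scaled vectors were 0, the other would be a multiple of d on the
    curve, and \<open>secant_vec\<close> itself would vanish.\<close>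
  have uk: "u $ k \<noteq> 0 \<and> v $ k \<noteq> 0"
  proof (rule ccontr)
    assume "\<not> ?thesis"
    then consider "u' = 0" | "v' = 0" by (auto simp: u'_def v'_def)
    then show False
    proof cases
      case 1
      then have v'm: "v' = m *s d" using m by simp
      show False
      proof (cases "m = 0")
        case True
        then have "v' = 0" using v'm by simp
        have "D = 0" unfolding D_def \<open>u' = 0\<close> \<open>v' = 0\<close> by (simp add: vec_eq_iff)
        then show False using d \<open>d \<noteq> 0\<close> by simp
      next
        case False
        then have "T d d d = 0" using u'v'(2) v'm by (simp add: peval_T tri_linear)
        then show False using nz 1 unfolding w by simp
      qed
    next
      case 2
      then have "- u' = m *s d" using m by simp
      then have "u' = - (m *s d)" by (metis minus_minus)
      then have u'm: "u' = (- m) *s d" by simp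
      show False
      proof (cases "m = 0")
        case True
        then have "u' = 0" using u'm by simp
        have "D = 0" unfolding D_def \<open>u' = 0\<close> \<open>v' = 0\<close> by (simp add: vec_eq_iff)
        then show False using d \<open>d \<noteq> 0\<close> by simp
      next
        case False
        then have "T d d d = 0" using u'v'(1) u'm by (simp add: peval_T tri_linear)
        then show False using nz unfolding w u'm by (simp add: tri_linear)
      qed
    qed
  qed
  then have "u' \<noteq> 0" "v' \<noteq> 0" using u v by (auto simp: u'_def v'_def)
  define A B E where "A = 3 * T u' u' d" and "B = 3 * T u' d d" and "E = T d d d"
  have line: "peval F (s *s u' + t *s d) = t * (A * s\<^sup>2 + B * (s * t) + E * t\<^sup>2)" for s t
    unfolding peval_line using u'v'(1)
    by (simp add: A_def B_def E_def peval_T power2_eq_square power3_eq_cube algebra_simps)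
  \<comment> \<open>This says that t = m s is a root of the quadratic factor; for m = 0 it is the
    tangency of d at u'.\<close>
  have ABE: "A = - m * B - m\<^sup>2 * E"
  proof (cases "m = 0")
    case True
    then have "v' = u'" using m by simp
    moreover have "dot3 D d = 0"
      unfolding d using exhaust_3[of k] by (auto simp: dot3_def axis_def algebra_simps)
    ultimately have "T u' u' d = 0" unfolding D by simp
    then show ?thesis using True by (simp add: A_def)
  next
    case False
    have "v' = 1 *s u' + m *s d" using m by (simp add: algebra_simps)
    then have "m * (A + B * m + E * m\<^sup>2) = 0" using line[of 1 m] u'v'(2) by simp
    then have "A + B * m + E * m\<^sup>2 = 0" using False by simp
    then show ?thesis by (simp add: algebra_simps eq_neg_iff_add_eq_0)
  qed
  have "cross u' d \<noteq> 0"
  proof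
    assume "cross u' d = 0"
    then obtain c where "d = c *s u'" using cross_eq_0 \<open>u' \<noteq> 0\<close> by blast
    moreover have "d $ k = 0" unfolding d using exhaust_3[of k] by (auto simp: axis_def)
    moreover have "u' $ k \<noteq> 0" using uk by (simp add: u'_def)
    ultimately show False using \<open>d \<noteq> 0\<close> by auto
  qed
  moreover have w': "secant_vec k j u v = (d $ j) *s (E *s u' + (- (B + m * E)) *s d)"
    unfolding w m by (simp add: E_def B_def vec3_eq_iff algebra_simps)
  then have "E \<noteq> 0 \<or> - (B + m * E) \<noteq> 0" using nz by auto
  ultimately have "line_cycle F (1 *s u' + 0 *s d) (1 *s u' + m *s d) (E *s u' + (- (B + m * E)) *s d)"
  proof (intro line_cycleI[where k = "-1"])
    show "peval F (s *s u' + t *s d) = - 1 * ((s * 0 - t * 1) * (s * m - t * 1) * (s * - (B + m * E) - t * E))" for s t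
      unfolding line ABE by (simp add: power2_eq_square algebra_simps)
  qed auto
  then have "line_cycle F u' v' (E *s u' + (- (B + m * E)) *s d)" using m by (simp add: algebra_simps)
  from line_cycle_scale[OF this, of 1 1 "d $ j"] dj
  have "line_cycle F u' v' (secant_vec k j u v)" unfolding w' by simp
  with uk show ?thesis by (simp add: u'_def v'_def)
qed

text \<open>On the diagonal m = 0, and what remains is \<open>d $ j\<close> times the third point of
  the tangent. Suitable k and j are indices of nonzero coordinates of u and of d.\<close>

lemma secant_vec_diagonal:
  assumes u: "u \<noteq> 0" "peval F u = 0"
  obtains k j where "secant_vec k j u u \<noteq> 0"
proof -
  obtain k where k: "u $ k \<noteq> 0" using u(1) by (auto simp: vec_eq_iff)
  define d where "d = secant_dir k u u"
  have "d \<noteq> 0" unfolding d_def using secant_dir_diagonal u k by blast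
  then obtain j where j: "d $ j \<noteq> 0" by (auto simp: vec_eq_iff)
  define u' where "u' = u $ k *s u"
  have w: "secant_vec k j u u = (d $ j) *s (T d d d *s u' - (3 * T u' d d) *s d)"
    by (simp add: secant_vec_def Let_def d_def u'_def vec3_eq_iff algebra_simps)
  have dk: "d $ k = 0" unfolding d_def secant_dir_def using exhaust_3[of k] by (auto simp: axis_def)
  have ud: "cross u' d \<noteq> 0"
  proof
    assume "cross u' d = 0"
    moreover have "u' \<noteq> 0" using k u by (simp add: u'_def)
    ultimately obtain c where "d = c *s u'" using cross_eq_0 by blast
    then show False using dk k \<open>d \<noteq> 0\<close> by (auto simp: u'_def)
  qed
  have "T u' u' d = 0"
  proof -
    define D where "D = (\<chi> c. T u' u' (axis c 1) + T u' u' (axis c 1) + T u' u' (axis c 1))"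
    have d: "d = cross D (axis k 1)" by (simp add: d_def secant_dir_def D_def u'_def)
    have "dot3 D d = 0"
      unfolding d using exhaust_3[of k] by (auto simp: dot3_def axis_def algebra_simps)
    moreover have "dot3 D d = 3 * T u' u' d"
      by (subst tri_expand3) (simp add: dot3_def D_def sum_3 algebra_simps)
    ultimately show ?thesis by simp
  qed
  moreover have "T u' u' u' = 0" using u by (simp add: u'_def tri_linear peval_T)
  ultimately have "\<not> (T d d d = 0 \<and> T u' d d = 0)" using no_line[OF ud] by blast
  moreover have "cross (T d d d *s u' - (3 * T u' d d) *s d) d = T d d d *s cross u' d"
    "cross u' (T d d d *s u' - (3 * T u' d d) *s d) = - (3 * T u' d d) *s cross u' d"
    by (simp_all add: vec3_eq_iff algebra_simps)
  ultimately have "T d d d *s u' - (3 * T u' d d) *s d \<noteq> 0" using ud by auto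
  then have "secant_vec k j u u \<noteq> 0" using j unfolding w vec.scale_eq_0_iff by blast
  then show ?thesis by (rule that)
qed

text \<open>\<open>chord_vec\<close> vanishes identically on the diagonal, so two charts are
  required: \<open>chord_vec\<close> at pairs of distinct points and \<open>secant_vec\<close> at
  pairs of equal ones.\<close>

lemma chord_regular2: "regular_map2 C C C (\<star>)"
proof (rule regular_map2I)
  fix x y assume xy: "x \<in> pts C" "y \<in> pts C"
  then show "x \<star> y \<in> pts C" by (rule chord_in)
  obtain u where u: "u \<noteq> 0" "x = point u" using xy(1) by (rule pts_cases)
  obtain v where v: "v \<noteq> 0" "y = point v" using xy(2) by (rule pts_cases)
  have u0: "peval F u = 0" and v0: "peval F v = 0" using xy u v in_C by auto
  show "\<exists>d e h. biform_vec d e h \<and>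
     (\<exists>u v. u \<noteq> 0 \<and> v \<noteq> 0 \<and> x = point u \<and> y = point v \<and> h u v \<noteq> 0) \<and>
     (\<forall>u v. u \<noteq> 0 \<and> v \<noteq> 0 \<and> point u \<in> pts C \<and> point v \<in> pts C \<and> h u v \<noteq> 0 \<longrightarrow>
        point u \<star> point v = point (h u v))"
  proof (cases "cross u v = 0")
    case False
    have "chord_vec u v \<noteq> 0" using line_cycle_chord_vec[OF False u0 v0] line_cycle_nonzero by blast
    moreover have "point u \<star> point v = point (chord_vec u v)"
      if "u \<noteq> 0" "v \<noteq> 0" "point u \<in> pts C" "point v \<in> pts C" "chord_vec u v \<noteq> 0" for u v
    proof -
      have 0: "peval F u = 0" "peval F v = 0" using that in_C by auto
      then have "cross u v \<noteq> 0" using chord_vec_eq_0 that by blast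
      then show ?thesis using line_cycle_chord_vec 0 chord_eq by blast
    qed
    ultimately show ?thesis using chord_vec_biform u v
      by (intro exI[of _ 2] exI[of _ chord_vec] conjI exI[of _ u] exI[of _ v]) simp_all
  next
    case True
    then have "point v = point u" using u v point_eq_cross by metis
    then have y: "y = point u" using v by simp
    obtain k j where "secant_vec k j u u \<noteq> 0" using secant_vec_diagonal[OF u(1) u0] .
    moreover have "point u \<star> point v = point (secant_vec k j u v)"
      if "u \<noteq> 0" "v \<noteq> 0" "point u \<in> pts C" "point v \<in> pts C" "secant_vec k j u v \<noteq> 0" for u v
    proof -
      have 0: "peval F u = 0" "peval F v = 0" using that in_C by auto
      note sv = secant_vec_line_cycle[OF that(1) 0(1) that(2) 0(2) that(5)]
      then have "point (v $ k *s u) \<star> point (u $ k *s v) = point (secant_vec k j u v)" using chord_eq by blast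
      moreover have "point (v $ k *s u) = point u" "point (u $ k *s v) = point v"
        using sv that by (auto intro!: point_scale)
      ultimately show ?thesis by simp
    qed
    ultimately show ?thesis using secant_vec_biform u y
      by (intro exI[of _ 9] exI[of _ "secant_vec k j"] conjI exI[of _ u]) simp_all
  qed
qed

lemma chord_regular: "regular_map B C f \<Longrightarrow> regular_map B C g \<Longrightarrow> regular_map B C (\<lambda>x. f x \<star> g x)"
  by (rule regular_map_compose2[OF chord_regular2])

end

section \<open>Polynomials in one variable\<close>

definition poly_fun :: "('a::comm_ring_1 \<Rightarrow> 'a) \<Rightarrow> bool" where
  "poly_fun f \<longleftrightarrow> (\<exists>p. \<forall>x. f x = poly p x)"

lemma poly_fun_const: "poly_fun (\<lambda>x. c)"
  unfolding poly_fun_def by (rule exI[of _ "[:c:]"]) simp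

lemma poly_fun_ident: "poly_fun (\<lambda>x. x)"
  unfolding poly_fun_def by (rule exI[of _ "[:0, 1:]"]) simp

lemma poly_fun_add: "poly_fun f \<Longrightarrow> poly_fun g \<Longrightarrow> poly_fun (\<lambda>x. f x + g x)"
  unfolding poly_fun_def by (metis poly_add)

lemma poly_fun_mult: "poly_fun f \<Longrightarrow> poly_fun g \<Longrightarrow> poly_fun (\<lambda>x. f x * g x)"
  unfolding poly_fun_def by (metis poly_mult)

lemma poly_fun_diff: "poly_fun f \<Longrightarrow> poly_fun g \<Longrightarrow> poly_fun (\<lambda>x. f x - g x)"
  unfolding poly_fun_def by (metis poly_diff)

text \<open>Roots of f are split off one at a time from both f and A, which replaces an argument
  with greatest common divisors.\<close>

lemma dvd_mult_no_common_root:
  fixes f g A :: "'a::alg_closed_field poly"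
  assumes "f \<noteq> 0" "f dvd A * g" "\<And>z. poly f z = 0 \<Longrightarrow> poly g z \<noteq> 0"
  shows "f dvd A"
  using assms
proof (induction "degree f" arbitrary: f A)
  case 0
  then have "is_unit f" by (simp add: is_unit_iff_degree)
  then show ?case by (rule unit_imp_dvd)
next
  case (Suc n)
  then obtain r where r: "poly f r = 0" using alg_closed_imp_poly_has_root[of f] by auto
  then obtain f' where f': "f = [:- r, 1:] * f'" by (meson dvdE poly_eq_0_iff_dvd)
  obtain h where h: "A * g = f * h" using Suc.prems(2) by (rule dvdE)
  have "poly (A * g) r = 0" unfolding h using r by simp
  then have "poly A r = 0" using Suc.prems(3)[OF r] by simp
  then obtain A' where A': "A = [:- r, 1:] * A'" by (meson dvdE poly_eq_0_iff_dvd)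
  have "[:- r, 1:] * (A' * g) = [:- r, 1:] * (f' * h)" using h unfolding f' A' by (simp only: mult.assoc)
  then have "A' * g = f' * h" by (subst (asm) mult_cancel_left) auto
  then have "f' dvd A' * g" by simp
  moreover have "f' \<noteq> 0" using Suc.prems(1) f' by auto
  moreover have "n = degree f'" using Suc.hyps(2) \<open>f' \<noteq> 0\<close> by (simp add: f' degree_mult_eq del: mult_pCons_left)
  moreover have "poly g z \<noteq> 0" if "poly f' z = 0" for z using Suc.prems(3)[of z] that by (simp add: f')
  ultimately have "f' dvd A'" using Suc.hyps(1) by blast
  then show ?case unfolding f' A' by (rule mult_dvd_mono[OF dvd_refl])
qed

lemma card_simple_roots:
  fixes p :: "'a::alg_closed_field poly"
  assumes "\<And>z. poly p z = 0 \<Longrightarrow> poly (pderiv p) z \<noteq> 0"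
  shows "card {z. poly p z = 0} = degree p"
  using assms
proof (induction "degree p" arbitrary: p)
  case 0
  then obtain c where c: "p = [:c:]" by (metis degree_eq_zeroE)
  then have "c \<noteq> 0" using "0.prems" by (auto simp: pderiv_pCons)
  then show ?case by (simp add: c)
next
  case (Suc n)
  then obtain r where r: "poly p r = 0" using alg_closed_imp_poly_has_root[of p] by auto
  then obtain q where q: "p = [:- r, 1:] * q" by (meson dvdE poly_eq_0_iff_dvd)
  have "q \<noteq> 0" using Suc.hyps(2) q by auto
  have d: "poly (pderiv p) z = poly q z + (z - r) * poly (pderiv q) z" for z
    unfolding q pderiv_mult by (simp add: pderiv_pCons algebra_simps)
  have n: "n = degree q" using Suc.hyps(2) \<open>q \<noteq> 0\<close> by (simp add: q degree_mult_eq del: mult_pCons_left)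
  have "poly (pderiv q) z \<noteq> 0" if "poly q z = 0" for z
    using Suc.prems[of z] that d[of z] by (auto simp: q)
  then have card: "card {z. poly q z = 0} = n" using Suc.hyps(1)[OF n] n by simp
  have "poly q r \<noteq> 0" using Suc.prems[OF r] d[of r] by simp
  have "{z. poly p z = 0} = insert r {z. poly q z = 0}" by (auto simp: q algebra_simps)
  then show ?case using \<open>poly q r \<noteq> 0\<close> \<open>q \<noteq> 0\<close> card Suc.hyps(2) by (simp add: poly_roots_finite)
qed

section \<open>Common zeros of two cubic forms\<close>

text \<open>The determinant of multiplication by \<open>g0 + g1 z + g2 z\<^sup>2\<close> modulo \<open>z\<^sup>3 + f2 z\<^sup>2 + f1 z + f0\<close>.\<close>

definition resultant3 :: "'a \<Rightarrow> 'a \<Rightarrow> 'a \<Rightarrow> 'a \<Rightarrow> 'a \<Rightarrow> 'a \<Rightarrow> 'a::comm_ring_1" where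
  "resultant3 f0 f1 f2 g0 g1 g2 =
     (let a = - (g2 * f0); b = g0 - g2 * f1; c = g1 - g2 * f2 in
       det3 (vector [g0, g1, g2]) (vector [a, b, c]) (vector [- (c * f0), a - c * f1, b - c * f2]))"

text \<open>The coefficients with index i have weight 3 - i, and the resultant is isobaric of weight
  9.\<close>

lemma resultant3_scale:
  "resultant3 (t ^ 3 * f0) (t ^ 2 * f1) (t * f2) (t ^ 3 * g0) (t ^ 2 * g1) (t * g2)
    = t ^ 9 * resultant3 f0 f1 f2 g0 g1 g2"
proof -
  have "t ^ 9 = t ^ 3 * t ^ 3 * t ^ 3" by (simp flip: power_add)
  then show ?thesis
    unfolding resultant3_def Let_def det3_def dot3_def cross_nth vector_3
    by (simp add: power2_eq_square power3_eq_cube algebra_simps)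
qed

text \<open>A kernel vector is a nonzero polynomial A of degree at most two with f dividing A g.
  Without a common root f would divide A, which its degree forbids.\<close>

lemma resultant3_zero:
  fixes f0 f1 f2 g0 g1 g2 :: "'a::alg_closed_field"
  assumes "resultant3 f0 f1 f2 g0 g1 g2 = 0"
  obtains z where "poly [:f0, f1, f2, 1:] z = 0" "poly [:g0, g1, g2:] z = 0"
proof -
  define a b c where abc: "a = - (g2 * f0)" "b = g0 - g2 * f1" "c = g1 - g2 * f2"
  define M :: "'a ^ 3 ^ 3" where "M = vector [vector [g0, g1, g2], vector [a, b, c], vector [- (c * f0), a - c * f1, b - c * f2]]"
  have "det (transpose M) = 0"
    unfolding det_transpose unfolding det_det3 M_def using assms by (simp add: resultant3_def Let_def abc)
  then obtain x where x: "x \<noteq> 0" "transpose M *v x = 0" using det_eq_0_kernel by blast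
  have "dot3 (transpose M $ i) x = 0" for i using x(2) by (metis mv_nth zero_index)
  note d = this[of 1] this[of 2] this[of 3]
  have e: "g0 * x $ 1 + a * x $ 2 - c * f0 * x $ 3 = 0"
    "g1 * x $ 1 + b * x $ 2 + (a - c * f1) * x $ 3 = 0"
    "g2 * x $ 1 + c * x $ 2 + (b - c * f2) * x $ 3 = 0"
    using d by (simp_all add: dot3_def transpose_def M_def algebra_simps)
  let ?f = "[:f0, f1, f2, 1:]" and ?g = "[:g0, g1, g2:]" and ?A = "[:x $ 1, x $ 2, x $ 3:]"
  have eq: "?A * ?g = [:g0 * x $ 1 + a * x $ 2 - c * f0 * x $ 3, g1 * x $ 1 + b * x $ 2 + (a - c * f1) * x $ 3,
      g2 * x $ 1 + c * x $ 2 + (b - c * f2) * x $ 3:] + ?f * [:x $ 2 * g2 + x $ 3 * c, x $ 3 * g2:]"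
    by (simp add: abc algebra_simps)
  have "[:g0 * x $ 1 + a * x $ 2 - c * f0 * x $ 3, g1 * x $ 1 + b * x $ 2 + (a - c * f1) * x $ 3,
      g2 * x $ 1 + c * x $ 2 + (b - c * f2) * x $ 3:] = 0" unfolding e by simp
  from eq[unfolded this add_0_left] have "?f dvd ?A * ?g" by (rule dvdI)
  moreover have "\<not> ?f dvd ?A"
  proof
    assume *: "?f dvd ?A"
    have "?A \<noteq> 0" using x(1) by (auto simp: vec3_eq_iff)
    then have "degree ?f \<le> degree ?A" using * by (rule dvd_imp_degree_le[rotated])
    moreover have "degree ?A \<le> 2" by (rule degree_le) (auto simp: coeff_pCons split: nat.splits)
    ultimately show False by simp
  qed
  ultimately show ?thesis using dvd_mult_no_common_root[of ?f ?A ?g] that by auto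
qed

lemma infinite_field: "infinite (UNIV :: 'a::field_char_0 set)"
  by (rule infinite_UNIV_char_0)

lemma poly_eq_infinite:
  fixes p q :: "'a::field_char_0 poly"
  assumes "finite S" "\<And>x. x \<notin> S \<Longrightarrow> poly p x = poly q x"
  shows "p = q"
proof (rule ccontr)
  assume "p \<noteq> q"
  then have "finite {x. poly (p - q) x = 0}" by (intro poly_roots_finite) simp
  moreover have "- S \<subseteq> {x. poly (p - q) x = 0}" using assms(2) by auto
  ultimately have "finite (- S)" by (rule finite_subset[rotated])
  then have "finite (UNIV :: 'a set)" using assms(1) by (metis Compl_partition finite_Un)
  then show False using infinite_field by blast
qed

text \<open>A weak form of Bezout's theorem. Project from a point e3 off the first cubic: the
  resultant in the direction e3 is a binary form of degree nine in the remaining coordinates and has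
  a zero.\<close>

lemma common_zero:
  fixes F G :: "'a::{alg_closed_field, field_char_0} form"
  assumes F: "F \<in> forms 3" "F \<noteq> 0" and G: "G \<in> forms 3"
  obtains v where "v \<noteq> 0" "peval F v = 0" "peval G v = 0"
proof -
  obtain e3 where e3: "peval F e3 \<noteq> 0" using peval_eq_0_imp[of F] F(2) by blast
  then have "e3 \<noteq> 0" by (auto simp: peval_tri[OF F(1)])
  then obtain e1 where "cross e3 e1 \<noteq> 0" using extend_basis1 by blast
  then obtain e2 where "det3 e3 e1 e2 \<noteq> 0" using extend_basis2 by blast
  then have e: "det3 e1 e2 e3 \<noteq> 0" by (simp add: det3_cyclic)
  \<comment> \<open>Subtracting r F from G removes the cubic term in the e3 direction, so
    \<open>resultant3\<close> applies.\<close>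
  define r where "r = peval G e3 / peval F e3"
  define f0 f1 f2 where f: "f0 = (\<lambda>w. tri F w w w / peval F e3)"
    "f1 = (\<lambda>w. 3 * tri F w w e3 / peval F e3)" "f2 = (\<lambda>w. 3 * tri F w e3 e3 / peval F e3)"
  define g0 g1 g2 where g: "g0 = (\<lambda>w. tri G w w w - r * tri F w w w)"
    "g1 = (\<lambda>w. 3 * (tri G w w e3 - r * tri F w w e3))" "g2 = (\<lambda>w. 3 * (tri G w e3 e3 - r * tri F w e3 e3))"
  define N where "N w = resultant3 (f0 w) (f1 w) (f2 w) (g0 w) (g1 w) (g2 w)" for w
  have F_line: "peval F (w + z *s e3) = peval F e3 * poly [:f0 w, f1 w, f2 w, 1:] z" for w z
  proof -
    have "peval F (w + z *s e3) = tri F w w w + 3 * tri F w w e3 * z + 3 * tri F w e3 e3 * z\<^sup>2 + peval F e3 * z ^ 3"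
      by (simp add: peval_tri[OF F(1)] tri_linear tri_commute power2_eq_square power3_eq_cube algebra_simps)
    then show ?thesis using e3 by (simp add: f power2_eq_square power3_eq_cube algebra_simps)
  qed
  have G_line: "peval G (w + z *s e3) = r * peval F (w + z *s e3) + poly [:g0 w, g1 w, g2 w:] z" for w z
  proof -
    have 1: "tri G e3 e3 e3 = r * tri F e3 e3 e3" using e3 by (simp add: r_def flip: peval_tri[OF F(1)] peval_tri[OF G])
    show ?thesis
      unfolding g peval_tri[OF F(1)] peval_tri[OF G]
      by (simp add: tri_linear tri_commute power2_eq_square algebra_simps) (simp add: 1 algebra_simps)
  qed
  have N_scale: "N (t *s w) = t ^ 9 * N w" for t w
  proof -
    have "f0 (t *s w) = t ^ 3 * f0 w" "f1 (t *s w) = t\<^sup>2 * f1 w" "f2 (t *s w) = t * f2 w"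
      "g0 (t *s w) = t ^ 3 * g0 w" "g1 (t *s w) = t\<^sup>2 * g1 w" "g2 (t *s w) = t * g2 w"
      by (simp_all add: f g tri_linear power2_eq_square power3_eq_cube algebra_simps)
    then show ?thesis unfolding N_def by (simp only: resultant3_scale)
  qed
  have N_poly: "poly_fun (\<lambda>x. N (x *s u + v))" for u v
  proof -
    have "poly_fun (\<lambda>x. tri K (x *s u + v) (x *s u + v) (x *s u + v))"
      "poly_fun (\<lambda>x. tri K (x *s u + v) (x *s u + v) e3)" "poly_fun (\<lambda>x. tri K (x *s u + v) e3 e3)" for K
      unfolding tri_linear by (intro poly_fun_add poly_fun_mult poly_fun_const poly_fun_ident)+
    then have "poly_fun (\<lambda>x. f0 (x *s u + v))" "poly_fun (\<lambda>x. f1 (x *s u + v))" "poly_fun (\<lambda>x. f2 (x *s u + v))"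
      "poly_fun (\<lambda>x. g0 (x *s u + v))" "poly_fun (\<lambda>x. g1 (x *s u + v))" "poly_fun (\<lambda>x. g2 (x *s u + v))"
      unfolding f g divide_inverse by (auto intro!: poly_fun_diff poly_fun_mult poly_fun_const)
    moreover have "poly_fun (\<lambda>x. - h x)" if "poly_fun h" for h :: "'a \<Rightarrow> 'a"
      using poly_fun_diff[OF poly_fun_const[of 0] that] by simp
    ultimately show ?thesis
      unfolding N_def resultant3_def Let_def det3_def dot3_def cross_nth vector_3
      by (auto intro!: poly_fun_diff poly_fun_add poly_fun_mult)
  qed
  obtain P where P: "\<And>x. N (x *s e1 + e2) = poly P x" using N_poly[of e1 e2] unfolding poly_fun_def by blast
  obtain Q where Q: "\<And>x. N (x *s e2 + e1) = poly Q x" using N_poly[of e2 e1] unfolding poly_fun_def by blast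
  have "\<exists>s t. (s \<noteq> 0 \<or> t \<noteq> 0) \<and> N (s *s e1 + t *s e2) = 0"
  proof (cases "degree P = 0")
    case False
    then obtain x where "poly P x = 0" using alg_closed_imp_poly_has_root[of P] by auto
    then show ?thesis using P[of x] by (intro exI[of _ x] exI[of _ 1]) simp
  next
    case True
    then obtain c where c: "P = [:c:]" by (metis degree_eq_zeroE)
    \<comment> \<open>If \<open>N\<close> is constant on the chart with e2-coordinate 1, then it is
      c times the ninth power of that coordinate and vanishes at e1.\<close>
    have "poly Q y = poly (Polynomial.monom c 9) y" if "y \<notin> {0}" for y
    proof -
      have "y *s ((1 / y) *s e1 + e2) = y *s e2 + e1" using that by (simp add: vec.scale_right_distrib add.commute)
      then have "poly Q y = y ^ 9 * poly P (1 / y)" by (metis Q P N_scale)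
      then show ?thesis by (simp add: c poly_monom)
    qed
    then have "Q = Polynomial.monom c 9" by (intro poly_eq_infinite[of "{0}"]) auto
    then have "N (0 *s e2 + e1) = 0" unfolding Q by (simp add: poly_monom)
    then show ?thesis by (intro exI[of _ 1] exI[of _ 0]) simp
  qed
  then obtain s t where st: "s \<noteq> 0 \<or> t \<noteq> 0" "N (s *s e1 + t *s e2) = 0" by blast
  define w where "w = s *s e1 + t *s e2"
  obtain z where z: "poly [:f0 w, f1 w, f2 w, 1:] z = 0" "poly [:g0 w, g1 w, g2 w:] z = 0"
    using resultant3_zero st(2) unfolding N_def w_def by blast
  have "w + z *s e3 \<noteq> 0"
  proof
    assume "w + z *s e3 = 0"
    then have "s *s e1 + t *s e2 + z *s e3 = 0 *s e1 + 0 *s e2 + 0 *s e3" by (simp add: w_def)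
    from det3_independent[OF e this] st(1) show False by simp
  qed
  moreover have "peval F (w + z *s e3) = 0" unfolding F_line z by simp
  moreover have "peval G (w + z *s e3) = 0" unfolding G_line z F_line by simp
  ultimately show ?thesis by (rule that)
qed

section \<open>Weierstrass coordinates\<close>

text \<open>The point e2 is a flex and becomes the origin of the group law; e1 and e2 span its
  tangent.\<close>

locale weierstrass = smooth_cubic +
  fixes e1 e2 e3 :: "'a ^ 3" and a b c :: 'a
  assumes basis: "det3 e1 e2 e3 \<noteq> 0"
    and equation: "peval F (x *s e1 + y *s e2 + z *s e3) = y\<^sup>2 * z - x ^ 3 - a * x\<^sup>2 * z - b * x * z\<^sup>2 - c * z ^ 3"

lemma (in smooth_cubic) F_nonzero: "F \<noteq> 0"
proof
  assume 0: "F = 0"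
  obtain w where "T (axis 1 1) (axis 1 1) w \<noteq> 0" using gradient_nonzero[of "axis 1 1"] 0 by (auto simp: axis_eq_0_iff)
  then show False by (simp add: 0 tri_def)
qed

text \<open>Flexes are the points of the cubic on its Hessian; n is a singular point of the polar
  conic of p.\<close>

lemma (in smooth_cubic) ex_flex:
  obtains p n where "p \<noteq> 0" "n \<noteq> 0" "peval F p = 0" "\<And>w. T p n w = 0"
proof -
  obtain p where p: "p \<noteq> 0" "peval F p = 0" "peval (discr_form (derivs F)) p = 0"
    using common_zero[OF cubic F_nonzero discr_form_forms] .
  have l: "lincomb (derivs F) v \<in> forms 2" for v by (intro lincomb_forms pdiff_forms2 cubic)
  obtain n where "n \<noteq> 0" "net_matrix (derivs F) p *v n = 0"
    using p(3) unfolding peval_discr_form det_eq_0_kernel by blast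
  then have "T p n w = 0" for w by (simp add: sym_matrix_kernel[OF l] polar_derivs[OF cubic])
  with that p \<open>n \<noteq> 0\<close> show ?thesis by blast
qed

lemma (in smooth_cubic) ex_weierstrass:
  obtains e1 e2 e3 a b c where "weierstrass F e1 e2 e3 a b c"
proof -
  obtain p n where p: "p \<noteq> 0" "n \<noteq> 0" "peval F p = 0" "\<And>w. T p n w = 0" by (rule ex_flex) blast
  have pn: "cross p n \<noteq> 0"
  proof
    assume "cross p n = 0"
    then obtain k where "n = k *s p" using cross_eq_0 p(1) by blast
    then have "T p p w = 0" for w using p(2) p(4)[of w] by (auto simp: tri_linear)
    then show False using gradient_nonzero p by blast
  qed
  have ppn: "T p p n = 0" using p(4)[of p] by (simp add: tri_commute2)
  have "T n n n \<noteq> 0" using no_line[OF pn] p(3) p(4)[of n] ppn by (auto simp: peval_T)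
  \<comment> \<open>The cube root rescales n so that x^3 gets the coefficient -1.\<close>
  then obtain k where k: "k ^ 3 = - 1 / T n n n" using nth_root_exists[of 3] by auto
  define e1 where "e1 = k *s n"
  obtain z where z: "T p p z \<noteq> 0" using gradient_nonzero p by blast
  define z' where "z' = (1 / (3 * T p p z)) *s z"
  have z': "3 * T p p z' = 1" using z by (simp add: z'_def tri_linear)
  \<comment> \<open>\<open>z'\<close> is normalised so that y^2 z gets the coefficient 1. The
    multiple of p is the one for which T(p, e3, e3) = 0, which removes the term y z^2.\<close>
  define e3 where "e3 = z' + (- (3 / 2) * T p z' z') *s p"
  have Tp1: "T p e1 w = 0" for w by (simp add: e1_def tri_linear p(4))
  have Tppp: "T p p p = 0" using p(3) by (simp add: peval_T)
  have e1: "T e1 e1 e1 = - 1" using k \<open>T n n n \<noteq> 0\<close> by (simp add: e1_def tri_linear power3_eq_cube field_simps)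
  have e3: "3 * T p p e3 = 1" using z' Tppp by (simp add: e3_def tri_linear tri_diff)
  have e33: "T p e3 e3 = 0"
  proof -
    have "T p e3 e3 = T p z' z' - T p z' z' * (3 * T p p z')"
      by (simp add: e3_def tri_linear tri_diff Tppp tri_commute algebra_simps)
    then show ?thesis unfolding z' by simp
  qed
  have "det3 e1 p e3 \<noteq> 0"
  proof
    assume 0: "det3 e1 p e3 = 0"
    have "k \<noteq> 0" using k \<open>T n n n \<noteq> 0\<close> by auto
    then have "cross e1 p \<noteq> 0" using pn by (simp add: e1_def cross_skew[of p n])
    then obtain s t where "e3 = s *s e1 + t *s p" using cross_eq_0_combination[OF _ 0] by blast
    then have "T p p e3 = 0" using Tp1[of p] Tppp by (simp add: tri_linear tri_commute2[of F p p e1])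
    with e3 show False by simp
  qed
  moreover have "peval F (x *s e1 + y *s p + z *s e3) = y\<^sup>2 * z - x ^ 3 - (- 3 * T e1 e1 e3) * x\<^sup>2 * z
      - (- 3 * T e1 e3 e3) * x * z\<^sup>2 - (- T e3 e3 e3) * z ^ 3" for x y z
  proof -
    have 0: "T e1 p w = 0" "T e1 w p = 0" "T w e1 p = 0" "T w p e1 = 0" "T p w e1 = 0" for w
      using Tp1[of w] by (metis tri_commute)+
    have 3: "T e3 p e3 = 0" "T e3 e3 p = 0" using e33 by (metis tri_commute)+
    have "peval F (x *s e1 + y *s p + z *s e3) = x ^ 3 * T e1 e1 e1 + y\<^sup>2 * z * (3 * T p p e3)
       + 3 * x\<^sup>2 * z * T e1 e1 e3 + 3 * x * z\<^sup>2 * T e1 e3 e3 + z ^ 3 * T e3 e3 e3"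
      unfolding peval_T
      by (simp add: tri_linear Tp1 0 3 e33 Tppp power2_eq_square power3_eq_cube algebra_simps
          tri_commute3[of F e3 p p] tri_commute2[of F p e3 p]
          tri_commute2[of F e1 e3 e1] tri_commute3[of F e3 e1 e1] tri_commute1[of F e3 e1 e3] tri_commute3[of F e3 e3 e1])
    then show ?thesis unfolding e1 e3 by (simp add: algebra_simps)
  qed
  ultimately have "weierstrass F e1 p e3 (- 3 * T e1 e1 e3) (- 3 * T e1 e3 e3) (- T e3 e3 e3)"
    by unfold_locales
  then show ?thesis by (rule that)
qed

context weierstrass
begin

abbreviation "f \<equiv> [:c, b, a, 1:]"
abbreviation "affp x y \<equiv> x *s e1 + y *s e2 + e3"
abbreviation "E \<equiv> {(x, y). y\<^sup>2 = poly f x}"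

lemma poly_f: "poly f x = x ^ 3 + a * x\<^sup>2 + b * x + c"
  by (simp add: power2_eq_square power3_eq_cube algebra_simps)

lemma peval_affine: "peval F (affp x y) = y\<^sup>2 - poly f x"
  using equation[of x y 1] unfolding poly_f by (simp add: algebra_simps)

lemma e2_nonzero: "e2 \<noteq> 0"
  using basis by (auto simp: det3_zero)

lemma affine_nonzero: "affp x y \<noteq> 0"
  using det3_independent[OF basis, of x y 1 0 0 0] by auto

lemma affine_inject: "point (affp x y) = point (affp x' y') \<longleftrightarrow> x = x' \<and> y = y'"
proof
  assume "point (affp x y) = point (affp x' y')"
  then obtain k where "affp x' y' = k *s affp x y" using point_eq_iff affine_nonzero by blast
  then have "x' *s e1 + y' *s e2 + 1 *s e3 = (k * x) *s e1 + (k * y) *s e2 + k *s e3"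
    by (simp add: vec.scale_right_distrib)
  from det3_independent[OF basis this] show "x = x' \<and> y = y'" by auto
qed simp

lemma affine_neq_e2: "point (affp x y) \<noteq> point e2"
proof
  assume "point (affp x y) = point e2"
  then obtain k where "affp x y = k *s e2" using point_eq_iff[OF e2_nonzero affine_nonzero, of x y] by auto
  then have "x *s e1 + y *s e2 + 1 *s e3 = 0 *s e1 + k *s e2 + 0 *s e3" by simp
  from det3_independent[OF basis this] show False by simp
qed

lemma e2_in_C: "point e2 \<in> pts C"
  using equation[of 0 1 0] in_C[OF e2_nonzero] by simp

lemma affine_in_C: "point (affp x y) \<in> pts C \<longleftrightarrow> (x, y) \<in> E"
  by (simp add: in_C[OF affine_nonzero] peval_affine)

lemma vector_cases:
  assumes "v \<noteq> 0" "peval F v = 0"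
  obtains (infinity) k where "k \<noteq> 0" "v = k *s e2"
    | (affine) k x y where "k \<noteq> 0" "(x, y) \<in> E" "v = k *s affp x y"
proof -
  obtain r s t where v: "v = r *s e1 + s *s e2 + t *s e3" using det3_coordinates[OF basis] .
  show ?thesis
  proof (cases "t = 0")
    case True
    then have "r = 0" using equation[of r s t] assms(2) v by simp
    then have "v = s *s e2" using v True by simp
    moreover then have "s \<noteq> 0" using assms(1) by auto
    ultimately show ?thesis using infinity by blast
  next
    case False
    then have *: "v = t *s affp (r / t) (s / t)" by (simp add: v vec.scale_right_distrib)
    have "peval F v = t ^ 3 * peval F (affp (r / t) (s / t))" by (subst *) (rule peval_scale[OF cubic])
    then have "peval F (affp (r / t) (s / t)) = 0" using assms(2) False by simp
    then show ?thesis using affine[of t "r / t" "s / t"] False * by (simp add: peval_affine)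
  qed
qed

lemma pts_C_cases:
  assumes "x \<in> pts C"
  obtains (infinity) "x = point e2" | (affine) s t where "(s, t) \<in> E" "x = point (affp s t)"
proof -
  obtain v where v: "v \<noteq> 0" "x = point v" using assms by (rule pts_cases)
  then have "peval F v = 0" using assms in_C by simp
  with v(1) show ?thesis
  proof (cases rule: vector_cases)
    case (infinity k)
    then have "x = point e2" unfolding v(2) infinity(2) using e2_nonzero by (intro point_scale)
    then show ?thesis by (rule that(1))
  next
    case (affine k s t)
    then have "x = point (affp s t)" unfolding v(2) affine(3) using affine_nonzero by (intro point_scale)
    then show ?thesis using that(2) affine(2) by blast
  qed
qed

text \<open>A multiple root r would make (r, 0) a singular point. Expressing b and c by r turns this
  into a polynomial identity through \<open>tri_formula\<close>.\<close>

lemma f_simple_roots: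
  assumes "poly f r = 0"
  shows "poly (pderiv f) r \<noteq> 0"
proof
  assume d: "poly (pderiv f) r = 0"
  have f0: "c = - (r ^ 3 + a * r\<^sup>2 + b * r)"
    by (rule eq_neg_iff_add_eq_0[THEN iffD2]) (use assms in \<open>simp add: poly_f algebra_simps del: poly_pCons\<close>)
  have d0: "b = - (3 * r\<^sup>2 + 2 * a * r)"
    using d by (simp add: pderiv_pCons power2_eq_square algebra_simps eq_neg_iff_add_eq_0)
  let ?v = "affp r 0"
  have "T ?v ?v w = 0" for w
  proof -
    obtain x y z where w: "w = x *s e1 + y *s e2 + z *s e3" using det3_coordinates[OF basis] .
    have p: "?v + w = (r + x) *s e1 + y *s e2 + (1 + z) *s e3"
      and m: "?v - w = (r - x) *s e1 + (- y) *s e2 + (1 - z) *s e3"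
      unfolding w by (simp_all add: vec3_eq_iff algebra_simps)
    have "peval F (?v + w) - peval F (?v - w) = 2 * peval F w"
      unfolding p m unfolding w equation f0 d0
      by (simp add: power2_eq_square power3_eq_cube algebra_simps)
    then have "3 * T ?v ?v w = 0" unfolding tri_formula[OF cubic] by simp
    then show ?thesis by simp
  qed
  moreover have "peval F ?v = 0" unfolding peval_affine using assms by simp
  ultimately show False using gradient_nonzero affine_nonzero by blast
qed

lemma card_f_roots: "card {x. poly f x = 0} = 3"
  using card_simple_roots[of f] f_simple_roots by simp

lemma E_fibre: obtains y where "(x, y) \<in> E"
  using nth_root_exists[of 2 "poly f x"] by auto

lemma infinite_pts: "infinite (pts C)"
proof -
  have "\<forall>x. \<exists>y. y\<^sup>2 = poly f x" by (intro allI nth_root_exists) simp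
  then obtain g where "\<forall>x. (g x)\<^sup>2 = poly f x" by (rule choice[THEN exE])
  then have g: "(x, g x) \<in> E" for x by blast
  have "inj (\<lambda>x. point (affp x (g x)))" by (rule injI) (simp add: affine_inject)
  then have "infinite (range (\<lambda>x. point (affp x (g x))))" using infinite_field finite_imageD by blast
  moreover have "range (\<lambda>x. point (affp x (g x))) \<subseteq> pts C" using g affine_in_C by blast
  ultimately show ?thesis using finite_subset by blast
qed

end

section \<open>Polynomial functions on the affine curve\<close>

text \<open>Parity of degrees: a polynomial of odd degree is not the square of a rational
  function.\<close>

lemma square_eq_square_odd:
  fixes A B g :: "'a::field poly"
  assumes "A\<^sup>2 = B\<^sup>2 * g" "odd (degree g)"
  shows "A = 0 \<and> B = 0"
proof (rule ccontr)
  assume *: "\<not> ?thesis"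
  have "g \<noteq> 0" using assms(2) by auto
  then have "A \<noteq> 0" "B \<noteq> 0" using * assms(1) by auto
  then have "2 * degree A = 2 * degree B + degree g"
    using arg_cong[OF assms(1), of degree] \<open>g \<noteq> 0\<close> by (simp add: degree_mult_eq degree_power_eq)
  then have "even (degree g)" by presburger
  with assms(2) show False by simp
qed

context weierstrass
begin

text \<open>Membership in the coordinate ring, in the normal form given by y^2 = f(x). Values of
  \<open>h\<close> off the curve are unconstrained.\<close>

definition polE :: "('a \<Rightarrow> 'a \<Rightarrow> 'a) \<Rightarrow> bool" where
  "polE h \<longleftrightarrow> (\<exists>A B. \<forall>(x, y)\<in>E. h x y = poly A x + poly B x * y)"

lemma polEI: "(\<And>x y. y\<^sup>2 = poly f x \<Longrightarrow> h x y = poly A x + poly B x * y) \<Longrightarrow> polE h"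
  unfolding polE_def by blast

lemma polEE:
  assumes "polE h"
  obtains A B where "\<And>x y. y\<^sup>2 = poly f x \<Longrightarrow> h x y = poly A x + poly B x * y"
proof -
  obtain A B where "\<forall>(x, y)\<in>E. h x y = poly A x + poly B x * y" using assms unfolding polE_def by blast
  then have "h x y = poly A x + poly B x * y" if "y\<^sup>2 = poly f x" for x y using that by blast
  then show ?thesis by (rule that)
qed

lemma polE_cong: "polE g \<Longrightarrow> (\<And>x y. y\<^sup>2 = poly f x \<Longrightarrow> h x y = g x y) \<Longrightarrow> polE h"
  by (erule polEE) (rule polEI, simp)

lemma polE_poly: "polE (\<lambda>x y. poly A x)"
  by (rule polEI[of _ A 0]) simp

lemma polE_const: "polE (\<lambda>x y. k)"
  by (rule polEI[of _ "[:k:]" 0]) simp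

lemma polE_x: "polE (\<lambda>x y. x)"
  by (rule polEI[of _ "[:0, 1:]" 0]) simp

lemma polE_y: "polE (\<lambda>x y. y)"
  by (rule polEI[of _ 0 1]) simp

lemma polE_add:
  assumes "polE g" "polE h" shows "polE (\<lambda>x y. g x y + h x y)"
proof -
  from assms(1) obtain A B where 1: "\<And>x y. y\<^sup>2 = poly f x \<Longrightarrow> g x y = poly A x + poly B x * y"
    using polEE by blast
  from assms(2) obtain A' B' where 2: "\<And>x y. y\<^sup>2 = poly f x \<Longrightarrow> h x y = poly A' x + poly B' x * y"
    using polEE by blast
  show ?thesis by (rule polEI[of _ "A + A'" "B + B'"]) (simp add: 1 2 algebra_simps del: poly_pCons)
qed

lemma polE_mult:
  assumes "polE g" "polE h" shows "polE (\<lambda>x y. g x y * h x y)"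
proof -
  from assms(1) obtain A B where 1: "\<And>x y. y\<^sup>2 = poly f x \<Longrightarrow> g x y = poly A x + poly B x * y"
    using polEE by blast
  from assms(2) obtain A' B' where 2: "\<And>x y. y\<^sup>2 = poly f x \<Longrightarrow> h x y = poly A' x + poly B' x * y"
    using polEE by blast
  show ?thesis
  proof (rule polEI[of _ "A * A' + B * B' * f" "A * B' + A' * B"])
    fix x y assume y: "y\<^sup>2 = poly f x"
    have "g x y * h x y = poly A x * poly A' x + poly B x * poly B' x * y\<^sup>2 + (poly A x * poly B' x + poly A' x * poly B x) * y"
      by (simp add: 1[OF y] 2[OF y] power2_eq_square algebra_simps del: poly_pCons)
    then show "g x y * h x y = poly (A * A' + B * B' * f) x + poly (A * B' + A' * B) x * y"
      unfolding y by (simp del: poly_pCons mult_pCons_right)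
  qed
qed

lemma polE_diff: "polE g \<Longrightarrow> polE h \<Longrightarrow> polE (\<lambda>x y. g x y - h x y)"
  using polE_add[of g "\<lambda>x y. - 1 * h x y"] polE_mult[OF polE_const, of h "- 1"] by simp

lemma polE_form:
  assumes "form_fun d p"
  shows "polE (\<lambda>x y. p (affp x y))"
proof -
  obtain G where G: "\<And>v. p v = peval G v" using assms by (auto simp: form_fun_def)
  have "polE (\<lambda>x y. affp x y $ i)" for i
    unfolding vector_add_component vector_smult_component
    by (intro polE_add polE_mult polE_x polE_y polE_const)
  then have "polE (curry (\<lambda>p. peval G (affp (fst p) (snd p))))"
    by (intro peval_closed[where C = "\<lambda>h. polE (curry h)" and f = "\<lambda>p. affp (fst p) (snd p)"])
      (simp_all add: curry_def polE_const polE_add polE_mult)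
  then show ?thesis by (simp add: G curry_def)
qed

lemma finite_fibre: "finite {y. y\<^sup>2 = (k :: 'a)}"
proof -
  have "{y. y\<^sup>2 = k} = {y. poly [:- k, 0, 1:] y = 0}" by (auto simp: power2_eq_square)
  then show ?thesis by (simp add: poly_roots_finite del: poly_pCons)
qed

text \<open>At a zero of A + B y the norm A^2 - B^2 f vanishes. A nonzero norm would leave finitely
  many x, each with a finite fibre.\<close>

lemma polE_zero:
  assumes "infinite {(x, y) \<in> E. poly A x + poly B x * y = 0}"
  shows "A = 0 \<and> B = 0"
proof -
  have "A\<^sup>2 = B\<^sup>2 * f"
  proof (rule ccontr)
    assume "A\<^sup>2 \<noteq> B\<^sup>2 * f"
    then have "finite {x. poly (A\<^sup>2 - B\<^sup>2 * f) x = 0}" by (intro poly_roots_finite) simp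
    then have "finite (SIGMA x:{x. poly (A\<^sup>2 - B\<^sup>2 * f) x = 0}. {y. y\<^sup>2 = poly f x})"
      by (intro finite_SigmaI finite_fibre)
    moreover have "poly (A\<^sup>2 - B\<^sup>2 * f) x = 0" if "y\<^sup>2 = poly f x" "poly A x + poly B x * y = 0" for x y
    proof -
      have "poly A x = - (poly B x * y)" using that(2) by (simp add: eq_neg_iff_add_eq_0)
      then show ?thesis unfolding poly_diff poly_mult poly_power that(1)[symmetric]
        by (simp add: power_mult_distrib)
    qed
    then have "{(x, y) \<in> E. poly A x + poly B x * y = 0} \<subseteq> (SIGMA x:{x. poly (A\<^sup>2 - B\<^sup>2 * f) x = 0}. {y. y\<^sup>2 = poly f x})"
      by (auto simp del: poly_pCons mult_pCons_right)
    ultimately show False using assms finite_subset by blast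
  qed
  then show ?thesis by (rule square_eq_square_odd) simp
qed

lemma infinite_E: "infinite E"
proof
  assume "finite E"
  then have "finite (fst ` E)" by simp
  moreover have "x \<in> fst ` E" for x
  proof -
    obtain y where "(x, y) \<in> E" by (rule E_fibre)
    then show ?thesis by force
  qed
  ultimately show False using infinite_field by (metis UNIV_eq_I)
qed

lemma polE_zero_all:
  assumes "\<And>x y. y\<^sup>2 = poly f x \<Longrightarrow> poly A x + poly B x * y = 0"
  shows "A = 0 \<and> B = 0"
proof (rule polE_zero)
  have "{(x, y) \<in> E. poly A x + poly B x * y = 0} = E" using assms by blast
  then show "infinite {(x, y) \<in> E. poly A x + poly B x * y = 0}" using infinite_E by simp
qed

text \<open>The ideal of denominators of a regular function contains a polynomial in \<open>x\<close>, namely a norm; a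
  generator of its intersection with the polynomials in \<open>x\<close> has no zeros.\<close>

lemma regular_function:
  assumes loc: "\<And>x y. y\<^sup>2 = poly f x \<Longrightarrow> \<exists>h k. polE h \<and> polE k \<and> h x y \<noteq> 0 \<and>
      (\<forall>x' y'. y'\<^sup>2 = poly f x' \<longrightarrow> h x' y' * \<xi> x' y' = k x' y')"
  shows "polE \<xi>"
proof -
  define I where "I h \<longleftrightarrow> polE h \<and> polE (\<lambda>x y. h x y * \<xi> x y)" for h
  have ex: "\<exists>h. I h \<and> h x y \<noteq> 0" if y: "y\<^sup>2 = poly f x" for x y
  proof -
    obtain h k where h: "polE h" "polE k" "h x y \<noteq> 0" "\<forall>x' y'. y'\<^sup>2 = poly f x' \<longrightarrow> h x' y' * \<xi> x' y' = k x' y'"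
      using loc[OF y] by blast
    then have "polE (\<lambda>x y. h x y * \<xi> x y)" by (intro polE_cong[OF h(2)]) blast
    then show ?thesis using h unfolding I_def by blast
  qed
  have I_add: "I (\<lambda>x y. g x y + h x y)" if "I g" "I h" for g h
    using that polE_add unfolding I_def by (simp add: distrib_right)
  have norm: "\<exists>N. I (\<lambda>x y. poly N x) \<and> (\<forall>x y. y\<^sup>2 = poly f x \<longrightarrow> poly N x = h x y * h x (- y))" if "I h" for h
  proof -
    have "polE h" using that by (simp add: I_def)
    then obtain A B where AB: "\<And>x y. y\<^sup>2 = poly f x \<Longrightarrow> h x y = poly A x + poly B x * y"
      using polEE by blast
    have N: "poly (A\<^sup>2 - B\<^sup>2 * f) x = h x y * h x (- y)" if y: "y\<^sup>2 = poly f x" for x y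
    proof -
      have y': "(- y)\<^sup>2 = poly f x" using y by simp
      show ?thesis unfolding AB[OF y] AB[OF y'] poly_diff poly_mult poly_power y[symmetric]
        by (simp add: power2_eq_square algebra_simps)
    qed
    have "polE (\<lambda>x y. (poly A x - poly B x * y) * (h x y * \<xi> x y))"
    proof (rule polE_mult)
      show "polE (\<lambda>x y. poly A x - poly B x * y)" by (intro polE_diff polE_mult polE_poly polE_y)
    qed (use that in \<open>simp add: I_def\<close>)
    moreover have "poly (A\<^sup>2 - B\<^sup>2 * f) x * \<xi> x y = (poly A x - poly B x * y) * (h x y * \<xi> x y)" if y: "y\<^sup>2 = poly f x" for x y
    proof -
      have "h x (- y) = poly A x - poly B x * y" using AB[of "- y" x] y by simp
      then show ?thesis using N[OF y] by (simp del: poly_pCons)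
    qed
    ultimately have "polE (\<lambda>x y. poly (A\<^sup>2 - B\<^sup>2 * f) x * \<xi> x y)" by (rule polE_cong)
    then have "I (\<lambda>x y. poly (A\<^sup>2 - B\<^sup>2 * f) x)" unfolding I_def using polE_poly by blast
    with N show ?thesis by blast
  qed
  \<comment> \<open>The norm of h is nonzero at x0 only if h is nonzero at both points above x0, so
    denominators good at one of them are added.\<close>
  have nv: "\<exists>N. I (\<lambda>x y. poly N x) \<and> poly N x0 \<noteq> 0" for x0
  proof -
    obtain y0 where y0: "y0\<^sup>2 = poly f x0" using nth_root_exists[of 2] by auto
    then have y0': "(- y0)\<^sup>2 = poly f x0" by simp
    obtain g where g: "I g" "g x0 y0 \<noteq> 0" using ex[OF y0] by blast
    obtain h where h: "I h" "h x0 (- y0) \<noteq> 0" using ex[OF y0'] by blast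
    have "\<exists>h. I h \<and> h x0 y0 \<noteq> 0 \<and> h x0 (- y0) \<noteq> 0"
    proof (cases "g x0 (- y0) = 0")
      case True
      show ?thesis
      proof (cases "h x0 y0 = 0")
        case h0: True
        then have "I (\<lambda>x y. g x y + h x y) \<and> g x0 y0 + h x0 y0 \<noteq> 0 \<and> g x0 (- y0) + h x0 (- y0) \<noteq> 0"
          using I_add g h True by simp
        then show ?thesis by (intro exI[of _ "\<lambda>x y. g x y + h x y"])
      qed (use h in blast)
    qed (use g in blast)
    then obtain h where h: "I h" "h x0 y0 \<noteq> 0" "h x0 (- y0) \<noteq> 0" by blast
    obtain N where "I (\<lambda>x y. poly N x)" "poly N x0 = h x0 y0 * h x0 (- y0)" using norm[OF h(1)] y0 by blast
    then show ?thesis using h by auto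
  qed
  define S where "S = {N. N \<noteq> 0 \<and> I (\<lambda>x y. poly N x)}"
  obtain N where "I (\<lambda>x y. poly N x)" "poly N 0 \<noteq> 0" using nv[of 0] by blast
  then have "N \<in> S" unfolding S_def by auto
  then obtain n where n: "n \<in> S" "\<And>m. m \<in> S \<Longrightarrow> degree n \<le> degree m"
    using ex_has_least_nat[of "\<lambda>m. m \<in> S" N degree] by blast
  have n': "n \<noteq> 0" "I (\<lambda>x y. poly n x)" using n(1) by (auto simp: S_def)
  have "degree n = 0"
  proof (rule ccontr)
    assume "degree n \<noteq> 0"
    then obtain x0 where x0: "poly n x0 = 0" using alg_closed_imp_poly_has_root[of n] by auto
    obtain M where M: "I (\<lambda>x y. poly M x)" "poly M x0 \<noteq> 0" using nv by blast
    \<comment> \<open>The remainder of M modulo n is again a denominator, since they form an ideal.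
      It is nonzero at x0 and of smaller degree, against minimality of n.\<close>
    define m where "m = M mod n"
    have Mm: "M = n * (M div n) + m" by (simp add: m_def)
    have m: "poly m x = poly M x - poly (M div n) x * poly n x" for x
      using arg_cong[OF Mm, of "\<lambda>p. poly p x"] by (simp add: algebra_simps)
    have "poly m x0 \<noteq> 0" unfolding m x0 using M(2) by simp
    then have "m \<noteq> 0" by auto
    have "polE (\<lambda>x y. poly M x * \<xi> x y - poly (M div n) x * (poly n x * \<xi> x y))"
      by (rule polE_diff[OF _ polE_mult[OF polE_poly]]) (use M(1) n'(2) in \<open>simp_all add: I_def\<close>)
    then have "polE (\<lambda>x y. poly m x * \<xi> x y)" by (rule polE_cong) (simp add: m algebra_simps)
    then have "m \<in> S" using \<open>m \<noteq> 0\<close> by (simp add: S_def I_def polE_poly)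
    then have "degree n \<le> degree m" by (rule n(2))
    moreover have "degree m < degree n"
      using \<open>m \<noteq> 0\<close> n'(1) degree_mod_less[of n M] unfolding m_def by blast
    ultimately show False by simp
  qed
  then obtain k where k: "n = [:k:]" by (metis degree_eq_zeroE)
  then have "k \<noteq> 0" using n'(1) by auto
  have "polE (\<lambda>x y. (1 / k) * (poly n x * \<xi> x y))"
    by (rule polE_mult[OF polE_const]) (use n'(2) in \<open>simp add: I_def\<close>)
  then show ?thesis by (rule polE_cong) (use \<open>k \<noteq> 0\<close> in \<open>simp add: k\<close>)
qed

text \<open>If \<open>B\<close> does not vanish, the norm of \<open>A + B y - k\<close> has degree at least three, and for all but
  finitely many values \<open>k\<close> its zeros are simple.\<close>

lemma two_to_one:
  assumes two: "\<And>k S. finite S \<Longrightarrow> S \<subseteq> {(x, y) \<in> E. poly A x + poly B x * y = k} \<Longrightarrow> card S \<le> 2"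
  shows "B = 0 \<and> degree A = 1"
proof -
  have B0: "B = 0"
  proof (rule ccontr)
    assume "B \<noteq> 0"
    define h where "h = B\<^sup>2 * f"
    have "h \<noteq> 0" using \<open>B \<noteq> 0\<close> unfolding h_def by (subst mult_eq_0_iff) simp
    have deg_h: "degree h = 2 * degree B + 3" using \<open>B \<noteq> 0\<close> by (simp add: h_def degree_mult_eq degree_power_eq del: mult_pCons_right)
    \<comment> \<open>If (A - k)^2 - h has a multiple root z, eliminating k between it and its
      derivative gives K(z) = 0. So only finitely many k are exceptional.\<close>
    define K where "K = 4 * h * (pderiv A)\<^sup>2 - (pderiv h)\<^sup>2"
    have "K \<noteq> 0"
    proof
      assume "K = 0"
      then have "(pderiv h)\<^sup>2 = (2 * pderiv A)\<^sup>2 * h" by (simp add: K_def power_mult_distrib algebra_simps)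
      then have "pderiv h = 0" using square_eq_square_odd[of "pderiv h" "2 * pderiv A" h] deg_h by simp
      then show False using deg_h by (simp add: pderiv_eq_0_iff)
    qed
    then have fin: "finite {z. poly K z = 0}" by (rule poly_roots_finite)
    have "k \<in> (\<Union>z\<in>{z. poly K z = 0}. (\<lambda>w. poly A z - w) ` {w. w\<^sup>2 = poly h z})" for k
    proof -
      define P where "P = (A - [:k:])\<^sup>2 - h"
      \<comment> \<open>The square has even degree and h has odd degree, so leading terms cannot
        cancel.\<close>
      have "degree P \<ge> 3"
      proof (cases "A - [:k:] = 0")
        case True
        then show ?thesis using deg_h by (simp add: P_def)
      next
        case False
        then have e: "degree ((A - [:k:])\<^sup>2) = 2 * degree (A - [:k:])" by (rule degree_power_eq)
        show ?thesis
        proof (cases "degree ((A - [:k:])\<^sup>2) < degree h")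
          case True
          then have "degree P = degree h" unfolding P_def diff_conv_add_uminus by (subst degree_add_eq_right) simp_all
          then show ?thesis using deg_h by simp
        next
          case False
          then have "degree h < degree ((A - [:k:])\<^sup>2)" using e deg_h by presburger
          then have "degree P = degree ((A - [:k:])\<^sup>2)" unfolding P_def diff_conv_add_uminus by (subst degree_add_eq_left) simp_all
          then show ?thesis using \<open>degree h < degree ((A - [:k:])\<^sup>2)\<close> deg_h by simp
        qed
      qed
      have "\<exists>y. y\<^sup>2 = poly f z \<and> poly A z + poly B z * y = k" if "poly P z = 0" for z
      proof -
        obtain y where y: "y\<^sup>2 = poly f z" using nth_root_exists[of 2] by auto
        have "(poly A z - k)\<^sup>2 = (poly B z * y)\<^sup>2"
          using that unfolding P_def h_def poly_diff poly_power poly_mult y[symmetric] power_mult_distrib by simp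
        then consider "poly A z - k = poly B z * y" | "poly A z - k = - (poly B z * y)"
          by (auto simp: power2_eq_iff)
        then show ?thesis
        proof cases
          case 1
          then show ?thesis using y by (intro exI[of _ "- y"]) (simp add: algebra_simps del: poly_pCons)
        next
          case 2
          then show ?thesis using y by (intro exI[of _ y]) (simp add: algebra_simps del: poly_pCons)
        qed
      qed
      \<comment> \<open>Over each root of the norm there is a choice of y that solves A + B y = k,
        so distinct roots give distinct points of the fibre.\<close>
      then obtain g where g: "\<And>z. poly P z = 0 \<Longrightarrow> (g z)\<^sup>2 = poly f z \<and> poly A z + poly B z * g z = k" by metis
      have "P \<noteq> 0" using \<open>degree P \<ge> 3\<close> by auto
      then have fP: "finite {z. poly P z = 0}" by (rule poly_roots_finite)
      have "card ((\<lambda>z. (z, g z)) ` {z. poly P z = 0}) \<le> 2" using fP g by (intro two[of _ k]) auto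
      moreover have "card ((\<lambda>z. (z, g z)) ` {z. poly P z = 0}) = card {z. poly P z = 0}"
        by (intro card_image inj_onI) simp
      ultimately have "card {z. poly P z = 0} \<noteq> degree P" using \<open>degree P \<ge> 3\<close> by simp
      then obtain z where z: "poly P z = 0" "poly (pderiv P) z = 0" using card_simple_roots[of P] by blast
      have 1: "(poly A z - k)\<^sup>2 = poly h z" using z(1) by (simp add: P_def)
      have 2: "2 * (poly A z - k) * poly (pderiv A) z = poly (pderiv h) z"
        using z(2) unfolding P_def pderiv_diff power2_eq_square pderiv_mult
        by (simp add: pderiv_pCons algebra_simps)
      have "poly K z = 0"
        unfolding K_def by (simp flip: 1 2) (simp add: power2_eq_square algebra_simps)
      moreover have "k = poly A z - (poly A z - k)" by simp
      ultimately show ?thesis using 1 by blast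
    qed
    then have "(UNIV :: 'a set) = (\<Union>z\<in>{z. poly K z = 0}. (\<lambda>w. poly A z - w) ` {w. w\<^sup>2 = poly h z})" by blast
    moreover have "finite (\<Union>z\<in>{z. poly K z = 0}. (\<lambda>w. poly A z - w) ` {w. w\<^sup>2 = poly h z})"
      using fin finite_fibre by blast
    ultimately show False using infinite_field by metis
  qed
  have "degree A \<noteq> 0"
  proof
    assume "degree A = 0"
    then obtain k where "A = [:k:]" by (metis degree_eq_zeroE)
    then have *: "{(x, y) \<in> E. poly A x + poly B x * y = k} = E" by (auto simp: B0)
    obtain S where "S \<subseteq> E" "finite S" "card S = 3" using infinite_arbitrarily_large[OF infinite_E] by blast
    then show False using two[of S k] * by simp
  qed
  moreover have "degree A \<le> 1"
  proof (rule ccontr)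
    assume deg: "\<not> degree A \<le> 1"
    then have "pderiv A \<noteq> 0" by (simp add: pderiv_eq_0_iff)
    then have "finite (poly A ` ({z. poly (pderiv A) z = 0} \<union> {z. poly f z = 0}))"
      by (intro finite_imageI finite_UnI poly_roots_finite) auto
    \<comment> \<open>For this k all roots of A - k are simple and none is a root of f. Two roots
      then yield three points of the fibre, two of them over the first root.\<close>
    then obtain k where k: "k \<notin> poly A ` ({z. poly (pderiv A) z = 0} \<union> {z. poly f z = 0})"
      using infinite_field ex_new_if_finite by blast
    define P where "P = A - [:k:]"
    have dP: "pderiv P = pderiv A" by (simp add: P_def pderiv_diff pderiv_pCons)
    have Pk: "poly P z = 0 \<longleftrightarrow> poly A z = k" for z by (simp add: P_def)
    have "degree P = degree A"
      unfolding P_def diff_conv_add_uminus using deg by (subst degree_add_eq_left) simp_all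
    moreover have "card {z. poly P z = 0} = degree P"
      using k by (intro card_simple_roots) (auto simp: dP Pk)
    ultimately have "card {z. poly P z = 0} \<ge> 2" using deg by simp
    then obtain S where "S \<subseteq> {z. poly P z = 0}" "card S = 2"
      using obtain_subset_with_card_n by metis
    then obtain z w where zw: "z \<noteq> w" "poly A z = k" "poly A w = k"
      using Pk by (auto simp: card_2_iff)
    obtain y where y: "y\<^sup>2 = poly f z" using nth_root_exists[of 2] by auto
    obtain y' where y': "y'\<^sup>2 = poly f w" using nth_root_exists[of 2] by auto
    have "y \<noteq> 0" using y k zw by (auto simp del: poly_pCons)
    then have "y \<noteq> - y" by (simp add: eq_neg_iff_add_eq_0)
    then have "card {(z, y), (z, - y), (w, y')} = 3" using zw by simp
    moreover have "card {(z, y), (z, - y), (w, y')} \<le> 2"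
      using y y' zw by (intro two[of _ k]) (auto simp: B0 simp del: poly_pCons)
    ultimately show False by simp
  qed
  ultimately show ?thesis using B0 by simp
qed

section \<open>The identity principle on the curve\<close>

text \<open>The origin is a flex: its tangent, spanned by e1 and e2, meets the curve three times
  there.\<close>

lemma line_cycle_e2: "line_cycle F e2 e2 e2"
proof -
  have "line_cycle F (1 *s e2 + 0 *s e1) (1 *s e2 + 0 *s e1) (1 *s e2 + 0 *s e1)"
  proof (rule line_cycleI[where k = 1])
    show "cross e2 e1 \<noteq> 0" using det3_cross[of e2 e1 e3] basis det3_swap(1)[of e2 e1 e3] by simp
    show "peval F (s *s e2 + t *s e1) = 1 * ((s * 0 - t * 1) * (s * 0 - t * 1) * (s * 0 - t * 1))" for s t
      using equation[of t s 0] by (simp add: power3_eq_cube add.commute)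
  qed auto
  then show ?thesis by simp
qed

lemma line_cycle_vertical:
  assumes "y\<^sup>2 = poly f x"
  shows "line_cycle F e2 (affp x y) (affp x (- y))"
proof -
  have "line_cycle F (1 *s e2 + 0 *s (x *s e1 + e3)) (y *s e2 + 1 *s (x *s e1 + e3)) ((- y) *s e2 + 1 *s (x *s e1 + e3))"
  proof (rule line_cycleI[where k = "- 1"])
    have "det3 e2 (x *s e1 + e3) e1 = det3 e1 e2 e3"
      by (simp add: det3_def dot3_def algebra_simps)
    then show "cross e2 (x *s e1 + e3) \<noteq> 0" using det3_cross basis by metis
    show "peval F (s *s e2 + t *s (x *s e1 + e3)) = - 1 * ((s * 0 - t * 1) * (s * 1 - t * y) * (s * 1 - t * - y))" for s t
    proof -
      have "peval F (s *s e2 + t *s (x *s e1 + e3)) = t * (s\<^sup>2 - t\<^sup>2 * poly f x)"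
        using equation[of "t * x" s t] unfolding poly_f
        by (simp add: vec.scale_right_distrib power2_eq_square power3_eq_cube algebra_simps)
      then show ?thesis unfolding assms[symmetric] by (simp add: power2_eq_square algebra_simps)
    qed
  qed auto
  then show ?thesis by (simp add: algebra_simps)
qed

lemma origin_chord_origin: "point e2 \<star> point e2 = point e2"
  by (rule chord_eq[OF line_cycle_e2])

lemma origin_chord_affine: "y\<^sup>2 = poly f x \<Longrightarrow> point e2 \<star> point (affp x y) = point (affp x (- y))"
  by (rule chord_eq[OF line_cycle_vertical])

lemma infinite_affine_points:
  assumes "infinite X" "X \<subseteq> pts C"
  shows "infinite {(x, y) \<in> E. point (affp x y) \<in> X}"
proof
  assume "finite {(x, y) \<in> E. point (affp x y) \<in> X}"
  then have "finite ((\<lambda>(x, y). point (affp x y)) ` {(x, y) \<in> E. point (affp x y) \<in> X})" by simp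
  then have "finite (insert (point e2) ((\<lambda>(x, y). point (affp x y)) ` {(x, y) \<in> E. point (affp x y) \<in> X}))" by simp
  moreover have "X \<subseteq> insert (point e2) ((\<lambda>(x, y). point (affp x y)) ` {(x, y) \<in> E. point (affp x y) \<in> X})"
  proof
    fix z assume z: "z \<in> X"
    then have "z \<in> pts C" using assms(2) by blast
    then show "z \<in> insert (point e2) ((\<lambda>(x, y). point (affp x y)) ` {(x, y) \<in> E. point (affp x y) \<in> X})"
    proof (cases rule: pts_C_cases)
      case (affine s t)
      then have "(s, t) \<in> {(x, y) \<in> E. point (affp x y) \<in> X}" using z by simp
      then show ?thesis using affine(2) by (intro insertI2) (rule image_eqI[where x = "(s, t)"], simp_all)
    qed simp
  qed
  ultimately show False using assms(1) finite_subset by blast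
qed

definition vanishes :: "('a ^ 3 \<Rightarrow> 'a) \<Rightarrow> 'a pt \<Rightarrow> bool" where
  "vanishes p x \<longleftrightarrow> (\<exists>v. v \<noteq> 0 \<and> x = point v \<and> p v = 0)"

lemma vanishes_iff:
  assumes "form_fun d p" "v \<noteq> 0"
  shows "vanishes p (point v) \<longleftrightarrow> p v = 0"
proof
  assume "vanishes p (point v)"
  then obtain u where u: "u \<noteq> 0" "point v = point u" "p u = 0" by (auto simp: vanishes_def)
  then obtain k where "v = k *s u" using point_eq_iff[of u v] assms(2) by auto
  then show "p v = 0" using u form_fun_scale[OF assms(1)] by simp
qed (use assms in \<open>auto simp: vanishes_def\<close>)

lemma vanishes_affine:
  assumes p: "form_fun d p" and X: "infinite X" "X \<subseteq> pts C" "\<And>x. x \<in> X \<Longrightarrow> vanishes p x" and "(x, y) \<in> E"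
  shows "p (affp x y) = 0"
proof -
  obtain A B where AB: "\<And>x y. y\<^sup>2 = poly f x \<Longrightarrow> p (affp x y) = poly A x + poly B x * y"
    using polE_form[OF p] polEE by blast
  have "poly A x + poly B x * y = 0" if xy: "y\<^sup>2 = poly f x" "point (affp x y) \<in> X" for x y
    using X(3)[OF xy(2)] vanishes_iff[OF p affine_nonzero] AB[OF xy(1)] by simp
  then have "{(x, y) \<in> E. point (affp x y) \<in> X} \<subseteq> {(x, y) \<in> E. poly A x + poly B x * y = 0}"
    by (auto simp del: poly_pCons)
  then have "infinite {(x, y) \<in> E. poly A x + poly B x * y = 0}"
    using infinite_affine_points[OF X(1,2)] finite_subset by blast
  then have "A = 0 \<and> B = 0" by (rule polE_zero)
  then show ?thesis using AB assms(5) by auto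
qed

text \<open>The point at infinity is reached by moving it to an affine point with a chord map.\<close>

lemma form_identity:
  assumes p: "form_fun d p" and X: "infinite X" "X \<subseteq> pts C" "\<And>x. x \<in> X \<Longrightarrow> vanishes p x"
    and v: "v \<noteq> 0" "peval F v = 0"
  shows "p v = 0"
proof -
  have aff: "p (affp x y) = 0" if "(x, y) \<in> E" for x y by (rule vanishes_affine[OF p X that])
  obtain y0 where y0: "(0, y0) \<in> E" by (rule E_fibre)
  define o' q where "o' = point (affp 0 y0)" and "q = point (affp 0 (- y0))"
  have o': "o' \<in> pts C" unfolding o'_def using y0 affine_in_C by blast
  have oq: "o' \<star> point e2 = q"
    using origin_chord_affine[of y0 0] y0 chord_commute[OF o' e2_in_C] unfolding o'_def q_def by simp
  have qC: "q \<in> pts C" using chord_in[OF o' e2_in_C] oq by simp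
  have reg: "regular_map C C (\<lambda>x. o' \<star> x)" by (intro chord_regular regular_map_const regular_map_id o')
  obtain l h w where h: "form_vec l h" "w \<noteq> 0" "q = point w" "h w \<noteq> 0"
    "\<forall>v. v \<noteq> 0 \<longrightarrow> point v \<in> pts C \<longrightarrow> h v \<noteq> 0 \<longrightarrow> o' \<star> point v = point (h v)"
    using regular_mapE[OF reg qC] .
  obtain i where i: "h w $ i \<noteq> 0" using h(4) by (auto simp: vec_eq_iff)
  \<comment> \<open>The pullback of p along x |-> o' \<star> x, which exchanges q and the point at
    infinity. It vanishes at all points other than q, hence at the affine point q, which gives p(e2)
    = 0.\<close>
  define r where "r v = h v $ i * p (h v)" for v
  have r: "form_fun (l + d * l) r"
    unfolding r_def using h(1) p unfolding form_vec_def by (intro form_fun_mult form_fun_compose) auto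
  have "vanishes r x" if x: "x \<in> pts C - {q}" for x
  proof -
    obtain u where u: "u \<noteq> 0" "x = point u" using x by (auto elim: pts_cases)
    have "r u = 0"
    proof (cases "h u $ i = 0")
      case False
      then have hu: "h u \<noteq> 0" by auto
      then have e: "o' \<star> x = point (h u)" using h(5) u x by simp
      then have "point (h u) \<in> pts C" using chord_in[OF o', of x] x by simp
      then have "peval F (h u) = 0" using in_C[OF hu] by simp
      with hu show ?thesis
      proof (cases rule: vector_cases)
        case (infinity k)
        then have "point (h u) = point e2" using e2_nonzero by (simp add: point_scale)
        then have "o' \<star> x = o' \<star> q" using e oq chord_chord[OF o' e2_in_C] by simp
        then have "x = q" using chord_cancel[OF o' _ qC] x by blast
        then show ?thesis using x by simp
      next
        case (affine k s t)
        have "p (h u) = k ^ d * p (affp s t)" unfolding affine(3) by (rule form_fun_scale[OF p])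
        then show ?thesis using aff[OF affine(2)] by (simp add: r_def)
      qed
    qed (simp add: r_def)
    then show ?thesis using u by (auto simp: vanishes_def)
  qed
  moreover have "infinite (pts C - {q})" using infinite_pts by simp
  ultimately have "r (affp 0 (- y0)) = 0"
    using y0 by (intro vanishes_affine[OF r, of "pts C - {q}"]) auto
  then have "vanishes r q"
    unfolding q_def vanishes_def by (intro exI[of _ "affp 0 (- y0)"] conjI affine_nonzero refl)
  then have "r w = 0" using vanishes_iff[OF r h(2)] h(3) by simp
  then have "p (h w) = 0" using i by (simp add: r_def)
  moreover have "point (h w) = point e2"
    using h qC oq chord_chord[OF o' e2_in_C] by metis
  ultimately have e2: "p e2 = 0" using vanishes_iff[OF p h(4)] vanishes_iff[OF p e2_nonzero] by simp
  show ?thesis using v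
  proof (cases rule: vector_cases)
    case (infinity k)
    then show ?thesis using form_fun_scale[OF p] e2 by simp
  next
    case (affine k s t)
    have "p v = k ^ d * p (affp s t)" unfolding affine(3) by (rule form_fun_scale[OF p])
    then show ?thesis using aff[OF affine(2)] by simp
  qed
qed

text \<open>Two nonzero vectors represent the same point iff their cross product vanishes, so
  \<open>form_identity\<close> applies to the coordinates of the cross product of local
  representations.\<close>

lemma regular_maps_equal:
  assumes g: "regular_map C D g" and h: "regular_map C D h"
    and X: "infinite X" "X \<subseteq> pts C" "\<And>x. x \<in> X \<Longrightarrow> g x = h x" and x: "x \<in> pts C"
  shows "g x = h x"
proof -
  obtain d p u where p: "form_vec d p" "u \<noteq> 0" "x = point u" "p u \<noteq> 0"
    "\<forall>v. v \<noteq> 0 \<longrightarrow> point v \<in> pts C \<longrightarrow> p v \<noteq> 0 \<longrightarrow> g (point v) = point (p v)"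
    using regular_mapE[OF g x] .
  obtain e q w where q: "form_vec e q" "w \<noteq> 0" "x = point w" "q w \<noteq> 0"
    "\<forall>v. v \<noteq> 0 \<longrightarrow> point v \<in> pts C \<longrightarrow> q v \<noteq> 0 \<longrightarrow> h (point v) = point (q v)"
    using regular_mapE[OF h x] .
  obtain k where k: "k \<noteq> 0" "w = k *s u" using point_eq_iff[OF p(2) q(2)] p(3) q(3) by auto
  have qu: "q u \<noteq> 0" using q(4) form_vec_scale[OF q(1), of k u] k by auto
  have cr: "form_fun (d + e) (\<lambda>v. cross (p v) (q v) $ i)" for i
  proof -
    have "form_fun (d + e) (\<lambda>v. p v $ k * q v $ l - p v $ k' * q v $ l')" for k l k' l'
      using p(1) q(1) unfolding form_vec_def by (intro form_fun_diff form_fun_mult) auto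
    then show ?thesis using exhaust_3[of i] by auto
  qed
  have "vanishes (\<lambda>v. cross (p v) (q v) $ i) y" if y: "y \<in> X" for y i
  proof -
    have yC: "y \<in> pts C" using y X(2) by blast
    obtain v where v: "v \<noteq> 0" "y = point v" using pts_cases[OF yC] by blast
    have "cross (p v) (q v) = 0"
    proof (cases "p v = 0 \<or> q v = 0")
      case False
      then have "point (p v) = point (q v)" using p(5) q(5) v yC X(3)[OF y] by metis
      then show ?thesis using point_eq_cross[of "p v" "q v"] False by simp
    qed auto
    then show ?thesis using v by (auto simp: vanishes_def)
  qed
  moreover have "peval F u = 0" using x p(2,3) in_C by simp
  ultimately have "cross (p u) (q u) $ i = 0" for i
    by (intro form_identity[OF cr X(1,2)]) (use p(2) in auto)
  then have "cross (p u) (q u) = 0" by (simp add: vec_eq_iff)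
  then have "point (p u) = point (q u)" using point_eq_cross[OF p(4) qu] by simp
  then show ?thesis using p(2,3,4,5) q(5) qu x by metis
qed

end

section \<open>Automorphisms fixing the origin\<close>

context weierstrass
begin

abbreviation "origin \<equiv> point e2"

definition coord :: "'a ^ 3 \<Rightarrow> 'a ^ 3" where
  "coord v = vector [det3 v e2 e3 / det3 e1 e2 e3, det3 e1 v e3 / det3 e1 e2 e3, det3 e1 e2 v / det3 e1 e2 e3]"

lemma coord_expand: "v = coord v $ 1 *s e1 + coord v $ 2 *s e2 + coord v $ 3 *s e3"
proof -
  have "v = (1 / det3 e1 e2 e3) *s (det3 e1 e2 e3 *s v)" using basis by simp
  also have "\<dots> = coord v $ 1 *s e1 + coord v $ 2 *s e2 + coord v $ 3 *s e3"
    by (subst det3_expand) (simp add: vec.scale_right_distrib coord_def)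
  finally show ?thesis .
qed

lemma coord_combination: "coord (r *s e1 + s *s e2 + t *s e3) = vector [r, s, t]"
  using basis by (simp add: coord_def det3_combination)

lemma coord_affine: "coord (affp x y) = vector [x, y, 1]"
  using coord_combination[of x y 1] by simp

lemma coord_scale: "coord (k *s v) = k *s coord v"
  by (simp add: coord_def vec3_eq_iff det3_def dot3_def algebra_simps add_divide_distrib diff_divide_distrib)

lemma form_fun_coord':
  assumes "form_vec d h"
  shows "form_fun d (\<lambda>v. coord (h v) $ i)"
proof -
  have h: "form_fun d (\<lambda>v. h v $ a)" for a using assms by (simp add: form_vec_def)
  have "form_fun d (\<lambda>v. \<alpha> * h v $ 1 + \<beta> * h v $ 2 + \<gamma> * h v $ 3)" for \<alpha> \<beta> \<gamma>
    by (intro form_fun_add form_fun_cmult h)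
  moreover have "\<exists>\<alpha> \<beta> \<gamma>. \<forall>v. coord v $ i = \<alpha> * v $ 1 + \<beta> * v $ 2 + \<gamma> * v $ 3"
  proof -
    have 1: "det3 v e2 e3 / d = (cross e2 e3 $ 1 / d) * v $ 1 + (cross e2 e3 $ 2 / d) * v $ 2 + (cross e2 e3 $ 3 / d) * v $ 3"
      and 2: "det3 e1 v e3 / d = (cross e3 e1 $ 1 / d) * v $ 1 + (cross e3 e1 $ 2 / d) * v $ 2 + (cross e3 e1 $ 3 / d) * v $ 3"
      and 3: "det3 e1 e2 v / d = (cross e1 e2 $ 1 / d) * v $ 1 + (cross e1 e2 $ 2 / d) * v $ 2 + (cross e1 e2 $ 3 / d) * v $ 3"
      for v d by (simp_all add: det3_def dot3_def algebra_simps add_divide_distrib diff_divide_distrib)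
    consider "i = 1" | "i = 2" | "i = 3" using exhaust_3[of i] by blast
    then show ?thesis
    proof cases
      case i: 1
      show ?thesis unfolding i coord_def vector_3 1[of _ "det3 e1 e2 e3"] by blast
    next
      case i: 2
      show ?thesis unfolding i coord_def vector_3 2[of _ "det3 e1 e2 e3"] by blast
    next
      case i: 3
      show ?thesis unfolding i coord_def vector_3 3[of _ "det3 e1 e2 e3"] by blast
    qed
  qed
  then obtain \<alpha> \<beta> \<gamma> where "\<forall>v. coord v $ i = \<alpha> * v $ 1 + \<beta> * v $ 2 + \<gamma> * v $ 3" by blast
  ultimately show ?thesis by simp
qed

lemma card_fibre: "card {y. y\<^sup>2 = (k :: 'a)} \<le> 2"
proof -
  have "{y. y\<^sup>2 = k} = {y. poly [:- k, 0, 1:] y = 0}" by (auto simp: power2_eq_square)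
  also have "card \<dots> \<le> degree [:- k, 0, 1:]" by (rule card_poly_roots_bound) simp
  finally show ?thesis by simp
qed

text \<open>The triple stands for (x, y) |-> (u x + r, s y); the last condition says that this
  preserves y^2 = f(x).\<close>

definition autos :: "('a \<times> 'a \<times> 'a) set" where
  "autos = {(u, r, s). u \<noteq> 0 \<and> s \<noteq> 0 \<and> (\<forall>x. poly f (u * x + r) = s\<^sup>2 * poly f x)}"

lemma autos_cube:
  assumes "(u, r, s) \<in> autos"
  shows "u ^ 3 = s\<^sup>2"
proof -
  have "poly (pcompose f [:r, u:]) x = poly (Polynomial.smult (s\<^sup>2) f) x" for x
  proof -
    have 1: "poly [:r, u:] x = u * x + r" by simp
    have 2: "poly f (u * x + r) = s\<^sup>2 * poly f x" using assms unfolding autos_def by blast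
    show ?thesis unfolding poly_pcompose poly_smult 1 2 ..
  qed
  then have "pcompose f [:r, u:] = Polynomial.smult (s\<^sup>2) f"
    by (intro poly_eq_infinite[of "{}"]) auto
  then have "Polynomial.coeff (pcompose f [:r, u:]) 3 = Polynomial.coeff (Polynomial.smult (s\<^sup>2) f) 3" by simp
  then show ?thesis
    by (simp add: pcompose_pCons numeral_3_eq_3 power2_eq_square algebra_simps)
qed

text \<open>The map x |-> u x + r sends roots of f to roots of f and is determined by its values at
  two of them; s is then one of the square roots of u^3.\<close>

lemma finite_autos: "finite autos"
proof -
  let ?R = "{x. poly f x = 0}"
  have fR: "finite ?R" by (rule poly_roots_finite) simp
  have "card ?R = 3" by (rule card_f_roots)
  then obtain S where "S \<subseteq> ?R" "card S = 2" using obtain_subset_with_card_n[of 2 ?R] by auto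
  then obtain \<rho> \<sigma> where rs: "\<rho> \<noteq> \<sigma>" "poly f \<rho> = 0" "poly f \<sigma> = 0" by (auto simp: card_2_iff simp del: poly_pCons)
  define g where "g = (\<lambda>(p, q). ((p - q) / (\<rho> - \<sigma>), p - (p - q) / (\<rho> - \<sigma>) * \<rho>))"
  have "autos \<subseteq> (\<lambda>((u, r), s). (u, r, s)) ` (SIGMA ur:g ` (?R \<times> ?R). {s. s\<^sup>2 = fst ur ^ 3})"
  proof
    fix t assume t: "t \<in> autos"
    obtain u r s where urs: "t = (u, r, s)" by (cases t)
    have 1: "poly f (u * x + r) = s\<^sup>2 * poly f x" for x using t urs unfolding autos_def by blast
    have "poly f (u * \<rho> + r) = 0" "poly f (u * \<sigma> + r) = 0" unfolding 1 rs by simp_all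
    then have m: "(u * \<rho> + r, u * \<sigma> + r) \<in> ?R \<times> ?R" by simp
    have "(u * \<rho> + r - (u * \<sigma> + r)) / (\<rho> - \<sigma>) = u" using rs(1) by (simp add: field_simps)
    then have "g (u * \<rho> + r, u * \<sigma> + r) = (u, r)" unfolding g_def by (simp only: prod.case) simp
    then have "(u, r) \<in> g ` (?R \<times> ?R)" using m by force
    moreover have "s\<^sup>2 = u ^ 3" using autos_cube t urs by simp
    ultimately have "((u, r), s) \<in> (SIGMA ur:g ` (?R \<times> ?R). {s. s\<^sup>2 = fst ur ^ 3})" by simp
    then show "t \<in> (\<lambda>((u, r), s). (u, r, s)) ` (SIGMA ur:g ` (?R \<times> ?R). {s. s\<^sup>2 = fst ur ^ 3})"
      unfolding urs by (rule image_eqI[rotated]) simp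
  qed
  moreover have "finite (SIGMA ur:g ` (?R \<times> ?R). {s. s\<^sup>2 = fst ur ^ 3})"
    using fR by (intro finite_SigmaI finite_imageI finite_cartesian_product finite_fibre)
  ultimately show ?thesis by (meson finite_imageI finite_subset)
qed

text \<open>The coordinate functions of the automorphism are regular away from the origin, hence polynomials.\<close>

lemma automorphism_fixing_origin:
  assumes reg: "regular_map C C \<alpha>" and inj: "inj_on \<alpha> (pts C)" and orig: "\<alpha> origin = origin"
  obtains u r s where "(u, r, s) \<in> autos" "\<And>x y. (x, y) \<in> E \<Longrightarrow> \<alpha> (point (affp x y)) = point (affp (u * x + r) (s * y))"
proof -
  have "\<exists>\<xi> \<eta>. (\<xi>, \<eta>) \<in> E \<and> \<alpha> (point (affp x y)) = point (affp \<xi> \<eta>)" if "(x, y) \<in> E" for x y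
  proof -
    have xy: "point (affp x y) \<in> pts C" using that affine_in_C by blast
    have "\<alpha> (point (affp x y)) \<noteq> origin"
      using inj_onD[OF inj _ xy e2_in_C] orig affine_neq_e2 by metis
    with regular_map_in[OF reg xy] show ?thesis by (cases rule: pts_C_cases) auto
  qed
  then obtain \<xi> \<eta> where \<xi>: "\<And>x y. (x, y) \<in> E \<Longrightarrow> (\<xi> x y, \<eta> x y) \<in> E"
    "\<And>x y. (x, y) \<in> E \<Longrightarrow> \<alpha> (point (affp x y)) = point (affp (\<xi> x y) (\<eta> x y))" by metis
  \<comment> \<open>The third homogeneous coordinate of a local representation is a common
    denominator of both affine coordinates.\<close>
  have loc: "\<exists>h k l. polE h \<and> polE k \<and> polE l \<and> h x y \<noteq> 0 \<and>
     (\<forall>x' y'. y'\<^sup>2 = poly f x' \<longrightarrow> h x' y' * \<xi> x' y' = k x' y' \<and> h x' y' * \<eta> x' y' = l x' y')"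
    if y: "y\<^sup>2 = poly f x" for x y
  proof -
    have xy: "point (affp x y) \<in> pts C" using y affine_in_C by blast
    obtain d h w where h: "form_vec d h" "w \<noteq> 0" "point (affp x y) = point w" "h w \<noteq> 0"
      "\<forall>v. v \<noteq> 0 \<longrightarrow> point v \<in> pts C \<longrightarrow> h v \<noteq> 0 \<longrightarrow> \<alpha> (point v) = point (h v)"
      using regular_mapE[OF reg xy] .
    obtain k where "k \<noteq> 0" "w = k *s affp x y" using h(2,3) point_eq_iff[OF affine_nonzero h(2)] by auto
    then have hxy: "h (affp x y) \<noteq> 0" using h(4) form_vec_scale[OF h(1), of k "affp x y"] by auto
    have pol: "polE (\<lambda>x y. coord (h (affp x y)) $ i)" for i
      by (rule polE_form[OF form_fun_coord'[OF h(1)]])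
    have eq: "h (affp x' y') = coord (h (affp x' y')) $ 3 *s affp (\<xi> x' y') (\<eta> x' y')" if y': "y'\<^sup>2 = poly f x'" for x' y'
    proof (cases "h (affp x' y') = 0")
      case True
      then show ?thesis by (simp add: coord_def det3_zero)
    next
      case False
      have E': "(x', y') \<in> E" using y' by blast
      then have "point (h (affp x' y')) = point (affp (\<xi> x' y') (\<eta> x' y'))"
        using h(5) affine_nonzero False \<xi>(2)[OF E'] affine_in_C by metis
      then obtain k where k: "h (affp x' y') = k *s affp (\<xi> x' y') (\<eta> x' y')"
        using point_eq_iff[OF affine_nonzero False] by metis
      have "coord (h (affp x' y')) $ 3 = k" unfolding k coord_scale coord_affine by simp
      with k show ?thesis by simp
    qed
    have "coord (h (affp x' y')) $ 3 * \<xi> x' y' = coord (h (affp x' y')) $ 1 \<and>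
       coord (h (affp x' y')) $ 3 * \<eta> x' y' = coord (h (affp x' y')) $ 2" if y': "y'\<^sup>2 = poly f x'" for x' y'
    proof -
      have c: "coord (h (affp x' y')) = coord (h (affp x' y')) $ 3 *s vector [\<xi> x' y', \<eta> x' y', 1]"
        by (rule trans[OF arg_cong[OF eq[OF y'], of coord]]) (simp only: coord_scale coord_affine)
      show ?thesis using arg_cong[OF c, of "\<lambda>v. v $ 1"] arg_cong[OF c, of "\<lambda>v. v $ 2"] by simp
    qed
    moreover have "coord (h (affp x y)) $ 3 \<noteq> 0" using eq[OF y] hxy by auto
    ultimately show ?thesis using pol by blast
  qed
  have "polE \<xi>" by (rule regular_function) (use loc in blast)
  then obtain A B where AB: "\<And>x y. y\<^sup>2 = poly f x \<Longrightarrow> \<xi> x y = poly A x + poly B x * y" using polEE by blast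
  have "polE \<eta>" by (rule regular_function) (use loc in blast)
  then obtain A' B' where AB': "\<And>x y. y\<^sup>2 = poly f x \<Longrightarrow> \<eta> x y = poly A' x + poly B' x * y" using polEE by blast
  \<comment> \<open>On a fibre of the new x-coordinate the new y-coordinate takes at most two
    values, and by injectivity it determines the point.\<close>
  have "card S \<le> 2" if S: "finite S" "S \<subseteq> {(x, y) \<in> E. poly A x + poly B x * y = k}" for k S
  proof -
    have S': "(x, y) \<in> E \<and> \<xi> x y = k" if "(x, y) \<in> S" for x y using S(2) that AB by auto
    have "inj_on (\<lambda>(x, y). \<eta> x y) S"
    proof (rule inj_onI, clarify)
      fix x y x' y' assume *: "(x, y) \<in> S" "(x', y') \<in> S" "\<eta> x y = \<eta> x' y'"
      then have "\<alpha> (point (affp x y)) = \<alpha> (point (affp x' y'))" using S' \<xi>(2) by metis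
      then have "point (affp x y) = point (affp x' y')"
        using inj_onD[OF inj] S' * affine_in_C by metis
      then show "x = x' \<and> y = y'" by (simp add: affine_inject)
    qed
    moreover have "(\<lambda>(x, y). \<eta> x y) ` S \<subseteq> {y. y\<^sup>2 = poly f k}"
      using S' \<xi>(1) by fastforce
    ultimately have "card S \<le> card {y. y\<^sup>2 = poly f k}"
      using finite_fibre card_inj_on_le by blast
    also have "\<dots> \<le> 2" by (rule card_fibre)
    finally show ?thesis .
  qed
  then have "B = 0 \<and> degree A = 1" by (rule two_to_one)
  then have B: "B = 0" "degree A = 1" by auto
  define u r where "u = Polynomial.coeff A 1" and "r = Polynomial.coeff A 0"
  have A: "A = [:r, u:]" using B(2) unfolding u_def r_def
    by (intro poly_eqI) (auto simp: coeff_pCons coeff_eq_0 split: nat.splits)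
  have "u \<noteq> 0" using B(2) A by auto
  have \<xi>_eq: "\<xi> x y = u * x + r" if "y\<^sup>2 = poly f x" for x y using AB[OF that] by (simp add: A B algebra_simps)
  let ?fA = "pcompose f A"
  \<comment> \<open>The image satisfies the equation of the curve. Comparing the parts without y and
    with y shows that one of A', B' is zero, and the odd degree of f composed with A rules out B' =
    0.\<close>
  have "poly (A'\<^sup>2 + B'\<^sup>2 * f - ?fA) x + poly (2 * A' * B') x * y = 0" if y: "y\<^sup>2 = poly f x" for x y
  proof -
    have "(poly A' x + poly B' x * y)\<^sup>2 = poly f (poly A x)"
      using \<xi>(1)[of x y] y AB'[OF y] \<xi>_eq[OF y] by (simp add: A algebra_simps)
    then have "(poly A' x)\<^sup>2 + (poly B' x)\<^sup>2 * y\<^sup>2 - poly f (poly A x) + 2 * poly A' x * poly B' x * y = 0"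
      by (simp add: power2_eq_square algebra_simps del: poly_pCons)
    then show ?thesis unfolding y poly_diff poly_add poly_mult poly_power poly_pcompose by (simp del: poly_pCons)
  qed
  then have 0: "A'\<^sup>2 + B'\<^sup>2 * f = ?fA" "A' * B' = 0"
    using polE_zero_all[of "A'\<^sup>2 + B'\<^sup>2 * f - ?fA" "2 * A' * B'"] by auto
  have deg_fA: "degree ?fA = 3" by (simp add: degree_pcompose B(2) del: pcompose_pCons)
  have "B' \<noteq> 0"
  proof
    assume "B' = 0"
    then have "degree ?fA = 2 * degree A'" using 0(1) by (cases "A' = 0") (simp_all add: degree_power_eq flip: 0(1))
    then show False using deg_fA by presburger
  qed
  then have "A' = 0" using 0(2) by simp
  then have "degree (B'\<^sup>2 * f) = 3" using 0(1) deg_fA by (simp del: mult_pCons_right pcompose_pCons)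
  then have "degree B' = 0" using \<open>B' \<noteq> 0\<close> by (simp add: degree_mult_eq degree_power_eq del: mult_pCons_right)
  then obtain s where s: "B' = [:s:]" by (metis degree_eq_zeroE)
  have "s \<noteq> 0" using s \<open>B' \<noteq> 0\<close> by auto
  have "poly f (u * x + r) = s\<^sup>2 * poly f x" for x
    using arg_cong[OF 0(1), of "\<lambda>p. poly p x"] unfolding \<open>A' = 0\<close> poly_pcompose poly_add poly_mult poly_power
    by (simp add: s A add.commute mult.commute[of u] del: poly_pCons) (simp add: add.commute mult.commute)
  then have "(u, r, s) \<in> autos" using \<open>u \<noteq> 0\<close> \<open>s \<noteq> 0\<close> unfolding autos_def by blast
  moreover have "\<alpha> (point (affp x y)) = point (affp (u * x + r) (s * y))" if "(x, y) \<in> E" for x y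
    using \<xi>(2)[OF that] \<xi>_eq[of y x] AB'[of y x] that by (simp add: s \<open>A' = 0\<close>)
  ultimately show ?thesis by (rule that)
qed

text \<open>Each \<open>\<Phi> p\<close> is given by one of finitely many triples, so by the
  pigeonhole principle infinitely many p share a triple. For fixed x the map p |->
  \<open>\<Phi> p x\<close> then agrees with a constant at infinitely many p, hence
  everywhere.\<close>

lemma rigidity:
  assumes reg: "\<And>p. p \<in> pts C \<Longrightarrow> regular_map C C (\<Phi> p)"
    and inj: "\<And>p. p \<in> pts C \<Longrightarrow> inj_on (\<Phi> p) (pts C)"
    and orig: "\<And>p. p \<in> pts C \<Longrightarrow> \<Phi> p origin = origin"
    and reg': "\<And>x. x \<in> pts C \<Longrightarrow> regular_map C C (\<lambda>p. \<Phi> p x)"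
    and p: "p \<in> pts C" "q \<in> pts C" "x \<in> pts C"
  shows "\<Phi> p x = \<Phi> q x"
proof -
  define h where "h = (\<lambda>(u, r, s) x y. point (affp (u * x + r) (s * y)))"
  have "\<exists>t\<in>autos. \<forall>(x, y)\<in>E. \<Phi> p (point (affp x y)) = h t x y" if p: "p \<in> pts C" for p
  proof -
    obtain u r s where "(u, r, s) \<in> autos"
      "\<And>x y. (x, y) \<in> E \<Longrightarrow> \<Phi> p (point (affp x y)) = point (affp (u * x + r) (s * y))"
      using automorphism_fixing_origin[OF reg[OF p] inj[OF p] orig[OF p]] by blast
    then show ?thesis unfolding h_def by (intro bexI[of _ "(u, r, s)"]) auto
  qed
  then have "\<forall>p\<in>pts C. \<exists>t. t \<in> autos \<and> (\<forall>(x, y)\<in>E. \<Phi> p (point (affp x y)) = h t x y)" by blast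
  from bchoice[OF this] obtain \<tau> where
    "\<forall>p\<in>pts C. \<tau> p \<in> autos \<and> (\<forall>(x, y)\<in>E. \<Phi> p (point (affp x y)) = h (\<tau> p) x y)" ..
  then have \<tau>: "\<And>p. p \<in> pts C \<Longrightarrow> \<tau> p \<in> autos"
    "\<And>p. p \<in> pts C \<Longrightarrow> \<forall>(x, y)\<in>E. \<Phi> p (point (affp x y)) = h (\<tau> p) x y" by blast+
  have "\<tau> ` pts C \<subseteq> autos" using \<tau>(1) by blast
  then have "finite (\<tau> ` pts C)" using finite_autos finite_subset by blast
  then obtain p0 where p0: "p0 \<in> pts C" "infinite {p \<in> pts C. \<tau> p = \<tau> p0}"
    using pigeonhole_infinite[OF infinite_pts] by blast
  have "\<Phi> p x = \<Phi> p0 x" if "p \<in> pts C" for p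
    using \<open>x \<in> pts C\<close>
  proof (cases rule: pts_C_cases)
    case infinity
    then show ?thesis using orig that p0(1) by simp
  next
    case (affine s t)
    show ?thesis
    proof (rule regular_maps_equal[OF reg'[OF p(3)] _ p0(2) _ _ that])
      show "regular_map C C (\<lambda>p. \<Phi> p0 x)" by (intro regular_map_const regular_map_in[OF reg] p0 p)
      show "{p \<in> pts C. \<tau> p = \<tau> p0} \<subseteq> pts C" by blast
      fix p assume "p \<in> {p \<in> pts C. \<tau> p = \<tau> p0}"
      then show "\<Phi> p x = \<Phi> p0 x" using \<tau>(2)[of p] \<tau>(2)[of p0] p0(1) affine by auto
    qed
  qed
  from this[OF p(1)] this[OF p(2)] show ?thesis by simp
qed

section \<open>The group law\<close>

definition curve_group :: "'a pt monoid" where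
  "curve_group = \<lparr>carrier = pts C, monoid.mult = (\<lambda>x y. origin \<star> (x \<star> y)), one = origin\<rparr>"

lemma curve_group_simps [simp]: "carrier curve_group = pts C" "one curve_group = origin"
  by (simp_all add: curve_group_def)

lemma curve_group_mult: "monoid.mult curve_group x y = origin \<star> (x \<star> y)"
  by (simp add: curve_group_def)

lemma chord_eq_iff: "x \<in> pts C \<Longrightarrow> y \<in> pts C \<Longrightarrow> z \<in> pts C \<Longrightarrow> x \<star> y = x \<star> z \<longleftrightarrow> y = z"
  using chord_cancel by blast

lemma chord_origin_chord: "x \<in> pts C \<Longrightarrow> x \<star> (origin \<star> x) = origin"
  using chord_commute[OF e2_in_C, of x] chord_chord[of x origin] e2_in_C by simp

text \<open>\<open>\<Phi> p z\<close> is the solution z' of (p + y) + z' = p + (y + z). As an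
  automorphism fixing the origin it does not depend on p, and for p equal to the origin it is the
  identity.\<close>

lemma chord_assoc:
  assumes x: "x \<in> pts C" and y: "y \<in> pts C" and z: "z \<in> pts C"
  shows "origin \<star> (x \<star> (origin \<star> (y \<star> z))) = origin \<star> ((origin \<star> (x \<star> y)) \<star> z)"
proof -
  note [simp] = chord_in e2_in_C
  define \<Phi> where "\<Phi> p z = (origin \<star> (p \<star> y)) \<star> (origin \<star> (origin \<star> (p \<star> (origin \<star> (y \<star> z)))))" for p z
  have "\<Phi> x z = \<Phi> origin z"
  proof (rule rigidity[where \<Phi> = \<Phi>])
    fix p assume p: "p \<in> pts C"
    show "regular_map C C (\<Phi> p)" "regular_map C C (\<lambda>q. \<Phi> q p)"
      unfolding \<Phi>_def
      by (intro chord_regular regular_map_const regular_map_id chord_in e2_in_C p y)+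
    show "inj_on (\<Phi> p) (pts C)"
    proof (rule inj_onI)
      fix u v assume "u \<in> pts C" "v \<in> pts C" "\<Phi> p u = \<Phi> p v"
      then show "u = v" unfolding \<Phi>_def using p y by (simp add: chord_eq_iff)
    qed
    have "\<Phi> p origin = (origin \<star> (p \<star> y)) \<star> (origin \<star> (origin \<star> (p \<star> y)))"
      unfolding \<Phi>_def using p y chord_commute[OF y e2_in_C] chord_chord[OF e2_in_C y] by simp
    also have "\<dots> = origin" by (rule chord_origin_chord) (use p y in simp)
    finally show "\<Phi> p origin = origin" .
  qed (use x z in auto)
  also have "\<Phi> origin z = y \<star> (origin \<star> (origin \<star> (y \<star> z)))"
    unfolding \<Phi>_def using y z by (simp add: chord_chord)
  also have "\<dots> = z" using y z by (simp add: chord_chord)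
  finally have "(origin \<star> (x \<star> y)) \<star> z = (origin \<star> (x \<star> y)) \<star> \<Phi> x z" by simp
  also have "\<dots> = origin \<star> (origin \<star> (x \<star> (origin \<star> (y \<star> z))))"
    unfolding \<Phi>_def using x y z by (simp add: chord_chord)
  finally show ?thesis using x y z by (simp add: chord_chord)
qed

sublocale G: comm_group curve_group
proof (rule comm_groupI)
  fix x y z assume "x \<in> carrier curve_group" "y \<in> carrier curve_group" "z \<in> carrier curve_group"
  then show "(x \<otimes>\<^bsub>curve_group\<^esub> y) \<otimes>\<^bsub>curve_group\<^esub> z = x \<otimes>\<^bsub>curve_group\<^esub> (y \<otimes>\<^bsub>curve_group\<^esub> z)"
    using chord_assoc by (simp add: curve_group_mult)
next
  fix x assume "x \<in> carrier curve_group"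
  then show "\<exists>y\<in>carrier curve_group. y \<otimes>\<^bsub>curve_group\<^esub> x = \<one>\<^bsub>curve_group\<^esub>"
    using chord_origin_chord[of x] chord_commute[of x "origin \<star> x"] chord_in[OF e2_in_C, of x]
    by (intro bexI[of _ "origin \<star> x"]) (simp_all add: curve_group_mult origin_chord_origin)
next
  fix x y assume "x \<in> carrier curve_group" "y \<in> carrier curve_group"
  then show "x \<otimes>\<^bsub>curve_group\<^esub> y = y \<otimes>\<^bsub>curve_group\<^esub> x"
    using chord_commute[of x y] by (simp add: curve_group_mult)
qed (auto simp: curve_group_mult chord_in e2_in_C chord_chord)

lemma G_inv: "x \<in> pts C \<Longrightarrow> inv\<^bsub>curve_group\<^esub> x = origin \<star> x"
  using chord_origin_chord[of x] chord_in[OF e2_in_C, of x]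
  by (intro G.inv_unique'[symmetric]) (simp_all add: curve_group_mult origin_chord_origin chord_commute)

lemma chord_eq_inv: "x \<in> pts C \<Longrightarrow> y \<in> pts C \<Longrightarrow> x \<star> y = inv\<^bsub>curve_group\<^esub> (x \<otimes>\<^bsub>curve_group\<^esub> y)"
  by (subst G_inv) (simp_all add: curve_group_mult chord_in e2_in_C chord_chord)

end

lemma (in group) ord_eq_2: "x \<in> carrier G \<Longrightarrow> ord x = 2 \<longleftrightarrow> x \<otimes> x = \<one> \<and> x \<noteq> \<one>"
proof -
  assume x: "x \<in> carrier G"
  have "x \<otimes> x = \<one> \<longleftrightarrow> ord x dvd 2" using pow_eq_id[OF x, of 2] x by (simp add: numeral_2_eq_2)
  also have "\<dots> \<longleftrightarrow> ord x = 1 \<or> ord x = 2"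
    by (metis One_nat_def dvd_refl one_dvd prime_nat_iff two_is_prime_nat)
  finally show ?thesis using ord_eq_1[OF x] by auto
qed

context weierstrass
begin

abbreviation padd (infixl "\<oplus>\<^sub>C" 65) where "x \<oplus>\<^sub>C y \<equiv> x \<otimes>\<^bsub>curve_group\<^esub> y"
abbreviation pneg ("\<ominus>\<^sub>C _" [81] 80) where "\<ominus>\<^sub>C x \<equiv> inv\<^bsub>curve_group\<^esub> x"

lemmas padd_closed [simp] = G.m_closed[simplified]
lemmas pneg_closed [simp] = G.inv_closed[simplified]
lemmas padd_assoc = G.m_assoc[simplified]
lemmas padd_commute = G.m_comm[simplified]
lemmas padd_left_commute = G.m_lcomm[simplified]
lemmas padd_ac = padd_assoc padd_commute padd_left_commute
lemmas origin_in [simp] = e2_in_C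
lemmas padd_origin [simp] = G.r_one[simplified] G.l_one[simplified]

lemma padd_pneg_cancel [simp]:
  "x \<in> pts C \<Longrightarrow> y \<in> pts C \<Longrightarrow> x \<oplus>\<^sub>C (\<ominus>\<^sub>C x \<oplus>\<^sub>C y) = y"
  "x \<in> pts C \<Longrightarrow> y \<in> pts C \<Longrightarrow> \<ominus>\<^sub>C x \<oplus>\<^sub>C (x \<oplus>\<^sub>C y) = y"
  by (simp_all flip: padd_assoc)

lemma padd_cancel [simp]:
  "x \<in> pts C \<Longrightarrow> y \<in> pts C \<Longrightarrow> z \<in> pts C \<Longrightarrow> x \<oplus>\<^sub>C y = x \<oplus>\<^sub>C z \<longleftrightarrow> y = z"
  "x \<in> pts C \<Longrightarrow> y \<in> pts C \<Longrightarrow> z \<in> pts C \<Longrightarrow> y \<oplus>\<^sub>C x = z \<oplus>\<^sub>C x \<longleftrightarrow> y = z"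
  by auto

lemma padd_regular: "regular_map B C g \<Longrightarrow> regular_map B C h \<Longrightarrow> regular_map B C (\<lambda>x. g x \<oplus>\<^sub>C h x)"
  unfolding curve_group_mult by (intro chord_regular regular_map_const e2_in_C)

lemma pneg_regular:
  assumes "regular_map B C g"
  shows "regular_map B C (\<lambda>x. \<ominus>\<^sub>C g x)"
proof (rule regular_map_cong)
  show "regular_map B C (\<lambda>x. origin \<star> g x)" by (intro chord_regular regular_map_const e2_in_C assms)
  show "\<ominus>\<^sub>C g x = origin \<star> g x" if "x \<in> pts B" for x
    by (intro G_inv regular_map_in[OF assms] that)
qed

lemma pneg_affine: "(x, y) \<in> E \<Longrightarrow> \<ominus>\<^sub>C point (affp x y) = point (affp x (- y))"
  using G_inv[of "point (affp x y)"] origin_chord_affine[of y x] affine_in_C by simp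

section \<open>Fixed-point-free involutions\<close>

text \<open>The slope of the tangent through \<open>p\<close> is a root of a discriminant of degree four.\<close>

lemma halving:
  assumes "p \<in> pts C"
  obtains x where "x \<in> pts C" "p \<star> x = x"
  using assms
proof (cases rule: pts_C_cases)
  case infinity
  \<comment> \<open>The tangents through the point at infinity are the vertical lines at points with
    y = 0.\<close>
  have "card {x. poly f x = 0} \<noteq> 0" by (simp only: card_f_roots)
  then obtain r where r: "poly f r = 0" by (metis (mono_tags, lifting) Collect_empty_eq card.empty)
  then have "(r, 0) \<in> E" by simp
  then have "point (affp r 0) \<in> pts C" "origin \<star> point (affp r 0) = point (affp r (- 0))"
    using affine_in_C origin_chord_affine by blast+
  then show ?thesis using that infinity by simp
next
  case (affine x0 y0)
  let ?g = "3 * x0 + a" and ?h = "3 * x0\<^sup>2 + 2 * a * x0 + b"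
  \<comment> \<open>The line of slope m through (x0, y0) meets the curve in two further points,
    given by t^2 + k t + (\<open>?h\<close> - 2 y0 m) = 0 with k = \<open>?g\<close> - m^2. The
    quartic is the discriminant of this quadratic.\<close>
  obtain m where m: "poly [:?g\<^sup>2 - 4 * ?h, 8 * y0, - 2 * ?g, 0, 1:] m = 0"
    using alg_closed_imp_poly_has_root[of "[:?g\<^sup>2 - 4 * ?h, 8 * y0, - 2 * ?g, 0, 1:]"] by auto
  define k where "k = ?g - m\<^sup>2"
  have disc: "k\<^sup>2 = 4 * (?h - 2 * y0 * m)"
    using m by (simp add: k_def power2_eq_square algebra_simps)
  have y0: "y0\<^sup>2 = x0 ^ 3 + a * x0\<^sup>2 + b * x0 + c" using affine(1) unfolding poly_f by blast
  let ?p = "affp x0 y0" and ?q = "1 *s e1 + m *s e2"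
  have "line_cycle F (1 *s ?p + 0 *s ?q) (1 *s ?p + (- k / 2) *s ?q) (1 *s ?p + (- k / 2) *s ?q)"
  proof (rule line_cycleI[where k = 1])
    have "det3 ?p ?q e2 = det3 e1 e2 e3" by (simp add: det3_def dot3_def algebra_simps)
    then show "cross ?p ?q \<noteq> 0" using det3_cross basis by metis
    fix s t
    have "s *s ?p + t *s ?q = (s * x0 + t) *s e1 + (s * y0 + t * m) *s e2 + s *s e3"
      by (simp add: vec3_eq_iff algebra_simps)
    then have "peval F (s *s ?p + t *s ?q) = (s * y0 + t * m)\<^sup>2 * s - (s * x0 + t) ^ 3 - a * (s * x0 + t)\<^sup>2 * s
        - b * (s * x0 + t) * s\<^sup>2 - c * s ^ 3"
      by (simp only: equation)
    also have "\<dots> = s ^ 3 * (y0\<^sup>2 - (x0 ^ 3 + a * x0\<^sup>2 + b * x0 + c)) - t * (t\<^sup>2 + k * (s * t) + (?h - 2 * y0 * m) * s\<^sup>2)"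
      by (simp add: k_def power2_eq_square power3_eq_cube algebra_simps)
    also have "\<dots> = - t * (t\<^sup>2 + k * (s * t) + (?h - 2 * y0 * m) * s\<^sup>2)" by (simp add: y0)
    also have "?h - 2 * y0 * m = k\<^sup>2 / 4" unfolding disc by simp
    also have "- t * (t\<^sup>2 + k * (s * t) + k\<^sup>2 / 4 * s\<^sup>2) = 1 * ((s * 0 - t * 1) * (s * (- k / 2) - t * 1) * (s * (- k / 2) - t * 1))"
      by (simp add: power2_eq_square field_simps)
    finally show "peval F (s *s ?p + t *s ?q) = 1 * ((s * 0 - t * 1) * (s * (- k / 2) - t * 1) * (s * (- k / 2) - t * 1))" .
  qed auto
  then have l: "line_cycle F ?p (?p + (- k / 2) *s ?q) (?p + (- k / 2) *s ?q)" by simp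
  let ?z = "point (?p + (- k / 2) *s ?q)"
  have "p \<star> ?z = ?z" using chord_eq[OF l] affine(2) by simp
  moreover have "?z \<in> pts C" using line_cycle_on_curve[OF l] line_cycle_nonzero[OF l] in_C by blast
  ultimately show ?thesis using that by blast
qed

abbreviation "two_torsion \<equiv> {t \<in> pts C. t \<oplus>\<^sub>C t = origin \<and> t \<noteq> origin}"

lemma two_torsion_eq: "two_torsion = (\<lambda>r. point (affp r 0)) ` {r. poly f r = 0}"
proof -
  have iff: "t \<oplus>\<^sub>C t = origin \<longleftrightarrow> \<ominus>\<^sub>C t = t" if "t \<in> pts C" for t
    using that G.inv_equality[of t t] G.l_inv[of t] by (metis curve_group_simps)
  have "point (affp r 0) \<in> two_torsion" if "poly f r = 0" for r
  proof -
    have "(r, 0) \<in> E" using that by simp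
    moreover from this have "point (affp r 0) \<in> pts C" using affine_in_C by blast
    moreover have "\<ominus>\<^sub>C point (affp r 0) = point (affp r 0)" using pneg_affine[OF \<open>(r, 0) \<in> E\<close>] by simp
    moreover have "point (affp r 0) \<noteq> origin" by (rule affine_neq_e2)
    ultimately show ?thesis using iff by blast
  qed
  moreover have "t \<in> (\<lambda>r. point (affp r 0)) ` {r. poly f r = 0}" if t: "t \<in> two_torsion" for t
  proof -
    have tC: "t \<in> pts C" using t by simp
    then show ?thesis
    proof (cases rule: pts_C_cases)
      case infinity
      then show ?thesis using t by simp
    next
      case (affine r s)
      have "\<ominus>\<^sub>C t = t" using t iff tC by blast
      then have "- s = s" using pneg_affine[OF affine(1)] unfolding affine(2) by (metis affine_inject)
      then have "s = 0" by (simp add: eq_neg_iff_add_eq_0 neg_eq_iff_add_eq_0)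
      then show ?thesis using affine by auto
    qed
  qed
  ultimately show ?thesis by blast
qed

lemma card_two_torsion: "card two_torsion = 3"
proof -
  have "inj_on (\<lambda>r. point (affp r 0)) {r. poly f r = 0}" by (rule inj_onI) (metis affine_inject)
  then show ?thesis unfolding two_torsion_eq by (simp only: card_image card_f_roots)
qed

lemma translation_involution:
  assumes "t \<in> two_torsion"
  shows "(\<lambda>x\<in>pts C. t \<oplus>\<^sub>C x) \<in> fpf_involutions C"
proof -
  have t: "t \<in> pts C" "t \<oplus>\<^sub>C t = origin" "t \<noteq> origin" using assms by auto
  have "regular_map C C (\<lambda>x\<in>pts C. t \<oplus>\<^sub>C x)"
    by (rule regular_map_cong[OF padd_regular[OF regular_map_const[OF t(1)] regular_map_id]]) simp
  moreover have "t \<oplus>\<^sub>C (t \<oplus>\<^sub>C x) = x" if "x \<in> pts C" for x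
    using that t by (simp flip: padd_assoc)
  moreover have "t \<oplus>\<^sub>C x \<noteq> x" if "x \<in> pts C" for x
    using that t padd_cancel(2)[of x t origin] by simp
  ultimately show ?thesis unfolding fpf_involutions_def using t by simp
qed

lemma involution_translation:
  assumes "i \<in> fpf_involutions C"
  shows "\<exists>t\<in>two_torsion. i = (\<lambda>x\<in>pts C. t \<oplus>\<^sub>C x)"
proof -
  have ext: "i \<in> extensional (pts C)" and reg: "regular_map C C i"
    and inv: "\<And>x. x \<in> pts C \<Longrightarrow> i (i x) = x" and fpf: "\<And>x. x \<in> pts C \<Longrightarrow> i x \<noteq> x"
    using assms by (auto simp: fpf_involutions_def)
  have iC [simp]: "i x \<in> pts C" if "x \<in> pts C" for x using regular_map_in[OF reg that] .
  define t where "t = i origin"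
  have t [simp]: "t \<in> pts C" by (simp add: t_def)
  \<comment> \<open>The map x |-> i(p + x) - i(p) fixes the origin, so by rigidity it does not
    depend on p. Consequently i(p + x) = i(p) + \<alpha>(x).\<close>
  define \<Phi> where "\<Phi> p x = i (p \<oplus>\<^sub>C x) \<oplus>\<^sub>C \<ominus>\<^sub>C i p" for p x
  have \<Phi>: "regular_map C C (\<Phi> p)" "inj_on (\<Phi> p) (pts C)" "\<Phi> p origin = origin"
    "regular_map C C (\<lambda>q. \<Phi> q p)" if p: "p \<in> pts C" for p
  proof -
    show "regular_map C C (\<Phi> p)" "regular_map C C (\<lambda>q. \<Phi> q p)"
      unfolding \<Phi>_def
      by (intro padd_regular pneg_regular regular_map_compose[OF _ reg] regular_map_const regular_map_id p
          iC)+
    show "inj_on (\<Phi> p) (pts C)"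
    proof (rule inj_onI)
      fix x y assume xy: "x \<in> pts C" "y \<in> pts C" "\<Phi> p x = \<Phi> p y"
      then have "i (p \<oplus>\<^sub>C x) = i (p \<oplus>\<^sub>C y)" using p by (simp add: \<Phi>_def)
      then have "i (i (p \<oplus>\<^sub>C x)) = i (i (p \<oplus>\<^sub>C y))" by simp
      then have "p \<oplus>\<^sub>C x = p \<oplus>\<^sub>C y" using inv xy p by simp
      then show "x = y" using xy p by simp
    qed
    show "\<Phi> p origin = origin" using p by (simp add: \<Phi>_def)
  qed
  define \<alpha> where "\<alpha> = \<Phi> origin"
  have rig: "\<Phi> p x = \<alpha> x" if "p \<in> pts C" "x \<in> pts C" for p x
    unfolding \<alpha>_def using that by (intro rigidity[where \<Phi> = \<Phi>] \<Phi>) auto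
  have \<alpha>C [simp]: "\<alpha> x \<in> pts C" if "x \<in> pts C" for x
    unfolding \<alpha>_def using \<Phi>(1)[OF origin_in] that by (rule regular_map_in)
  have i_add: "i (p \<oplus>\<^sub>C x) = i p \<oplus>\<^sub>C \<alpha> x" if "p \<in> pts C" "x \<in> pts C" for p x
    using rig[OF that] that by (simp add: \<Phi>_def flip: rig[OF that]) (simp add: padd_ac)
  have i_eq: "i x = t \<oplus>\<^sub>C \<alpha> x" if "x \<in> pts C" for x
    using i_add[of origin x] that by (simp add: t_def)
  have it: "i t = origin" using inv[of origin] by (simp add: t_def)
  have \<alpha>\<alpha>: "\<alpha> (\<alpha> x) = x" if "x \<in> pts C" for x
    using inv[OF that] i_eq[OF that] i_add[of t "\<alpha> x"] that it by simp
  obtain u r s where urs: "(u, r, s) \<in> autos"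
    "\<And>x y. (x, y) \<in> E \<Longrightarrow> \<alpha> (point (affp x y)) = point (affp (u * x + r) (s * y))"
    using automorphism_fixing_origin[of \<alpha>] \<Phi>[OF origin_in] unfolding \<alpha>_def by metis
  have twice: "u * (u * x + r) + r = x \<and> s * (s * y) = y" if xy: "(x, y) \<in> E" for x y
  proof -
    have "point (affp x y) \<in> pts C" using xy affine_in_C by blast
    moreover have "(u * x + r, s * y) \<in> E"
    proof -
      have "point (affp (u * x + r) (s * y)) \<in> pts C" using \<alpha>C calculation urs(2)[OF xy] by metis
      then show ?thesis using affine_in_C by blast
    qed
    ultimately have "point (affp (u * (u * x + r) + r) (s * (s * y))) = point (affp x y)"
      using \<alpha>\<alpha> urs(2) xy by metis
    then show ?thesis by (simp only: affine_inject)
  qed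
  \<comment> \<open>The identity \<alpha>(\<alpha>(x)) = x is read off at the abscissas 0 and
    1.\<close>
  have us: "u\<^sup>2 = 1 \<and> u * r + r = 0"
  proof -
    obtain y0 where "(0, y0) \<in> E" by (rule E_fibre)
    moreover obtain y1 where "(1, y1) \<in> E" by (rule E_fibre)
    ultimately have "u * r + r = 0" "u * (u + r) + r = 1" using twice[of 0 y0] twice[of 1 y1] by auto
    moreover have "u * (u + r) + r = u\<^sup>2 + (u * r + r)" by (simp add: power2_eq_square algebra_simps)
    ultimately show ?thesis by simp
  qed
  have s2: "s\<^sup>2 = 1"
  proof -
    have "finite {x. poly f x = 0}" by (rule poly_roots_finite) simp
    then obtain x where x: "poly f x \<noteq> 0" using infinite_field ex_new_if_finite by blast
    obtain y where y: "(x, y) \<in> E" by (rule E_fibre)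
    then have "y \<noteq> 0" using x by auto
    moreover have "s * (s * y) = y" using twice[OF y] by blast
    ultimately show ?thesis by (simp add: power2_eq_square)
  qed
  \<comment> \<open>u^2 = 1 and u^3 = s^2 = 1 leave only u = 1, and only s remains undetermined up
    to sign.\<close>
  have u1: "u = 1"
  proof -
    have "u ^ 3 = u * u\<^sup>2" by (simp add: power2_eq_square power3_eq_cube)
    then show ?thesis using us s2 autos_cube[OF urs(1)] by simp
  qed
  then have r0: "r = 0" using us by simp
  have "s \<noteq> - 1"
  proof
    assume s: "s = - 1"
    have \<alpha>_neg: "\<alpha> x = \<ominus>\<^sub>C x" if x: "x \<in> pts C" for x
      using x
    proof (cases rule: pts_C_cases)
      case infinity
      then show ?thesis using \<Phi>(3)[OF origin_in] G.inv_one by (simp add: \<alpha>_def)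
    next
      case (affine y z)
      then show ?thesis using urs(2)[OF affine(1)] pneg_affine[OF affine(1)] by (simp add: u1 r0 s)
    qed
    \<comment> \<open>If -t, x, x are collinear, then 2 x = t, so that x is fixed by x |-> t -
      x.\<close>
    obtain x where x: "x \<in> pts C" "(\<ominus>\<^sub>C t) \<star> x = x" using halving[of "\<ominus>\<^sub>C t"] by auto
    have "\<ominus>\<^sub>C (\<ominus>\<^sub>C t \<oplus>\<^sub>C x) = x" using chord_eq_inv[of "\<ominus>\<^sub>C t" x] x by simp
    moreover have "\<ominus>\<^sub>C (\<ominus>\<^sub>C t \<oplus>\<^sub>C x) = t \<oplus>\<^sub>C \<ominus>\<^sub>C x"
      using G.inv_mult[of "\<ominus>\<^sub>C t" x] G.inv_inv[of t] x by simp
    ultimately have "i x = x" using i_eq[OF x(1)] \<alpha>_neg[OF x(1)] by simp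
    then show False using fpf x by blast
  qed
  then have s1: "s = 1" using s2 by (auto simp: power2_eq_1_iff)
  have \<alpha>_id: "\<alpha> x = x" if x: "x \<in> pts C" for x
    using x
  proof (cases rule: pts_C_cases)
    case infinity
    then show ?thesis using \<Phi>(3)[OF origin_in] by (simp add: \<alpha>_def)
  next
    case (affine y z)
    then show ?thesis using urs(2)[OF affine(1)] by (simp add: u1 r0 s1)
  qed
  have "t \<oplus>\<^sub>C t = origin" using it i_eq[of t] \<alpha>_id[of t] by simp
  moreover have "t \<noteq> origin" using fpf[of origin] by (simp add: t_def)
  moreover have "i = (\<lambda>x\<in>pts C. t \<oplus>\<^sub>C x)"
    using ext i_eq \<alpha>_id by (intro extensionalityI[OF ext]) auto
  ultimately show ?thesis using t by blast
qed

lemma fpf_involutions_eq: "fpf_involutions C = (\<lambda>t. \<lambda>x\<in>pts C. t \<oplus>\<^sub>C x) ` two_torsion"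
proof (intro equalityI subsetI)
  fix i assume "i \<in> fpf_involutions C"
  then obtain t where "t \<in> two_torsion" "i = (\<lambda>x\<in>pts C. t \<oplus>\<^sub>C x)" using involution_translation[of i] by blast
  then show "i \<in> (\<lambda>t. \<lambda>x\<in>pts C. t \<oplus>\<^sub>C x) ` two_torsion" by (intro image_eqI)
qed (elim imageE, simp only: translation_involution)

lemma card_fpf_involutions: "card (fpf_involutions C) = 3"
proof -
  have "inj_on (\<lambda>t. \<lambda>x\<in>pts C. t \<oplus>\<^sub>C x) two_torsion"
  proof (rule inj_onI)
    fix t t' assume *: "t \<in> two_torsion" "t' \<in> two_torsion" "(\<lambda>x\<in>pts C. t \<oplus>\<^sub>C x) = (\<lambda>x\<in>pts C. t' \<oplus>\<^sub>C x)"
    from fun_cong[OF *(3), of origin] *(1,2) show "t = t'" by simp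
  qed
  then show ?thesis unfolding fpf_involutions_eq by (simp only: card_image card_two_torsion)
qed

section \<open>Algebraic group structures\<close>

text \<open>The law with neutral element o' is x + y - o', with inverse 2 o' - x. The chord
  expression provides regularity in two variables, and the expression in the known group provides
  the axioms.\<close>

lemma ex_algebraic_group:
  assumes o: "o' \<in> pts C"
  shows "\<exists>G. algebraic_group_on C G \<and> \<one>\<^bsub>G\<^esub> = o'"
proof -
  define G where "G = \<lparr>carrier = pts C, monoid.mult = (\<lambda>x y. o' \<star> (x \<star> y)), one = o'\<rparr>"
  have m: "x \<otimes>\<^bsub>G\<^esub> y = \<ominus>\<^sub>C o' \<oplus>\<^sub>C (x \<oplus>\<^sub>C y)" if "x \<in> pts C" "y \<in> pts C" for x y
    using that o chord_in[OF that] G.inv_mult[of o' "\<ominus>\<^sub>C (x \<oplus>\<^sub>C y)"] G.inv_inv[of "x \<oplus>\<^sub>C y"]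
    by (simp add: G_def chord_eq_inv)
  have grp: "group G"
  proof (rule groupI)
    fix x y z assume "x \<in> carrier G" "y \<in> carrier G" "z \<in> carrier G"
    then have "x \<in> pts C" "y \<in> pts C" "z \<in> pts C" by (simp_all add: G_def)
    then show "(x \<otimes>\<^bsub>G\<^esub> y) \<otimes>\<^bsub>G\<^esub> z = x \<otimes>\<^bsub>G\<^esub> (y \<otimes>\<^bsub>G\<^esub> z)" using o by (simp add: m padd_ac)
  next
    fix x assume "x \<in> carrier G"
    then have x: "x \<in> pts C" by (simp add: G_def)
    show "\<one>\<^bsub>G\<^esub> \<otimes>\<^bsub>G\<^esub> x = x" using x o m[OF o x] by (simp add: G_def)
    have "(o' \<oplus>\<^sub>C o' \<oplus>\<^sub>C \<ominus>\<^sub>C x) \<otimes>\<^bsub>G\<^esub> x = \<one>\<^bsub>G\<^esub>"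
      using x o by (simp add: m padd_assoc) (simp add: G_def)
    then show "\<exists>y\<in>carrier G. y \<otimes>\<^bsub>G\<^esub> x = \<one>\<^bsub>G\<^esub>"
      using x o by (intro bexI[of _ "o' \<oplus>\<^sub>C o' \<oplus>\<^sub>C \<ominus>\<^sub>C x"]) (simp_all add: G_def)
  qed (use o in \<open>simp_all add: G_def chord_in\<close>)
  have "regular_map2 C C C (mult G)"
    unfolding G_def using regular_map2_compose[OF chord_regular2 chord_regular[OF regular_map_const[OF o] regular_map_id]]
    by simp
  moreover have "regular_map C C (m_inv G)"
  proof (rule regular_map_cong)
    show "regular_map C C (\<lambda>x. o' \<oplus>\<^sub>C o' \<oplus>\<^sub>C \<ominus>\<^sub>C x)"
      by (intro padd_regular pneg_regular regular_map_const regular_map_id o padd_closed)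
    fix x assume x: "x \<in> pts C"
    have "(o' \<oplus>\<^sub>C o' \<oplus>\<^sub>C \<ominus>\<^sub>C x) \<otimes>\<^bsub>G\<^esub> x = \<one>\<^bsub>G\<^esub>"
      using x o by (simp add: m padd_assoc) (simp add: G_def)
    then show "inv\<^bsub>G\<^esub> x = o' \<oplus>\<^sub>C o' \<oplus>\<^sub>C \<ominus>\<^sub>C x"
      using x o by (intro group.inv_equality[OF grp]) (simp_all add: G_def)
  qed
  ultimately have "algebraic_group_on C G" using grp by (simp add: algebraic_group_on_def G_def)
  then show ?thesis by (intro exI[of _ G]) (simp add: G_def)
qed

text \<open>Rigidity for \<open>\<Phi> p x\<close>, the product of p and x + o' in \<open>G\<close>
  minus p: it fixes the origin because o' is neutral, and evaluation at p = o' identifies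
  it.\<close>

lemma algebraic_group_mult:
  assumes G: "algebraic_group_on C G" and x: "x \<in> pts C" and y: "y \<in> pts C"
  shows "x \<otimes>\<^bsub>G\<^esub> y = x \<oplus>\<^sub>C (y \<oplus>\<^sub>C \<ominus>\<^sub>C \<one>\<^bsub>G\<^esub>)"
proof -
  interpret H: group G using G by (simp add: algebraic_group_on_def)
  have car: "carrier G = pts C" and reg: "regular_map2 C C C (mult G)" using G by (auto simp: algebraic_group_on_def)
  define o' where "o' = \<one>\<^bsub>G\<^esub>"
  have o [simp]: "o' \<in> pts C" using H.one_closed by (simp add: o'_def car)
  have cl [simp]: "x \<otimes>\<^bsub>G\<^esub> y \<in> pts C" if "x \<in> pts C" "y \<in> pts C" for x y using H.m_closed that by (simp add: car)
  define \<Phi> where "\<Phi> p x = (p \<otimes>\<^bsub>G\<^esub> (x \<oplus>\<^sub>C o')) \<oplus>\<^sub>C \<ominus>\<^sub>C p" for p x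
  have rig: "\<Phi> x (y \<oplus>\<^sub>C \<ominus>\<^sub>C o') = \<Phi> o' (y \<oplus>\<^sub>C \<ominus>\<^sub>C o')"
  proof (rule rigidity[where \<Phi> = \<Phi>])
    fix p assume p: "p \<in> pts C"
    show "regular_map C C (\<Phi> p)" "regular_map C C (\<lambda>q. \<Phi> q p)"
      unfolding \<Phi>_def
      by (intro padd_regular pneg_regular regular_map_compose2[OF reg] regular_map_const regular_map_id p o padd_closed pneg_closed)+
    show "inj_on (\<Phi> p) (pts C)"
    proof (rule inj_onI)
      fix u v assume uv: "u \<in> pts C" "v \<in> pts C" "\<Phi> p u = \<Phi> p v"
      then have "p \<otimes>\<^bsub>G\<^esub> (u \<oplus>\<^sub>C o') = p \<otimes>\<^bsub>G\<^esub> (v \<oplus>\<^sub>C o')" using p by (simp add: \<Phi>_def)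
      then have "u \<oplus>\<^sub>C o' = v \<oplus>\<^sub>C o'" using uv p by (simp add: car)
      then show "u = v" using uv by simp
    qed
    have "p \<otimes>\<^bsub>G\<^esub> o' = p" unfolding o'_def using p by (intro H.r_one) (simp add: car)
    then show "\<Phi> p origin = origin" using p by (simp add: \<Phi>_def)
  qed (use x y in simp_all)
  have yo: "y \<oplus>\<^sub>C \<ominus>\<^sub>C o' \<oplus>\<^sub>C o' = y" using y by (simp add: padd_assoc)
  have "x \<otimes>\<^bsub>G\<^esub> y = \<Phi> x (y \<oplus>\<^sub>C \<ominus>\<^sub>C o') \<oplus>\<^sub>C x" unfolding \<Phi>_def yo using x y by (simp add: padd_assoc)
  also have "\<Phi> x (y \<oplus>\<^sub>C \<ominus>\<^sub>C o') = y \<oplus>\<^sub>C \<ominus>\<^sub>C o'"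
    unfolding rig using H.l_one[of y] y by (simp add: \<Phi>_def yo o'_def[symmetric] car)
  finally show ?thesis using x y by (simp add: padd_commute[of _ x] flip: o'_def)
qed

text \<open>By \<open>algebraic_group_mult\<close> the shift t |-> t + o' carries the points of
  order two of \<open>curve_group\<close> to those of \<open>G\<close>, and translation by t + o' in
  \<open>G\<close> is x |-> t + x.\<close>

lemma algebraic_group_involutions:
  assumes G: "algebraic_group_on C G"
  shows "card {t \<in> carrier G. group.ord G t = 2} = 3"
    "fpf_involutions C = translation G ` {t \<in> carrier G. group.ord G t = 2}"
proof -
  interpret H: group G using G by (simp add: algebraic_group_on_def)
  have car: "carrier G = pts C" using G by (simp add: algebraic_group_on_def)
  define o' where "o' = \<one>\<^bsub>G\<^esub>"
  have o [simp]: "o' \<in> pts C" using H.one_closed by (simp add: o'_def car)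
  have mult: "x \<otimes>\<^bsub>G\<^esub> y = x \<oplus>\<^sub>C (y \<oplus>\<^sub>C \<ominus>\<^sub>C o')" if "x \<in> pts C" "y \<in> pts C" for x y
    using algebraic_group_mult[OF G that] by (simp add: o'_def)
  have ord: "H.ord (t \<oplus>\<^sub>C o') = 2 \<longleftrightarrow> t \<oplus>\<^sub>C t = origin \<and> t \<noteq> origin" if t: "t \<in> pts C" for t
  proof -
    have "(t \<oplus>\<^sub>C o') \<otimes>\<^bsub>G\<^esub> (t \<oplus>\<^sub>C o') = (t \<oplus>\<^sub>C t) \<oplus>\<^sub>C o'"
      using t padd_commute[of o' t] by (simp add: mult padd_assoc)
    then have "(t \<oplus>\<^sub>C o') \<otimes>\<^bsub>G\<^esub> (t \<oplus>\<^sub>C o') = o' \<longleftrightarrow> t \<oplus>\<^sub>C t = origin"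
      using padd_cancel(2)[of o' "t \<oplus>\<^sub>C t" origin] t by simp
    moreover have "t \<oplus>\<^sub>C o' = o' \<longleftrightarrow> t = origin" using padd_cancel(2)[of o' t origin] t by simp
    ultimately show ?thesis using H.ord_eq_2[of "t \<oplus>\<^sub>C o'"] t by (simp add: car o'_def[symmetric])
  qed
  have eq: "{t \<in> carrier G. H.ord t = 2} = (\<lambda>t. t \<oplus>\<^sub>C o') ` two_torsion"
  proof -
    have "t \<in> (\<lambda>t. t \<oplus>\<^sub>C o') ` two_torsion" if "t \<in> carrier G" "H.ord t = 2" for t
    proof -
      have t: "t \<in> pts C" using that by (simp add: car)
      then have "t = (t \<oplus>\<^sub>C \<ominus>\<^sub>C o') \<oplus>\<^sub>C o'" by (simp add: padd_assoc)
      moreover from this have "t \<oplus>\<^sub>C \<ominus>\<^sub>C o' \<in> two_torsion" using ord[of "t \<oplus>\<^sub>C \<ominus>\<^sub>C o'"] that t by simp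
      ultimately show ?thesis by (rule image_eqI)
    qed
    then show ?thesis using ord by (auto simp: car)
  qed
  have "inj_on (\<lambda>t. t \<oplus>\<^sub>C o') two_torsion" by (rule inj_onI) simp
  then show "card {t \<in> carrier G. H.ord t = 2} = 3" unfolding eq by (simp only: card_image card_two_torsion)
  have tr: "translation G (t \<oplus>\<^sub>C o') = (\<lambda>x\<in>pts C. t \<oplus>\<^sub>C x)" if t: "t \<in> two_torsion" for t
    unfolding translation_def car
  proof (rule restrict_ext)
    fix x assume x: "x \<in> pts C"
    then show "(t \<oplus>\<^sub>C o') \<otimes>\<^bsub>G\<^esub> x = t \<oplus>\<^sub>C x"
      using t padd_commute[of x "\<ominus>\<^sub>C o'"] by (simp add: mult padd_assoc)
  qed
  show "fpf_involutions C = translation G ` {t \<in> carrier G. H.ord t = 2}"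
    unfolding eq fpf_involutions_eq image_image using tr by (intro image_cong) auto
qed

end

section \<open>The net of a translation of order two\<close>

context weierstrass
begin

abbreviation frame :: "3 \<Rightarrow> 'a ^ 3" where
  "frame k \<equiv> vector [e1, e2, e3] $ k"

lemma polar_frame_expand:
  assumes "q \<in> forms 2"
  shows "polar q (x *s e1 + y *s e2 + z *s e3) (x' *s e1 + y' *s e2 + z' *s e3) =
    x * x' * polar q e1 e1 + y * y' * polar q e2 e2 + z * z' * polar q e3 e3
    + (x * y' + y * x') * polar q e1 e2 + (x * z' + z * x') * polar q e1 e3 + (y * z' + z * y') * polar q e2 e3"
  by (simp add: polar_linear[OF assms] polar_commute[of q e2 e1] polar_commute[of q e3 e1] polar_commute[of q e3 e2]
      algebra_simps)

lemma polar_frame_eq: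
  assumes "q \<in> forms 2" "q' \<in> forms 2"
    and "polar q e1 e1 = polar q' e1 e1" "polar q e2 e2 = polar q' e2 e2" "polar q e3 e3 = polar q' e3 e3"
    "polar q e1 e2 = polar q' e1 e2" "polar q e1 e3 = polar q' e1 e3" "polar q e2 e3 = polar q' e2 e3"
  shows "q = q'"
proof (rule form2_eq_polar[OF assms(1,2)])
  fix u v
  show "polar q u v = polar q' u v"
    using coord_expand[of u] coord_expand[of v]
      polar_frame_expand[OF assms(1)] polar_frame_expand[OF assms(2)] assms(3-) by metis
qed

lemma det_sym_matrix_frame:
  assumes "q \<in> forms 2"
  shows "det (\<chi> k l. polar q (frame k) (frame l)) = (det3 e1 e2 e3)\<^sup>2 * det (sym_matrix q)"
proof -
  define M :: "'a ^ 3 ^ 3" where "M = vector [e1, e2, e3]"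
  have "(\<chi> k l. polar q (frame k) (frame l)) = M ** sym_matrix q ** transpose M"
    by (simp add: M_def vec_eq_iff polar_sym_matrix[OF assms] matrix_matrix_mult_def transpose_def sum_3 algebra_simps)
  then have "det (\<chi> k l. polar q (frame k) (frame l)) = det M * det (sym_matrix q) * det M"
    by (simp add: det_mul det_transpose)
  also have "det M = det3 e1 e2 e3" unfolding det_det3 M_def by simp
  finally show ?thesis by (simp add: power2_eq_square)
qed

text \<open>For \<open>c = 0\<close> the point \<open>e3\<close> has order two, and translation by it maps \<open>(x, y)\<close> to
  \<open>(b / x, - b y / x\<^sup>2)\<close>. The denominators are cleared below.\<close>

lemma translation_formula:
  assumes c: "c = 0" and xy: "(x, y) \<in> E" "x \<noteq> 0"
  shows "point e3 \<oplus>\<^sub>C point (affp x y) = point ((b * x) *s e1 + (- b * y) *s e2 + x\<^sup>2 *s e3)"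
proof -
  have y2: "y\<^sup>2 = x ^ 3 + a * x\<^sup>2 + b * x" using xy(1) c unfolding poly_f by simp
  let ?q = "x *s e1 + y *s e2"
  \<comment> \<open>The line through (0, 0) and (x, y) meets the curve a third time in (b / x, b y /
    x^2); negation then changes the sign of the second coordinate.\<close>
  have L: "line_cycle F (1 *s e3 + 0 *s ?q) (1 *s e3 + 1 *s ?q) (x\<^sup>2 *s e3 + b *s ?q)"
  proof (rule line_cycleI[where k = x])
    have "det3 e3 ?q e2 = x * det3 e1 e2 e3" by (simp add: det3_def dot3_def algebra_simps)
    then show "cross e3 ?q \<noteq> 0" using basis xy(2) by (intro det3_cross[of _ _ e2]) simp
    show "peval F (s *s e3 + t *s ?q) = x * ((s * 0 - t * 1) * (s * 1 - t * 1) * (s * b - t * x\<^sup>2))" for s t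
    proof -
      have e: "s *s e3 + t *s ?q = (t * x) *s e1 + (t * y) *s e2 + s *s e3" by (simp add: vec3_eq_iff algebra_simps)
      have "peval F (s *s e3 + t *s ?q) = t\<^sup>2 * s * y\<^sup>2 - t ^ 3 * x ^ 3 - a * t\<^sup>2 * x\<^sup>2 * s - b * t * x * s\<^sup>2"
        unfolding e equation c by (simp add: power2_eq_square power3_eq_cube)
      then show ?thesis unfolding y2 by (simp add: power2_eq_square power3_eq_cube algebra_simps)
    qed
  qed (use xy in auto)
  have e: "1 *s e3 + 0 *s ?q = e3" by simp
  have q: "1 *s e3 + 1 *s ?q = affp x y" by (simp add: algebra_simps)
  have w: "x\<^sup>2 *s e3 + b *s ?q = x\<^sup>2 *s affp (b / x) (b * y / x\<^sup>2)"
    using xy(2) by (simp add: vec3_eq_iff power2_eq_square field_simps)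
  have l: "line_cycle F e3 (affp x y) (x\<^sup>2 *s affp (b / x) (b * y / x\<^sup>2))" using L unfolding e q w .
  have "point e3 \<star> point (affp x y) = point (x\<^sup>2 *s affp (b / x) (b * y / x\<^sup>2))" by (rule chord_eq[OF l])
  also have "\<dots> = point (affp (b / x) (b * y / x\<^sup>2))" using xy(2) by (intro point_scale affine_nonzero) simp
  finally have 1: "point e3 \<star> point (affp x y) = point (affp (b / x) (b * y / x\<^sup>2))" .
  have "peval F (x\<^sup>2 *s affp (b / x) (b * y / x\<^sup>2)) = 0" using line_cycle_on_curve[OF l] by blast
  then have "peval F (affp (b / x) (b * y / x\<^sup>2)) = 0" using xy(2) by (simp only: peval_scale[OF cubic]) simp
  then have "(b * y / x\<^sup>2)\<^sup>2 = poly f (b / x)" unfolding peval_affine by (simp only: eq_iff_diff_eq_0[symmetric])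
  then have "point e3 \<oplus>\<^sub>C point (affp x y) = point (affp (b / x) (- (b * y / x\<^sup>2)))"
    unfolding curve_group_mult 1 by (rule origin_chord_affine)
  also have "\<dots> = point (x\<^sup>2 *s affp (b / x) (- (b * y / x\<^sup>2)))"
    using xy(2) by (intro point_scale[symmetric] affine_nonzero) simp
  also have "x\<^sup>2 *s affp (b / x) (- (b * y / x\<^sup>2)) = (b * x) *s e1 + (- b * y) *s e2 + x\<^sup>2 *s e3"
    using xy(2) by (simp add: vec3_eq_iff power2_eq_square field_simps)
  finally show ?thesis .
qed

lemma conic_condition:
  assumes c: "c = 0" and i: "i = (\<lambda>x\<in>pts C. point e3 \<oplus>\<^sub>C x)" and t: "point e3 \<in> two_torsion"
    and q: "q \<in> forms 2"
  shows "(\<forall>x\<in>pts C. conjugate (pol.span {q}) x (i x)) \<longleftrightarrow>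
    polar q e2 e3 = 0 \<and> polar q e1 e3 = b * polar q e2 e2 \<and> polar q e3 e3 = a * b * polar q e2 e2 - b * polar q e1 e1"
    (is "?L \<longleftrightarrow> ?R")
proof -
  have val: "polar q (affp x y) ((b * x) *s e1 + (- b * y) *s e2 + x\<^sup>2 *s e3) =
     b * x\<^sup>2 * polar q e1 e1 - b * y\<^sup>2 * polar q e2 e2 + x\<^sup>2 * polar q e3 e3
     + (x ^ 3 + b * x) * polar q e1 e3 + (x\<^sup>2 - b) * polar q e2 e3 * y" for x y
    using polar_frame_expand[OF q, of x y 1 "b * x" "- b * y" "x\<^sup>2"]
    by (simp add: power2_eq_square power3_eq_cube algebra_simps)
  have y2: "y\<^sup>2 = x ^ 3 + a * x\<^sup>2 + b * x" if "(x, y) \<in> E" for x y using that c unfolding poly_f by simp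
  have conj: "conjugate (pol.span {q}) (point (affp x y)) (i (point (affp x y))) \<longleftrightarrow>
      polar q (affp x y) ((b * x) *s e1 + (- b * y) *s e2 + x\<^sup>2 *s e3) = 0" if "(x, y) \<in> E" "x \<noteq> 0" for x y
  proof -
    have "point (affp x y) \<in> pts C" using that affine_in_C by blast
    then have "i (point (affp x y)) = point ((b * x) *s e1 + (- b * y) *s e2 + x\<^sup>2 *s e3)"
      using translation_formula[OF c that] by (simp add: i)
    then show ?thesis by (simp only: conjugate_point_iff[OF q])
  qed
  show ?thesis
  proof
    assume L: ?L
    \<comment> \<open>After y^2 is replaced by f(x), \<open>A\<close> and \<open>B\<close> are the
      parts of the conjugacy condition without y and with y.\<close>
    define A where "A = [:0, b * polar q e1 e3 - b * b * polar q e2 e2,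
      b * polar q e1 e1 + polar q e3 e3 - a * b * polar q e2 e2, polar q e1 e3 - b * polar q e2 e2:]"
    define B where "B = [:- b * polar q e2 e3, 0, polar q e2 e3:]"
    have "poly ([:0, 1:] * A) x + poly ([:0, 1:] * B) x * y = 0" if y: "y\<^sup>2 = poly f x" for x y
    proof (cases "x = 0")
      case False
      have E: "(x, y) \<in> E" using y by blast
      then have "point (affp x y) \<in> pts C" using affine_in_C by blast
      then have "polar q (affp x y) ((b * x) *s e1 + (- b * y) *s e2 + x\<^sup>2 *s e3) = 0"
        using L conj[OF E False] by blast
      then have "poly A x + poly B x * y = 0"
        unfolding val y2[OF E] A_def B_def by (simp add: power2_eq_square power3_eq_cube algebra_simps)
      then show ?thesis by (simp add: algebra_simps) (simp flip: distrib_left add: mult.left_commute[of _ x])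
    qed simp
    then have "[:0, 1:] * A = 0 \<and> [:0, 1:] * B = 0" by (rule polE_zero_all)
    then have "A = 0" "B = 0" by (simp_all add: mult_eq_0_iff del: mult_pCons_left)
    then show ?R unfolding A_def B_def by (simp add: algebra_simps eq_neg_iff_add_eq_0)
  next
    assume R: ?R
    show ?L
    proof
      fix x assume x: "x \<in> pts C"
      then show "conjugate (pol.span {q}) x (i x)"
      proof (cases rule: pts_C_cases)
        case infinity
        then show ?thesis using R t by (simp add: i conjugate_point_iff[OF q])
      next
        case (affine s u)
        show ?thesis
        proof (cases "s = 0")
          case True
          then have "u = 0" using y2[OF affine(1)] by simp
          then have "x = point e3" using affine(2) True by simp
          then have "i x = origin" using t x by (simp add: i)
          moreover have "polar q e3 e2 = 0" using R polar_commute[of q e3 e2] by simp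
          ultimately show ?thesis unfolding \<open>x = point e3\<close> by (simp only: conjugate_point_iff[OF q])
        next
          case False
          have R': "polar q e2 e3 = 0" "polar q e1 e3 = b * polar q e2 e2"
            "polar q e3 e3 = a * b * polar q e2 e2 - b * polar q e1 e1" using R by auto
          have "polar q (affp s u) ((b * s) *s e1 + (- b * u) *s e2 + s\<^sup>2 *s e3) = 0"
            unfolding val y2[OF affine(1)] R' by (simp add: algebra_simps power2_eq_square power3_eq_cube)
          then show ?thesis using conj[OF affine(1) False] affine(2) by blast
        qed
      qed
    qed
  qed
qed

text \<open>For c = 0 the cubic is x (x^2 + a x + b); both inequalities express that its roots are
  simple.\<close>

lemma discriminant_nonzero:
  assumes "c = 0"
  shows "b \<noteq> 0" "a\<^sup>2 \<noteq> 4 * b"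
proof -
  show "b \<noteq> 0" using f_simple_roots[of 0] assms by (simp add: pderiv_pCons)
  show "a\<^sup>2 \<noteq> 4 * b"
  proof
    assume "a\<^sup>2 = 4 * b"
    then have b: "b = a * a / 4" by (simp add: power2_eq_square)
    have "poly f (- a / 2) = 0" unfolding assms b by (simp add: field_simps)
    moreover have "poly (pderiv f) (- a / 2) = 0" unfolding b by (simp add: pderiv_pCons field_simps)
    ultimately show False using f_simple_roots by blast
  qed
qed

lemma translation_net:
  assumes c: "c = 0" and i: "i = (\<lambda>x\<in>pts C. point e3 \<oplus>\<^sub>C x)" and t: "point e3 \<in> two_torsion"
  obtains \<beta> where "smooth_net_basis \<beta>" "net_of C i = proj (range (lincomb \<beta>))"
proof -
  define c1 c2 c3 where cc: "c1 = (\<lambda>v. coord v $ 1)" "c2 = (\<lambda>v. coord v $ 2)" "c3 = (\<lambda>v. coord v $ 3)"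
  have "form_vec 1 (\<lambda>v :: 'a ^ 3. v)" unfolding form_vec_def using form_fun_coord by blast
  then have cf: "form_fun 1 c1" "form_fun 1 c2" "form_fun 1 c3"
    unfolding cc by (rule form_fun_coord')+
  note cf2 = form_fun_mult[OF cf(1) cf(1)] form_fun_mult[OF cf(2) cf(2)] form_fun_mult[OF cf(3) cf(3)]
    form_fun_mult[OF cf(1) cf(2)] form_fun_mult[OF cf(1) cf(3)]
  \<comment> \<open>\<open>conic_condition\<close> leaves the polar values at (e1, e1), (e2, e2),
    (e1, e2) free and determines the others; \<open>q1\<close>, \<open>q2\<close>, \<open>q3\<close>
    are the solutions with one of these equal to 1 and the other two equal to 0.\<close>
  have "form_fun 2 (\<lambda>v. c1 v * c1 v - b * (c3 v * c3 v))"
    using form_fun_diff[OF cf2(1) form_fun_cmult[OF cf2(3)]] by (simp add: numeral_2_eq_2)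
  then obtain q1 where q1: "q1 \<in> forms 2" "\<And>v. peval q1 v = c1 v * c1 v - b * (c3 v * c3 v)"
    unfolding form_fun_def by auto
  have "form_fun 2 (\<lambda>v. c2 v * c2 v + 2 * b * (c1 v * c3 v) + a * b * (c3 v * c3 v))"
    using form_fun_add[OF form_fun_add[OF cf2(2) form_fun_cmult[OF cf2(5)]] form_fun_cmult[OF cf2(3)]]
    by (simp add: numeral_2_eq_2)
  then obtain q2 where q2: "q2 \<in> forms 2"
    "\<And>v. peval q2 v = c2 v * c2 v + 2 * b * (c1 v * c3 v) + a * b * (c3 v * c3 v)"
    unfolding form_fun_def by auto
  have "form_fun 2 (\<lambda>v. 2 * (c1 v * c2 v))" using form_fun_cmult[OF cf2(4)] by (simp add: numeral_2_eq_2)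
  then obtain q3 where q3: "q3 \<in> forms 2" "\<And>v. peval q3 v = 2 * (c1 v * c2 v)"
    unfolding form_fun_def by auto
  define \<beta> where "\<beta> k = (if k = 1 then q1 else if k = 2 then q2 else q3)" for k :: 3
  have \<beta>: "\<beta> k \<in> forms 2" for k by (simp add: \<beta>_def q1 q2 q3)
  have lf: "lincomb \<beta> v \<in> forms 2" for v by (intro lincomb_forms \<beta>)
  have coord_e: "coord e1 = vector [1, 0, 0]" "coord e2 = vector [0, 1, 0]" "coord e3 = vector [0, 0, 1]"
    "coord (e1 + e2) = vector [1, 1, 0]" "coord (e1 + e3) = vector [1, 0, 1]" "coord (e2 + e3) = vector [0, 1, 1]"
    using coord_combination[of 1 0 0] coord_combination[of 0 1 0] coord_combination[of 0 0 1]
      coord_combination[of 1 1 0] coord_combination[of 1 0 1] coord_combination[of 0 1 1] by simp_all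
  have pl: "polar (lincomb \<beta> v) u w = v $ 1 * polar q1 u w + v $ 2 * polar q2 u w + v $ 3 * polar q3 u w" for v u w
    by (simp add: polar_lincomb sum_3 \<beta>_def)
  have Q: "polar (lincomb \<beta> v) e1 e1 = v $ 1" "polar (lincomb \<beta> v) e2 e2 = v $ 2"
    "polar (lincomb \<beta> v) e3 e3 = a * b * v $ 2 - b * v $ 1" "polar (lincomb \<beta> v) e1 e2 = v $ 3"
    "polar (lincomb \<beta> v) e1 e3 = b * v $ 2" "polar (lincomb \<beta> v) e2 e3 = 0" for v
    unfolding pl
    by (simp_all add: polar_self q1 q2 q3) (simp_all add: polar_def q1 q2 q3 cc coord_e)
  have cond: "(\<forall>x\<in>pts C. conjugate (pol.span {q}) x (i x)) \<longleftrightarrow> q \<in> range (lincomb \<beta>)" if q: "q \<in> forms 2" for q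
    unfolding conic_condition[OF c i t q]
  proof
    assume *: "polar q e2 e3 = 0 \<and> polar q e1 e3 = b * polar q e2 e2 \<and> polar q e3 e3 = a * b * polar q e2 e2 - b * polar q e1 e1"
    have "q = lincomb \<beta> (vector [polar q e1 e1, polar q e2 e2, polar q e1 e2])"
      by (rule polar_frame_eq[OF q lf]) (simp_all add: Q *)
    then show "q \<in> range (lincomb \<beta>)" by blast
  next
    assume "q \<in> range (lincomb \<beta>)"
    then show "polar q e2 e3 = 0 \<and> polar q e1 e3 = b * polar q e2 e2 \<and> polar q e3 e3 = a * b * polar q e2 e2 - b * polar q e1 e1"
      by (auto simp: Q)
  qed
  have "net_of C i = proj (range (lincomb \<beta>))"
  proof (rule Set.set_eqI)
    fix \<gamma>
    have "\<gamma> \<in> net_of C i \<longleftrightarrow> (\<exists>q. q \<in> forms 2 \<and> q \<noteq> 0 \<and> \<gamma> = pol.span {q} \<and> (\<forall>x\<in>pts C. conjugate (pol.span {q}) x (i x)))"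
      unfolding net_of_def curves_iff by blast
    also have "\<dots> \<longleftrightarrow> (\<exists>q. q \<in> range (lincomb \<beta>) \<and> q \<noteq> 0 \<and> \<gamma> = pol.span {q})"
      using cond lf by blast
    also have "\<dots> \<longleftrightarrow> \<gamma> \<in> proj (range (lincomb \<beta>))" unfolding proj_def by blast
    finally show "\<gamma> \<in> net_of C i \<longleftrightarrow> \<gamma> \<in> proj (range (lincomb \<beta>))" .
  qed
  moreover have "smooth_net_basis \<beta>"
  proof
    let ?d = "(det3 e1 e2 e3)\<^sup>2"
    \<comment> \<open>The determinant of the matrix with rows (s, t, b r), (t, r, 0), (b r, 0, a b r
      - b s), i.e. of the conic with parameters s, r, t in the frame.\<close>
    define D where "D s r t = s * r * (a * b * r - b * s) - t * t * (a * b * r - b * s) - b * b * r * r * r" for s r t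
    have d: "?d \<noteq> 0" using basis by simp
    have discr: "?d * peval (discr_form \<beta>) v = D (v $ 1) (v $ 2) (v $ 3)" for v
      unfolding peval_discr_form det_sym_matrix_frame[OF lf, symmetric]
      by (simp add: det_3 Q polar_commute[of _ e2 e1] polar_commute[of _ e3 e1] polar_commute[of _ e3 e2] D_def algebra_simps)
    show "Defs.smooth (pol.span {discr_form \<beta>})"
      unfolding smooth_cubic_iff[OF discr_form_forms]
    proof (intro allI impI, rule ccontr)
      fix v assume v: "v \<noteq> 0 \<and> peval (discr_form \<beta>) v = 0"
        and "\<not> (\<exists>w. tri (discr_form \<beta>) v v w \<noteq> 0)"
      then have "tri (discr_form \<beta>) v v w = 0" for w by blast
      \<comment> \<open>A vanishing gradient means D(v + w) - D(v - w) = 2 D(w) for all w. Taking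
        basis vectors for w below gives the three partial derivatives of \<open>D\<close> at
        v.\<close>
      then have "(peval (discr_form \<beta>) (v + w) - peval (discr_form \<beta>) (v - w)) / 2 = peval (discr_form \<beta>) w" for w
        using tri_formula[OF discr_form_forms, of \<beta> v w] by simp
      moreover have "x = 2 * y" if "x / 2 = y" for x y :: 'a using that by auto
      ultimately have "peval (discr_form \<beta>) (v + w) - peval (discr_form \<beta>) (v - w) = 2 * peval (discr_form \<beta>) w" for w
        by metis
      then have "?d * peval (discr_form \<beta>) (v + w) - ?d * peval (discr_form \<beta>) (v - w) = 2 * (?d * peval (discr_form \<beta>) w)" for w
        by (metis mult.left_commute right_diff_distrib)
      then have D: "D (v $ 1 + w $ 1) (v $ 2 + w $ 2) (v $ 3 + w $ 3) - D (v $ 1 - w $ 1) (v $ 2 - w $ 2) (v $ 3 - w $ 3)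
          = 2 * D (w $ 1) (w $ 2) (w $ 3)" for w :: "'a ^ 3"
        unfolding discr by simp
      define s r u where sru: "s = v $ 1" "r = v $ 2" "u = v $ 3"
      have D': "D (s + x) (r + y) (u + z) - D (s - x) (r - y) (u - z) = 2 * D x y z" for x y z
        using D[of "vector [x, y, z]"] by (simp add: sru)
      have "2 * (b * (a * (r * r) - 2 * (s * r) + u * u)) = 0"
        using D'[of 1 0 0] by (simp add: D_def algebra_simps)
      then have 1: "a * (r * r) - 2 * (s * r) + u * u = 0" using discriminant_nonzero[OF c] by simp
      have "2 * (b * (2 * a * (s * r) - s * s - a * (u * u) - 3 * b * (r * r))) = 0"
        using D'[of 0 1 0] by (simp add: D_def algebra_simps)
      then have 2: "2 * a * (s * r) - s * s - a * (u * u) - 3 * b * (r * r) = 0" using discriminant_nonzero[OF c] by simp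
      have "4 * (b * (u * (a * r - s))) = 0"
        using D'[of 0 0 1] by (auto simp: D_def algebra_simps)
      then have 3: "u = 0 \<or> s = a * r" using discriminant_nonzero[OF c] by auto
      have "s = 0 \<and> r = 0 \<and> u = 0"
      proof (cases "u = 0")
        case True
        show ?thesis
        proof (cases "r = 0")
          case r: True
          then show ?thesis using 2 True by simp
        next
          case False
          \<comment> \<open>With u = 0 and r nonzero the equations force s = a r / 2 and then a^2 =
            4 b, which is excluded.\<close>
          have "r * (a * r - 2 * s) = 0" using 1 True by (simp add: algebra_simps)
          then have s: "a * r = 2 * s" using False by simp
          have "4 * (2 * (a * r) * s - s * s - 3 * b * (r * r)) = 0" using 2 True by (simp add: algebra_simps)
          then have "3 * (2 * s) * (2 * s) - 12 * b * (r * r) = 0" unfolding s by (simp add: algebra_simps)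
          then have "3 * ((a\<^sup>2 - 4 * b) * (r * r)) = 0" unfolding s[symmetric] by (simp add: power2_eq_square algebra_simps)
          then show ?thesis using False discriminant_nonzero[OF c] by simp
        qed
      next
        case False
        then have s: "s = a * r" using 3 by blast
        then have "u * u = a * (r * r)" using 1 by (simp add: algebra_simps)
        then have "3 * b * (r * r) = 0" using 2 s by (simp add: algebra_simps)
        then have "r = 0" using discriminant_nonzero[OF c] by simp
        then have "u * u = 0" using 1 by simp
        then show ?thesis using False by simp
      qed
      then have "v = 0" by (simp add: sru vec3_eq_iff)
      with v show False by blast
    qed
  qed (rule \<beta>)
  ultimately show ?thesis using that by blast
qed

text \<open>Moves the root r to x = 0 by a change of e3 alone. The coefficients are f''(r) / 2,
  f'(r) and f(r) = 0.\<close>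

lemma shift_frame:
  assumes r: "poly f r = 0"
  shows "weierstrass F e1 e2 (affp r 0) (3 * r + a) (3 * r\<^sup>2 + 2 * a * r + b) 0"
proof
  have "det3 e1 e2 (affp r 0) = det3 e1 e2 e3" by (simp add: det3_def dot3_def algebra_simps)
  then show "det3 e1 e2 (affp r 0) \<noteq> 0" using basis by simp
  show "peval F (x *s e1 + y *s e2 + z *s affp r 0) = y\<^sup>2 * z - x ^ 3 - (3 * r + a) * x\<^sup>2 * z
      - (3 * r\<^sup>2 + 2 * a * r + b) * x * z\<^sup>2 - 0 * z ^ 3" for x y z
  proof -
    have e: "x *s e1 + y *s e2 + z *s affp r 0 = (x + z * r) *s e1 + y *s e2 + z *s e3"
      by (simp add: vec3_eq_iff algebra_simps)
    have c: "c = - (r ^ 3 + a * r\<^sup>2 + b * r)"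
      by (rule eq_neg_iff_add_eq_0[THEN iffD2]) (use r in \<open>simp add: poly_f algebra_simps del: poly_pCons\<close>)
    show ?thesis unfolding e equation c by (simp add: power2_eq_square power3_eq_cube algebra_simps)
  qed
qed

lemma involution_net:
  assumes "i \<in> fpf_involutions C"
  obtains \<beta> where "smooth_net_basis \<beta>" "net_of C i = proj (range (lincomb \<beta>))"
proof -
  obtain t where t: "t \<in> two_torsion" "i = (\<lambda>x\<in>pts C. t \<oplus>\<^sub>C x)" using involution_translation[OF assms] by blast
  obtain r where r: "poly f r = 0" "t = point (affp r 0)" using t(1) unfolding two_torsion_eq by blast
  interpret W: weierstrass F e1 e2 "affp r 0" "3 * r + a" "3 * r\<^sup>2 + 2 * a * r + b" 0
    by (rule shift_frame[OF r(1)])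
  \<comment> \<open>The group depends only on \<open>F\<close> and on the origin e2, both of which
    are kept.\<close>
  have "W.curve_group = curve_group" by (simp add: W.curve_group_def curve_group_def)
  then obtain \<beta> where "smooth_net_basis \<beta>" "net_of C i = proj (range (lincomb \<beta>))"
    using W.translation_net[OF refl, of i] t r(2) by metis
  then show ?thesis by (rule that)
qed

text \<open>On the affine curve the cubic G reduces to A(x) + B(x) y, and both polynomials vanish.
  Solving for the ten coefficients of G leaves only the multiples of the Weierstrass
  equation.\<close>

lemma cubic_vanishing:
  assumes G: "G \<in> forms 3" and v: "\<And>v. v \<noteq> 0 \<Longrightarrow> peval F v = 0 \<Longrightarrow> peval G v = 0"
  shows "\<exists>k. G = pscale k F"
proof -
  let ?T = "tri G"
  have exp: "peval G (x *s e1 + y *s e2 + z *s e3) = x ^ 3 * ?T e1 e1 e1 + y ^ 3 * ?T e2 e2 e2 + z ^ 3 * ?T e3 e3 e3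
     + 3 * x\<^sup>2 * y * ?T e1 e1 e2 + 3 * x\<^sup>2 * z * ?T e1 e1 e3 + 3 * x * y\<^sup>2 * ?T e1 e2 e2 + 3 * x * z\<^sup>2 * ?T e1 e3 e3
     + 3 * y\<^sup>2 * z * ?T e2 e2 e3 + 3 * y * z\<^sup>2 * ?T e2 e3 e3 + 6 * x * y * z * ?T e1 e2 e3" for x y z
    unfolding peval_tri[OF G]
    by (simp add: tri_linear tri_commute1[of G e2 e1] tri_commute1[of G e3 e1] tri_commute1[of G e3 e2]
        tri_commute2[of G _ e2 e1] tri_commute2[of G _ e3 e1] tri_commute2[of G _ e3 e2] power2_eq_square power3_eq_cube algebra_simps)
  define A where "A = [:?T e3 e3 e3, 3 * ?T e1 e3 e3, 3 * ?T e1 e1 e3, ?T e1 e1 e1:] + f * [:3 * ?T e2 e2 e3, 3 * ?T e1 e2 e2:]"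
  define B where "B = [:3 * ?T e2 e3 e3, 6 * ?T e1 e2 e3, 3 * ?T e1 e1 e2:] + Polynomial.smult (?T e2 e2 e2) f"
  have "poly A x + poly B x * y = 0" if y: "y\<^sup>2 = poly f x" for x y
  proof -
    have "peval F (affp x y) = 0" using y unfolding peval_affine by simp
    then have "0 = peval G (affp x y)" using v[OF affine_nonzero] by simp
    also have "\<dots> = poly [:?T e3 e3 e3, 3 * ?T e1 e3 e3, 3 * ?T e1 e1 e3, ?T e1 e1 e1:] x
        + y\<^sup>2 * poly [:3 * ?T e2 e2 e3, 3 * ?T e1 e2 e2:] x
        + (poly [:3 * ?T e2 e3 e3, 6 * ?T e1 e2 e3, 3 * ?T e1 e1 e2:] x + ?T e2 e2 e2 * y\<^sup>2) * y"
      using exp[of x y 1] by (simp add: power2_eq_square power3_eq_cube algebra_simps)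
    finally show ?thesis unfolding A_def B_def poly_add poly_mult poly_smult y by simp
  qed
  then have AB: "A = 0" "B = 0" using polE_zero_all by blast+
  have "?T e2 e2 e2 = 0" using AB(2) unfolding B_def by simp
  then have B0: "?T e2 e2 e2 = 0" "?T e2 e3 e3 = 0" "?T e1 e2 e3 = 0" "?T e1 e1 e2 = 0"
    using AB(2) unfolding B_def by simp_all
  have "?T e1 e2 e2 = 0" using AB(1) unfolding A_def by simp
  moreover have "3 * (?T e1 e1 e3 + a * ?T e2 e2 e3) = 0" "3 * (?T e1 e3 e3 + b * ?T e2 e2 e3) = 0"
    using AB(1) \<open>?T e1 e2 e2 = 0\<close> unfolding A_def by (simp_all add: algebra_simps)
  then have "?T e1 e1 e3 + a * ?T e2 e2 e3 = 0" "?T e1 e3 e3 + b * ?T e2 e2 e3 = 0"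
    unfolding mult_eq_0_iff by simp_all
  ultimately have A0: "?T e1 e2 e2 = 0" "?T e1 e1 e1 = - 3 * ?T e2 e2 e3" "?T e1 e1 e3 = - a * ?T e2 e2 e3"
    "?T e1 e3 e3 = - b * ?T e2 e2 e3" "?T e3 e3 e3 = - 3 * c * ?T e2 e2 e3"
    using AB(1) unfolding A_def by (simp_all add: eq_neg_iff_add_eq_0 algebra_simps)
  have "G = pscale (3 * ?T e2 e2 e3) F"
  proof (rule peval_inject)
    fix u
    obtain x y z where u: "u = x *s e1 + y *s e2 + z *s e3" using det3_coordinates[OF basis] .
    show "peval G u = peval (pscale (3 * ?T e2 e2 e3) F) u"
      unfolding u peval_pscale exp equation B0 A0 by (simp add: algebra_simps)
  qed
  then show ?thesis ..
qed

end

section \<open>Nets and involutions\<close>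

lemma smooth_cubic_cases:
  fixes H :: "'a::{alg_closed_field, field_char_0} curve"
  assumes "H \<in> curves 3" "smooth H"
  obtains F e1 e2 e3 a b c where "H = pol.span {F}" "weierstrass F e1 e2 e3 a b c"
proof -
  obtain F where F: "F \<in> forms 3" "H = pol.span {F}" using assms(1) unfolding curves_iff by blast
  interpret smooth_cubic F using F assms(2) by unfold_locales simp_all
  obtain e1 e2 e3 a b c where "weierstrass F e1 e2 e3 a b c" by (rule ex_weierstrass)
  with F(2) that show ?thesis by metis
qed

text \<open>The matrix expressing \<open>b'\<close> through \<open>b\<close> is injective, hence
  invertible: a dimension count in coordinates.\<close>

lemma range_lincomb_subset_eq:
  fixes b b' :: "3 \<Rightarrow> 'a::field form"
  assumes "range (lincomb b') \<subseteq> range (lincomb b)" "\<And>v. lincomb b' v = 0 \<Longrightarrow> v = 0"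
  shows "range (lincomb b') = range (lincomb b)"
proof -
  have "b' c \<in> range (lincomb b)" for c using assms(1) lincomb_axis[of b' c] by (metis rangeI subsetD)
  then have "\<forall>c. \<exists>w. b' c = lincomb b w" by blast
  then obtain g where g: "\<And>c. b' c = lincomb b (g c)" by metis
  define B where "B = (\<chi> i j. g j $ i)"
  have "B *v v = v $ 1 *s g 1 + v $ 2 *s g 2 + v $ 3 *s g 3" for v
    by (simp add: B_def vec_eq_iff matrix_vector_mult_def sum_3 mult.commute)
  then have B: "lincomb b' v = lincomb b (B *v v)" for v
    by (simp only: lincomb_add lincomb_scale g[symmetric]) (simp add: lincomb_def sum_3)
  show ?thesis
  proof (rule range_lincomb_comp[where B = B, OF B])
    show "v = 0" if "B *v v = 0" for v using B[of v] assms(2)[of v] that by simp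
  qed
qed

text \<open>The computation made for (b), applied to the Hessian and its conjugation map, shows that
  the right-hand side is a net too; together with \<open>net_subset\<close> this gives
  equality.\<close>

lemma (in polar_cubic) net_eq: "\<pi> = net_of H i"
proof -
  interpret S: smooth_cubic "discr_form (derivs F)"
    using discr_form_forms polars.smooth by unfold_locales
  obtain e1 e2 e3 a b c where "weierstrass (discr_form (derivs F)) e1 e2 e3 a b c" by (rule S.ex_weierstrass)
  then interpret W: weierstrass "discr_form (derivs F)" e1 e2 e3 a b c .
  obtain \<beta> where \<beta>: "smooth_net_basis \<beta>" "net_of H i = proj (range (lincomb \<beta>))"
    using W.involution_net[OF conjugate_map_involution[unfolded hessian_eq]] unfolding hessian_eq by metis
  have "range (lincomb (derivs F)) \<subseteq> range (lincomb \<beta>)"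
    using net_subset unfolding \<beta>(2) unfolding jacobian_net_span proj_subset_iff[OF lincomb_subspace lincomb_subspace] .
  then have "range (lincomb (derivs F)) = range (lincomb \<beta>)"
    by (rule range_lincomb_subset_eq) (simp add: polars.lincomb_eq_0)
  then show ?thesis unfolding \<beta>(2) unfolding jacobian_net_span by simp
qed

lemma involution_net_hessian:
  fixes H :: "'a::{alg_closed_field, field_char_0} curve"
  assumes H: "H \<in> curves 3" "smooth H" and i: "i \<in> fpf_involutions H"
  shows "is_net (net_of H i)" "smooth_discr (net_of H i)"
    and "\<phi> \<in> curves 3 \<Longrightarrow> net_of H i = jacobian_net \<phi> \<Longrightarrow> H = hessian \<phi> \<and> i = conjugate_map (net_of H i) H"
proof -
  obtain G e1 e2 e3 a b c where G: "H = pol.span {G}" "weierstrass G e1 e2 e3 a b c"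
    using smooth_cubic_cases[OF H] .
  interpret W: weierstrass G e1 e2 e3 a b c by (rule G(2))
  obtain \<beta> where \<beta>: "smooth_net_basis \<beta>" "net_of H i = proj (range (lincomb \<beta>))"
    using W.involution_net[OF i[unfolded G(1)]] unfolding G(1) by metis
  then show net: "is_net (net_of H i)" "smooth_discr (net_of H i)"
    using smooth_net_basis.smooth_net[OF \<beta>(1)] by simp_all
  assume \<phi>: "\<phi> \<in> curves 3" "net_of H i = jacobian_net \<phi>"
  obtain F where F: "F \<in> forms 3" "net_of H i = jacobian_net (pol.span {F})" "smooth_net_basis (derivs F)"
    "\<phi> = pol.span {F}"
    by (rule smooth_net_cubic[OF net]) (use \<phi> in blast)
  interpret P: polar_cubic F using F(1,3) by (rule polar_cubic.intro)
  have cc: "common_conjugate (net_of H i) x (i x)" if x: "x \<in> pts H" for x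
  proof -
    have "i x \<in> pts H" using i x unfolding fpf_involutions_def regular_map_def by blast
    then show ?thesis using pts_subset_P2[of H] x unfolding common_conjugate_def net_of_def by blast
  qed
  \<comment> \<open>Each point of H has the common conjugate i(x) and so lies on the Hessian;
    \<open>cubic_vanishing\<close> lifts this inclusion of point sets to proportional
    equations.\<close>
  have vanish: "peval (discr_form (derivs F)) v = 0" if v: "v \<noteq> 0" "peval G v = 0" for v
  proof -
    have p: "point v \<in> pts H" unfolding G(1) point_in_pts_iff[OF W.cubic v(1)] by (rule v(2))
    have "point v \<in> P2" using v(1) by (auto simp: P2_iff)
    then have "point v \<in> pts P.H" by (rule P.ex_common_conjugate_iff[THEN iffD1]) (use cc[OF p] in \<open>auto simp: F(2)\<close>)
    then show ?thesis unfolding P.hessian_eq point_in_pts_iff[OF discr_form_forms v(1)] .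
  qed
  have "\<exists>k. discr_form (derivs F) = pscale k G" by (rule W.cubic_vanishing[OF discr_form_forms vanish])
  then obtain k where k: "discr_form (derivs F) = pscale k G" ..
  then have "k \<noteq> 0" using P.discr_form_nonzero by auto
  then have hess: "H = P.H" unfolding G(1) P.hessian_eq k by (rule span_scaled[symmetric])
  have "i = conjugate_map (net_of H i) H"
  proof (rule extensionalityI)
    show "i \<in> extensional (pts H)" using i by (simp add: fpf_involutions_def)
    show "conjugate_map (net_of H i) H \<in> extensional (pts H)" by (simp add: conjugate_map_def)
    fix x assume x: "x \<in> pts H"
    show "i x = conjugate_map (net_of H i) H x"
      using P.conjugate_map_iff[of x "i x"] cc[OF x] x unfolding hess[symmetric] F(2)[symmetric] by simp
  qed
  with hess F(4) show "H = hessian \<phi> \<and> i = conjugate_map (net_of H i) H" by simp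
qed

lemma smooth_nets_cases:
  fixes \<pi> :: "'a::{alg_closed_field, field_char_0} curve set"
  assumes "\<pi> \<in> smooth_nets"
  obtains F where "polar_cubic F" "F \<noteq> 0" "\<pi> = jacobian_net (pol.span {F})"
    "\<forall>\<phi>. \<phi> \<in> curves 3 \<and> \<pi> = jacobian_net \<phi> \<longleftrightarrow> \<phi> = pol.span {F}"
proof -
  have "is_net \<pi>" "smooth_discr \<pi>" using assms by (simp_all add: smooth_nets_def)
  then obtain F where F: "F \<in> forms 3" "F \<noteq> 0" "\<pi> = jacobian_net (pol.span {F})" "smooth_net_basis (derivs F)"
    "\<forall>\<phi>. \<phi> \<in> curves 3 \<longrightarrow> \<pi> = jacobian_net \<phi> \<longrightarrow> \<phi> = pol.span {F}"
    by (rule smooth_net_cubic) blast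
  have "polar_cubic F" using F(1,4) by (rule polar_cubic.intro)
  moreover have "pol.span {F} \<in> curves 3" using F(1,2) unfolding curves_iff by blast
  ultimately show ?thesis using F by (intro that[of F]) blast+
qed

lemma pair_of_net_eq:
  assumes "\<forall>\<phi>. \<phi> \<in> curves 3 \<and> \<pi> = jacobian_net \<phi> \<longleftrightarrow> \<phi> = \<psi>"
  shows "pair_of_net \<pi> = (hessian \<psi>, conjugate_map \<pi> (hessian \<psi>))"
  using assms by (simp add: pair_of_net_def cubic_of_net_def Let_def)

lemma pair_of_net_in:
  fixes \<pi> :: "'a::{alg_closed_field, field_char_0} curve set"
  assumes "\<pi> \<in> smooth_nets"
  shows "pair_of_net \<pi> \<in> cubic_pairs" "case_prod net_of (pair_of_net \<pi>) = \<pi>"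
proof -
  obtain F where F: "polar_cubic F" "F \<noteq> 0" "\<pi> = jacobian_net (pol.span {F})"
    "\<forall>\<phi>. \<phi> \<in> curves 3 \<and> \<pi> = jacobian_net \<phi> \<longleftrightarrow> \<phi> = pol.span {F}"
    using smooth_nets_cases[OF assms] .
  interpret polar_cubic F by (rule F(1))
  note p = pair_of_net_eq[OF F(4)]
  show "pair_of_net \<pi> \<in> cubic_pairs"
    unfolding p unfolding F(3) using H_cubic H_smooth conjugate_map_involution by (simp add: cubic_pairs_def)
  show "case_prod net_of (pair_of_net \<pi>) = \<pi>"
    unfolding p unfolding F(3) using net_eq by simp
qed

lemma net_of_in:
  fixes H :: "'a::{alg_closed_field, field_char_0} curve"
  assumes "(H, i) \<in> cubic_pairs"
  shows "net_of H i \<in> smooth_nets" "pair_of_net (net_of H i) = (H, i)"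
proof -
  have H: "H \<in> curves 3" "smooth H" "i \<in> fpf_involutions H" using assms by (simp_all add: cubic_pairs_def)
  show net: "net_of H i \<in> smooth_nets" using involution_net_hessian(1,2)[OF H] by (simp add: smooth_nets_def)
  obtain F where F: "polar_cubic F" "F \<noteq> 0" "net_of H i = jacobian_net (pol.span {F})"
    "\<forall>\<phi>. \<phi> \<in> curves 3 \<and> net_of H i = jacobian_net \<phi> \<longleftrightarrow> \<phi> = pol.span {F}"
    using smooth_nets_cases[OF net] .
  then have "H = hessian (pol.span {F}) \<and> i = conjugate_map (net_of H i) H"
    using involution_net_hessian(3)[OF H] by blast
  then show "pair_of_net (net_of H i) = (H, i)" unfolding pair_of_net_eq[OF F(4)] by metis
qed

lemma pair_of_net_bij:
  "bij_betw pair_of_net (smooth_nets :: 'a::{alg_closed_field, field_char_0} curve set set) cubic_pairs"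
proof (rule bij_betw_byWitness[where f' = "case_prod net_of"])
  show "\<forall>\<pi>\<in>smooth_nets. case_prod net_of (pair_of_net \<pi>) = (\<pi> :: 'a curve set)"
    by (rule ballI) (rule pair_of_net_in(2))
  show "pair_of_net ` smooth_nets \<subseteq> (cubic_pairs :: ('a curve \<times> ('a pt \<Rightarrow> 'a pt)) set)"
    by (rule image_subsetI) (rule pair_of_net_in(1))
qed (use net_of_in in auto)

text \<open>Describes the curve and the involution by common conjugates alone, so that equivariance
  does not require following the cubic or its Hessian through a change of coordinates.\<close>

lemma pair_of_net_properties:
  fixes \<pi> :: "'a::{alg_closed_field, field_char_0} curve set"
  assumes "\<pi> \<in> smooth_nets" "pair_of_net \<pi> = (H, i)"
  shows "x \<in> P2 \<Longrightarrow> x \<in> pts H \<longleftrightarrow> (\<exists>y. common_conjugate \<pi> x y)"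
    "x \<in> pts H \<Longrightarrow> i x = y \<longleftrightarrow> common_conjugate \<pi> x y"
proof -
  obtain F where F: "polar_cubic F" "F \<noteq> 0" "\<pi> = jacobian_net (pol.span {F})"
    "\<forall>\<phi>. \<phi> \<in> curves 3 \<and> \<pi> = jacobian_net \<phi> \<longleftrightarrow> \<phi> = pol.span {F}"
    using smooth_nets_cases[OF assms(1)] .
  interpret P: polar_cubic F by (rule F(1))
  have "H = P.H" "i = conjugate_map \<pi> P.H" using assms(2) unfolding pair_of_net_eq[OF F(4)] by auto
  then show "x \<in> P2 \<Longrightarrow> x \<in> pts H \<longleftrightarrow> (\<exists>y. common_conjugate \<pi> x y)"
    "x \<in> pts H \<Longrightarrow> i x = y \<longleftrightarrow> common_conjugate \<pi> x y"
    using P.ex_common_conjugate_iff P.conjugate_map_iff unfolding F(3) by auto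
qed

section \<open>Projective equivalence\<close>

lemma image_point: "(*v) g ` point v = point (g *v v)" for v :: "'a::field ^ 3"
proof (rule Set.set_eqI)
  have "g *v (c *s v) = c *s (g *v v)" for c by (rule vector_scalar_commute)
  then show "w \<in> (*v) g ` point v \<longleftrightarrow> w \<in> point (g *v v)" for w
    unfolding image_iff Bex_def in_point_iff by metis
qed

lemma linsubst_linsubst: "linsubst g (linsubst h q) = linsubst (h ** g) q" for q :: "'a::field_char_0 form"
  by (rule peval_inject) (simp add: peval_linsubst matrix_vector_mul_assoc)

lemma linsubst_one: "linsubst (mat 1) q = q" for q :: "'a::field_char_0 form"
  by (rule peval_inject) (simp add: peval_linsubst)

lemma linsubst_zero: "linsubst g 0 = 0" for g :: "'a::field_char_0 ^ 3 ^ 3"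
  by (simp add: linsubst_def)

lemma linsubst_span: "linsubst g ` pol.span {q} = pol.span {linsubst g q}" for q :: "'a::field_char_0 form"
proof (rule Set.set_eqI)
  have "linsubst g (pscale c q) = pscale c (linsubst g q)" for c
    by (rule peval_inject) (simp add: peval_linsubst peval_pscale)
  then show "p \<in> linsubst g ` pol.span {q} \<longleftrightarrow> p \<in> pol.span {linsubst g q}" for p
    unfolding image_iff Bex_def span_pol_singleton by metis
qed

lemma polar_linsubst: "polar (linsubst g q) u v = polar q (g *v u) (g *v v)"
  by (simp add: polar_def peval_linsubst matrix_vector_right_distrib)

lemma conjugate_linsubst: "conjugate (linsubst g ` \<gamma>) x y \<longleftrightarrow> conjugate \<gamma> ((*v) g ` x) ((*v) g ` y)"
  by (simp add: conjugate_def polar_linsubst)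

text \<open>The inverse matrix is carried along so that each rule is also available for the opposite
  direction.\<close>

locale projectivity =
  fixes g g' :: "'a::field_char_0 ^ 3 ^ 3"
  assumes left: "g' ** g = mat 1" and right: "g ** g' = mat 1"
begin

lemma mv_inverse [simp]: "g *v (g' *v v) = v" "g' *v (g *v v) = v"
  by (simp_all add: matrix_vector_mul_assoc left right)

lemma image_inverse [simp]: "(*v) g ` (*v) g' ` x = x" "(*v) g' ` (*v) g ` x = x"
  by (simp_all add: image_image)

lemma image_in_P2: "x \<in> P2 \<Longrightarrow> (*v) g ` x \<in> P2"
  using mv_inverse(2) by (metis P2_iff image_point matrix_vector_mult_0_right)

lemma linsubst_inverse [simp]: "linsubst g ` linsubst g' ` \<gamma> = \<gamma>"
  by (simp add: image_image linsubst_linsubst left linsubst_one)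

lemma linsubst_eq_0: "linsubst g q = 0 \<longleftrightarrow> q = 0"
proof
  assume "linsubst g q = 0"
  then have "linsubst g' (linsubst g q) = 0" by (simp add: linsubst_zero)
  then show "q = 0" by (simp add: linsubst_linsubst right linsubst_one)
qed (simp add: linsubst_zero)

lemma linsubst_curve: "\<gamma> \<in> curves d \<Longrightarrow> linsubst g ` \<gamma> \<in> curves d"
  unfolding curves_iff using linsubst_span linsubst_forms linsubst_eq_0 by metis

end

lemma projectivity_inverse: "projectivity g g' \<Longrightarrow> projectivity g' g"
  by (simp add: projectivity_def)

context projectivity
begin

interpretation inverse: projectivity g' g
  by (rule projectivity_inverse) unfold_locales

lemma image_P2_iff: "(*v) g ` x \<in> P2 \<longleftrightarrow> x \<in> P2"
  using image_in_P2 inverse.image_in_P2[of "(*v) g ` x"] by auto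

lemma pts_linsubst: "x \<in> pts (linsubst g ` D) \<longleftrightarrow> (*v) g ` x \<in> pts D"
  by (simp add: pts_def peval_linsubst image_P2_iff)

lemma common_conjugate_linsubst:
  "common_conjugate ((\<lambda>\<gamma>. linsubst g ` \<gamma>) ` \<pi>) x y \<longleftrightarrow> common_conjugate \<pi> ((*v) g ` x) ((*v) g ` y)"
  by (simp add: common_conjugate_def conjugate_linsubst image_P2_iff)

end

text \<open>Common conjugates are visibly equivariant, which gives equality of the point sets;
  \<open>cubic_vanishing\<close> turns this into equality of the curves, without a chain rule for
  the Hessian.\<close>

lemma net_transport_imp_pair_transport:
  fixes g :: "'a::{alg_closed_field, field_char_0} ^ 3 ^ 3"
  assumes g: "projectivity g g'" and \<pi>: "\<pi> \<in> smooth_nets" "\<pi>' \<in> smooth_nets" "net_transport g \<pi> \<pi>'"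
  shows "pair_transport g (pair_of_net \<pi>) (pair_of_net \<pi>')"
proof -
  interpret projectivity g g' by (rule g)
  obtain H i where p: "pair_of_net \<pi> = (H, i)" by (cases "pair_of_net \<pi>")
  obtain H' i' where p': "pair_of_net \<pi>' = (H', i')" by (cases "pair_of_net \<pi>'")
  have H: "H \<in> curves 3" "smooth H" "H' \<in> curves 3"
    using pair_of_net_in(1)[OF \<pi>(1)] pair_of_net_in(1)[OF \<pi>(2)] by (auto simp: p p' cubic_pairs_def)
  have cc: "common_conjugate \<pi> x y \<longleftrightarrow> common_conjugate \<pi>' ((*v) g ` x) ((*v) g ` y)" for x y
    using \<pi>(3) common_conjugate_linsubst by (simp add: net_transport_def)
  have ex: "(\<exists>y. common_conjugate \<pi> x y) \<longleftrightarrow> (\<exists>z. common_conjugate \<pi>' ((*v) g ` x) z)" for x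
    unfolding cc by (metis image_inverse(1))
  have pts: "x \<in> pts H \<longleftrightarrow> (*v) g ` x \<in> pts H'" if x: "x \<in> P2" for x
    using pair_of_net_properties(1)[OF \<pi>(1) p x] pair_of_net_properties(1)[OF \<pi>(2) p' image_in_P2[OF x]] ex
    by simp
  obtain G e1 e2 e3 a b c where G: "H = pol.span {G}" "weierstrass G e1 e2 e3 a b c"
    using smooth_cubic_cases[OF H(1,2)] .
  interpret W: weierstrass G e1 e2 e3 a b c by (rule G(2))
  obtain G' where G': "G' \<in> forms 3" "G' \<noteq> 0" "H' = pol.span {G'}" using H(3) unfolding curves_iff by blast
  have vanish: "peval (linsubst g G') v = 0" if v: "v \<noteq> 0" "peval G v = 0" for v
  proof -
    have "point v \<in> pts H" unfolding G(1) point_in_pts_iff[OF W.cubic v(1)] by (rule v(2))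
    then have "point v \<in> pts (linsubst g ` H')" using pts pts_subset_P2[of H] unfolding pts_linsubst by blast
    then show ?thesis unfolding G'(3) linsubst_span point_in_pts_iff[OF linsubst_forms[OF G'(1)] v(1)] .
  qed
  have "\<exists>k. linsubst g G' = pscale k G" by (rule W.cubic_vanishing[OF linsubst_forms[OF G'(1)] vanish])
  then obtain k where k: "linsubst g G' = pscale k G" ..
  then have "k \<noteq> 0" using linsubst_eq_0[of G'] G'(2) by auto
  then have "H = linsubst g ` H'" unfolding G(1) G'(3) linsubst_span k by (rule span_scaled[symmetric])
  moreover have "i' ((*v) g ` x) = (*v) g ` i x" if x: "x \<in> pts H" for x
  proof -
    have gx: "(*v) g ` x \<in> pts H'" using pts[of x] pts_subset_P2[of H] x by auto
    have "common_conjugate \<pi> x (i x)" using pair_of_net_properties(2)[OF \<pi>(1) p x, of "i x"] by simp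
    then show ?thesis unfolding pair_of_net_properties(2)[OF \<pi>(2) p' gx] cc .
  qed
  ultimately show ?thesis unfolding p p' pair_transport_def by simp
qed

lemma net_of_transport:
  fixes g :: "'a::field_char_0 ^ 3 ^ 3"
  assumes g: "projectivity g g'" and H: "pair_transport g (H, i) (H', i')"
  shows "net_transport g (net_of H i) (net_of H' i')"
proof -
  interpret projectivity g g' by (rule g)
  interpret inverse: projectivity g' g by (rule projectivity_inverse[OF g])
  have HH: "H = linsubst g ` H'" and i: "\<And>x. x \<in> pts H \<Longrightarrow> i' ((*v) g ` x) = (*v) g ` i x"
    using H by (simp_all add: pair_transport_def)
  have conj: "(\<forall>x\<in>pts H. conjugate (linsubst g ` \<gamma>) x (i x)) \<longleftrightarrow> (\<forall>x\<in>pts H'. conjugate \<gamma> x (i' x))" for \<gamma>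
  proof -
    have "pts H' = (\<lambda>x. (*v) g ` x) ` pts H"
    proof (rule Set.set_eqI)
      fix x
      have "x \<in> pts H' \<longleftrightarrow> (*v) g' ` x \<in> pts H" unfolding HH pts_linsubst by simp
      then show "x \<in> pts H' \<longleftrightarrow> x \<in> (\<lambda>x. (*v) g ` x) ` pts H" unfolding image_iff Bex_def by (metis image_inverse)
    qed
    then show ?thesis by (simp add: conjugate_linsubst i)
  qed
  have "\<gamma> \<in> net_of H i \<longleftrightarrow> \<gamma> \<in> (\<lambda>\<gamma>. linsubst g ` \<gamma>) ` net_of H' i'" for \<gamma>
  proof
    assume \<gamma>: "\<gamma> \<in> net_of H i"
    have "linsubst g ` linsubst g' ` \<gamma> = \<gamma>" by (rule linsubst_inverse)
    moreover have "linsubst g' ` \<gamma> \<in> net_of H' i'"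
      using \<gamma> conj[of "linsubst g' ` \<gamma>"] inverse.linsubst_curve by (simp add: net_of_def)
    ultimately show "\<gamma> \<in> (\<lambda>\<gamma>. linsubst g ` \<gamma>) ` net_of H' i'" by (metis imageI)
  next
    assume "\<gamma> \<in> (\<lambda>\<gamma>. linsubst g ` \<gamma>) ` net_of H' i'"
    then show "\<gamma> \<in> net_of H i" using conj linsubst_curve by (auto simp: net_of_def)
  qed
  then show ?thesis unfolding net_transport_def by blast
qed

lemma transport_iff:
  fixes g :: "'a::{alg_closed_field, field_char_0} ^ 3 ^ 3"
  assumes "invertible g" and \<pi>: "\<pi> \<in> smooth_nets" "\<pi>' \<in> smooth_nets"
  shows "net_transport g \<pi> \<pi>' \<longleftrightarrow> pair_transport g (pair_of_net \<pi>) (pair_of_net \<pi>')"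
proof -
  obtain g' where g: "projectivity g g'" using assms(1) unfolding invertible_def projectivity_def by blast
  have "net_transport g \<pi> \<pi>'" if "pair_transport g (pair_of_net \<pi>) (pair_of_net \<pi>')"
    using net_of_transport[OF g, of "fst (pair_of_net \<pi>)" "snd (pair_of_net \<pi>)" "fst (pair_of_net \<pi>')" "snd (pair_of_net \<pi>')"]
      that pair_of_net_in(2)[OF \<pi>(1)] pair_of_net_in(2)[OF \<pi>(2)] by (simp add: case_prod_beta)
  then show ?thesis using net_transport_imp_pair_transport[OF g \<pi>] by blast
qed

text \<open>The image under f of the r-class of x is the s-class of f x; the bijection on classes is
  that of images of subsets.\<close>

lemma bij_betw_quotient:
  assumes f: "bij_betw f A B" and r: "r \<subseteq> A \<times> A" and s: "s \<subseteq> B \<times> B"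
    and rs: "\<And>x y. x \<in> A \<Longrightarrow> y \<in> A \<Longrightarrow> (x, y) \<in> r \<longleftrightarrow> (f x, f y) \<in> s"
  shows "bij_betw ((`) f) (A // r) (B // s)"
proof -
  have cls: "f ` (r `` {x}) = s `` {f x}" if "x \<in> A" for x
  proof
    show "f ` (r `` {x}) \<subseteq> s `` {f x}" using rs that r by blast
    show "s `` {f x} \<subseteq> f ` (r `` {x})"
    proof
      fix z assume z: "z \<in> s `` {f x}"
      then obtain y where "y \<in> A" "z = f y" using s bij_betw_imp_surj_on[OF f] by blast
      then show "z \<in> f ` (r `` {x})" using z rs that by blast
    qed
  qed
  have "A // r \<subseteq> Pow A" using r by (auto simp: quotient_def)
  then have "inj_on ((`) f) (A // r)"
    using inj_on_image_Pow[OF bij_betw_imp_inj_on[OF f]] inj_on_subset by blast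
  moreover have "(`) f ` (A // r) = B // s"
  proof -
    have "A // r = (\<lambda>x. r `` {x}) ` A" by (auto simp: quotient_def)
    then have "(`) f ` (A // r) = (\<lambda>x. s `` {f x}) ` A" by (simp add: image_image cls)
    also have "\<dots> = (\<lambda>y. s `` {y}) ` B" unfolding bij_betw_imp_surj_on[OF f, symmetric] by (simp add: image_image)
    finally show ?thesis by (auto simp: quotient_def)
  qed
  ultimately show ?thesis by (simp add: bij_betw_def)
qed

lemma equiv_classes_bij:
  "bij_betw ((`) pair_of_net) ((smooth_nets :: 'a::{alg_closed_field, field_char_0} curve set set) // net_equiv)
     (cubic_pairs // pair_equiv)"
proof (rule bij_betw_quotient[OF pair_of_net_bij])
  show "net_equiv \<subseteq> smooth_nets \<times> (smooth_nets :: 'a curve set set)" by (auto simp: net_equiv_def)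
  show "pair_equiv \<subseteq> cubic_pairs \<times> (cubic_pairs :: ('a curve \<times> ('a pt \<Rightarrow> 'a pt)) set)" by (auto simp: pair_equiv_def)
  show "(\<pi>, \<pi>') \<in> net_equiv \<longleftrightarrow> (pair_of_net \<pi>, pair_of_net \<pi>') \<in> pair_equiv"
    if "\<pi> \<in> smooth_nets" "\<pi>' \<in> smooth_nets" for \<pi> \<pi>' :: "'a curve set"
  proof -
    have "(\<exists>g. invertible g \<and> net_transport g \<pi> \<pi>') \<longleftrightarrow> (\<exists>g. invertible g \<and> pair_transport g (pair_of_net \<pi>) (pair_of_net \<pi>'))"
      using transport_iff[OF _ that] by blast
    then show ?thesis using that pair_of_net_in(1)[OF that(1)] pair_of_net_in(1)[OF that(2)]
      by (simp add: net_equiv_def pair_equiv_def)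
  qed
qed

section \<open>Assembly of the statements (a) to (d)\<close>

lemma smooth_net_properties:
  fixes \<pi> :: "'a::{alg_closed_field, field_char_0} curve set"
  assumes "is_net \<pi>" "smooth_discr \<pi>"
  shows "\<exists>!\<phi>. \<phi> \<in> curves 3 \<and> \<pi> = jacobian_net \<phi>"
    and "\<phi> \<in> curves 3 \<and> \<pi> = jacobian_net \<phi> \<and> H = hessian \<phi> \<and> i = conjugate_map \<pi> H \<Longrightarrow>
          (\<forall>x\<in>P2. (\<exists>y. common_conjugate \<pi> x y) \<longleftrightarrow> x \<in> pts H) \<and>
          (\<forall>x\<in>pts H. (\<exists>!y. common_conjugate \<pi> x y) \<and>
             (\<forall>y. common_conjugate \<pi> x y \<longrightarrow> y \<noteq> x \<and> y \<in> pts H)) \<and>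
          i \<in> fpf_involutions H \<and>
          \<pi> = {\<gamma> \<in> curves 2. \<forall>x\<in>pts H. conjugate \<gamma> x (i x)}"
proof -
  have "\<pi> \<in> smooth_nets" using assms by (simp add: smooth_nets_def)
  then obtain F where F: "polar_cubic F" "F \<noteq> 0" "\<pi> = jacobian_net (pol.span {F})"
    "\<forall>\<phi>. \<phi> \<in> curves 3 \<and> \<pi> = jacobian_net \<phi> \<longleftrightarrow> \<phi> = pol.span {F}"
    by (rule smooth_nets_cases)
  interpret P: polar_cubic F by (rule F(1))
  show "\<exists>!\<phi>. \<phi> \<in> curves 3 \<and> \<pi> = jacobian_net \<phi>" using F(4) by blast
  assume *: "\<phi> \<in> curves 3 \<and> \<pi> = jacobian_net \<phi> \<and> H = hessian \<phi> \<and> i = conjugate_map \<pi> H"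
  then have \<phi>: "\<phi> = pol.span {F}" using F(4) by blast
  then have Hi: "H = P.H" "i = conjugate_map (jacobian_net (pol.span {F})) P.H" using * F(3) by auto
  show "(\<forall>x\<in>P2. (\<exists>y. common_conjugate \<pi> x y) \<longleftrightarrow> x \<in> pts H) \<and>
      (\<forall>x\<in>pts H. (\<exists>!y. common_conjugate \<pi> x y) \<and> (\<forall>y. common_conjugate \<pi> x y \<longrightarrow> y \<noteq> x \<and> y \<in> pts H)) \<and>
      i \<in> fpf_involutions H \<and> \<pi> = {\<gamma> \<in> curves 2. \<forall>x\<in>pts H. conjugate \<gamma> x (i x)}"
    unfolding Hi F(3)
  proof (intro conjI ballI)
    show "(\<exists>y. common_conjugate (jacobian_net (pol.span {F})) x y) \<longleftrightarrow> x \<in> pts P.H" if "x \<in> P2" for x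
      by (rule P.ex_common_conjugate_iff[OF that])
    show "\<exists>!y. common_conjugate (jacobian_net (pol.span {F})) x y" if "x \<in> pts P.H" for x
      by (rule P.conjugate_properties(1)[OF that])
    show "\<forall>y. common_conjugate (jacobian_net (pol.span {F})) x y \<longrightarrow> y \<noteq> x \<and> y \<in> pts P.H" if "x \<in> pts P.H" for x
      using P.conjugate_properties(2)[OF that] by blast
    show "conjugate_map (jacobian_net (pol.span {F})) P.H \<in> fpf_involutions P.H"
      by (rule P.conjugate_map_involution)
    show "jacobian_net (pol.span {F}) = {\<gamma> \<in> curves 2. \<forall>x\<in>pts P.H. conjugate \<gamma> x (conjugate_map (jacobian_net (pol.span {F})) P.H x)}"
      using P.net_eq unfolding net_of_def .
  qed
qed

lemma smooth_cubic_involutions: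
  fixes H :: "'a::{alg_closed_field, field_char_0} curve"
  assumes "H \<in> curves 3" "smooth H"
  shows "card (fpf_involutions H) = 3"
    and "O' \<in> pts H \<Longrightarrow> \<exists>G. algebraic_group_on H G \<and> \<one>\<^bsub>G\<^esub> = O'"
    and "algebraic_group_on H G \<Longrightarrow> card {t \<in> carrier G. group.ord G t = 2} = 3 \<and>
      fpf_involutions H = translation G ` {t \<in> carrier G. group.ord G t = 2}"
proof -
  obtain F e1 e2 e3 a b c where F: "H = pol.span {F}" "weierstrass F e1 e2 e3 a b c"
    using smooth_cubic_cases[OF assms] .
  interpret weierstrass F e1 e2 e3 a b c by (rule F(2))
  show "card (fpf_involutions H) = 3" unfolding F(1) by (rule card_fpf_involutions)
  show "\<exists>G. algebraic_group_on H G \<and> \<one>\<^bsub>G\<^esub> = O'" if "O' \<in> pts H"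
    using ex_algebraic_group that unfolding F(1) by blast
  show "card {t \<in> carrier G. group.ord G t = 2} = 3 \<and>
      fpf_involutions H = translation G ` {t \<in> carrier G. group.ord G t = 2}" if "algebraic_group_on H G"
    using algebraic_group_involutions[of G] that unfolding F(1) by simp
qed

theorem proposition4p5:
  shows
    "(\<forall>\<pi> :: 'a::{alg_closed_field, field_char_0} curve set.
        is_net \<pi> \<and> smooth_discr \<pi> \<longrightarrow>
        (\<exists>!\<phi>. \<phi> \<in> curves 3 \<and> \<pi> = jacobian_net \<phi>) \<and>
        (\<forall>\<phi> H i. \<phi> \<in> curves 3 \<and> \<pi> = jacobian_net \<phi> \<and> H = hessian \<phi> \<and>
            i = conjugate_map \<pi> H \<longrightarrow>
          (\<forall>x\<in>P2. (\<exists>y. common_conjugate \<pi> x y) \<longleftrightarrow> x \<in> pts H) \<and>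
          (\<forall>x\<in>pts H. (\<exists>!y. common_conjugate \<pi> x y) \<and>
             (\<forall>y. common_conjugate \<pi> x y \<longrightarrow> y \<noteq> x \<and> y \<in> pts H)) \<and>
          i \<in> fpf_involutions H \<and>
          \<pi> = {\<gamma> \<in> curves 2. \<forall>x\<in>pts H. conjugate \<gamma> x (i x)}))
     \<and>
     (\<forall>(H :: 'a curve) i \<pi>.
        H \<in> curves 3 \<and> smooth H \<and> i \<in> fpf_involutions H \<and>
        \<pi> = {\<gamma> \<in> curves 2. \<forall>x\<in>pts H. conjugate \<gamma> x (i x)} \<longrightarrow>
        is_net \<pi> \<and> smooth_discr \<pi> \<and>
        (\<forall>\<phi>. \<phi> \<in> curves 3 \<and> \<pi> = jacobian_net \<phi> \<longrightarrow>
           H = hessian \<phi> \<and> i = conjugate_map \<pi> H))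
     \<and>
     (bij_betw pair_of_net (smooth_nets :: 'a curve set set) cubic_pairs \<and>
      (\<forall>(H, i) \<in> (cubic_pairs :: ('a curve \<times> ('a pt \<Rightarrow> 'a pt)) set).
         net_of H i \<in> smooth_nets \<and> pair_of_net (net_of H i) = (H, i)) \<and>
      (\<forall>\<pi> \<in> (smooth_nets :: 'a curve set set). \<forall>\<pi>' \<in> smooth_nets. \<forall>g. invertible g \<longrightarrow>
         (net_transport g \<pi> \<pi>' \<longleftrightarrow> pair_transport g (pair_of_net \<pi>) (pair_of_net \<pi>'))) \<and>
      bij_betw ((`) pair_of_net)
        ((smooth_nets :: 'a curve set set) // net_equiv) (cubic_pairs // pair_equiv))
     \<and>
     (\<forall>H :: 'a curve. H \<in> curves 3 \<and> smooth H \<longrightarrow>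
        card (fpf_involutions H) = 3 \<and>
        (\<forall>O' \<in> pts H.
           (\<exists>G. algebraic_group_on H G \<and> \<one>\<^bsub>G\<^esub> = O') \<and>
           (\<forall>G. algebraic_group_on H G \<and> \<one>\<^bsub>G\<^esub> = O' \<longrightarrow>
              card {t \<in> carrier G. group.ord G t = 2} = 3 \<and>
              fpf_involutions H = translation G ` {t \<in> carrier G. group.ord G t = 2})))"
  (is "?A \<and> ?B \<and> (?C1 \<and> ?C2 \<and> ?C3 \<and> ?C4) \<and> ?D")
proof (intro conjI)
  show ?A
    by (intro allI impI, elim conjE, rule conjI, erule (1) smooth_net_properties(1), intro allI impI,
        rule smooth_net_properties(2), assumption+)
  show ?B
  proof (intro allI impI)
    fix H :: "'a curve" and i \<pi>
    assume *: "H \<in> curves 3 \<and> smooth H \<and> i \<in> fpf_involutions H \<and> \<pi> = {\<gamma> \<in> curves 2. \<forall>x\<in>pts H. conjugate \<gamma> x (i x)}"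
    then have \<pi>: "\<pi> = net_of H i" by (simp add: net_of_def)
    show "is_net \<pi> \<and> smooth_discr \<pi> \<and>
        (\<forall>\<phi>. \<phi> \<in> curves 3 \<and> \<pi> = jacobian_net \<phi> \<longrightarrow> H = hessian \<phi> \<and> i = conjugate_map \<pi> H)"
      unfolding \<pi> using involution_net_hessian[of H i] * by blast
  qed
  show ?C1 by (rule pair_of_net_bij)
  show ?C2 using net_of_in by blast
  show ?C3 using transport_iff by blast
  show ?C4 by (rule equiv_classes_bij)
  show ?D using smooth_cubic_involutions by blast
qed

end
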